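(* Let $M$ be a closed connected smooth manifold of dimension $n\geqslant 2$ and $f\colon M\to\mathbb{R}$ a $C^1$-function all of whose critical points are isolated. Let $\iota\colon\Gamma(f)\hookrightarrow M$ be the inclusion, $\pi\colon M\to\mathcal{R}(f)$ the canonical projection, and let $r$ be the rank of the free group $\pi_1(\mathcal{R}(f))\cong\pi_1(\Gamma(f))\cong\mathbb{F}_r$. Then the map $\pi\circ\iota\colon\Gamma(f)\to\mathcal{R}(f)$ induces isomorphisms (1) on fundamental groups, $(\pi\circ\iota)_\#=\pi_\#\circ\iota_\#\colon\mathbb{F}_r\to\mathbb{F}_r$; (2) on first homology groups, $(\pi\circ\iota)_*=\pi_*\circ\iota_*\colon\mathbb{Z}^r\to\mathbb{Z}^r$; (3) on first cohomology groups, $(\pi\circ\iota)^*=\iota^*\circ\pi^*\colon R^r\to R^r$, for every coefficient ring $R$.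
   Context: "Smooth" means (at least) $C^1$. Write $\mathrm{Cr}(f)$ for the (finite) set of critical points, $M_c=f^{-1}(c)$, $M^{(c,c')}=\{x\in M: c<f(x)<c'\}$, $\mathrm{cl}$ for closure, $I=[0,1]$. Fundamental groups are taken with base point a vertex $x_0$ of $\Gamma(f)$ and its image $\pi(x_0)$ in $\mathcal{R}(f)$. Here $H_1(\mathcal{R}(f);\mathbb{Z})\cong\mathbb{Z}^r$ and $H^1(\mathcal{R}(f);R)\cong R^r$, and likewise for $\Gamma(f)$. Reeb graph: $\mathcal{R}(f)=M/\!\sim$, where $x\sim y$ iff $x,y$ lie in the same connected component of a level set $M_c$; it has the quotient topology and is (homeomorphic to) a finite graph whose vertices are the classes of the critical points. Essential component: a connected component of a level set $M_c$ that contains a critical point; it is denoted $M_c^{es}$. Component of type (IIa): for critical values $c<c'$, a connected component $C$ of $M^{(c,c')}$ that contains no critical point and whose closure $\mathrm{cl}(C)$ meets an essential component of $M_c$ and an essential component of $M_{c'}$ (these essential components are denoted $M_c^{es}$, $M_{c'}^{es}$ when $C$ is fixed). Decreasing edge-path of $C$: a path $\gamma\colon I\to M$ with $\gamma(0)\in M_{c'}^{es}$, $\gamma(1)\in M_c^{es}$, $\gamma((0,1))\subset C$, and $f(\gamma(t))<f(\gamma(t'))$ for $t>t'$. The graph $\Gamma(f)$: for each component $C$ of type (IIa) of $M^{(c,c')}$ choose critical points $x_c^C\in\mathrm{cl}(C)\cap M_c^{es}$ and $x_{c'}^C\in\mathrm{cl}(C)\cap M_{c'}^{es}$, to be joined by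 a decreasing edge-path of $C$. $\Gamma(f)\subset M$ is the 1-dimensional CW-complex with: (i) $0$-cells the critical points of $f$; (ii) $1$-cells the edges of a "spanning tree" $\Gamma_c^{es}\subset M_c^{es}$, one for every essential component of every level set, i.e. a closed subspace of $M_c^{es}$ homeomorphic to a tree with vertex set $M_c^{es}\cap\mathrm{Cr}(f)$; (iii) as additional $1$-cells, for every component $C$ of type (IIa) one decreasing edge-path $\gamma_C$ of $C$ joining the chosen critical points $x_{c'}^C$ and $x_c^C$. (Such trees and edge-paths exist.) *)

theory Defs
  imports
    "HOL-Analysis.Analysis"
    "HOL-Algebra.AbelCoset"
    "HOL-Algebra.Generated_Groups"
    "HOL-Algebra.Module"
    "HOL-Homology.Homology"
begin

section \<open>Closed \<open>C\<^sup>1\<close>-manifolds and \<open>C\<^sup>1\<close>-functions\<close>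

text \<open>Only meaningful for open \<open>S\<close>.\<close>

definition C1_on :: "('u::real_normed_vector \<Rightarrow> 'v::real_normed_vector) \<Rightarrow> 'u set \<Rightarrow> bool" where
  "C1_on g S \<longleftrightarrow>
     (\<exists>g'. (\<forall>x\<in>S. (g has_derivative blinfun_apply (g' x)) (at x)) \<and> continuous_on S g')"

text \<open>A chart is a pair \<open>(U, \<phi>)\<close>; the values of \<open>\<phi>\<close> outside \<open>U\<close> are irrelevant.
  The transition map from \<open>(U, \<phi>)\<close> to \<open>(V, \<psi>)\<close> is \<open>\<psi> \<circ> \<phi>\<^sup>-\<^sup>1\<close> on \<open>\<phi>(U \<inter> V)\<close>.\<close>

type_synonym ('a, 'e) chart = "'a set \<times> ('a \<Rightarrow> 'e)"

definition C1_atlas :: "'a topology \<Rightarrow> ('a, real ^ 'n) chart set \<Rightarrow> bool" where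
  "C1_atlas X A \<longleftrightarrow>
     (\<forall>(U, \<phi>)\<in>A. openin X U \<and> open (\<phi> ` U) \<and>
        homeomorphic_map (subtopology X U) (top_of_set (\<phi> ` U)) \<phi>) \<and>
     (\<Union>(U, \<phi>)\<in>A. U) = topspace X \<and>
     (\<forall>(U, \<phi>)\<in>A. \<forall>(V, \<psi>)\<in>A. C1_on (\<psi> \<circ> inv_into U \<phi>) (\<phi> ` (U \<inter> V)))"

text \<open>Second countability is automatic, the space being compact and locally Euclidean.\<close>

definition closed_connected_C1_manifold :: "'a topology \<Rightarrow> ('a, real ^ 'n) chart set \<Rightarrow> bool" where
  "closed_connected_C1_manifold X A \<longleftrightarrow>
     Hausdorff_space X \<and> compact_space X \<and> connected_space X \<and> C1_atlas X A"

definition C1_function :: "('a, real ^ 'n) chart set \<Rightarrow> ('a \<Rightarrow> real) \<Rightarrow> bool" where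
  "C1_function A f \<longleftrightarrow> (\<forall>(U, \<phi>)\<in>A. C1_on (f \<circ> inv_into U \<phi>) (\<phi> ` U))"

text \<open>The vanishing of the differential does not depend on the chart.\<close>

definition critical_points :: "('a, real ^ 'n) chart set \<Rightarrow> ('a \<Rightarrow> real) \<Rightarrow> 'a set" where
  "critical_points A f =
     {x. \<exists>(U, \<phi>)\<in>A. x \<in> U \<and> ((f \<circ> inv_into U \<phi>) has_derivative (\<lambda>_. 0)) (at (\<phi> x))}"

definition isolated_points :: "'a topology \<Rightarrow> 'a set \<Rightarrow> bool" where
  "isolated_points X S \<longleftrightarrow> (\<forall>x\<in>S. \<exists>U. openin X U \<and> U \<inter> S = {x})"


section \<open>The Reeb graph\<close>

definition quotient_topology :: "'a topology \<Rightarrow> ('a \<Rightarrow> 'b) \<Rightarrow> 'b topology" where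
  "quotient_topology X q =
     topology (\<lambda>V. V \<subseteq> q ` topspace X \<and> openin X {x \<in> topspace X. q x \<in> V})"

lemma openin_quotient_topology:
  "openin (quotient_topology X q) V \<longleftrightarrow>
     V \<subseteq> q ` topspace X \<and> openin X {x \<in> topspace X. q x \<in> V}"
proof -
  have "istopology (\<lambda>V. V \<subseteq> q ` topspace X \<and> openin X {x \<in> topspace X. q x \<in> V})"
    unfolding istopology_def
  proof (intro conjI allI impI)
    fix S T
    assume S: "S \<subseteq> q ` topspace X \<and> openin X {x \<in> topspace X. q x \<in> S}"
      and T: "T \<subseteq> q ` topspace X \<and> openin X {x \<in> topspace X. q x \<in> T}"
    show "S \<inter> T \<subseteq> q ` topspace X"
      using S by blast
    have "{x \<in> topspace X. q x \<in> S \<inter> T} =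
          {x \<in> topspace X. q x \<in> S} \<inter> {x \<in> topspace X. q x \<in> T}"
      by blast
    then show "openin X {x \<in> topspace X. q x \<in> S \<inter> T}"
      using S T by (simp add: openin_Int)
  next
    fix \<K>
    assume K: "\<forall>K\<in>\<K>. K \<subseteq> q ` topspace X \<and> openin X {x \<in> topspace X. q x \<in> K}"
    show "\<Union>\<K> \<subseteq> q ` topspace X"
      using K by blast
    have "{x \<in> topspace X. q x \<in> \<Union>\<K>} = (\<Union>K\<in>\<K>. {x \<in> topspace X. q x \<in> K})"
      by blast
    then show "openin X {x \<in> topspace X. q x \<in> \<Union>\<K>}"
      using K by auto
  qed
  then show ?thesis
    by (simp add: quotient_topology_def topology_inverse')
qed

lemma topspace_quotient_topology: "topspace (quotient_topology X q) = q ` topspace X"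
proof
  show "topspace (quotient_topology X q) \<subseteq> q ` topspace X"
    by (auto simp: topspace_def openin_quotient_topology)
  have "{x \<in> topspace X. q x \<in> q ` topspace X} = topspace X"
    by blast
  then have "openin (quotient_topology X q) (q ` topspace X)"
    by (simp add: openin_quotient_topology)
  then show "q ` topspace X \<subseteq> topspace (quotient_topology X q)"
    by (rule openin_subset)
qed

lemma quotient_map_quotient_topology: "quotient_map X (quotient_topology X q) q"
  by (simp add: quotient_map_def topspace_quotient_topology openin_quotient_topology)

definition level_set :: "'a topology \<Rightarrow> ('a \<Rightarrow> real) \<Rightarrow> real \<Rightarrow> 'a set" where
  "level_set X f c = {x \<in> topspace X. f x = c}"

text \<open>The class of \<open>x\<close> is the connected component of \<open>x\<close> in its level set.\<close>

definition reeb_projection :: "'a topology \<Rightarrow> ('a \<Rightarrow> real) \<Rightarrow> 'a \<Rightarrow> 'a set" where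
  "reeb_projection X f x = connected_component_of_set (subtopology X (level_set X f (f x))) x"

definition reeb_graph :: "'a topology \<Rightarrow> ('a \<Rightarrow> real) \<Rightarrow> 'a set topology" where
  "reeb_graph X f = quotient_topology X (reeb_projection X f)"


section \<open>The graph \<open>\<Gamma>(f)\<close>\<close>

definition essential_component ::
  "'a topology \<Rightarrow> ('a, real ^ 'n) chart set \<Rightarrow> ('a \<Rightarrow> real) \<Rightarrow> real \<Rightarrow> 'a set \<Rightarrow> bool" where
  "essential_component X A f c K \<longleftrightarrow>
     K \<in> connected_components_of (subtopology X (level_set X f c)) \<and>
     K \<inter> critical_points A f \<noteq> {}"

definition type_IIa ::
  "'a topology \<Rightarrow> ('a, real ^ 'n) chart set \<Rightarrow> ('a \<Rightarrow> real) \<Rightarrow> real \<Rightarrow> real \<Rightarrow> 'a set \<Rightarrow> bool" where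
  "type_IIa X A f c c' C \<longleftrightarrow>
     c \<in> f ` critical_points A f \<and> c' \<in> f ` critical_points A f \<and> c < c' \<and>
     C \<in> connected_components_of (subtopology X {x \<in> topspace X. c < f x \<and> f x < c'}) \<and>
     C \<inter> critical_points A f = {} \<and>
     (\<exists>K. essential_component X A f c K \<and> X closure_of C \<inter> K \<noteq> {}) \<and>
     (\<exists>K'. essential_component X A f c' K' \<and> X closure_of C \<inter> K' \<noteq> {})"

text \<open>A decreasing edge-path of \<open>C\<close> whose end points are critical points in the closure of \<open>C\<close>;
  here \<open>K'\<close> and \<open>K\<close> are the essential components of the levels \<open>c'\<close> and \<open>c\<close> met by that closure.\<close>

definition decreasing_edge_path ::
  "'a topology \<Rightarrow> ('a, real ^ 'n) chart set \<Rightarrow> ('a \<Rightarrow> real) \<Rightarrow> real \<Rightarrow> real \<Rightarrow> 'a set \<Rightarrow>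
    (real \<Rightarrow> 'a) \<Rightarrow> bool" where
  "decreasing_edge_path X A f c c' C \<gamma> \<longleftrightarrow>
     pathin X \<gamma> \<and>
     (\<exists>K'. essential_component X A f c' K' \<and>
        \<gamma> 0 \<in> X closure_of C \<inter> K' \<inter> critical_points A f) \<and>
     (\<exists>K. essential_component X A f c K \<and>
        \<gamma> 1 \<in> X closure_of C \<inter> K \<inter> critical_points A f) \<and>
     \<gamma> ` {0<..<1} \<subseteq> C \<and>
     (\<forall>t\<in>{0..1}. \<forall>t'\<in>{0..1}. t' < t \<longrightarrow> f (\<gamma> t) < f (\<gamma> t'))"

text \<open>\<open>T\<close> is the union of \<open>V\<close> and of finitely many arcs (the edges) with end points in \<open>V\<close> and
  pairwise disjoint interiors avoiding \<open>V\<close>; being a tree means connected and without cycles,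
  i.e. without embedded circles.\<close>

definition embedded_tree :: "'a topology \<Rightarrow> 'a set \<Rightarrow> 'a set \<Rightarrow> bool" where
  "embedded_tree X V T \<longleftrightarrow>
     (\<exists>E :: (real \<Rightarrow> 'a) set. finite E \<and>
        (\<forall>e\<in>E. pathin X e \<and> inj_on e {0..1} \<and> e 0 \<in> V \<and> e 1 \<in> V \<and> e ` {0<..<1} \<inter> V = {}) \<and>
        (\<forall>e\<in>E. \<forall>e'\<in>E. e \<noteq> e' \<longrightarrow> e ` {0<..<1} \<inter> e' ` {0<..<1} = {}) \<and>
        T = V \<union> (\<Union>e\<in>E. e ` {0..1})) \<and>
     finite V \<and> V \<noteq> {} \<and>
     connectedin X T \<and>
     \<not> (\<exists>S\<subseteq>T. subtopology X S homeomorphic_space top_of_set (sphere (0::complex) 1))"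

definition spanning_tree ::
  "'a topology \<Rightarrow> ('a, real ^ 'n) chart set \<Rightarrow> ('a \<Rightarrow> real) \<Rightarrow> 'a set \<Rightarrow> 'a set \<Rightarrow> bool" where
  "spanning_tree X A f K T \<longleftrightarrow>
     closedin (subtopology X K) T \<and> embedded_tree X (K \<inter> critical_points A f) T"

text \<open>\<open>G\<close> is one of the possible \<open>\<Gamma>(f)\<close>, for some choice of spanning trees and edge-paths.  It is a
  finite CW-complex in a Hausdorff space, so its CW-topology is the subspace topology.\<close>

definition gamma_graph ::
  "'a topology \<Rightarrow> ('a, real ^ 'n) chart set \<Rightarrow> ('a \<Rightarrow> real) \<Rightarrow> 'a set \<Rightarrow> bool" where
  "gamma_graph X A f G \<longleftrightarrow>
     (\<exists>T \<gamma>.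
        (\<forall>c K. essential_component X A f c K \<longrightarrow> spanning_tree X A f K (T K)) \<and>
        (\<forall>c c' C. type_IIa X A f c c' C \<longrightarrow> decreasing_edge_path X A f c c' C (\<gamma> c c' C)) \<and>
        G = critical_points A f
            \<union> \<Union>{T K | c K. essential_component X A f c K}
            \<union> \<Union>{\<gamma> c c' C ` {0..1} | c c' C. type_IIa X A f c c' C})"


section \<open>Fundamental groups\<close>

definition loops :: "'a topology \<Rightarrow> 'a \<Rightarrow> (real \<Rightarrow> 'a) set" where
  "loops X x0 = {p. pathin X p \<and> p 0 = x0 \<and> p 1 = x0}"

definition loop_class :: "'a topology \<Rightarrow> 'a \<Rightarrow> (real \<Rightarrow> 'a) \<Rightarrow> (real \<Rightarrow> 'a) set" where
  "loop_class X x0 p =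
     {q \<in> loops X x0. homotopic_with (\<lambda>h. h 0 = x0 \<and> h 1 = x0) (top_of_set {0..1}) X p q}"

text \<open>The library's \<open>joinpaths\<close> is restricted to types of class \<open>topological_space\<close>.\<close>

definition join_loops :: "(real \<Rightarrow> 'a) \<Rightarrow> (real \<Rightarrow> 'a) \<Rightarrow> real \<Rightarrow> 'a" where
  "join_loops p q t = (if t \<le> 1/2 then p (2 * t) else q (2 * t - 1))"

text \<open>All members of the unions below are equal, as the operations are well defined on classes.\<close>

definition fundamental_group :: "'a topology \<Rightarrow> 'a \<Rightarrow> (real \<Rightarrow> 'a) set monoid" where
  "fundamental_group X x0 =
     \<lparr>carrier = loop_class X x0 ` loops X x0,
      monoid.mult = (\<lambda>a b. \<Union>p\<in>a. \<Union>q\<in>b. loop_class X x0 (join_loops p q)),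
      one = loop_class X x0 (\<lambda>_. x0)\<rparr>"

definition fundamental_group_map ::
  "'b topology \<Rightarrow> 'b \<Rightarrow> ('a \<Rightarrow> 'b) \<Rightarrow> (real \<Rightarrow> 'a) set \<Rightarrow> (real \<Rightarrow> 'b) set" where
  "fundamental_group_map Y y0 h a = (\<Union>p\<in>a. loop_class Y y0 (h \<circ> p))"


section \<open>Free groups of finite rank\<close>

text \<open>The letter \<open>(s, True)\<close> stands for \<open>s\<close> and \<open>(s, False)\<close> for its inverse.\<close>

fun word_value :: "('a, 'm) monoid_scheme \<Rightarrow> ('a \<times> bool) list \<Rightarrow> 'a" where
  "word_value G [] = \<one>\<^bsub>G\<^esub>"
| "word_value G ((s, b) # w) = (if b then s else inv\<^bsub>G\<^esub> s) \<otimes>\<^bsub>G\<^esub> word_value G w"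

definition reduced_word :: "('a \<times> bool) list \<Rightarrow> bool" where
  "reduced_word w \<longleftrightarrow> successively (\<lambda>(s, b) (t, d). \<not> (s = t \<and> b \<noteq> d)) w"

definition free_basis :: "('a, 'm) monoid_scheme \<Rightarrow> 'a set \<Rightarrow> bool" where
  "free_basis G S \<longleftrightarrow>
     S \<subseteq> carrier G \<and> generate G S = carrier G \<and>
     (\<forall>w. w \<noteq> [] \<and> fst ` set w \<subseteq> S \<and> reduced_word w \<longrightarrow> word_value G w \<noteq> \<one>\<^bsub>G\<^esub>)"

definition free_group_of_rank :: "('a, 'm) monoid_scheme \<Rightarrow> nat \<Rightarrow> bool" where
  "free_group_of_rank G r \<longleftrightarrow> group G \<and> (\<exists>S. finite S \<and> card S = r \<and> free_basis G S)"


section \<open>Singular cohomology with coefficients in a ring\<close>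

text \<open>\<open>R\<close> is unital but not necessarily commutative, hence modules are left modules given by the
  library's record type; the ring multiplication fields of that record are not used.\<close>

definition free_module :: "('r, 'm) ring_scheme \<Rightarrow> nat \<Rightarrow> ('r, nat \<Rightarrow> 'r) module" where
  "free_module R r =
     \<lparr>carrier = {..<r} \<rightarrow>\<^sub>E carrier R, monoid.mult = undefined, one = undefined,
      zero = (\<lambda>i\<in>{..<r}. \<zero>\<^bsub>R\<^esub>),
      add = (\<lambda>u v. \<lambda>i\<in>{..<r}. u i \<oplus>\<^bsub>R\<^esub> v i),
      smult = (\<lambda>a v. \<lambda>i\<in>{..<r}. a \<otimes>\<^bsub>R\<^esub> v i)\<rparr>"

definition module_iso ::
  "('r, 'm) ring_scheme \<Rightarrow> ('r, 'u, 'x) module_scheme \<Rightarrow> ('r, 'v, 'y) module_scheme \<Rightarrow>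
    ('u \<Rightarrow> 'v) set" where
  "module_iso R M N =
     {h \<in> iso (add_monoid M) (add_monoid N).
        \<forall>a\<in>carrier R. \<forall>x\<in>carrier M. h (a \<odot>\<^bsub>M\<^esub> x) = a \<odot>\<^bsub>N\<^esub> h x}"

text \<open>\<open>C\<^sup>p(X; R) = Hom(C\<^sub>p(X), R)\<close>, with extensional homomorphisms.\<close>

definition cochains :: "('r, 'm) ring_scheme \<Rightarrow> nat \<Rightarrow> 'a topology \<Rightarrow> ('r, 'a chain \<Rightarrow> 'r) module" where
  "cochains R p X =
     \<lparr>carrier = hom (chain_group p X) (add_monoid R) \<inter> extensional (singular_chain_set p X),
      monoid.mult = undefined, one = undefined,
      zero = (\<lambda>c\<in>singular_chain_set p X. \<zero>\<^bsub>R\<^esub>),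
      add = (\<lambda>u v. \<lambda>c\<in>singular_chain_set p X. u c \<oplus>\<^bsub>R\<^esub> v c),
      smult = (\<lambda>a u. \<lambda>c\<in>singular_chain_set p X. a \<otimes>\<^bsub>R\<^esub> u c)\<rparr>"

definition coboundary_map :: "nat \<Rightarrow> 'a topology \<Rightarrow> ('a chain \<Rightarrow> 'r) \<Rightarrow> 'a chain \<Rightarrow> 'r" where
  "coboundary_map p X u = (\<lambda>c\<in>singular_chain_set (Suc p) X. u (chain_boundary (Suc p) c))"

definition cocycles :: "('r, 'm) ring_scheme \<Rightarrow> nat \<Rightarrow> 'a topology \<Rightarrow> ('a chain \<Rightarrow> 'r) set" where
  "cocycles R p X =
     {u \<in> carrier (cochains R p X). coboundary_map p X u = \<zero>\<^bsub>cochains R (Suc p) X\<^esub>}"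

definition coboundaries :: "('r, 'm) ring_scheme \<Rightarrow> nat \<Rightarrow> 'a topology \<Rightarrow> ('a chain \<Rightarrow> 'r) set" where
  "coboundaries R p X =
     (case p of 0 \<Rightarrow> {\<zero>\<^bsub>cochains R 0 X\<^esub>}
      | Suc k \<Rightarrow> coboundary_map k X ` carrier (cochains R k X))"

definition cohomology_class ::
  "('r, 'm) ring_scheme \<Rightarrow> nat \<Rightarrow> 'a topology \<Rightarrow> ('a chain \<Rightarrow> 'r) \<Rightarrow> ('a chain \<Rightarrow> 'r) set" where
  "cohomology_class R p X u = coboundaries R p X +>\<^bsub>cochains R p X\<^esub> u"

definition cohomology ::
  "('r, 'm) ring_scheme \<Rightarrow> nat \<Rightarrow> 'a topology \<Rightarrow> ('r, ('a chain \<Rightarrow> 'r) set) module" where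
  "cohomology R p X =
     \<lparr>carrier = cohomology_class R p X ` cocycles R p X,
      monoid.mult = undefined, one = undefined,
      zero = coboundaries R p X,
      add = (\<lambda>a b. a <+>\<^bsub>cochains R p X\<^esub> b),
      smult = (\<lambda>r a. \<Union>u\<in>a. cohomology_class R p X (r \<odot>\<^bsub>cochains R p X\<^esub> u))\<rparr>"

text \<open>The map \<open>h\<^sup>* : H\<^sup>p(Y; R) \<rightarrow> H\<^sup>p(X; R)\<close> induced by \<open>h : X \<rightarrow> Y\<close>.\<close>

definition cohomology_map ::
  "('r, 'm) ring_scheme \<Rightarrow> nat \<Rightarrow> 'a topology \<Rightarrow> ('a \<Rightarrow> 'b) \<Rightarrow>
    ('b chain \<Rightarrow> 'r) set \<Rightarrow> ('a chain \<Rightarrow> 'r) set" where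
  "cohomology_map R p X h a =
     (\<Union>u\<in>a. cohomology_class R p X (\<lambda>c\<in>singular_chain_set p X. u (chain_map p h c)))"

end

theory Submission
  imports Defs "HOL-Algebra.Bij" "HOL-Complex_Analysis.Contour_Integration"
begin

text \<open>
  The Reeb space \<open>\<R>(f)\<close> is a finite graph: its vertices are the classes of the critical points, and its
  open edges are the images of the components of type (IIa).  Indeed \<open>f\<close> induces a function \<open>fbar\<close> on
  \<open>\<R>(f)\<close> that is injective near every regular class (\<open>fbar_locally_injective\<close>: near a regular point \<open>f\<close> is
  a coordinate, and a class is compact and connected), so a regular class lies on a maximal piece of
  \<open>\<R>(f)\<close> that \<open>fbar\<close> maps bijectively to an open interval; the ends of such a piece can only be vertices
  (\<open>maximal_branch\<close>), and its preimage in \<open>M\<close> is a component of type (IIa) (\<open>regular_in_IIa\<close>).  The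
  decreasing path \<open>\<gamma>_C\<close> of such a component \<open>C\<close> runs monotonically through the edge.  Hence
  \<open>\<pi>\<close> restricted to \<open>\<Gamma>(f)\<close> maps each \<open>\<gamma>_C\<close> homeomorphically to the closed edge belonging to \<open>C\<close> and collapses
  each spanning tree of an essential component to a vertex: \<open>\<R>(f)\<close> arises from the graph \<open>\<Gamma>(f)\<close> by
  contracting disjoint subtrees (\<open>graph_collapse_reeb\<close>).

  Contracting disjoint subtrees is an isomorphism on \<open>\<pi>\<^sub>1\<close>, \<open>H\<^sub>1\<close> and \<open>H\<^sup>1\<close>.  A spanning tree of the quotient
  graph together with the contracted subtrees is a spanning tree of the original graph, so the same
  edges remain outside the spanning trees in both graphs.  Each of them closes up to a loop \<open>l i\<close> in the
  original graph, and the loops \<open>\<pi> \<circ> l i\<close> are the corresponding loops in the quotient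
  (\<open>corresponding_loop_bases\<close>).  It remains to see that such a family of loops is a basis of each of the
  three invariants, since a map that matches bases is an isomorphism.

  The loops generate \<open>\<pi>\<^sub>1\<close>, because a path can be subdivided into pieces in stars of vertices and stars
  contract along the edges (\<open>fundamental_group_generated_by_edges\<close>).  They are independent, because each
  loop crosses one wall once, the walls being the midpoints of the remaining edges or the preimages of
  these midpoints.  For every group \<open>F\<close> and every labelling of the walls by elements of \<open>F\<close> there is a
  holonomy homomorphism from \<open>\<pi>\<^sub>1\<close> to \<open>F\<close> sending each loop to the label of its wall; it comes from the
  covering space in which copies of \<open>F\<close> are glued along the walls (locale \<open>wall_holonomy\<close>).  With
  permutations of reduced words as labels this shows that \<open>\<pi>\<^sub>1\<close> is free on the loops
  (\<open>fundamental_group_free\<close>).  With labels in an abelian group the holonomy is a singular cocycle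
  (\<open>dual_cochain\<close>): integral labels show that the loops are independent in \<open>H\<^sub>1\<close>, and labels in the additive group of
  \<open>R\<close> show that every assignment of values to the loops is realized in \<open>H\<^sup>1\<close>
  (\<open>homology_basis_map_iso\<close>, \<open>cohomology_free\<close>).
\<close>

section \<open>Homotopy of paths in an abstract topological space\<close>

definition path_homotopic :: "'a topology \<Rightarrow> (real \<Rightarrow> 'a) \<Rightarrow> (real \<Rightarrow> 'a) \<Rightarrow> bool" where
  "path_homotopic X p q \<longleftrightarrow>
     homotopic_with (\<lambda>h. h 0 = p 0 \<and> h 1 = p 1) (top_of_set {0..1}) X p q"

definition reverse_path :: "(real \<Rightarrow> 'a) \<Rightarrow> real \<Rightarrow> 'a" where
  "reverse_path p t = p (1 - t)"

lemma reverse_path_ends [simp]: "reverse_path p 0 = p 1" "reverse_path p 1 = p 0"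
  by (auto simp: reverse_path_def)

lemma reverse_path_reverse_path [simp]: "reverse_path (reverse_path p) = p"
  by (auto simp: reverse_path_def)

lemma join_loops_ends [simp]: "join_loops p q 0 = p 0" "join_loops p q 1 = q 1"
  by (auto simp: join_loops_def)

lemma join_loops_compose: "join_loops (f \<circ> p) (f \<circ> q) = f \<circ> join_loops p q"
  by (auto simp: join_loops_def)

lemma join_loops_image:
  "join_loops p q ` {0..1} \<subseteq> p ` {0..1} \<union> q ` {0..1}"
  by (force simp: join_loops_def)

lemma reverse_path_image: "reverse_path p ` {0..1} = p ` {0..1}"
proof -
  have "(\<lambda>t. 1 - t) ` {0..1} = {0..1::real}"
    by (auto simp: image_iff intro: bexI[of _ "1 - x" for x])
  then show ?thesis
    unfolding reverse_path_def by (metis image_image)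
qed

lemma pathin_compose_map:
  assumes "continuous_map (top_of_set S) X K" "continuous_on {0..1} a" "a ` {0..1} \<subseteq> S"
  shows "pathin X (K \<circ> a)"
  unfolding pathin_def
  by (rule continuous_map_compose[of _ "top_of_set S"]) (use assms in \<open>auto simp: image_subset_iff_funcset\<close>)

lemma pathin_reverse_path: "pathin X p \<Longrightarrow> pathin X (reverse_path p)"
proof -
  assume "pathin X p"
  then have "pathin X (p \<circ> (\<lambda>t. 1 - t))"
    by (intro pathin_compose_map[of "{0..1}"]) (auto simp: pathin_def intro!: continuous_intros)
  then show ?thesis
    by (simp add: reverse_path_def[abs_def] o_def)
qed

lemma pathin_join_loops:
  assumes "pathin X p" "pathin X q" "p 1 = q 0"
  shows "pathin X (join_loops p q)"
proof -
  have 1: "continuous_map (top_of_set {t\<in>{0..1}. t \<le> 1/2}) X (p \<circ> (\<lambda>t. 2 * t))"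
    by (rule continuous_map_compose[OF _ assms(1)[unfolded pathin_def]]) (auto intro!: continuous_intros)
  have 2: "continuous_map (top_of_set {t\<in>{0..1}. 1/2 \<le> t}) X (q \<circ> (\<lambda>t. 2 * t - 1))"
    by (rule continuous_map_compose[OF _ assms(2)[unfolded pathin_def]]) (auto intro!: continuous_intros)
  have "continuous_map (top_of_set {0..1}) X
      (\<lambda>t. if t \<le> 1/2 then (p \<circ> (\<lambda>t. 2 * t)) t else (q \<circ> (\<lambda>t. 2 * t - 1)) t)"
  proof (rule continuous_map_cases_le)
    have e: "subtopology (top_of_set {0..1}) {t \<in> topspace (top_of_set {0..1}). P t} = top_of_set {t\<in>{0..1}. P t}"
      for P :: "real \<Rightarrow> bool"
      unfolding subtopology_subtopology by (rule arg_cong[where f = top_of_set]) auto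
    show "continuous_map (subtopology (top_of_set {0..1}) {t \<in> topspace (top_of_set {0..1}). t \<le> 1/2}) X (p \<circ> (\<lambda>t. 2 * t))"
      unfolding e by (rule 1)
    show "continuous_map (subtopology (top_of_set {0..1}) {t \<in> topspace (top_of_set {0..1}). 1/2 \<le> t}) X (q \<circ> (\<lambda>t. 2 * t - 1))"
      unfolding e by (rule 2)
    show "(p \<circ> (\<lambda>t. 2 * t)) t = (q \<circ> (\<lambda>t. 2 * t - 1)) t" if "t \<in> topspace (top_of_set {0..1})" "t = 1/2" for t
    proof -
      have "2 * t = 1" "2 * t - 1 = 0" using that by auto
      then show ?thesis using assms by (simp only: o_apply)
    qed
  qed auto
  then show ?thesis
    unfolding pathin_def join_loops_def[abs_def] o_def .
qed

text \<open>In this form, with values outside of the square left open, homotopies are restricted to the sides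
  of the square and pasted.\<close>

lemma path_homotopic_iff_square:
  "path_homotopic X p q \<longleftrightarrow>
     (\<exists>h. continuous_map (top_of_set ({0..1::real} \<times> {0..1::real})) X h \<and>
        (\<forall>t\<in>{0..1}. h (0, t) = p t \<and> h (1, t) = q t) \<and>
        (\<forall>s\<in>{0..1}. h (s, 0) = p 0 \<and> h (s, 1) = p 1))"
  (is "?L \<longleftrightarrow> (\<exists>h. ?R h)")
proof -
  have top: "prod_topology (top_of_set {0..1}) (top_of_set {0..1}) =
      top_of_set ({0..1::real} \<times> {0..1::real})"
    by (simp add: prod_topology_subtopology(1) subtopology_subtopology prod_topology_subtopology(2) flip: euclidean_product_topology)
      (simp add: Times_Int_Times Int_commute)
  have "?L \<longleftrightarrow> (\<exists>h. continuous_map (prod_topology (top_of_set {0..1::real}) (top_of_set {0..1::real})) X h \<and>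
                   (\<forall>x\<in>topspace (top_of_set {0..1}). h (0, x) = p x) \<and> (\<forall>x\<in>topspace (top_of_set {0..1}). h (1, x) = q x) \<and>
                   (\<forall>t\<in>{0..1}. h (t, 0) = p 0 \<and> h (t, 1) = p 1))"
    unfolding path_homotopic_def by (subst homotopic_with) auto
  also have "\<dots> \<longleftrightarrow> (\<exists>h. ?R h)"
    unfolding top by (intro ex_cong1) auto
  finally show ?thesis .
qed

lemma path_homotopic_squareE:
  assumes "path_homotopic X p q"
  obtains h where "continuous_map (top_of_set ({0..1::real} \<times> {0..1::real})) X h"
    "\<And>t. t\<in>{0..1} \<Longrightarrow> h (0, t) = p t" "\<And>t. t\<in>{0..1} \<Longrightarrow> h (1, t) = q t"
    "\<And>s. s\<in>{0..1} \<Longrightarrow> h (s, 0) = p 0"  "\<And>s. s\<in>{0..1} \<Longrightarrow> h (s, 1) = p 1"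
  using assms unfolding path_homotopic_iff_square by auto

lemma path_homotopic_ends: "path_homotopic X p q \<Longrightarrow> q 0 = p 0 \<and> q 1 = p 1"
  unfolding path_homotopic_def by (drule homotopic_with_imp_property) auto

lemma path_homotopic_pathin: "path_homotopic X p q \<Longrightarrow> pathin X p \<and> pathin X q"
  unfolding path_homotopic_def pathin_def by (drule homotopic_with_imp_continuous_maps) auto

lemma path_homotopic_refl: "pathin X p \<Longrightarrow> path_homotopic X p p"
  by (simp add: path_homotopic_def pathin_def)

lemma path_homotopic_sym: "path_homotopic X p q \<Longrightarrow> path_homotopic X q p"
  using path_homotopic_ends[of X p q] unfolding path_homotopic_def
  by (simp add: homotopic_with_sym)

lemma path_homotopic_trans [trans]:
  "path_homotopic X p q \<Longrightarrow> path_homotopic X q r \<Longrightarrow> path_homotopic X p r"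
  using path_homotopic_ends[of X p q] unfolding path_homotopic_def
  by (auto intro: homotopic_with_trans)

lemma path_homotopic_cong:
  "pathin X p \<Longrightarrow> (\<And>t. t \<in> {0..1} \<Longrightarrow> p t = q t) \<Longrightarrow> path_homotopic X p q"
  unfolding path_homotopic_def
  by (rule homotopic_with_equal) (auto simp: pathin_def intro: continuous_map_eq)

lemma path_homotopic_image:
  "path_homotopic X p q \<Longrightarrow> continuous_map X Y f \<Longrightarrow> path_homotopic Y (f \<circ> p) (f \<circ> q)"
  unfolding path_homotopic_def
  by (rule homotopic_with_compose_continuous_map_left[of "\<lambda>h. h 0 = p 0 \<and> h 1 = p 1"]) auto

text \<open>Every elementary homotopy of paths is an instance of this: two paths in a convex set are
  homotopic by straight lines, and continuous maps preserve the homotopy.\<close>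

lemma path_homotopic_convex:
  fixes a b :: "real \<Rightarrow> 'e::real_normed_vector"
  assumes K: "continuous_map (top_of_set S) X K" and "convex S"
    and a: "continuous_on {0..1} a" "a ` {0..1} \<subseteq> S"
    and b: "continuous_on {0..1} b" "b ` {0..1} \<subseteq> S"
    and "a 0 = b 0" "a 1 = b 1"
  shows "path_homotopic X (K \<circ> a) (K \<circ> b)"
  unfolding path_homotopic_iff_square
proof (intro exI conjI)
  let ?h = "\<lambda>(s, t). (1 - s) *\<^sub>R a t + s *\<^sub>R b t"
  have "continuous_on ({0..1} \<times> {0..1}) ?h"
    unfolding case_prod_unfold
    by (intro continuous_intros continuous_on_compose2[OF a(1)] continuous_on_compose2[OF b(1)]) auto
  moreover have "?h ` ({0..1} \<times> {0..1}) \<subseteq> S"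
    using a(2) b(2) convexD_alt[OF \<open>convex S\<close>] by (auto simp: image_subset_iff)
  ultimately show "continuous_map (top_of_set ({0..1} \<times> {0..1})) X (K \<circ> ?h)"
    by (intro continuous_map_compose[OF _ K]) (auto simp: image_subset_iff_funcset)
qed (use assms in \<open>auto simp: algebra_simps simp flip: scaleR_add_left\<close>)

lemma path_homotopic_join:
  assumes "path_homotopic X p p'" "path_homotopic X q q'" "p 1 = q 0"
  shows "path_homotopic X (join_loops p q) (join_loops p' q')"
proof -
  obtain h where h: "continuous_map (top_of_set ({0..1::real} \<times> {0..1::real})) X h"
    "\<And>t. t\<in>{0..1} \<Longrightarrow> h (0, t) = p t" "\<And>t. t\<in>{0..1} \<Longrightarrow> h (1, t) = p' t"
    "\<And>s. s\<in>{0..1} \<Longrightarrow> h (s, 0) = p 0"  "\<And>s. s\<in>{0..1} \<Longrightarrow> h (s, 1) = p 1"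
    by (rule path_homotopic_squareE[OF assms(1)], rule that)
  obtain k where k: "continuous_map (top_of_set ({0..1::real} \<times> {0..1::real})) X k"
    "\<And>t. t\<in>{0..1} \<Longrightarrow> k (0, t) = q t" "\<And>t. t\<in>{0..1} \<Longrightarrow> k (1, t) = q' t"
    "\<And>s. s\<in>{0..1} \<Longrightarrow> k (s, 0) = q 0"  "\<And>s. s\<in>{0..1} \<Longrightarrow> k (s, 1) = q 1"
    by (rule path_homotopic_squareE[OF assms(2)], rule that)
  let ?S = "{0..1::real} \<times> {0..1::real}"
  have 1: "continuous_map (top_of_set {z\<in>?S. snd z \<le> 1/2}) X (h \<circ> (\<lambda>z. (fst z, 2 * snd z)))"
    by (rule continuous_map_compose[OF _ h(1)]) (auto intro!: continuous_intros)
  have 2: "continuous_map (top_of_set {z\<in>?S. 1/2 \<le> snd z}) X (k \<circ> (\<lambda>z. (fst z, 2 * snd z - 1)))"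
    by (rule continuous_map_compose[OF _ k(1)]) (auto intro!: continuous_intros)
  have eq: "(h \<circ> (\<lambda>z. (fst z, 2 * snd z))) z = (k \<circ> (\<lambda>z. (fst z, 2 * snd z - 1))) z"
    if "z \<in> ?S" "snd z = 1/2" for z
  proof -
    have "2 * snd z = 1" "2 * snd z - 1 = 0" "fst z \<in> {0..1}" using that by auto
    then show ?thesis using h(5)[of "fst z"] k(4)[of "fst z"] assms(3) by (simp only: o_apply)
  qed
  have "continuous_map (top_of_set ?S) X
      (\<lambda>z. if snd z \<le> 1/2 then (h \<circ> (\<lambda>z. (fst z, 2 * snd z))) z else (k \<circ> (\<lambda>z. (fst z, 2 * snd z - 1))) z)"
  proof (rule continuous_map_cases_le)
    show "continuous_map (subtopology (top_of_set ?S) {z \<in> topspace (top_of_set ?S). snd z \<le> 1/2}) X (h \<circ> (\<lambda>z. (fst z, 2 * snd z)))"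
      using 1 by (simp add: subtopology_subtopology Int_def)
    show "continuous_map (subtopology (top_of_set ?S) {z \<in> topspace (top_of_set ?S). 1/2 \<le> snd z}) X (k \<circ> (\<lambda>z. (fst z, 2 * snd z - 1)))"
      using 2 by (simp add: subtopology_subtopology Int_def)
    show "(h \<circ> (\<lambda>z. (fst z, 2 * snd z))) z = (k \<circ> (\<lambda>z. (fst z, 2 * snd z - 1))) z"
      if "z \<in> topspace (top_of_set ?S)" "snd z = 1/2" for z
      using that eq by simp
  qed (auto intro!: continuous_intros)
  then show ?thesis
    unfolding path_homotopic_iff_square
    by (rule_tac exI, intro conjI, assumption) (use h(2-) k(2-) in \<open>auto simp: join_loops_def\<close>)
qed

lemma path_homotopic_reparametrize:
  assumes "pathin X p" "continuous_on {0..1} a" "a ` {0..1} \<subseteq> {0..1}"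
    "continuous_on {0..1} b" "b ` {0..1} \<subseteq> {0..1}" "a 0 = b 0" "a 1 = b 1"
  shows "path_homotopic X (p \<circ> a) (p \<circ> b)"
  by (rule path_homotopic_convex[of "{0..1}"]) (use assms in \<open>auto simp: pathin_def\<close>)

lemma path_homotopic_unit_left:
  assumes "pathin X p" "c = p 0" shows "path_homotopic X (join_loops (\<lambda>_. c) p) p"
proof -
  have "path_homotopic X (p \<circ> (\<lambda>t. max 0 (2 * t - 1))) (p \<circ> (\<lambda>t. t))"
    by (rule path_homotopic_reparametrize) (use assms in \<open>auto intro!: continuous_intros\<close>)
  moreover have "p \<circ> (\<lambda>t. max 0 (2 * t - 1)) = join_loops (\<lambda>_. c) p"
  proof -
    have "max 0 (2 * t - 1) = (if t \<le> 1/2 then 0 else 2 * t - 1)" for t :: real by auto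
    then show ?thesis
      using assms by (intro ext) (simp only: join_loops_def o_def if_distrib[of p] mult_zero_right diff_self)
  qed
  ultimately show ?thesis by (simp add: o_def)
qed

lemma path_homotopic_unit_right:
  assumes "pathin X p" "c = p 1" shows "path_homotopic X (join_loops p (\<lambda>_. c)) p"
proof -
  have "path_homotopic X (p \<circ> (\<lambda>t. min 1 (2 * t))) (p \<circ> (\<lambda>t. t))"
    by (rule path_homotopic_reparametrize) (use assms in \<open>auto intro!: continuous_intros\<close>)
  moreover have "p \<circ> (\<lambda>t. min 1 (2 * t)) = join_loops p (\<lambda>_. c)"
  proof -
    have "min 1 (2 * t) = (if t \<le> 1/2 then 2 * t else 1)" for t :: real by auto
    then show ?thesis
      using assms by (intro ext) (simp only: join_loops_def o_def if_distrib[of p] mult_zero_right diff_self)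
  qed
  ultimately show ?thesis by (simp add: o_def)
qed

lemma path_homotopic_inverse_right:
  assumes "pathin X p" shows "path_homotopic X (join_loops p (reverse_path p)) (\<lambda>_. p 0)"
proof -
  have "path_homotopic X (p \<circ> (\<lambda>t. min (2 * t) (2 - 2 * t))) (p \<circ> (\<lambda>t. 0))"
    by (rule path_homotopic_reparametrize) (use assms in \<open>auto intro!: continuous_intros\<close>)
  moreover have "p \<circ> (\<lambda>t. min (2 * t) (2 - 2 * t)) = join_loops p (reverse_path p)"
    by (auto simp: join_loops_def reverse_path_def min_def algebra_simps)
  ultimately show ?thesis by (simp add: o_def)
qed

lemma path_homotopic_inverse_left:
  assumes "pathin X p" shows "path_homotopic X (join_loops (reverse_path p) p) (\<lambda>_. p 1)"
  using path_homotopic_inverse_right[OF pathin_reverse_path[OF assms]] by simp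

lemma path_homotopic_assoc:
  assumes "pathin X p" "pathin X q" "pathin X r" "p 1 = q 0" "q 1 = r 0"
  shows "path_homotopic X (join_loops (join_loops p q) r) (join_loops p (join_loops q r))"
proof -
  let ?K = "join_loops (join_loops p q) r"
  define \<phi> where "\<phi> = (\<lambda>t::real. max (t / 2) (max (min (t - 1/4) (1/2)) (2 * t - 1)))"
  have \<phi>: "t \<le> 1/2 \<Longrightarrow> 0 \<le> t \<Longrightarrow> \<phi> t = t / 2" "1/2 < t \<Longrightarrow> t \<le> 3/4 \<Longrightarrow> \<phi> t = t - 1/4"
    "3/4 < t \<Longrightarrow> t \<le> 1 \<Longrightarrow> \<phi> t = 2 * t - 1" for t
    unfolding \<phi>_def by linarith+
  have K: "pathin X ?K"
    using assms by (simp add: pathin_join_loops)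
  have 1: "path_homotopic X (?K \<circ> (\<lambda>t. t)) (?K \<circ> \<phi>)"
  proof (rule path_homotopic_reparametrize[OF K])
    show "continuous_on {0..1} \<phi>" unfolding \<phi>_def by (intro continuous_intros) simp_all
    have "0 \<le> \<phi> t \<and> \<phi> t \<le> 1" if "0 \<le> t" "t \<le> 1" for t
      using \<phi>[of t] that by linarith
    then show "\<phi> ` {0..1} \<subseteq> {0..1}" by auto
  qed (auto simp: \<phi>_def)
  have "(?K \<circ> \<phi>) t = join_loops p (join_loops q r) t" if t: "t \<in> {0..1}" for t
  proof -
    consider "t \<le> 1/2" | "1/2 < t" "t \<le> 3/4" | "3/4 < t" by linarith
    then show ?thesis
    proof cases
      case 1
      then show ?thesis using t unfolding o_apply \<phi>(1)[OF 1 atLeastAtMost_iff[THEN iffD1, OF t, THEN conjunct1]] by (simp add: join_loops_def)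
    next
      case 2
      then have "2 * (2 * (t - 1/4)) - 1 = 2 * (2 * t - 1)" "\<not> t \<le> 1/2" "2 * t - 1 \<le> 1/2"
        "t - 1/4 \<le> 1/2" "\<not> 2 * (t - 1/4) \<le> 1/2" by auto
      then show ?thesis unfolding o_apply \<phi>(2)[OF 2] join_loops_def by (simp only: if_True if_False)
    next
      case 3
      then have "\<not> t \<le> 1/2" "\<not> 2 * t - 1 \<le> 1/2" "t \<le> 1" using t by auto
      then show ?thesis unfolding o_apply \<phi>(3)[OF 3 \<open>t \<le> 1\<close>] join_loops_def by (simp only: if_True if_False)
    qed
  qed
  then have 2: "path_homotopic X (?K \<circ> \<phi>) (join_loops p (join_loops q r))"
    by (rule path_homotopic_cong[OF conjunct2[OF path_homotopic_pathin[OF 1]]])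
  have "?K \<circ> (\<lambda>t. t) = ?K" by (rule ext) (rule o_apply)
  then show ?thesis
    using path_homotopic_trans[OF 1 2] by (simp only:)
qed

section \<open>The fundamental group\<close>

lemma loopsD: "p \<in> loops X x0 \<Longrightarrow> pathin X p \<and> p 0 = x0 \<and> p 1 = x0"
  by (simp add: loops_def)

lemma loop_class_alt:
  assumes "p \<in> loops X x0" shows "loop_class X x0 p = {q. path_homotopic X p q}"
proof -
  have "q \<in> loops X x0" if "path_homotopic X p q" for q
    using that path_homotopic_pathin[OF that] path_homotopic_ends[OF that] loopsD[OF assms]
    by (simp add: loops_def)
  then show ?thesis
    using loopsD[OF assms] by (auto simp: loop_class_def path_homotopic_def)
qed

lemma loop_class_eq_iff:
  assumes "p \<in> loops X x0" "q \<in> loops X x0"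
  shows "loop_class X x0 p = loop_class X x0 q \<longleftrightarrow> path_homotopic X p q"
proof -
  have "path_homotopic X p q" if "{r. path_homotopic X p r} = {r. path_homotopic X q r}"
    using that path_homotopic_refl[of X q] loopsD[OF assms(2)] by blast
  moreover have "{r. path_homotopic X p r} = {r. path_homotopic X q r}" if "path_homotopic X p q"
    using that path_homotopic_sym path_homotopic_trans by blast
  ultimately show ?thesis
    using assms by (simp only: loop_class_alt) blast
qed

lemma loop_class_self: "p \<in> loops X x0 \<Longrightarrow> p \<in> loop_class X x0 p"
  by (simp add: loop_class_alt path_homotopic_refl loops_def)

lemma loop_class_subset: "q \<in> loop_class X x0 p \<Longrightarrow> q \<in> loops X x0"
  by (simp add: loop_class_def)

lemma join_loops_in_loops: "p \<in> loops X x0 \<Longrightarrow> q \<in> loops X x0 \<Longrightarrow> join_loops p q \<in> loops X x0"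
  by (simp add: loops_def pathin_join_loops)

lemma carrier_fundamental_group:
  "carrier (fundamental_group X x0) = loop_class X x0 ` loops X x0"
  by (simp add: fundamental_group_def)

lemma one_fundamental_group: "\<one>\<^bsub>fundamental_group X x0\<^esub> = loop_class X x0 (\<lambda>_. x0)"
  by (simp add: fundamental_group_def)

lemma loop_class_carrier:
  "p \<in> loops X x0 \<Longrightarrow> loop_class X x0 p \<in> carrier (fundamental_group X x0)"
  by (simp add: carrier_fundamental_group)

lemma UNION_constant: "a \<in> A \<Longrightarrow> (\<And>x. x \<in> A \<Longrightarrow> F x = c) \<Longrightarrow> (\<Union>x\<in>A. F x) = c"
  by auto

lemma mult_fundamental_group:
  assumes p: "p \<in> loops X x0" and q: "q \<in> loops X x0"
  shows "loop_class X x0 p \<otimes>\<^bsub>fundamental_group X x0\<^esub> loop_class X x0 q = loop_class X x0 (join_loops p q)"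
proof -
  have eq: "loop_class X x0 (join_loops p' q') = loop_class X x0 (join_loops p q)"
    if p': "p' \<in> loop_class X x0 p" and q': "q' \<in> loop_class X x0 q" for p' q'
  proof -
    have pp: "path_homotopic X p p'" "path_homotopic X q q'"
      using p' q' unfolding loop_class_alt[OF p] loop_class_alt[OF q] by simp_all
    have "path_homotopic X (join_loops p q) (join_loops p' q')"
      by (rule path_homotopic_join[OF pp]) (use loopsD[OF p] loopsD[OF q] in simp)
    then show ?thesis
      using loop_class_eq_iff[OF join_loops_in_loops[OF p q]
          join_loops_in_loops[OF loop_class_subset[OF p'] loop_class_subset[OF q']]] by simp
  qed
  show ?thesis
    unfolding fundamental_group_def monoid.simps
    by (intro UNION_constant[OF loop_class_self[OF p]] UNION_constant[OF loop_class_self[OF q]] eq)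
qed

lemma const_loop: "x0 \<in> topspace X \<Longrightarrow> (\<lambda>_. x0) \<in> loops X x0"
  by (simp add: loops_def)

lemma reverse_path_in_loops: "p \<in> loops X x0 \<Longrightarrow> reverse_path p \<in> loops X x0"
  by (simp add: loops_def pathin_reverse_path)

lemma loop_class_join_assoc:
  assumes "p \<in> loops X x0" "q \<in> loops X x0" "r \<in> loops X x0"
  shows "loop_class X x0 (join_loops (join_loops p q) r) = loop_class X x0 (join_loops p (join_loops q r))"
proof -
  have "path_homotopic X (join_loops (join_loops p q) r) (join_loops p (join_loops q r))"
    using loopsD[OF assms(1)] loopsD[OF assms(2)] loopsD[OF assms(3)]
    by (intro path_homotopic_assoc) simp_all
  then show ?thesis
    using assms by (simp only: loop_class_eq_iff join_loops_in_loops)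
qed

lemma loop_class_join_const:
  assumes "p \<in> loops X x0"
  shows "loop_class X x0 (join_loops (\<lambda>_. x0) p) = loop_class X x0 p"
proof -
  have "path_homotopic X (join_loops (\<lambda>_. x0) p) p" "x0 \<in> topspace X"
    using loopsD[OF assms] path_start_in_topspace[of X p]
    by (auto intro!: path_homotopic_unit_left)
  then show ?thesis
    using assms by (simp only: loop_class_eq_iff join_loops_in_loops const_loop)
qed

lemma loop_class_join_reverse:
  assumes "p \<in> loops X x0"
  shows "loop_class X x0 (join_loops (reverse_path p) p) = loop_class X x0 (\<lambda>_. x0)"
proof -
  have "path_homotopic X (join_loops (reverse_path p) p) (\<lambda>_. x0)" "x0 \<in> topspace X"
    using loopsD[OF assms] path_start_in_topspace[of X p] path_homotopic_inverse_left[of X p] by auto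
  then show ?thesis
    using assms by (simp only: loop_class_eq_iff join_loops_in_loops const_loop reverse_path_in_loops)
qed

lemma group_fundamental_group:
  assumes "x0 \<in> topspace X" shows "group (fundamental_group X x0)"
proof (rule groupI)
  let ?G = "fundamental_group X x0"
  note [simp] = one_fundamental_group mult_fundamental_group loop_class_carrier
    const_loop[OF assms] join_loops_in_loops reverse_path_in_loops
  show "\<one>\<^bsub>?G\<^esub> \<in> carrier ?G" by simp
  fix a assume "a \<in> carrier ?G"
  then obtain p where p: "p \<in> loops X x0" and a: "a = loop_class X x0 p"
    unfolding carrier_fundamental_group by (rule imageE)
  show "\<one>\<^bsub>?G\<^esub> \<otimes>\<^bsub>?G\<^esub> a = a"
    using p unfolding a by (simp add: loop_class_join_const)
  show "\<exists>b\<in>carrier ?G. b \<otimes>\<^bsub>?G\<^esub> a = \<one>\<^bsub>?G\<^esub>"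
    using p unfolding a by (intro bexI[of _ "loop_class X x0 (reverse_path p)"]) (simp_all add: loop_class_join_reverse)
  fix b assume "b \<in> carrier ?G"
  then obtain q where q: "q \<in> loops X x0" and b: "b = loop_class X x0 q"
    unfolding carrier_fundamental_group by (rule imageE)
  show "a \<otimes>\<^bsub>?G\<^esub> b \<in> carrier ?G"
    using p q unfolding a b by simp
  fix c assume "c \<in> carrier ?G"
  then obtain r where r: "r \<in> loops X x0" and c: "c = loop_class X x0 r"
    unfolding carrier_fundamental_group by (rule imageE)
  show "a \<otimes>\<^bsub>?G\<^esub> b \<otimes>\<^bsub>?G\<^esub> c = a \<otimes>\<^bsub>?G\<^esub> (b \<otimes>\<^bsub>?G\<^esub> c)"
    using p q r unfolding a b c by (simp add: loop_class_join_assoc)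
qed

lemma inv_fundamental_group:
  assumes "x0 \<in> topspace X" "p \<in> loops X x0"
  shows "inv\<^bsub>fundamental_group X x0\<^esub> (loop_class X x0 p) = loop_class X x0 (reverse_path p)"
proof (rule group.inv_equality[OF group_fundamental_group])
  show "loop_class X x0 (reverse_path p) \<otimes>\<^bsub>fundamental_group X x0\<^esub> loop_class X x0 p = \<one>\<^bsub>fundamental_group X x0\<^esub>"
    using assms by (simp add: one_fundamental_group mult_fundamental_group reverse_path_in_loops loop_class_join_reverse)
qed (use assms in \<open>simp_all add: loop_class_carrier reverse_path_in_loops\<close>)

lemma loops_compose:
  "p \<in> loops X x0 \<Longrightarrow> continuous_map X Y h \<Longrightarrow> h \<circ> p \<in> loops Y (h x0)"
  by (auto simp: loops_def pathin_compose)

lemma fundamental_group_map_loop_class: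
  assumes "p \<in> loops X x0" "continuous_map X Y h"
  shows "fundamental_group_map Y (h x0) h (loop_class X x0 p) = loop_class Y (h x0) (h \<circ> p)"
proof -
  have "loop_class Y (h x0) (h \<circ> q) = loop_class Y (h x0) (h \<circ> p)" if "q \<in> loop_class X x0 p" for q
  proof -
    have "path_homotopic X p q" using that loop_class_alt[OF assms(1)] by blast
    then have "path_homotopic Y (h \<circ> q) (h \<circ> p)"
      by (intro path_homotopic_sym[OF path_homotopic_image[OF _ assms(2)]])
    then show ?thesis
      using loops_compose[OF loop_class_subset[OF that] assms(2)] loops_compose[OF assms]
      by (simp only: loop_class_eq_iff)
  qed
  then show ?thesis
    unfolding fundamental_group_map_def by (rule UNION_constant[OF loop_class_self[OF assms(1)]])
qed

lemma fundamental_group_map_hom: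
  assumes "continuous_map X Y h"
  shows "fundamental_group_map Y (h x0) h \<in> hom (fundamental_group X x0) (fundamental_group Y (h x0))"
proof (rule homI)
  fix a b assume "a \<in> carrier (fundamental_group X x0)" "b \<in> carrier (fundamental_group X x0)"
  then show "fundamental_group_map Y (h x0) h (a \<otimes>\<^bsub>fundamental_group X x0\<^esub> b) =
     fundamental_group_map Y (h x0) h a \<otimes>\<^bsub>fundamental_group Y (h x0)\<^esub> fundamental_group_map Y (h x0) h b"
    using assms by (auto simp: carrier_fundamental_group mult_fundamental_group join_loops_in_loops
        fundamental_group_map_loop_class loops_compose join_loops_compose)
next
  fix a assume "a \<in> carrier (fundamental_group X x0)"
  then show "fundamental_group_map Y (h x0) h a \<in> carrier (fundamental_group Y (h x0))"
    using assms by (auto simp: carrier_fundamental_group fundamental_group_map_loop_class loops_compose)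
qed

text \<open>Choosing a path \<open>\<tau> x\<close> from the base point to every point \<open>x\<close> turns arbitrary paths into elements
  of the fundamental group.  Concatenation becomes the group multiplication, so that homotopies
  between composite paths reduce to computations in a group.\<close>

definition path_system :: "'a topology \<Rightarrow> 'a \<Rightarrow> ('a \<Rightarrow> real \<Rightarrow> 'a) \<Rightarrow> bool" where
  "path_system X x0 \<tau> \<longleftrightarrow> x0 \<in> topspace X \<and> (\<forall>x\<in>topspace X. pathin X (\<tau> x) \<and> \<tau> x 0 = x0 \<and> \<tau> x 1 = x)"

definition path_class :: "'a topology \<Rightarrow> 'a \<Rightarrow> ('a \<Rightarrow> real \<Rightarrow> 'a) \<Rightarrow> (real \<Rightarrow> 'a) \<Rightarrow> (real \<Rightarrow> 'a) set" where
  "path_class X x0 \<tau> q = loop_class X x0 (join_loops (join_loops (\<tau> (q 0)) q) (reverse_path (\<tau> (q 1))))"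

lemma path_system_at:
  assumes "path_system X x0 \<tau>" "pathin X q"
  shows "pathin X (\<tau> (q 0))" "\<tau> (q 0) 0 = x0" "\<tau> (q 0) 1 = q 0"
    "pathin X (\<tau> (q 1))" "\<tau> (q 1) 0 = x0" "\<tau> (q 1) 1 = q 1"
  using assms path_start_in_topspace[OF assms(2)] path_finish_in_topspace[OF assms(2)]
  by (auto simp: path_system_def)

lemma path_class_loop:
  assumes "path_system X x0 \<tau>" "pathin X q"
  shows "join_loops (join_loops (\<tau> (q 0)) q) (reverse_path (\<tau> (q 1))) \<in> loops X x0"
  using path_system_at[OF assms] assms
  by (auto simp: loops_def intro!: pathin_join_loops pathin_reverse_path)

lemma path_class_carrier:
  "path_system X x0 \<tau> \<Longrightarrow> pathin X q \<Longrightarrow> path_class X x0 \<tau> q \<in> carrier (fundamental_group X x0)"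
  by (simp add: path_class_def loop_class_carrier path_class_loop)

lemma path_class_eqI:
  assumes \<tau>: "path_system X x0 \<tau>" and pq: "path_homotopic X p q"
  shows "path_class X x0 \<tau> p = path_class X x0 \<tau> q"
proof -
  note e = path_homotopic_ends[OF pq] and c = path_homotopic_pathin[OF pq]
  note s = path_system_at[OF \<tau> conjunct1[OF c]]
  have "path_homotopic X (join_loops (join_loops (\<tau> (p 0)) p) (reverse_path (\<tau> (p 1))))
     (join_loops (join_loops (\<tau> (p 0)) q) (reverse_path (\<tau> (p 1))))"
    by (intro path_homotopic_join pq path_homotopic_refl pathin_reverse_path s(1,4)) (simp_all add: s)
  then show ?thesis
    using loop_class_eq_iff[OF path_class_loop[OF \<tau> conjunct1[OF c]] path_class_loop[OF \<tau> conjunct2[OF c]]] e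
    by (simp add: path_class_def)
qed

lemma path_homotopic_cancel_middle:
  assumes "pathin X a" "pathin X b" "pathin X t" "a 1 = t 1" "b 0 = t 1"
  shows "path_homotopic X (join_loops (join_loops a (reverse_path t)) (join_loops t b)) (join_loops a b)"
proof -
  note [simp] = assms pathin_join_loops pathin_reverse_path
  have "path_homotopic X (join_loops (join_loops a (reverse_path t)) (join_loops t b))
     (join_loops a (join_loops (reverse_path t) (join_loops t b)))"
    by (rule path_homotopic_assoc) simp_all
  also have "path_homotopic X \<dots> (join_loops a (join_loops (join_loops (reverse_path t) t) b))"
    by (intro path_homotopic_join path_homotopic_refl path_homotopic_sym[OF path_homotopic_assoc]) simp_all
  also have "path_homotopic X \<dots> (join_loops a (join_loops (\<lambda>_. t 1) b))"
    by (intro path_homotopic_join path_homotopic_refl path_homotopic_inverse_left) simp_all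
  also have "path_homotopic X \<dots> (join_loops a b)"
    by (intro path_homotopic_join path_homotopic_refl path_homotopic_unit_left) simp_all
  finally show ?thesis .
qed

lemma path_class_join:
  assumes \<tau>: "path_system X x0 \<tau>" and p: "pathin X p" and q: "pathin X q" and pq: "p 1 = q 0"
  shows "path_class X x0 \<tau> (join_loops p q) =
    path_class X x0 \<tau> p \<otimes>\<^bsub>fundamental_group X x0\<^esub> path_class X x0 \<tau> q"
proof -
  note [simp] = p q pq pathin_join_loops pathin_reverse_path path_system_at[OF \<tau> p] path_system_at[OF \<tau> q]
  let ?a = "join_loops (\<tau> (p 0)) p" let ?t = "\<tau> (q 0)" let ?b = "join_loops q (reverse_path (\<tau> (q 1)))"
  have "path_homotopic X (join_loops (join_loops ?a (reverse_path ?t)) (join_loops (join_loops ?t q) (reverse_path (\<tau> (q 1)))))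
      (join_loops (join_loops ?a (reverse_path ?t)) (join_loops ?t ?b))"
    by (intro path_homotopic_join path_homotopic_refl path_homotopic_assoc) simp_all
  also have "path_homotopic X \<dots> (join_loops ?a ?b)"
    by (rule path_homotopic_cancel_middle) simp_all
  also have "path_homotopic X \<dots> (join_loops (join_loops ?a q) (reverse_path (\<tau> (q 1))))"
    by (rule path_homotopic_sym[OF path_homotopic_assoc]) simp_all
  also have "path_homotopic X \<dots> (join_loops (join_loops (\<tau> (p 0)) (join_loops p q)) (reverse_path (\<tau> (q 1))))"
    by (intro path_homotopic_join path_homotopic_refl path_homotopic_assoc) simp_all
  finally have h: "path_homotopic X (join_loops (join_loops (join_loops (\<tau> (p 0)) p) (reverse_path (\<tau> (p 1))))
       (join_loops (join_loops (\<tau> (q 0)) q) (reverse_path (\<tau> (q 1)))))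
     (join_loops (join_loops (\<tau> (join_loops p q 0)) (join_loops p q)) (reverse_path (\<tau> (join_loops p q 1))))"
    by simp
  have l: "join_loops (join_loops (\<tau> (p 0)) p) (reverse_path (\<tau> (p 1))) \<in> loops X x0"
     "join_loops (join_loops (\<tau> (q 0)) q) (reverse_path (\<tau> (q 1))) \<in> loops X x0"
     "join_loops (join_loops (\<tau> (join_loops p q 0)) (join_loops p q)) (reverse_path (\<tau> (join_loops p q 1))) \<in> loops X x0"
    using path_class_loop[OF \<tau> p] path_class_loop[OF \<tau> q] path_class_loop[OF \<tau> pathin_join_loops[OF p q pq]] by auto
  show ?thesis
    unfolding path_class_def mult_fundamental_group[OF l(1,2)]
    using h loop_class_eq_iff[OF join_loops_in_loops[OF l(1,2)] l(3)] by simp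
qed

lemma path_class_const:
  assumes \<tau>: "path_system X x0 \<tau>" and "x \<in> topspace X"
  shows "path_class X x0 \<tau> (\<lambda>_. x) = \<one>\<^bsub>fundamental_group X x0\<^esub>"
proof -
  have x0: "x0 \<in> topspace X" using \<tau> by (simp add: path_system_def)
  have p: "pathin X (\<lambda>_. x)" using assms by simp
  note s = path_system_at[OF \<tau> p]
  interpret group "fundamental_group X x0" by (rule group_fundamental_group[OF x0])
  have "path_class X x0 \<tau> (\<lambda>_. x) \<otimes>\<^bsub>fundamental_group X x0\<^esub> path_class X x0 \<tau> (\<lambda>_. x) = path_class X x0 \<tau> (\<lambda>_. x)"
    using path_class_join[OF \<tau> p p] by (simp add: join_loops_def[abs_def])
  then show ?thesis
    using path_class_carrier[OF \<tau> p] by (simp add: l_cancel_one)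
qed

lemma path_class_reverse:
  assumes \<tau>: "path_system X x0 \<tau>" and q: "pathin X q"
  shows "path_class X x0 \<tau> (reverse_path q) = inv\<^bsub>fundamental_group X x0\<^esub> (path_class X x0 \<tau> q)"
proof -
  have x0: "x0 \<in> topspace X" using \<tau> by (simp add: path_system_def)
  interpret group "fundamental_group X x0" by (rule group_fundamental_group[OF x0])
  have "path_class X x0 \<tau> (reverse_path q) \<otimes>\<^bsub>fundamental_group X x0\<^esub> path_class X x0 \<tau> q =
      path_class X x0 \<tau> (join_loops (reverse_path q) q)"
    by (rule path_class_join[symmetric, OF \<tau> pathin_reverse_path[OF q] q]) simp
  also have "\<dots> = path_class X x0 \<tau> (\<lambda>_. q 1)"
    by (rule path_class_eqI[OF \<tau> path_homotopic_inverse_left[OF q]])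
  also have "\<dots> = \<one>\<^bsub>fundamental_group X x0\<^esub>"
    by (rule path_class_const[OF \<tau> path_finish_in_topspace[OF q]])
  finally show ?thesis
    using inv_equality path_class_carrier[OF \<tau> q] path_class_carrier[OF \<tau> pathin_reverse_path[OF q]] by simp
qed

lemma path_class_based_loop:
  assumes \<tau>: "path_system X x0 \<tau>" "\<tau> x0 = (\<lambda>_. x0)" and q: "q \<in> loops X x0"
  shows "path_class X x0 \<tau> q = loop_class X x0 q"
proof -
  have x0: "x0 \<in> topspace X" using \<tau>(1) by (simp add: path_system_def)
  have r: "reverse_path (\<lambda>_. x0) = (\<lambda>_. x0)" by (simp add: reverse_path_def[abs_def])
  have j: "join_loops (\<lambda>_. x0) q \<in> loops X x0" by (intro join_loops_in_loops const_loop x0 q)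
  have "path_homotopic X (join_loops (join_loops (\<lambda>_. x0) q) (\<lambda>_. x0)) (join_loops (\<lambda>_. x0) q)"
    using loopsD[OF j] by (intro path_homotopic_unit_right) auto
  also have "path_homotopic X \<dots> q"
    using loopsD[OF q] by (intro path_homotopic_unit_left) auto
  finally show ?thesis
    using loop_class_eq_iff[OF join_loops_in_loops[OF j const_loop[OF x0]] q] loopsD[OF q]
    by (simp add: path_class_def \<tau>(2) r)
qed

text \<open>In the square \<open>H (s, q t)\<close> the path \<open>q\<close> is one side and a constant path
  the opposite one; the other two sides are the tracks of the end points of \<open>q\<close>.\<close>

lemma path_homotopic_tracks:
  assumes H: "continuous_map (prod_topology (top_of_set {0..1}) (subtopology X U)) X H"
    and q: "pathin X q" "q ` {0..1} \<subseteq> U"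
    and H0: "\<And>x. x \<in> U \<Longrightarrow> H (0, x) = x" and H1: "\<And>x. x \<in> U \<Longrightarrow> H (1, x) = v"
  shows "path_homotopic X q (join_loops (\<lambda>t. H (t, q 0)) (reverse_path (\<lambda>t. H (t, q 1))))"
proof -
  let ?K = "H \<circ> (\<lambda>z. (fst z, q (snd z)))"
  have qU: "q t \<in> U" if "t \<in> {0..1}" for t using q(2) that by blast
  have qs: "continuous_map (top_of_set ({0..1} \<times> {0..1})) (subtopology X U) (q \<circ> snd)"
    by (rule continuous_map_compose[of _ "top_of_set {0..1}"])
      (use q in \<open>auto simp: pathin_def continuous_map_in_subtopology intro!: continuous_intros\<close>)
  have K: "continuous_map (top_of_set ({0..1} \<times> {0..1})) X ?K"
    by (rule continuous_map_compose[OF _ H])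
      (use qs in \<open>auto simp: continuous_map_pairedI o_def intro!: continuous_intros\<close>)
  let ?a = "\<lambda>t::real. (0::real, t)"
  let ?b = "\<lambda>t::real. (min (3*t) (min 1 (3 - 3 * t)), max 0 (min 1 (3 * t - 1)))"
  have 1: "path_homotopic X (?K \<circ> ?a) (?K \<circ> ?b)"
    by (rule path_homotopic_convex[OF K]) (auto intro!: continuous_intros convex_Times)
  have 2: "path_homotopic X (?K \<circ> ?b) (join_loops (\<lambda>t. H (t, q 0)) (reverse_path (\<lambda>t. H (t, q 1))))"
  proof -
    let ?x = "\<lambda>t. H (t, q 0)" let ?y = "\<lambda>t. H (t, q 1)"
    have px: "pathin X ?x" and py: "pathin X ?y"
    proof -
      have "pathin X (?K \<circ> (\<lambda>t. (t, 0)))" "pathin X (?K \<circ> (\<lambda>t. (t, 1)))"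
        by (rule pathin_compose_map[OF K]; auto intro!: continuous_intros)+
      then show "pathin X ?x" "pathin X ?y" by (simp_all add: o_def)
    qed
    define \<phi> where "\<phi> = (\<lambda>t::real. max (min (3/2 * t) (1/2)) (3/2 * t - 1/2))"
    have \<phi>: "t \<le> 1/3 \<Longrightarrow> \<phi> t = 3/2 * t" "1/3 < t \<Longrightarrow> t \<le> 2/3 \<Longrightarrow> \<phi> t = 1/2"
      "2/3 < t \<Longrightarrow> \<phi> t = 3/2 * t - 1/2" for t
      unfolding \<phi>_def by linarith+
    have b: "t \<le> 1/3 \<Longrightarrow> ?b t = (3 * t, 0)" "1/3 < t \<Longrightarrow> t \<le> 2/3 \<Longrightarrow> ?b t = (1, 3 * t - 1)"
      "2/3 < t \<Longrightarrow> ?b t = (3 - 3 * t, 1)" for t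
      by (subst prod.inject, intro conjI; linarith)+
    have 3: "path_homotopic X (join_loops ?x (reverse_path ?y) \<circ> \<phi>) (join_loops ?x (reverse_path ?y) \<circ> (\<lambda>t. t))"
    proof (rule path_homotopic_reparametrize)
      have "H (1, q 0) = H (1, q 1)" using H1 qU by simp
      then show "pathin X (join_loops ?x (reverse_path ?y))"
        by (intro pathin_join_loops px pathin_reverse_path py) simp
    qed (auto simp: \<phi>_def intro!: continuous_intros)
    have "(join_loops ?x (reverse_path ?y) \<circ> \<phi>) t = (?K \<circ> ?b) t" if "t \<in> {0..1}" for t
    proof -
      consider "t \<le> 1/3" | "1/3 < t" "t \<le> 2/3" | "2/3 < t" by linarith
      then show ?thesis
      proof cases
        case 1 then show ?thesis unfolding o_apply \<phi>(1)[OF 1] b(1)[OF 1] by (simp add: join_loops_def)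
      next
        case 2
        then show ?thesis unfolding o_apply \<phi>(2)[OF 2] b(2)[OF 2] using H1 qU by (simp add: join_loops_def)
      next
        case 3
        then have "\<not> 3/2 * t - 1/2 \<le> 1/2" "1 - (2 * (3/2 * t - 1/2) - 1) = 3 - 3 * t" by auto
        then show ?thesis unfolding o_apply \<phi>(3)[OF 3] b(3)[OF 3] join_loops_def reverse_path_def
          by (simp only: if_False fst_conv snd_conv)
      qed
    qed
    then have 4: "path_homotopic X (join_loops ?x (reverse_path ?y) \<circ> \<phi>) (?K \<circ> ?b)"
      by (rule path_homotopic_cong[OF conjunct1[OF path_homotopic_pathin[OF 3]]])
    have "join_loops ?x (reverse_path ?y) \<circ> (\<lambda>t. t) = join_loops ?x (reverse_path ?y)"
      by (rule ext) (rule o_apply)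
    then show ?thesis
      using path_homotopic_trans[OF path_homotopic_sym[OF 4] 3] by (simp only:)
  qed
  have "path_homotopic X q (?K \<circ> ?a)"
    by (rule path_homotopic_cong[OF q(1)]) (use H0 qU in auto)
  then show ?thesis
    using 1 2 path_homotopic_trans by blast
qed

section \<open>Holonomy of paths crossing walls\<close>

text \<open>A wall has a negative side \<open>N i\<close> and a positive side \<open>P i\<close>, so that it
  makes sense to say in which direction a path crosses it. In a graph the walls are midpoints of
  edges.\<close>

locale wall_system =
  fixes X :: "'a topology" and B :: "'i set" and N M P :: "'i \<Rightarrow> 'a set"
  assumes finite_walls: "finite B"
    and wall_nbhd: "\<And>i. i \<in> B \<Longrightarrow> openin X (N i \<union> M i \<union> P i)"
    and open_sides: "\<And>i. i \<in> B \<Longrightarrow> openin X (N i)" "\<And>i. i \<in> B \<Longrightarrow> openin X (P i)"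
    and closed_wall: "\<And>i. i \<in> B \<Longrightarrow> closedin X (M i)"
    and sides_disjoint: "\<And>i. i \<in> B \<Longrightarrow> N i \<inter> M i = {}" "\<And>i. i \<in> B \<Longrightarrow> P i \<inter> M i = {}"
      "\<And>i. i \<in> B \<Longrightarrow> N i \<inter> P i = {}"
    and walls_disjoint: "\<And>i j. i \<in> B \<Longrightarrow> j \<in> B \<Longrightarrow> i \<noteq> j \<Longrightarrow> M j \<inter> (N i \<union> M i \<union> P i) = {}"

text \<open>The crossing is at time \<open>a\<close>, from outside of the positive side into the positive
  side.\<close>

definition crosses_once :: "'i set \<Rightarrow> ('i \<Rightarrow> 'a set) \<Rightarrow> ('i \<Rightarrow> 'a set) \<Rightarrow> 'i \<Rightarrow> (real \<Rightarrow> 'a) \<Rightarrow> bool" where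
  "crosses_once B M P i q \<longleftrightarrow>
     (\<exists>a\<in>{0<..<1}. (\<forall>t\<in>{0..1}. \<forall>j\<in>B. q t \<in> M j \<longleftrightarrow> j = i \<and> t = a) \<and>
        (\<exists>d>0. \<forall>t\<in>{0..1}. (a - d < t \<and> t < a \<longrightarrow> q t \<notin> P i) \<and> (a < t \<and> t < a + d \<longrightarrow> q t \<in> P i)))"

definition avoids :: "'i set \<Rightarrow> ('i \<Rightarrow> 'a set) \<Rightarrow> (real \<Rightarrow> 'a) \<Rightarrow> bool" where
  "avoids B M q \<longleftrightarrow> (\<forall>t\<in>{0..1}. \<forall>i\<in>B. q t \<notin> M i)"

locale wall_holonomy = wall_system X B N M P + group F
  for X :: "'a topology" and B :: "'i set" and N M P and F :: "('f, 'm) monoid_scheme" (structure) +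
  fixes g :: "'i \<Rightarrow> 'f"
  assumes g_carrier: "\<And>i. i \<in> B \<Longrightarrow> g i \<in> carrier F"
begin

text \<open>The label that is picked up in moving from \<open>y\<close> to a nearby point \<open>y'\<close>:
  it is nontrivial only if \<open>y\<close> lies on a wall and \<open>y'\<close> on its positive side.\<close>

definition jump :: "'a \<Rightarrow> 'a \<Rightarrow> 'f" where
  "jump y y' = (if \<exists>i\<in>B. y \<in> M i \<and> y' \<in> P i then g (THE i. i \<in> B \<and> y \<in> M i) else \<one>)"

text \<open>A section over a map \<open>K\<close> of a parameter space into \<open>X\<close> is a lift of \<open>K\<close> to the covering space
  of \<open>X\<close> with fibre \<open>F\<close> that is glued by \<open>g i\<close> along the wall \<open>M i\<close>, in the coordinate of the fibre.\<close>

definition lifts :: "('z::metric_space \<Rightarrow> 'a) \<Rightarrow> 'z set \<Rightarrow> ('z \<Rightarrow> 'f) \<Rightarrow> bool" where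
  "lifts K S h \<longleftrightarrow> h \<in> S \<rightarrow> carrier F \<and>
     (\<forall>z\<in>S. \<exists>W. open W \<and> z \<in> W \<and> (\<exists>k\<in>carrier F. \<forall>w\<in>S \<inter> W. h w = k \<otimes> jump (K z) (K w)))"

lemma wall_unique: "i \<in> B \<Longrightarrow> j \<in> B \<Longrightarrow> y \<in> M i \<Longrightarrow> y \<in> M j \<Longrightarrow> i = j"
  using walls_disjoint[of i j] by blast

lemma jump_wall:
  assumes "i \<in> B" "y \<in> M i" shows "jump y y' = (if y' \<in> P i then g i else \<one>)"
proof -
  have "(THE i. i \<in> B \<and> y \<in> M i) = i"
    using assms wall_unique by (intro the_equality) auto
  moreover have "(\<exists>i\<in>B. y \<in> M i \<and> y' \<in> P i) \<longleftrightarrow> y' \<in> P i"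
    using assms wall_unique by auto
  ultimately show ?thesis by (simp add: jump_def)
qed

lemma jump_off_walls: "(\<And>i. i \<in> B \<Longrightarrow> y \<notin> M i) \<Longrightarrow> jump y y' = \<one>"
  by (auto simp: jump_def)

lemma jump_carrier [simp]: "jump y y' \<in> carrier F"
  using jump_wall[of _ y y'] jump_off_walls[of y y'] g_carrier by (cases "\<exists>i\<in>B. y \<in> M i") auto

lemma lifts_carrier: "lifts K S h \<Longrightarrow> z \<in> S \<Longrightarrow> h z \<in> carrier F"
  by (auto simp: lifts_def)

lemma lifts_nbhd:
  assumes "lifts K S h" "z \<in> S"
  obtains W k where "open W" "z \<in> W" "k \<in> carrier F" "\<And>w. w \<in> S \<Longrightarrow> w \<in> W \<Longrightarrow> h w = k \<otimes> jump (K z) (K w)"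
  using assms by (auto simp: lifts_def)

lemma liftsI:
  assumes "\<And>z. z \<in> S \<Longrightarrow> h z \<in> carrier F"
    and "\<And>z. z \<in> S \<Longrightarrow> \<exists>W k. open W \<and> z \<in> W \<and> k \<in> carrier F \<and> (\<forall>w. w \<in> S \<longrightarrow> w \<in> W \<longrightarrow> h w = k \<otimes> jump (K z) (K w))"
  shows "lifts K S h"
  unfolding lifts_def
proof (intro conjI Pi_I ballI)
  fix z assume z: "z \<in> S"
  obtain W k where "open W" "z \<in> W" "k \<in> carrier F" "\<forall>w. w \<in> S \<longrightarrow> w \<in> W \<longrightarrow> h w = k \<otimes> jump (K z) (K w)"
    using assms(2)[OF z] by (elim exE conjE) (rule that)
  then show "\<exists>W. open W \<and> z \<in> W \<and> (\<exists>k\<in>carrier F. \<forall>w\<in>S \<inter> W. h w = k \<otimes> jump (K z) (K w))"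
    by (intro exI[of _ W] conjI bexI[of _ k] ballI) simp_all
qed (rule assms(1))

lemma cancel_left: "a \<in> carrier F \<Longrightarrow> b \<in> carrier F \<Longrightarrow> inv a \<otimes> (a \<otimes> b) = b"
  "a \<in> carrier F \<Longrightarrow> b \<in> carrier F \<Longrightarrow> a \<otimes> (inv a \<otimes> b) = b"
  by (simp_all add: m_assoc[symmetric])

lemma preimage_open:
  assumes "continuous_map (top_of_set S) X K" "openin X U"
  obtains W where "open W" "S \<inter> W = {w \<in> S. K w \<in> U}"
proof -
  have "openin (top_of_set S) {w \<in> topspace (top_of_set S). K w \<in> U}"
    by (rule openin_continuous_map_preimage[OF assms])
  then have "openin (top_of_set S) {w \<in> S. K w \<in> U}" by simp
  then obtain W where "open W" "{w \<in> S. K w \<in> U} = S \<inter> W" by (auto simp: openin_open)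
  then show thesis using that[of W] by simp
qed

lemma lifts_translate:
  assumes "lifts K S h" "c \<in> carrier F" shows "lifts K S (\<lambda>z. c \<otimes> h z)"
proof (rule liftsI)
  fix z assume z: "z \<in> S"
  show "c \<otimes> h z \<in> carrier F" using lifts_carrier[OF assms(1) z] assms(2) by simp
  obtain W k where W: "open W" "z \<in> W" "k \<in> carrier F" "\<And>w. w \<in> S \<Longrightarrow> w \<in> W \<Longrightarrow> h w = k \<otimes> jump (K z) (K w)"
    by (rule lifts_nbhd[OF assms(1) z], rule that)
  have "c \<otimes> h w = (c \<otimes> k) \<otimes> jump (K z) (K w)" if "w \<in> S" "w \<in> W" for w
    using W(3,4) that assms(2) by (simp add: m_assoc)
  then show "\<exists>W k. open W \<and> z \<in> W \<and> k \<in> carrier F \<and> (\<forall>w. w \<in> S \<longrightarrow> w \<in> W \<longrightarrow> c \<otimes> h w = k \<otimes> jump (K z) (K w))"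
    using W assms(2) by (intro exI[of _ W] exI[of _ "c \<otimes> k"]) auto
qed

lemma lifts_compose:
  fixes \<phi> :: "'y::metric_space \<Rightarrow> 'z::metric_space"
  assumes "lifts K S h" "continuous_on S' \<phi>" "\<phi> ` S' \<subseteq> S"
  shows "lifts (K \<circ> \<phi>) S' (h \<circ> \<phi>)"
proof (rule liftsI)
  fix z assume z: "z \<in> S'"
  then have \<phi>z: "\<phi> z \<in> S" using assms(3) by blast
  show "(h \<circ> \<phi>) z \<in> carrier F" using lifts_carrier[OF assms(1) \<phi>z] by simp
  obtain W k where W: "open W" "\<phi> z \<in> W" "k \<in> carrier F"
      "\<And>w. w \<in> S \<Longrightarrow> w \<in> W \<Longrightarrow> h w = k \<otimes> jump (K (\<phi> z)) (K w)"
    by (rule lifts_nbhd[OF assms(1) \<phi>z], rule that)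
  obtain Wb where Wb: "open Wb" "Wb \<inter> S' = \<phi> -` W \<inter> S'"
    using assms(2) W(1) by (auto simp: continuous_on_open_invariant)
  then show "\<exists>W k. open W \<and> z \<in> W \<and> k \<in> carrier F \<and>
      (\<forall>w. w \<in> S' \<longrightarrow> w \<in> W \<longrightarrow> (h \<circ> \<phi>) w = k \<otimes> jump ((K \<circ> \<phi>) z) ((K \<circ> \<phi>) w))"
    using W z assms(3) by (intro exI[of _ Wb] exI[of _ k]) auto
qed

lemma lifts_subset: "lifts K S h \<Longrightarrow> S' \<subseteq> S \<Longrightarrow> lifts K S' h"
  using lifts_compose[of K S h S' "\<lambda>x. x"] by (simp add: o_def)

lemma lifts_cong:
  assumes "lifts K S h" "\<And>z. z \<in> S \<Longrightarrow> K z = K' z" shows "lifts K' S h"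
  using assms by (simp add: lifts_def)

text \<open>Two sections over the same map make the same jumps, so their quotient is locally constant.\<close>

lemma lifts_ratio:
  assumes h: "lifts K S h" and h': "lifts K S h'" and S: "connected S"
  obtains c where "c \<in> carrier F" "\<And>z. z \<in> S \<Longrightarrow> h z = c \<otimes> h' z"
proof -
  have "(\<lambda>z. h z \<otimes> inv (h' z)) constant_on S"
  proof (rule locally_constant_imp_constant[OF S])
    fix z assume z: "z \<in> S"
    obtain W k where W: "open W" "z \<in> W" "k \<in> carrier F" "\<And>w. w \<in> S \<Longrightarrow> w \<in> W \<Longrightarrow> h w = k \<otimes> jump (K z) (K w)"
      by (rule lifts_nbhd[OF h z], rule that)
    obtain Wb k' where Wb: "open Wb" "z \<in> Wb" "k' \<in> carrier F" "\<And>w. w \<in> S \<Longrightarrow> w \<in> Wb \<Longrightarrow> h' w = k' \<otimes> jump (K z) (K w)"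
      by (rule lifts_nbhd[OF h' z], rule that)
    have "h w \<otimes> inv (h' w) = k \<otimes> inv k'" if "w \<in> S \<inter> (W \<inter> Wb)" for w
    proof -
      have "(k \<otimes> jump (K z) (K w)) \<otimes> (inv (jump (K z) (K w)) \<otimes> inv k') = k \<otimes> inv k'"
        using W(3) Wb(3) by (simp add: m_assoc) (simp add: m_assoc[symmetric])
      then show ?thesis using W Wb that by (simp add: inv_mult_group)
    qed
    then show "\<exists>T. openin (top_of_set S) T \<and> z \<in> T \<and> (\<forall>x\<in>T. h x \<otimes> inv (h' x) = h z \<otimes> inv (h' z))"
      using W Wb z by (intro exI[of _ "S \<inter> (W \<inter> Wb)"]) (auto simp: openin_open)
  qed
  then obtain c where c: "\<And>z. z \<in> S \<Longrightarrow> h z \<otimes> inv (h' z) = c"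
    by (auto simp: constant_on_def)
  show ?thesis
  proof (cases "S = {}")
    case True then show ?thesis using that[of \<one>] by auto
  next
    case False
    then have "c \<in> carrier F"
      using c lifts_carrier[OF h] lifts_carrier[OF h'] by (metis ex_in_conv inv_closed m_closed)
    moreover have "h z = c \<otimes> h' z" if "z \<in> S" for z
      using c[OF that, symmetric] lifts_carrier[OF h that] lifts_carrier[OF h' that] by (simp add: m_assoc)
    ultimately show ?thesis using that by blast
  qed
qed

text \<open>On the connected overlap the two sections differ by a constant, by which one of them can be
  translated.\<close>

lemma lifts_glue:
  assumes h1: "lifts K S1 h1" and h2: "lifts K S2 h2"
    and "closed S1" "closed S2" and conn: "connected (S1 \<inter> S2)"
  shows "\<exists>h. lifts K (S1 \<union> S2) h"
proof -
  obtain c where c: "c \<in> carrier F" "\<And>z. z \<in> S1 \<inter> S2 \<Longrightarrow> h1 z = c \<otimes> h2 z"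
    using lifts_ratio[OF lifts_subset[OF h1] lifts_subset[OF h2] conn] by blast
  let ?h2 = "\<lambda>z. c \<otimes> h2 z"
  have h2': "lifts K S2 ?h2" by (rule lifts_translate[OF h2 c(1)])
  let ?h = "\<lambda>z. if z \<in> S1 then h1 z else ?h2 z"
  have "lifts K (S1 \<union> S2) ?h"
  proof (rule liftsI)
    fix z assume z: "z \<in> S1 \<union> S2"
    then show "?h z \<in> carrier F"
      using lifts_carrier[OF h1, of z] lifts_carrier[OF h2', of z] by auto
    consider "z \<in> S1" "z \<in> S2" | "z \<in> S1" "z \<notin> S2" | "z \<notin> S1" "z \<in> S2" using z by blast
    then show "\<exists>W k. open W \<and> z \<in> W \<and> k \<in> carrier F \<and>
       (\<forall>w. w \<in> S1 \<union> S2 \<longrightarrow> w \<in> W \<longrightarrow> ?h w = k \<otimes> jump (K z) (K w))"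
    proof cases
      case 1
      obtain W k where W: "open W" "z \<in> W" "k \<in> carrier F" "\<And>w. w \<in> S1 \<Longrightarrow> w \<in> W \<Longrightarrow> h1 w = k \<otimes> jump (K z) (K w)"
        by (rule lifts_nbhd[OF h1 1(1)], rule that)
      obtain Wb k' where Wb: "open Wb" "z \<in> Wb" "k' \<in> carrier F" "\<And>w. w \<in> S2 \<Longrightarrow> w \<in> Wb \<Longrightarrow> ?h2 w = k' \<otimes> jump (K z) (K w)"
        by (rule lifts_nbhd[OF h2' 1(2)], rule that)
      have "k \<otimes> jump (K z) (K z) = k' \<otimes> jump (K z) (K z)"
        using W(4)[OF 1(1) W(2)] Wb(4)[OF 1(2) Wb(2)] c(2) 1 by auto
      then have "k = k'" using W(3) Wb(3) by simp
      then show ?thesis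
        using W Wb c(2) by (intro exI[of _ "W \<inter> Wb"] exI[of _ k]) auto
    next
      case 2
      obtain W k where W: "open W" "z \<in> W" "k \<in> carrier F" "\<And>w. w \<in> S1 \<Longrightarrow> w \<in> W \<Longrightarrow> h1 w = k \<otimes> jump (K z) (K w)"
        by (rule lifts_nbhd[OF h1 2(1)], rule that)
      then show ?thesis
        using 2 \<open>closed S2\<close> by (intro exI[of _ "W \<inter> - S2"] exI[of _ k]) auto
    next
      case 3
      obtain W k where W: "open W" "z \<in> W" "k \<in> carrier F" "\<And>w. w \<in> S2 \<Longrightarrow> w \<in> W \<Longrightarrow> ?h2 w = k \<otimes> jump (K z) (K w)"
        by (rule lifts_nbhd[OF h2' 3(2)], rule that)
      then show ?thesis
        using 3 \<open>closed S1\<close> by (intro exI[of _ "W \<inter> - S1"] exI[of _ k]) auto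
    qed
  qed
  then show ?thesis by (rule exI[of "\<lambda>h. lifts K (S1 \<union> S2) h" ?h])
qed

text \<open>Near a point on a wall the jumps from that point form a section; near any other point a constant
  does.\<close>

lemma lifts_exist_locally:
  assumes K: "continuous_map (top_of_set S) X K" and z: "z \<in> S"
  obtains W where "open W" "z \<in> W" "\<And>S'. S' \<subseteq> S \<inter> W \<Longrightarrow> \<exists>h. lifts K S' h"
proof (cases "\<exists>i\<in>B. K z \<in> M i")
  case False
  define V where "V = topspace X - (\<Union>i\<in>B. M i)"
  have "openin X V"
    unfolding V_def using finite_walls closed_wall by (intro openin_diff closedin_Union) auto
  then obtain W where W: "open W" "S \<inter> W = {w \<in> S. K w \<in> V}"
    by (rule preimage_open[OF K])
  have "z \<in> W" using W z False K by (auto simp: V_def continuous_map_def)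
  moreover have "lifts K S' (\<lambda>_. \<one>)" if "S' \<subseteq> S \<inter> W" for S'
  proof -
    have "jump (K x) y = \<one>" if "x \<in> S'" for x y
      using \<open>S' \<subseteq> S \<inter> W\<close> that W by (intro jump_off_walls) (auto simp: V_def)
    then show ?thesis
      by (intro liftsI exI[of _ UNIV] exI[of _ \<one>]) auto
  qed
  ultimately show thesis using W(1) that by blast
next
  case True
  then obtain i where i: "i \<in> B" "K z \<in> M i" by blast
  define V where "V = N i \<union> M i \<union> P i"
  obtain W where W: "open W" "S \<inter> W = {w \<in> S. K w \<in> V}"
    using preimage_open[OF K wall_nbhd[OF i(1)]] unfolding V_def .
  obtain WP where WP: "open WP" "S \<inter> WP = {w \<in> S. K w \<in> P i}"
    using preimage_open[OF K open_sides(2)[OF i(1)]] .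
  obtain WN where WN: "open WN" "S \<inter> WN = {w \<in> S. K w \<in> N i}"
    using preimage_open[OF K open_sides(1)[OF i(1)]] .
  have "z \<in> W" using W z i by (auto simp: V_def)
  moreover have "lifts K S' (\<lambda>w. jump (K z) (K w))" if S': "S' \<subseteq> S \<inter> W" for S'
  proof (rule liftsI)
    fix x assume x: "x \<in> S'"
    note j = jump_wall[OF i]
    have off: "jump (K x) y = \<one>" if "K x \<in> N i \<union> P i" for y
      using that i walls_disjoint[OF i(1)] sides_disjoint[OF i(1)] by (intro jump_off_walls) blast
    have V: "K x \<in> V" and xS: "x \<in> S" using x S' W by auto
    then consider "K x \<in> M i" | "K x \<in> P i" | "K x \<in> N i" by (auto simp: V_def)
    then show "\<exists>W k. open W \<and> x \<in> W \<and> k \<in> carrier F \<and>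
       (\<forall>w. w \<in> S' \<longrightarrow> w \<in> W \<longrightarrow> jump (K z) (K w) = k \<otimes> jump (K x) (K w))"
    proof cases
      case 1
      then show ?thesis using j jump_wall[OF i(1) 1] g_carrier[OF i(1)]
        by (intro exI[of _ UNIV] exI[of _ \<one>]) auto
    next
      case 2
      have "K w \<in> P i" if "w \<in> S'" "w \<in> WP" for w using that S' WP by auto
      then show ?thesis using 2 j off g_carrier[OF i(1)] WP xS
        by (intro exI[of _ WP] exI[of _ "g i"]) auto
    next
      case 3
      have "K w \<notin> P i" if "w \<in> S'" "w \<in> WN" for w using that S' WN sides_disjoint(3)[OF i(1)] by auto
      then show ?thesis using 3 j off WN xS
        by (intro exI[of _ WN] exI[of _ \<one>]) auto
    qed
  qed simp
  ultimately show thesis using W(1) that by blast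
qed

text \<open>Bisecting the second coordinate produces sections over narrow strips around every value of the
  first coordinate, and bisecting the first coordinate glues the strips.\<close>

lemma lifts_exist_square:
  assumes K: "continuous_map (top_of_set ({0..1} \<times> {0..1})) X (K :: real \<times> real \<Rightarrow> 'a)"
  shows "\<exists>h. lifts K ({0..1} \<times> {0..1}) h"
proof -
  let ?I = "{0..1::real}"
  have strip: "\<exists>d>0. \<exists>h. lifts K (({s-d..s+d} \<inter> ?I) \<times> ({0..1} \<inter> ?I)) h" if s: "s \<in> ?I" for s
  proof (rule Bolzano[OF zero_le_one, of "\<lambda>a b. \<exists>d>0. \<exists>h. lifts K (({s-d..s+d} \<inter> ?I) \<times> ({a..b} \<inter> ?I)) h"])
    fix a b c :: real
    assume trans: "\<exists>d>0. \<exists>h. lifts K (({s-d..s+d} \<inter> ?I) \<times> ({a..b} \<inter> ?I)) h"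
      "\<exists>d>0. \<exists>h. lifts K (({s-d..s+d} \<inter> ?I) \<times> ({b..c} \<inter> ?I)) h" "a \<le> b" "b \<le> c"
    obtain d1 h1 d2 h2 where d: "d1 > 0" "d2 > 0"
      and h: "lifts K (({s-d1..s+d1} \<inter> ?I) \<times> ({a..b} \<inter> ?I)) h1" "lifts K (({s-d2..s+d2} \<inter> ?I) \<times> ({b..c} \<inter> ?I)) h2"
      using trans by blast
    let ?d = "min d1 d2" let ?J = "{s - ?d..s + ?d} \<inter> ?I"
    have eq: "?J \<times> ({a..c} \<inter> ?I) = ?J \<times> ({a..b} \<inter> ?I) \<union> ?J \<times> ({b..c} \<inter> ?I)"
      "?J \<times> ({a..b} \<inter> ?I) \<inter> ?J \<times> ({b..c} \<inter> ?I) = ?J \<times> ({b} \<inter> ?I)"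
      using trans by auto
    have "\<exists>h. lifts K (?J \<times> ({a..b} \<inter> ?I) \<union> ?J \<times> ({b..c} \<inter> ?I)) h"
    proof (rule lifts_glue)
      show "lifts K (?J \<times> ({a..b} \<inter> ?I)) h1" by (rule lifts_subset[OF h(1)]) auto
      show "lifts K (?J \<times> ({b..c} \<inter> ?I)) h2" by (rule lifts_subset[OF h(2)]) auto
      show "connected (?J \<times> ({a..b} \<inter> ?I) \<inter> ?J \<times> ({b..c} \<inter> ?I))"
        unfolding eq(2) by (intro convex_connected convex_Times convex_Int) auto
    qed (auto intro!: closed_Times)
    then show "\<exists>d>0. \<exists>h. lifts K (({s-d..s+d} \<inter> ?I) \<times> ({a..c} \<inter> ?I)) h"
      unfolding eq(1)[symmetric] using d by (intro exI[of _ ?d]) auto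
  next
    fix t :: real assume local: "0 \<le> t" "t \<le> 1"
    then have st: "(s, t) \<in> ?I \<times> ?I" using s by simp
    obtain W where W: "open W" "(s, t) \<in> W" "\<And>S'. S' \<subseteq> ?I \<times> ?I \<inter> W \<Longrightarrow> \<exists>h. lifts K S' h"
      by (rule lifts_exist_locally[OF K st], rule that)
    obtain U V where "open U" "open V" "(s, t) \<in> U \<times> V" "U \<times> V \<subseteq> W"
      by (rule open_prod_elim[OF W(1,2)])
    then have UV: "open U" "open V" "s \<in> U" "t \<in> V" "U \<times> V \<subseteq> W" by auto
    obtain d where d: "d > 0" "ball s d \<subseteq> U" using UV open_contains_ball by blast
    obtain e where e: "e > 0" "ball t e \<subseteq> V" using UV open_contains_ball by blast
    have "\<exists>h. lifts K (({s-d/2..s+d/2} \<inter> ?I) \<times> ({a..b} \<inter> ?I)) h" if "a \<le> t" "t \<le> b" "b - a < e" for a b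
    proof (rule W(3))
      have "{s-d/2..s+d/2} \<subseteq> ball s d" "{a..b} \<subseteq> ball t e"
        using d that by (auto simp: dist_real_def)
      then show "({s-d/2..s+d/2} \<inter> ?I) \<times> ({a..b} \<inter> ?I) \<subseteq> ?I \<times> ?I \<inter> W"
        using d e UV by blast
    qed
    then show "\<exists>e>0. \<forall>a b. a \<le> t \<and> t \<le> b \<and> b - a < e \<longrightarrow>
        (\<exists>d>0. \<exists>h. lifts K (({s-d..s+d} \<inter> ?I) \<times> ({a..b} \<inter> ?I)) h)"
      using d e by (intro exI[of _ e]) (auto intro!: exI[of _ "d/2"])
  qed
  have "\<exists>h. lifts K (({0..1} \<inter> ?I) \<times> ?I) h"
  proof (rule Bolzano[OF zero_le_one, of "\<lambda>a b. \<exists>h. lifts K (({a..b} \<inter> ?I) \<times> ?I) h"])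
    fix a b c :: real
    assume trans: "\<exists>h. lifts K (({a..b} \<inter> ?I) \<times> ?I) h" "\<exists>h. lifts K (({b..c} \<inter> ?I) \<times> ?I) h" "a \<le> b" "b \<le> c"
    obtain h1 h2 where h: "lifts K (({a..b} \<inter> ?I) \<times> ?I) h1" "lifts K (({b..c} \<inter> ?I) \<times> ?I) h2"
      using trans by blast
    have eq: "({a..c} \<inter> ?I) \<times> ?I = ({a..b} \<inter> ?I) \<times> ?I \<union> ({b..c} \<inter> ?I) \<times> ?I"
      "({a..b} \<inter> ?I) \<times> ?I \<inter> ({b..c} \<inter> ?I) \<times> ?I = ({b} \<inter> ?I) \<times> ?I"
      using trans by auto
    show "\<exists>h. lifts K (({a..c} \<inter> ?I) \<times> ?I) h" unfolding eq(1)
    proof (rule lifts_glue[OF h])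
      show "connected (({a..b} \<inter> ?I) \<times> ?I \<inter> ({b..c} \<inter> ?I) \<times> ?I)"
        unfolding eq(2) by (intro convex_connected convex_Times convex_Int) auto
    qed (auto intro!: closed_Times)
  next
    fix s :: real assume "0 \<le> s" "s \<le> 1"
    then obtain d h where d: "d > 0" and h: "lifts K (({s-d..s+d} \<inter> ?I) \<times> ?I) h"
      using strip[of s] by auto
    have "\<exists>h. lifts K (({a..b} \<inter> ?I) \<times> ?I) h" if "a \<le> s" "s \<le> b" "b - a < d" for a b
    proof -
      have "({a..b} \<inter> ?I) \<times> ?I \<subseteq> ({s-d..s+d} \<inter> ?I) \<times> ?I"
        using that by (intro Sigma_mono Int_mono) auto
      then show ?thesis using lifts_subset[OF h] by blast
    qed
    then show "\<exists>d>0. \<forall>a b. a \<le> s \<and> s \<le> b \<and> b - a < d \<longrightarrow> (\<exists>h. lifts K (({a..b} \<inter> ?I) \<times> ?I) h)"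
      using d by blast
  qed
  then show ?thesis by simp
qed

lemma lifts_exist_path:
  assumes "pathin X q" shows "\<exists>h. lifts q {0..1} h"
proof -
  have "continuous_map (top_of_set ({0..1} \<times> {0..1})) X (q \<circ> (snd :: real \<times> real \<Rightarrow> real))"
    by (rule continuous_map_compose[of _ "top_of_set {0..1}"])
      (use assms in \<open>auto simp: pathin_def intro!: continuous_intros\<close>)
  then obtain h where "lifts (q \<circ> (snd :: real \<times> real \<Rightarrow> real)) ({0..1} \<times> {0..1}) h"
    using lifts_exist_square by blast
  then have "lifts ((q \<circ> snd) \<circ> (\<lambda>t. (0::real, t))) {0..1} (h \<circ> (\<lambda>t. (0, t)))"
    by (rule lifts_compose) (auto intro!: continuous_intros)
  then show ?thesis by (auto simp: o_def)
qed

text \<open>The difference of a section at the two ends; by \<open>lifts_ratio\<close> it is the same for all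
  sections.\<close>

definition holonomy :: "(real \<Rightarrow> 'a) \<Rightarrow> 'f" where
  "holonomy q = (THE x. \<exists>h. lifts q {0..1} h \<and> x = inv (h 0) \<otimes> h 1)"

lemma holonomy_eq:
  assumes h: "lifts q {0..1} h" shows "holonomy q = inv (h 0) \<otimes> h 1"
  unfolding holonomy_def
proof (rule the_equality)
  fix x assume "\<exists>h. lifts q {0..1} h \<and> x = inv (h 0) \<otimes> h 1"
  then obtain h' where h': "lifts q {0..1} h'" "x = inv (h' 0) \<otimes> h' 1" by blast
  obtain c where c: "c \<in> carrier F" "\<And>z. z \<in> {0..1} \<Longrightarrow> h' z = c \<otimes> h z"
    using lifts_ratio[OF h'(1) h] by auto
  have hc: "h 0 \<in> carrier F" "h 1 \<in> carrier F" using lifts_carrier[OF h] by auto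
  have "inv (c \<otimes> h 0) \<otimes> (c \<otimes> h 1) = inv (h 0) \<otimes> h 1"
    using hc c(1) by (simp add: inv_mult_group m_assoc cancel_left)
  then show "x = inv (h 0) \<otimes> h 1"
    using h'(2) c hc by simp
qed (use h in blast)

lemma holonomy_carrier: "pathin X q \<Longrightarrow> holonomy q \<in> carrier F"
  using lifts_exist_path[of q] holonomy_eq[of q] lifts_carrier[of q "{0..1}"] by fastforce

lemma holonomy_join:
  assumes p: "pathin X p" and q: "pathin X q" and pq: "p 1 = q 0"
  shows "holonomy (join_loops p q) = holonomy p \<otimes> holonomy q"
proof -
  obtain h where h: "lifts (join_loops p q) {0..1} h"
    using lifts_exist_path[OF pathin_join_loops[OF p q pq]] by blast
  have "lifts (join_loops p q \<circ> (\<lambda>t. t / 2)) {0..1} (h \<circ> (\<lambda>t. t / 2))"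
    by (rule lifts_compose[OF h]) (auto intro!: continuous_intros)
  then have 1: "lifts p {0..1} (h \<circ> (\<lambda>t. t / 2))"
    by (rule lifts_cong) (auto simp: join_loops_def)
  have "lifts (join_loops p q \<circ> (\<lambda>t. t / 2 + 1/2)) {0..1} (h \<circ> (\<lambda>t. t / 2 + 1/2))"
    by (rule lifts_compose[OF h]) (auto intro!: continuous_intros)
  then have 2: "lifts q {0..1} (h \<circ> (\<lambda>t. t / 2 + 1/2))"
    by (rule lifts_cong) (use pq in \<open>auto simp: join_loops_def\<close>)
  have hc: "h 0 \<in> carrier F" "h (1/2) \<in> carrier F" "h 1 \<in> carrier F"
    using lifts_carrier[OF h] by auto
  have "inv (h 0) \<otimes> h (1/2) \<otimes> (inv (h (1/2)) \<otimes> h 1) = inv (h 0) \<otimes> h 1"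
    using hc by (simp add: m_assoc cancel_left)
  then show ?thesis
    using holonomy_eq[OF h] holonomy_eq[OF 1] holonomy_eq[OF 2] hc by simp
qed

text \<open>A section over the square of the homotopy is constant along the two sides on which the homotopy
  is.\<close>

lemma holonomy_homotopic:
  assumes "path_homotopic X p q" shows "holonomy p = holonomy q"
proof -
  obtain K where K: "continuous_map (top_of_set ({0..1::real} \<times> {0..1::real})) X K"
    "\<And>t. t\<in>{0..1} \<Longrightarrow> K (0, t) = p t" "\<And>t. t\<in>{0..1} \<Longrightarrow> K (1, t) = q t"
    "\<And>s. s\<in>{0..1} \<Longrightarrow> K (s, 0) = p 0"  "\<And>s. s\<in>{0..1} \<Longrightarrow> K (s, 1) = p 1"
    by (rule path_homotopic_squareE[OF assms], rule that)
  obtain h where h: "lifts K ({0..1} \<times> {0..1}) h" using lifts_exist_square[OF K(1)] by blast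
  have side: "h (0, e) = h (1, e)" if e: "e \<in> {0, 1}" for e :: real
  proof -
    define y where "y = K (0, e)"
    have "lifts (K \<circ> (\<lambda>s. (s, e))) {0..1} (h \<circ> (\<lambda>s. (s, e)))"
      by (rule lifts_compose[OF h]) (use e in \<open>auto intro!: continuous_intros\<close>)
    then have 1: "lifts (\<lambda>_. y) {0..1} (h \<circ> (\<lambda>s. (s, e)))"
      by (rule lifts_cong) (use e K in \<open>auto simp: y_def\<close>)
    have 2: "lifts (\<lambda>_. y) {0..1::real} (\<lambda>_. \<one>)"
      by (intro liftsI exI[of _ UNIV] exI[of _ "inv (jump y y)"]) auto
    obtain c where "c \<in> carrier F" "\<And>z. z \<in> {0..1} \<Longrightarrow> (h \<circ> (\<lambda>s. (s, e))) z = c \<otimes> \<one>"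
      using lifts_ratio[OF 1 2] by auto
    then show ?thesis by simp
  qed
  have "lifts (K \<circ> (\<lambda>t. (0, t))) {0..1} (h \<circ> (\<lambda>t. (0, t)))"
    by (rule lifts_compose[OF h]) (auto intro!: continuous_intros)
  then have 1: "lifts p {0..1} (h \<circ> (\<lambda>t. (0, t)))"
    by (rule lifts_cong) (use K in auto)
  have "lifts (K \<circ> (\<lambda>t. (1, t))) {0..1} (h \<circ> (\<lambda>t. (1, t)))"
    by (rule lifts_compose[OF h]) (auto intro!: continuous_intros)
  then have 2: "lifts q {0..1} (h \<circ> (\<lambda>t. (1, t)))"
    by (rule lifts_cong) (use K in auto)
  show ?thesis
    using holonomy_eq[OF 1] holonomy_eq[OF 2] side by simp
qed

lemma holonomy_avoids:
  assumes "avoids B M q" shows "holonomy q = \<one>"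
proof -
  have "lifts q {0..1} (\<lambda>_. \<one>)"
    using assms by (intro liftsI exI[of _ UNIV] exI[of _ \<one>]) (auto simp: avoids_def jump_off_walls)
  then show ?thesis using holonomy_eq by force
qed

lemma holonomy_crosses_once:
  assumes "crosses_once B M P i q" and i: "i \<in> B" shows "holonomy q = g i"
proof -
  obtain a d where a: "0 < a" "a < 1" "\<And>t j. t \<in> {0..1} \<Longrightarrow> j \<in> B \<Longrightarrow> q t \<in> M j \<longleftrightarrow> j = i \<and> t = a"
    and d: "d > 0" "\<And>t. t \<in> {0..1} \<Longrightarrow> a - d < t \<Longrightarrow> t < a \<Longrightarrow> q t \<notin> P i"
      "\<And>t. t \<in> {0..1} \<Longrightarrow> a < t \<Longrightarrow> t < a + d \<Longrightarrow> q t \<in> P i"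
    using assms(1) unfolding crosses_once_def by auto
  let ?h = "\<lambda>t. if t \<le> a then \<one> else g i"
  have gi: "g i \<in> carrier F" by (rule g_carrier[OF i])
  have "lifts q {0..1} ?h"
  proof (rule liftsI)
    fix z :: real assume z: "z \<in> {0..1}"
    show "?h z \<in> carrier F" using gi by simp
    have off: "jump (q z) y = \<one>" if "z \<noteq> a" for y
      using that a(3)[OF z] by (intro jump_off_walls) auto
    consider "z < a" | "z = a" | "a < z" by linarith
    then show "\<exists>W k. open W \<and> z \<in> W \<and> k \<in> carrier F \<and> (\<forall>w. w \<in> {0..1} \<longrightarrow> w \<in> W \<longrightarrow> ?h w = k \<otimes> jump (q z) (q w))"
    proof cases
      case 1 then show ?thesis using off by (intro exI[of _ "{..<a}"] exI[of _ \<one>]) auto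
    next
      case 3 then show ?thesis using off gi by (intro exI[of _ "{a<..}"] exI[of _ "g i"]) auto
    next
      case 2
      then have qa: "q a \<in> M i" using a(3)[OF z i] by simp
      have "?h w = \<one> \<otimes> jump (q a) (q w)" if "w \<in> {0..1}" "w \<in> {a - d<..<a + d}" for w
        using d(2,3)[OF that(1)] that(2) jump_wall[OF i qa] gi qa sides_disjoint(2)[OF i]
        by (cases w a rule: linorder_cases) auto
      then show ?thesis using 2 d(1) by (intro exI[of _ "{a - d<..<a + d}"] exI[of _ \<one>]) auto
    qed
  qed
  then show ?thesis using holonomy_eq[of q ?h] a gi by simp
qed

lemma holonomy_hom:
  assumes "x0 \<in> topspace X"
  obtains H where "H \<in> hom (fundamental_group X x0) F"
    "\<And>p. p \<in> loops X x0 \<Longrightarrow> H (loop_class X x0 p) = holonomy p"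
proof -
  define H where "H c = holonomy (SOME p. p \<in> c)" for c
  have H: "H (loop_class X x0 p) = holonomy p" if p: "p \<in> loops X x0" for p
  proof -
    have "(SOME q. q \<in> loop_class X x0 p) \<in> loop_class X x0 p"
      by (rule someI[where P = "\<lambda>q. q \<in> loop_class X x0 p", OF loop_class_self[OF p]])
    then have "path_homotopic X p (SOME q. q \<in> loop_class X x0 p)"
      using loop_class_alt[OF p] by simp
    then show ?thesis by (simp add: H_def holonomy_homotopic)
  qed
  have "H \<in> hom (fundamental_group X x0) F"
  proof (rule homI)
    fix a assume "a \<in> carrier (fundamental_group X x0)"
    then obtain p where p: "p \<in> loops X x0" and a: "a = loop_class X x0 p"
      unfolding carrier_fundamental_group by (rule imageE)
    show "H a \<in> carrier F" unfolding a H[OF p] using loopsD[OF p] by (intro holonomy_carrier) simp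
    fix b assume "b \<in> carrier (fundamental_group X x0)"
    then obtain q where q: "q \<in> loops X x0" and b: "b = loop_class X x0 q"
      unfolding carrier_fundamental_group by (rule imageE)
    have "holonomy (join_loops p q) = holonomy p \<otimes> holonomy q"
      using loopsD[OF p] loopsD[OF q] by (intro holonomy_join) auto
    then show "H (a \<otimes>\<^bsub>fundamental_group X x0\<^esub> b) = H a \<otimes> H b"
      unfolding a b mult_fundamental_group[OF p q] H[OF p] H[OF q] H[OF join_loops_in_loops[OF p q]] .
  qed
  with H that show thesis by blast
qed

end

section \<open>Systems of loops dual to walls\<close>

text \<open>Loop \<open>i\<close> meets the walls only once, in wall \<open>i\<close>. Its holonomy is
  therefore the label of wall \<open>i\<close>, whatever the labels are, which makes the loops
  independent.\<close>

locale loop_basis = wall_system X B N M P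
  for X :: "'a topology" and B :: "'i set" and N M P +
  fixes x0 :: 'a and loop :: "'i \<Rightarrow> real \<Rightarrow> 'a"
  assumes path_connected: "path_connected_space X"
    and base_point: "x0 \<in> topspace X"
    and loop: "\<And>i. i \<in> B \<Longrightarrow> loop i \<in> loops X x0"
    and generates: "generate (fundamental_group X x0) ((\<lambda>i. loop_class X x0 (loop i)) ` B) =
        carrier (fundamental_group X x0)"
    and crossing: "\<And>i. i \<in> B \<Longrightarrow> \<exists>\<sigma> \<epsilon> \<rho>. pathin X \<sigma> \<and> pathin X \<epsilon> \<and> pathin X \<rho> \<and> \<sigma> 1 = \<epsilon> 0 \<and> \<epsilon> 1 = \<rho> 0 \<and>
        loop i = join_loops (join_loops \<sigma> \<epsilon>) \<rho> \<and> avoids B M \<sigma> \<and> avoids B M \<rho> \<and> crosses_once B M P i \<epsilon>"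
begin

lemma holonomy_exists:
  assumes F: "group F" and g: "\<And>i. i \<in> B \<Longrightarrow> g i \<in> carrier F"
  obtains hol H where "\<And>p. pathin X p \<Longrightarrow> hol p \<in> carrier F"
    and "\<And>p q. pathin X p \<Longrightarrow> pathin X q \<Longrightarrow> p 1 = q 0 \<Longrightarrow> hol (join_loops p q) = hol p \<otimes>\<^bsub>F\<^esub> hol q"
    and "\<And>p q. path_homotopic X p q \<Longrightarrow> hol p = hol q"
    and "\<And>i. i \<in> B \<Longrightarrow> hol (loop i) = g i"
    and "H \<in> hom (fundamental_group X x0) F"
    and "\<And>i. i \<in> B \<Longrightarrow> H (loop_class X x0 (loop i)) = g i"
proof -
  interpret F: group F by fact
  interpret wall_holonomy X B N M P F g
    by unfold_locales (rule g)
  have l: "holonomy (loop i) = g i" if i: "i \<in> B" for i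
  proof -
    obtain \<sigma> \<epsilon> \<rho> where *: "pathin X \<sigma>" "pathin X \<epsilon>" "pathin X \<rho>" "\<sigma> 1 = \<epsilon> 0" "\<epsilon> 1 = \<rho> 0"
        "loop i = join_loops (join_loops \<sigma> \<epsilon>) \<rho>" "avoids B M \<sigma>" "avoids B M \<rho>" "crosses_once B M P i \<epsilon>"
      using crossing[OF i] by (elim exE conjE) (rule that)
    have "holonomy (loop i) = (holonomy \<sigma> \<otimes>\<^bsub>F\<^esub> holonomy \<epsilon>) \<otimes>\<^bsub>F\<^esub> holonomy \<rho>"
      unfolding *(6) using *(1-5) by (simp add: holonomy_join pathin_join_loops)
    then show ?thesis
      using *(7-9) g[OF i] i by (simp add: holonomy_avoids holonomy_crosses_once)
  qed
  obtain H where H: "H \<in> hom (fundamental_group X x0) F"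
      "\<And>p. p \<in> loops X x0 \<Longrightarrow> H (loop_class X x0 p) = holonomy p"
    by (rule holonomy_hom[OF base_point], rule that)
  have "H (loop_class X x0 (loop i)) = g i" if "i \<in> B" for i
    using H(2)[OF loop[OF that]] l[OF that] by simp
  then show thesis
    using that[of holonomy H] holonomy_carrier holonomy_join holonomy_homotopic l H(1) by blast
qed

end

section \<open>Freeness of the fundamental group\<close>

text \<open>Reduced words act on themselves by left multiplication and cancellation; this realizes the
  free group as a permutation group, in which no nonempty reduced word fixes the empty word.\<close>

definition reduced_words :: "'i set \<Rightarrow> ('i \<times> bool) list set" where
  "reduced_words B = {w. reduced_word w \<and> fst ` set w \<subseteq> B}"

definition letter_action :: "'i \<times> bool \<Rightarrow> ('i \<times> bool) list \<Rightarrow> ('i \<times> bool) list" where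
  "letter_action x w = (if w \<noteq> [] \<and> hd w = (fst x, \<not> snd x) then tl w else x # w)"

lemma reduced_word_Cons:
  "reduced_word (x # w) \<longleftrightarrow> reduced_word w \<and> (w = [] \<or> hd w \<noteq> (fst x, \<not> snd x))"
  by (cases x; cases w) (auto simp: reduced_word_def successively_Cons case_prod_beta prod_eq_iff)

lemma letter_action_reduced:
  "w \<in> reduced_words B \<Longrightarrow> fst x \<in> B \<Longrightarrow> letter_action x w \<in> reduced_words B"
  by (cases w) (auto simp: reduced_words_def letter_action_def reduced_word_Cons)

lemma letter_action_inverse:
  "w \<in> reduced_words B \<Longrightarrow> letter_action (s, \<not> b) (letter_action (s, b) w) = w"
  by (cases w) (auto simp: reduced_words_def letter_action_def reduced_word_Cons)

lemma letter_action_Cons: "reduced_word (x # w) \<Longrightarrow> letter_action x w = x # w"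
  by (auto simp: letter_action_def reduced_word_Cons)

abbreviation word_group :: "'i set \<Rightarrow> (('i \<times> bool) list \<Rightarrow> ('i \<times> bool) list) monoid" where
  "word_group B \<equiv> BijGroup (reduced_words B)"

definition letter_perm :: "'i set \<Rightarrow> 'i \<times> bool \<Rightarrow> ('i \<times> bool) list \<Rightarrow> ('i \<times> bool) list" where
  "letter_perm B x = restrict (letter_action x) (reduced_words B)"

lemma letter_perm_Bij: "fst x \<in> B \<Longrightarrow> letter_perm B x \<in> Bij (reduced_words B)"
proof -
  assume x: "fst x \<in> B"
  obtain s b where sb: "x = (s, b)" by (cases x)
  have "bij_betw (letter_action x) (reduced_words B) (reduced_words B)"
  proof (rule bij_betw_byWitness[where f' = "letter_action (s, \<not> b)"])
    show "\<forall>w\<in>reduced_words B. letter_action (s, \<not> b) (letter_action x w) = w"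
      unfolding sb by (simp add: letter_action_inverse)
    show "\<forall>w\<in>reduced_words B. letter_action x (letter_action (s, \<not> b) w) = w"
      unfolding sb using letter_action_inverse[of _ B s "\<not> b"] by simp
  qed (use x sb in \<open>auto intro: letter_action_reduced\<close>)
  then have "bij_betw (letter_perm B x) (reduced_words B) (reduced_words B)"
    by (subst bij_betw_cong[of _ _ "letter_action x"]) (simp_all add: letter_perm_def)
  then show ?thesis by (simp add: Bij_def letter_perm_def)
qed

lemma letter_perm_inverse:
  assumes "s \<in> B" shows "inv\<^bsub>word_group B\<^esub> (letter_perm B (s, True)) = letter_perm B (s, False)"
proof (rule group.inv_equality[OF group_BijGroup])
  have "letter_perm B (s, False) (letter_perm B (s, True) w) = w" if "w \<in> reduced_words B" for w
    using that letter_action_inverse[OF that, of s True] letter_action_reduced[OF that, of "(s, True)"] assms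
    by (simp add: letter_perm_def)
  then have "compose (reduced_words B) (letter_perm B (s, False)) (letter_perm B (s, True)) = (\<lambda>w\<in>reduced_words B. w)"
    by (auto simp: compose_def)
  then show "letter_perm B (s, False) \<otimes>\<^bsub>word_group B\<^esub> letter_perm B (s, True) = \<one>\<^bsub>word_group B\<^esub>"
    using assms by (simp add: BijGroup_def letter_perm_Bij)
qed (use assms in \<open>simp_all add: BijGroup_def letter_perm_Bij\<close>)

lemma word_value_carrier:
  assumes "group G" "fst ` set w \<subseteq> carrier G" shows "word_value G w \<in> carrier G"
proof -
  interpret group G by fact
  show ?thesis using assms(2)
  proof (induction w)
    case (Cons x w) then show ?case by (cases x) auto
  qed simp
qed

lemma word_value_hom:
  assumes "h \<in> hom G F" "group G" "group F" "fst ` set w \<subseteq> carrier G"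
  shows "h (word_value G w) = word_value F (map (\<lambda>(s, b). (h s, b)) w)"
proof -
  interpret group_hom G F h using assms by (simp add: group_hom_def group_hom_axioms_def)
  show ?thesis using assms(4)
  proof (induction w)
    case (Cons x w)
    obtain s b where "x = (s, b)" by (cases x)
    then show ?case using Cons word_value_carrier[OF assms(2), of w] by auto
  qed auto
qed

lemma BijGroup_mult: "f \<in> Bij S \<Longrightarrow> h \<in> Bij S \<Longrightarrow> f \<otimes>\<^bsub>BijGroup S\<^esub> h = compose S f h"
  by (simp add: BijGroup_def)

lemma word_value_letter_perm:
  assumes "w \<in> reduced_words B"
  shows "word_value (word_group B) (map (\<lambda>(i, b). (letter_perm B (i, True), b)) w) [] = w"
  using assms
proof (induction w)
  case Nil
  then show ?case by (simp add: BijGroup_def)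
next
  case (Cons x w)
  obtain s b where x: "x = (s, b)" by (cases x)
  have w: "w \<in> reduced_words B" and s: "s \<in> B" and r: "reduced_word (x # w)"
    using Cons.prems x by (auto simp: reduced_words_def reduced_word_Cons)
  let ?v = "word_value (word_group B) (map (\<lambda>(i, b). (letter_perm B (i, True), b)) w)"
  have "fst ` set (map (\<lambda>(i, b). (letter_perm B (i, True), b)) w) \<subseteq> carrier (word_group B)"
  proof -
    have "letter_perm B (i, True) \<in> carrier (word_group B)" if "(i, b) \<in> set w" for i b
    proof -
      have "i \<in> B" using that w by (force simp: reduced_words_def)
      then show ?thesis using letter_perm_Bij[of "(i, True)" B] by (simp add: BijGroup_def)
    qed
    then show ?thesis by auto
  qed
  then have v: "?v \<in> Bij (reduced_words B)"
    using word_value_carrier[OF group_BijGroup[of "reduced_words B"]] by (force simp: BijGroup_def)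
  have e: "[] \<in> reduced_words B" by (simp add: reduced_words_def reduced_word_def)
  have "word_value (word_group B) (map (\<lambda>(i, b). (letter_perm B (i, True), b)) (x # w)) =
      letter_perm B x \<otimes>\<^bsub>word_group B\<^esub> ?v"
    using x s letter_perm_inverse[OF s] by simp
  also have "\<dots> = compose (reduced_words B) (letter_perm B x) ?v"
    using BijGroup_mult[OF letter_perm_Bij v] s x by simp
  finally have eq: "word_value (word_group B) (map (\<lambda>(i, b). (letter_perm B (i, True), b)) (x # w)) =
      compose (reduced_words B) (letter_perm B x) ?v" .
  have "letter_perm B x w = x # w" by (simp add: letter_perm_def w letter_action_Cons[OF r])
  then show ?case unfolding eq compose_def using e Cons.IH[OF w] by simp
qed

lemma reduced_word_pullback:
  assumes "inj_on c B" "reduced_word w" "fst ` set w \<subseteq> c ` B"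
  obtains v where "v \<in> reduced_words B" "w = map (\<lambda>(i, b). (c i, b)) v"
proof -
  define v where "v = map (\<lambda>(s, b). (the_inv_into B c s, b)) w"
  have inv: "the_inv_into B c s \<in> B \<and> c (the_inv_into B c s) = s" if "s \<in> c ` B" for s
    using the_inv_into_into[OF assms(1) that] f_the_inv_into_f[OF assms(1) that] by auto
  have c: "the_inv_into B c (fst x) \<in> B \<and> c (the_inv_into B c (fst x)) = fst x" if "x \<in> set w" for x
    using assms(3) that by (intro inv) auto
  have "map (\<lambda>(i, b). (c i, b)) v = map (\<lambda>x. x) w"
    unfolding v_def map_map by (rule map_cong[OF refl]) (use c in \<open>auto simp: case_prod_beta\<close>)
  then have w: "w = map (\<lambda>(i, b). (c i, b)) v" by simp
  have "reduced_word v"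
    using assms(2) unfolding w reduced_word_def successively_map by (rule successively_mono) auto
  moreover have "fst ` set v \<subseteq> B" using c by (auto simp: v_def case_prod_beta)
  ultimately show thesis using w that by (simp add: reduced_words_def)
qed

context loop_basis
begin

lemma group_fundamental: "group (fundamental_group X x0)"
  by (rule group_fundamental_group[OF base_point])

lemma loop_class_in_carrier: "i \<in> B \<Longrightarrow> loop_class X x0 (loop i) \<in> carrier (fundamental_group X x0)"
  by (simp add: loop loop_class_carrier)

lemma dual_permutations:
  obtains H where "H \<in> hom (fundamental_group X x0) (word_group B)"
    "\<And>i. i \<in> B \<Longrightarrow> H (loop_class X x0 (loop i)) = letter_perm B (i, True)"
proof (rule holonomy_exists[OF group_BijGroup, of "\<lambda>i. letter_perm B (i, True)" "reduced_words B"])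
  show "letter_perm B (i, True) \<in> carrier (word_group B)" if "i \<in> B" for i
    using that by (simp add: BijGroup_def letter_perm_Bij)
qed (rule that)

lemma inj_on_loop_class: "inj_on (\<lambda>i. loop_class X x0 (loop i)) B"
proof (rule inj_onI)
  obtain H where H: "H \<in> hom (fundamental_group X x0) (word_group B)"
    "\<And>i. i \<in> B \<Longrightarrow> H (loop_class X x0 (loop i)) = letter_perm B (i, True)"
    by (rule dual_permutations, rule that)
  fix i j assume ij: "i \<in> B" "j \<in> B" "loop_class X x0 (loop i) = loop_class X x0 (loop j)"
  then have "letter_perm B (i, True) [] = letter_perm B (j, True) []" using H(2)[OF ij(1)] H(2)[OF ij(2)] by simp
  then show "i = j" by (simp add: letter_perm_def letter_action_def reduced_words_def reduced_word_def)
qed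

text \<open>The homomorphism of \<open>dual_permutations\<close> sends the value of the word to a permutation
  that maps the empty word to the given word.\<close>

lemma reduced_loop_word_nontrivial:
  assumes w: "w \<in> reduced_words B" "w \<noteq> []"
  shows "word_value (fundamental_group X x0) (map (\<lambda>(i, b). (loop_class X x0 (loop i), b)) w) \<noteq> \<one>\<^bsub>fundamental_group X x0\<^esub>"
proof
  let ?w = "map (\<lambda>(i, b). (loop_class X x0 (loop i), b)) w"
  assume 1: "word_value (fundamental_group X x0) ?w = \<one>\<^bsub>fundamental_group X x0\<^esub>"
  obtain H where H: "H \<in> hom (fundamental_group X x0) (word_group B)"
    "\<And>i. i \<in> B \<Longrightarrow> H (loop_class X x0 (loop i)) = letter_perm B (i, True)"
    by (rule dual_permutations, rule that)
  have "fst ` set ?w \<subseteq> carrier (fundamental_group X x0)"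
    using w(1) loop_class_in_carrier by (auto simp: reduced_words_def)
  then have "H (word_value (fundamental_group X x0) ?w) = word_value (word_group B) (map (\<lambda>(s, b). (H s, b)) ?w)"
    by (rule word_value_hom[OF H(1) group_fundamental group_BijGroup])
  also have "map (\<lambda>(s, b). (H s, b)) ?w = map (\<lambda>(i, b). (letter_perm B (i, True), b)) w"
    using w(1) H(2) by (auto simp: reduced_words_def)
  finally have "\<one>\<^bsub>word_group B\<^esub> [] = w"
    using 1 word_value_letter_perm[OF w(1)] hom_one[OF H(1) group_fundamental group_BijGroup] by simp
  then show False using w(2) by (simp add: BijGroup_def reduced_words_def reduced_word_def)
qed

theorem fundamental_group_free: "free_group_of_rank (fundamental_group X x0) (card B)"
  unfolding free_group_of_rank_def
proof (intro conjI exI)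
  let ?c = "\<lambda>i. loop_class X x0 (loop i)"
  show "group (fundamental_group X x0)" by (rule group_fundamental)
  show "finite (?c ` B)" using finite_walls by simp
  show "card (?c ` B) = card B" by (rule card_image[OF inj_on_loop_class])
  show "free_basis (fundamental_group X x0) (?c ` B)"
    unfolding free_basis_def
  proof (intro conjI allI impI)
    show "?c ` B \<subseteq> carrier (fundamental_group X x0)" using loop_class_in_carrier by auto
    show "generate (fundamental_group X x0) (?c ` B) = carrier (fundamental_group X x0)" by (rule generates)
    fix w assume w: "w \<noteq> [] \<and> fst ` set w \<subseteq> ?c ` B \<and> reduced_word w"
    obtain v where v: "v \<in> reduced_words B" and wv: "w = map (\<lambda>(i, b). (?c i, b)) v"
      using w by (elim conjE) (rule reduced_word_pullback[OF inj_on_loop_class], auto)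
    then have "v \<noteq> []" using w by auto
    then show "word_value (fundamental_group X x0) w \<noteq> \<one>\<^bsub>fundamental_group X x0\<^esub>"
      using reduced_loop_word_nontrivial[OF v] wv by simp
  qed
qed

end

lemma hom_iso_if_kernel_trivial:
  assumes "h \<in> hom G F" "group G" "group F" "h ` carrier G = carrier F"
    "\<And>a. a \<in> carrier G \<Longrightarrow> h a = \<one>\<^bsub>F\<^esub> \<Longrightarrow> a = \<one>\<^bsub>G\<^esub>"
  shows "h \<in> iso G F"
proof -
  interpret group_hom G F h using assms by (simp add: group_hom_def group_hom_axioms_def)
  have "inj_on h (carrier G)"
    using assms(5) by (intro inj_on_one_iff[THEN iffD2]) auto
  then show ?thesis using assms by (simp add: iso_def bij_betw_def)
qed

text \<open>Multiplying the value of a reduced word by a letter or its inverse either prolongs the word or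
  cancels its first letter.\<close>

lemma generate_word:
  assumes "group G" "S \<subseteq> carrier G" "a \<in> generate G S"
  shows "\<exists>w. reduced_word w \<and> fst ` set w \<subseteq> S \<and> word_value G w = a"
proof -
  interpret group G by fact
  have step: "\<exists>w'. reduced_word w' \<and> fst ` set w' \<subseteq> S \<and> word_value G w' = word_value G [x] \<otimes>\<^bsub>G\<^esub> word_value G w"
    if w: "reduced_word w" "fst ` set w \<subseteq> S" and x: "fst x \<in> S" for x w
  proof -
    obtain s b where sb: "x = (s, b)" by (cases x)
    have "fst ` set (tl w) \<subseteq> carrier G" using w(2) assms(2) by (cases w) auto
    then have c: "s \<in> carrier G" "word_value G (tl w) \<in> carrier G" "word_value G w \<in> carrier G"
      using word_value_carrier[OF assms(1)] assms(2) w(2) x sb by auto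
    show ?thesis
    proof (cases "w \<noteq> [] \<and> hd w = (s, \<not> b)")
      case True
      then obtain v where v: "w = (s, \<not> b) # v" by (cases w) auto
      have "word_value G v = word_value G [x] \<otimes>\<^bsub>G\<^esub> word_value G w"
        using c v sb by (cases b) (simp_all add: m_assoc[symmetric])
      then show ?thesis using w v by (intro exI[of _ v]) (auto simp: reduced_word_Cons)
    next
      case False
      then show ?thesis using w x sb c by (intro exI[of _ "x # w"]) (auto simp: reduced_word_Cons)
    qed
  qed
  have app: "\<exists>w'. reduced_word w' \<and> fst ` set w' \<subseteq> S \<and> word_value G w' = word_value G v \<otimes>\<^bsub>G\<^esub> word_value G w"
    if w: "reduced_word w" "fst ` set w \<subseteq> S" and v: "fst ` set v \<subseteq> S" for v w
    using v
  proof (induction v)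
    case Nil
    have "word_value G w \<in> carrier G" using word_value_carrier[OF assms(1)] w(2) assms(2) by blast
    then show ?case using w by (intro exI[of _ w]) simp
  next
    case (Cons x v)
    then obtain w' where w': "reduced_word w'" "fst ` set w' \<subseteq> S" "word_value G w' = word_value G v \<otimes>\<^bsub>G\<^esub> word_value G w"
      by auto
    obtain u where u: "reduced_word u" "fst ` set u \<subseteq> S" "word_value G u = word_value G [x] \<otimes>\<^bsub>G\<^esub> word_value G w'"
      using step[OF w'(1,2), of x] Cons.prems by auto
    have "word_value G v \<in> carrier G" "word_value G w \<in> carrier G" "fst x \<in> carrier G"
      using word_value_carrier[OF assms(1)] w(2) Cons.prems assms(2) by (auto simp: subset_iff)
    then have "word_value G u = word_value G (x # v) \<otimes>\<^bsub>G\<^esub> word_value G w"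
      using u(3) w'(3) by (cases x) (auto simp: m_assoc)
    then show ?case using u by blast
  qed
  show ?thesis using assms(3)
  proof (induction rule: generate.induct)
    case one show ?case by (intro exI[of _ "[]"]) (simp add: reduced_word_def)
  next
    case (incl h) then show ?case using assms(2) by (intro exI[of _ "[(h, True)]"]) (auto simp: reduced_word_def)
  next
    case (inv h) then show ?case using assms(2) by (intro exI[of _ "[(h, False)]"]) (auto simp: reduced_word_def)
  next
    case (eng h1 h2) then show ?case using app by metis
  qed
qed

text \<open>The image is generated by the loops \<open>h \<circ> l i\<close>. An element of the kernel is the
  value of a reduced word in the loops \<open>l i\<close>, and the same word in the loops \<open>h \<circ> l
  i\<close> is trivial only if it is empty.\<close>

lemma loop_basis_fundamental_group_iso:
  assumes X: "loop_basis X B N M P x0 l" and Y: "loop_basis Y B N' M' P' (h x0) (\<lambda>i. h \<circ> l i)"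
    and h: "continuous_map X Y h"
  shows "fundamental_group_map Y (h x0) h \<in> iso (fundamental_group X x0) (fundamental_group Y (h x0))"
proof -
  interpret X: loop_basis X B N M P x0 l by fact
  interpret Y: loop_basis Y B N' M' P' "h x0" "\<lambda>i. h \<circ> l i" by fact
  let ?G = "fundamental_group X x0" let ?F = "fundamental_group Y (h x0)" let ?f = "fundamental_group_map Y (h x0) h"
  let ?c = "\<lambda>i. loop_class X x0 (l i)" let ?d = "\<lambda>i. loop_class Y (h x0) (h \<circ> l i)"
  have f: "?f \<in> hom ?G ?F" by (rule fundamental_group_map_hom[OF h])
  interpret group_hom ?G ?F ?f
    using f X.group_fundamental Y.group_fundamental by (simp add: group_hom_def group_hom_axioms_def)
  have fc: "?f (?c i) = ?d i" if "i \<in> B" for i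
    by (rule fundamental_group_map_loop_class[OF X.loop[OF that] h])
  have "?f ` carrier ?G = generate ?F (?f ` ?c ` B)"
    using generate_img[of "?c ` B"] X.generates X.loop_class_in_carrier by (metis image_subsetI)
  also have "?f ` ?c ` B = ?d ` B" using fc by (simp add: image_image)
  finally have surj: "?f ` carrier ?G = carrier ?F" using Y.generates by simp
  show ?thesis
  proof (rule hom_iso_if_kernel_trivial[OF f X.group_fundamental Y.group_fundamental surj])
    fix a assume a: "a \<in> carrier ?G" "?f a = \<one>\<^bsub>?F\<^esub>"
    have "?c ` B \<subseteq> carrier ?G" using X.loop_class_in_carrier by auto
    then obtain w where w: "reduced_word w" "fst ` set w \<subseteq> ?c ` B" "word_value ?G w = a"
      using generate_word[OF X.group_fundamental, of "?c ` B" a] X.generates a(1) by auto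
    obtain v where v: "v \<in> reduced_words B" and wv: "w = map (\<lambda>(i, b). (?c i, b)) v"
      by (rule reduced_word_pullback[OF X.inj_on_loop_class w(1,2)])
    have vB: "fst ` set v \<subseteq> B" using v by (simp add: reduced_words_def)
    have "?f (word_value ?G w) = word_value ?F (map (\<lambda>(s, b). (?f s, b)) w)"
      using w(2) X.loop_class_in_carrier by (intro word_value_hom[OF f X.group_fundamental Y.group_fundamental]) auto
    also have "map (\<lambda>(s, b). (?f s, b)) w = map (\<lambda>(i, b). (?d i, b)) v"
      unfolding wv using vB fc by auto
    finally have "v = []"
      using Y.reduced_loop_word_nontrivial[OF v] a(2) w(3) by auto
    then show "a = \<one>\<^bsub>?G\<^esub>" using w(3) wv by simp
  qed
qed

section \<open>Paths as singular one-chains\<close>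

text \<open>The second barycentric coordinate \<open>x 1\<close> serves as time.\<close>

definition path_simplex :: "(real \<Rightarrow> 'a) \<Rightarrow> (nat \<Rightarrow> real) \<Rightarrow> 'a" where
  "path_simplex p = restrict (\<lambda>x. p (x 1)) (standard_simplex 1)"

definition path_chain :: "(real \<Rightarrow> 'a) \<Rightarrow> 'a chain" where
  "path_chain p = frag_of (path_simplex p)"

definition point_chain :: "'a \<Rightarrow> 'a chain" where
  "point_chain y = frag_of (restrict (\<lambda>_. y) (standard_simplex 0))"

definition segment_point :: "real \<Rightarrow> nat \<Rightarrow> real" where
  "segment_point t = (\<lambda>i. if i = 0 then 1 - t else if i = 1 then t else 0)"

lemma segment_point_in: "t \<in> {0..1} \<Longrightarrow> segment_point t \<in> standard_simplex 1"
  by (auto simp: segment_point_def standard_simplex_def)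

lemma standard_simplex_1: "x \<in> standard_simplex 1 \<Longrightarrow> x = segment_point (x 1) \<and> x 1 \<in> {0..1}"
proof -
  assume x: "x \<in> standard_simplex 1"
  then have "x 0 + x 1 = 1" "\<And>i. 1 < i \<Longrightarrow> x i = 0" "0 \<le> x 1" "x 1 \<le> 1"
    by (auto simp: standard_simplex_def)
  then show ?thesis by (auto simp: segment_point_def fun_eq_iff not_less_eq) 
qed

lemma continuous_segment_point: "continuous_map (top_of_set {0..1}) (subtopology (powertop_real UNIV) (standard_simplex 1)) segment_point"
proof -
  have "continuous_map (top_of_set {0..1}) euclideanreal (\<lambda>t. segment_point t i)" for i
    unfolding segment_point_def by (cases "i = 0"; cases "i = 1") (auto intro!: continuous_intros)
  then show ?thesis
    using segment_point_in by (auto simp: continuous_map_in_subtopology continuous_map_componentwise_UNIV)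
qed

lemma path_simplex_cong: "(\<And>t. t \<in> {0..1} \<Longrightarrow> p t = q t) \<Longrightarrow> path_simplex p = path_simplex q"
  unfolding path_simplex_def using standard_simplex_1 by (intro restrict_ext) auto

lemma singular_path_simplex: "pathin X p \<Longrightarrow> singular_simplex 1 X (path_simplex p)"
  unfolding singular_simplex_def path_simplex_def
proof (intro conjI)
  assume p: "pathin X p"
  have "continuous_map (subtopology (powertop_real UNIV) (standard_simplex 1)) (top_of_set {0..1}) (\<lambda>x. x 1)"
    using standard_simplex_1
    by (auto simp: continuous_map_in_subtopology intro: continuous_map_from_subtopology continuous_map_product_projection)
  then have "continuous_map (subtopology (powertop_real UNIV) (standard_simplex 1)) X (p \<circ> (\<lambda>x. x 1))"
    using p unfolding pathin_def by (rule continuous_map_compose)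
  then show "continuous_map (subtopology (powertop_real UNIV) (standard_simplex 1)) X
     (restrict (\<lambda>x. p (x 1)) (standard_simplex 1))"
    by (rule continuous_map_eq) auto
qed simp

lemma simplex_path:
  assumes "singular_simplex 1 X \<sigma>"
  shows "pathin X (\<sigma> \<circ> segment_point)" "path_simplex (\<sigma> \<circ> segment_point) = \<sigma>"
proof -
  show "pathin X (\<sigma> \<circ> segment_point)"
    using assms unfolding pathin_def singular_simplex_def
    by (intro continuous_map_compose[OF continuous_segment_point]) simp
  have e: "\<sigma> \<in> extensional (standard_simplex 1)" using assms by (simp add: singular_simplex_def)
  show "path_simplex (\<sigma> \<circ> segment_point) = \<sigma>"
  proof (rule ext)
    fix x show "path_simplex (\<sigma> \<circ> segment_point) x = \<sigma> x"
      using standard_simplex_1[of x] extensional_arb[OF e, of x]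
      by (cases "x \<in> standard_simplex 1") (auto simp: path_simplex_def)
  qed
qed

lemma singular_chain_path_chain: "pathin X p \<Longrightarrow> singular_chain 1 X (path_chain p)"
  unfolding path_chain_def singular_chain_of by (rule singular_path_simplex)

lemma chain_boundary_path_chain: "chain_boundary 1 (path_chain p) = point_chain (p 1) - point_chain (p 0)"
proof -
  have "singular_face 1 0 (path_simplex p) = restrict (\<lambda>_. p 1) (standard_simplex 0)"
    "singular_face 1 1 (path_simplex p) = restrict (\<lambda>_. p 0) (standard_simplex 0)"
  proof -
    have "simplical_face 0 x \<in> standard_simplex 1" "simplical_face (Suc 0) x \<in> standard_simplex 1"
      "simplical_face 0 x 1 = (1::real)" "simplical_face (Suc 0) x 1 = (0::real)" if "x \<in> standard_simplex 0" for x
      using that simplical_face_in_standard_simplex[of 1 0 x] simplical_face_in_standard_simplex[of 1 1 x]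
      by (auto simp: standard_simplex_0 simplical_face_def)
    then show "singular_face 1 0 (path_simplex p) = restrict (\<lambda>_. p 1) (standard_simplex 0)"
      "singular_face 1 1 (path_simplex p) = restrict (\<lambda>_. p 0) (standard_simplex 0)"
      by (auto simp: singular_face_def path_simplex_def fun_eq_iff)
  qed
  then show ?thesis
    by (simp add: path_chain_def point_chain_def chain_boundary_of)
qed

lemma chain_map_path_chain: "chain_map 1 h (path_chain p) = path_chain (h \<circ> p)"
  by (auto simp: path_chain_def simplex_map_def path_simplex_def fun_eq_iff intro!: arg_cong[where f = frag_of])

lemma path_chain_cycle:
  "p \<in> loops X x0 \<Longrightarrow> singular_relcycle 1 X {} (path_chain p)"
  using loopsD[of p X x0] singular_chain_path_chain[of X p]
  unfolding singular_cycle chain_boundary_path_chain by simp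

text \<open>A convex set is contractible. Every relation below between chains of paths comes from a cycle in
  an interval or in a square.\<close>

lemma convex_cycle_bounds:
  fixes S :: "'e::real_normed_vector set"
  assumes K: "continuous_map (top_of_set S) X K" and S: "convex S"
    and c: "singular_chain 1 (top_of_set S) c" "chain_boundary 1 c = 0"
  shows "singular_relboundary 1 X {} (chain_map 1 K c)"
proof -
  have "contractible_space (top_of_set S)" using S by (simp add: convex_imp_contractible)
  then have "trivial_group (homology_group 1 (top_of_set S))"
    using trivial_reduced_homology_group_contractible_space[of "top_of_set S" 1]
      un_reduced_homology_group[of 1 "top_of_set S"] by simp
  then have triv: "carrier (homology_group (int 1) (top_of_set S)) = {singular_relboundary_set 1 (top_of_set S) {}}"
    using one_relative_homology_group[of 1 "top_of_set S" "{}"] by (simp add: trivial_group_def)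
  have "singular_relcycle 1 (top_of_set S) {} c" using c by (simp add: singular_cycle)
  then have "homologous_rel_set 1 (top_of_set S) {} c \<in> carrier (homology_group (int 1) (top_of_set S))"
    unfolding carrier_relative_homology_group by (intro imageI) simp
  then have eq: "homologous_rel_set 1 (top_of_set S) {} c = singular_relboundary_set 1 (top_of_set S) {}"
    unfolding triv by (rule singletonD)
  have "c \<in> homologous_rel_set 1 (top_of_set S) {} c" by simp
  then have "singular_relboundary 1 (top_of_set S) {} c" unfolding eq by (rule CollectD)
  then show ?thesis
    using singular_relboundary_chain_map[OF _ K, of 1 "{}" c "{}"] by simp
qed

abbreviation homologous :: "'a topology \<Rightarrow> 'a chain \<Rightarrow> 'a chain \<Rightarrow> bool" where
  "homologous X a b \<equiv> homologous_rel 1 X {} a b"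

lemma homologous_join:
  assumes "pathin X p" "pathin X q" "p 1 = q 0"
  shows "homologous X (path_chain (join_loops p q)) (path_chain p + path_chain q)"
proof -
  let ?K = "join_loops p q" let ?a = "\<lambda>t::real. t / 2" let ?b = "\<lambda>t::real. t / 2 + 1/2"
  let ?c = "path_chain (\<lambda>t::real. t) - (path_chain ?a + path_chain ?b)"
  have I: "pathin (top_of_set {0..1}) (\<lambda>t::real. t)" "pathin (top_of_set {0..1}) ?a" "pathin (top_of_set {0..1}) ?b"
    by (auto simp: pathin_def intro!: continuous_intros)
  have "singular_relboundary 1 X {} (chain_map 1 ?K ?c)"
  proof (rule convex_cycle_bounds)
    show "continuous_map (top_of_set {0..1}) X ?K"
      using pathin_join_loops[OF assms] by (simp add: pathin_def)
    show "singular_chain 1 (top_of_set {0..1}) ?c"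
      using I by (intro singular_chain_diff singular_chain_add singular_chain_path_chain)
    show "chain_boundary 1 ?c = 0"
      unfolding chain_boundary_diff chain_boundary_add chain_boundary_path_chain by simp
  qed simp
  moreover have "path_chain (?K \<circ> ?a) = path_chain p"
    unfolding path_chain_def by (intro arg_cong[where f = frag_of] path_simplex_cong) (simp add: join_loops_def)
  moreover have "path_chain (?K \<circ> ?b) = path_chain q"
    unfolding path_chain_def using assms(3)
    by (intro arg_cong[where f = frag_of] path_simplex_cong) (auto simp: join_loops_def)
  moreover have "path_chain (?K \<circ> (\<lambda>t. t)) = path_chain ?K" by (simp add: o_def)
  ultimately show ?thesis
    by (simp only: homologous_rel_def chain_map_diff chain_map_add chain_map_path_chain)
qed

lemma homologous_iff: "homologous X a b \<longleftrightarrow> singular_relboundary 1 X {} (a - b)"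
  by (simp add: homologous_rel_def)

lemma homologous_const:
  assumes "y \<in> topspace X" shows "homologous X (path_chain (\<lambda>_. y)) 0"
proof -
  have "homologous X (path_chain (join_loops (\<lambda>_. y) (\<lambda>_. y))) (path_chain (\<lambda>_. y) + path_chain (\<lambda>_. y))"
    by (rule homologous_join) (use assms in auto)
  then have "homologous X (path_chain (\<lambda>_. y)) (path_chain (\<lambda>_. y) + path_chain (\<lambda>_. y))"
    by (simp add: join_loops_def[abs_def])
  then have "homologous X (path_chain (\<lambda>_. y) + path_chain (\<lambda>_. y)) (path_chain (\<lambda>_. y))"
    by (rule homologous_rel_sym[THEN iffD1])
  then show ?thesis by (simp add: homologous_iff del: One_nat_def)
qed

lemma homologous_path_homotopic:
  assumes "path_homotopic X p q" shows "homologous X (path_chain p) (path_chain q)"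
proof -
  obtain K where K: "continuous_map (top_of_set ({0..1::real} \<times> {0..1::real})) X K"
    "\<And>t. t\<in>{0..1} \<Longrightarrow> K (0, t) = p t" "\<And>t. t\<in>{0..1} \<Longrightarrow> K (1, t) = q t"
    "\<And>s. s\<in>{0..1} \<Longrightarrow> K (s, 0) = p 0"  "\<And>s. s\<in>{0..1} \<Longrightarrow> K (s, 1) = p 1"
    by (rule path_homotopic_squareE[OF assms], rule that)
  let ?S = "{0..1::real} \<times> {0..1::real}"
  let ?c = "(path_chain (\<lambda>t::real. (0::real, t)) + path_chain (\<lambda>s::real. (s, 1::real))) -
    (path_chain (\<lambda>s::real. (s, 0::real)) + path_chain (\<lambda>t::real. (1::real, t)))"
  have b: "singular_relboundary 1 X {} (chain_map 1 K ?c)"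
  proof (rule convex_cycle_bounds[OF K(1)])
    show "singular_chain 1 (top_of_set ?S) ?c"
      by (intro singular_chain_diff singular_chain_add singular_chain_path_chain)
        (auto simp: pathin_def intro!: continuous_intros)
    show "chain_boundary 1 ?c = 0"
      unfolding chain_boundary_diff chain_boundary_add chain_boundary_path_chain by simp
  qed (simp add: convex_Times)
  have eq: "path_chain (K \<circ> (\<lambda>t. (0, t))) = path_chain p" "path_chain (K \<circ> (\<lambda>t. (1, t))) = path_chain q"
     "path_chain (K \<circ> (\<lambda>s. (s, 0))) = path_chain (\<lambda>_. p 0)" "path_chain (K \<circ> (\<lambda>s. (s, 1))) = path_chain (\<lambda>_. p 1)"
    unfolding path_chain_def using K(2-)
    by (auto intro!: arg_cong[where f = frag_of] path_simplex_cong)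
  have "homologous X (path_chain p + path_chain (\<lambda>_. p 1)) (path_chain (\<lambda>_. p 0) + path_chain q)"
    using b unfolding homologous_rel_def chain_map_diff chain_map_add chain_map_path_chain eq .
  moreover have "p 0 \<in> topspace X" "p 1 \<in> topspace X"
    using path_homotopic_pathin[OF assms] path_start_in_topspace path_finish_in_topspace by blast+
  then have "homologous X (path_chain (\<lambda>_. p 0) - path_chain (\<lambda>_. p 1)) (0 - 0)"
    by (intro homologous_rel_diff homologous_const)
  ultimately have "homologous X (path_chain p + path_chain (\<lambda>_. p 1) + (path_chain (\<lambda>_. p 0) - path_chain (\<lambda>_. p 1)))
      (path_chain (\<lambda>_. p 0) + path_chain q + (0 - 0))"
    by (rule homologous_rel_add)
  then have "singular_relboundary 1 X {} (path_chain p - path_chain q)"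
    by (simp add: homologous_iff algebra_simps del: One_nat_def)
  then show ?thesis by (simp add: homologous_iff del: One_nat_def)
qed

lemma homologous_reverse:
  assumes "pathin X p" shows "homologous X (path_chain (reverse_path p)) (- path_chain p)"
proof -
  have "homologous X (path_chain (join_loops (reverse_path p) p)) (path_chain (reverse_path p) + path_chain p)"
    by (rule homologous_join) (simp_all add: assms pathin_reverse_path)
  moreover have "homologous X (path_chain (join_loops (reverse_path p) p)) (path_chain (\<lambda>_. p 1))"
    by (rule homologous_path_homotopic[OF path_homotopic_inverse_left[OF assms]])
  moreover have "homologous X (path_chain (\<lambda>_. p 1)) 0"
    by (rule homologous_const[OF path_finish_in_topspace[OF assms]])
  ultimately have "homologous X (path_chain (reverse_path p) + path_chain p) 0"
    using homologous_rel_sym homologous_rel_trans by blast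
  then show ?thesis by (simp add: homologous_iff del: One_nat_def)
qed

text \<open>The paths \<open>\<tau>\<close> turn every one-chain into a combination of loops, up to a homology and a chain that
  only depends on the boundary.\<close>

lemma homologous_conjugate:
  assumes \<tau>: "path_system X x0 \<tau>" and q: "pathin X q"
  shows "homologous X (path_chain (join_loops (join_loops (\<tau> (q 0)) q) (reverse_path (\<tau> (q 1)))))
     (path_chain q - (path_chain (\<tau> (q 1)) - path_chain (\<tau> (q 0))))"
proof -
  note s = path_system_at[OF \<tau> q]
  let ?a = "join_loops (\<tau> (q 0)) q"
  have a: "pathin X ?a" using s q by (intro pathin_join_loops) auto
  have "homologous X (path_chain (join_loops ?a (reverse_path (\<tau> (q 1))))) (path_chain ?a + path_chain (reverse_path (\<tau> (q 1))))"
    by (rule homologous_join[OF a pathin_reverse_path]) (use s in auto)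
  moreover have "homologous X (path_chain ?a + path_chain (reverse_path (\<tau> (q 1))))
     ((path_chain (\<tau> (q 0)) + path_chain q) + - path_chain (\<tau> (q 1)))"
    using s q by (intro homologous_rel_add homologous_join homologous_reverse) auto
  ultimately show ?thesis
    using homologous_rel_trans by (fastforce simp: algebra_simps)
qed

section \<open>First homology\<close>

text \<open>A singular 0-simplex is a function on the standard 0-simplex, whose only point is \<open>(1, 0, 0,
  \<dots>)\<close>.\<close>

definition transfer_chain :: "('a \<Rightarrow> real \<Rightarrow> 'a) \<Rightarrow> 'a chain \<Rightarrow> 'a chain" where
  "transfer_chain \<tau> = frag_extend (\<lambda>v. path_chain (\<tau> (v (\<lambda>j. if j = 0 then 1 else 0))))"

lemma transfer_chain_point: "transfer_chain \<tau> (point_chain y) = path_chain (\<tau> y)"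
  by (simp add: transfer_chain_def point_chain_def standard_simplex_0)

context loop_basis
begin

lemma loop_pathin: "i \<in> B \<Longrightarrow> pathin X (loop i)"
  by (rule conjunct1[OF loopsD[OF loop]])

definition loop_sum :: "('i \<Rightarrow>\<^sub>0 int) \<Rightarrow> 'a chain" where
  "loop_sum = frag_extend (\<lambda>i. path_chain (loop i))"

text \<open>Concatenation of loops becomes addition of chains, so the generation of the fundamental group by
  the basic loops is inherited by the classes of loops in homology.\<close>

lemma loop_homologous_loop_sum:
  assumes "p \<in> loops X x0"
  shows "\<exists>n. Poly_Mapping.keys n \<subseteq> B \<and> homologous X (path_chain p) (loop_sum n)"
proof -
  have "\<forall>p\<in>loops X x0. loop_class X x0 p = a \<longrightarrow>
     (\<exists>n. Poly_Mapping.keys n \<subseteq> B \<and> homologous X (path_chain p) (loop_sum n))"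
    if "a \<in> generate (fundamental_group X x0) ((\<lambda>i. loop_class X x0 (loop i)) ` B)" for a
    using that
  proof (induction rule: generate.induct)
    case one
    show ?case
    proof (intro ballI impI exI[of _ 0] conjI)
      fix p assume p: "p \<in> loops X x0" "loop_class X x0 p = \<one>\<^bsub>fundamental_group X x0\<^esub>"
      then have "path_homotopic X p (\<lambda>_. x0)"
        by (simp add: one_fundamental_group loop_class_eq_iff const_loop base_point)
      then show "homologous X (path_chain p) (loop_sum 0)"
        using homologous_path_homotopic homologous_const[OF base_point] homologous_rel_trans
        by (fastforce simp: loop_sum_def)
    qed simp
  next
    case (incl h)
    then obtain i where i: "i \<in> B" "h = loop_class X x0 (loop i)" by auto
    show ?case
    proof (intro ballI impI exI[of _ "frag_of i"] conjI)
      fix p assume p: "p \<in> loops X x0" "loop_class X x0 p = h"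
      then have "path_homotopic X p (loop i)" using i loop by (simp add: loop_class_eq_iff)
      then show "homologous X (path_chain p) (loop_sum (frag_of i))"
        using homologous_path_homotopic by (simp add: loop_sum_def)
    qed (use i in simp)
  next
    case (inv h)
    then obtain i where i: "i \<in> B" "h = loop_class X x0 (loop i)" by auto
    show ?case
    proof (intro ballI impI exI[of _ "- frag_of i"] conjI)
      fix p assume p: "p \<in> loops X x0" "loop_class X x0 p = inv\<^bsub>fundamental_group X x0\<^esub> h"
      then have "path_homotopic X p (reverse_path (loop i))"
        using i loop by (simp add: inv_fundamental_group base_point loop_class_eq_iff reverse_path_in_loops)
      then show "homologous X (path_chain p) (loop_sum (- frag_of i))"
        using homologous_path_homotopic homologous_reverse[OF loop_pathin[OF i(1)]] homologous_rel_trans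
        by (fastforce simp: loop_sum_def frag_extend_minus)
    qed (use i in simp)
  next
    case (eng h1 h2)
    have gen: "a \<in> carrier (fundamental_group X x0)"
      if "a \<in> generate (fundamental_group X x0) ((\<lambda>i. loop_class X x0 (loop i)) ` B)" for a
      using that generates by simp
    obtain p1 where p1: "p1 \<in> loops X x0" "h1 = loop_class X x0 p1"
      using gen[OF eng.hyps(1)] unfolding carrier_fundamental_group by (rule imageE)
    obtain p2 where p2: "p2 \<in> loops X x0" "h2 = loop_class X x0 p2"
      using gen[OF eng.hyps(2)] unfolding carrier_fundamental_group by (rule imageE)
    obtain n1 where n1: "Poly_Mapping.keys n1 \<subseteq> B" "homologous X (path_chain p1) (loop_sum n1)"
      using eng.IH(1) p1 by auto
    obtain n2 where n2: "Poly_Mapping.keys n2 \<subseteq> B" "homologous X (path_chain p2) (loop_sum n2)"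
      using eng.IH(2) p2 by auto
    show ?case
    proof (intro ballI impI exI[of _ "n1 + n2"] conjI)
      fix p assume p: "p \<in> loops X x0" "loop_class X x0 p = h1 \<otimes>\<^bsub>fundamental_group X x0\<^esub> h2"
      then have "path_homotopic X p (join_loops p1 p2)"
        using p1 p2 by (simp add: mult_fundamental_group loop_class_eq_iff join_loops_in_loops)
      then have "homologous X (path_chain p) (path_chain (join_loops p1 p2))"
        by (rule homologous_path_homotopic)
      moreover have "homologous X (path_chain (join_loops p1 p2)) (path_chain p1 + path_chain p2)"
        using loopsD[OF p1(1)] loopsD[OF p2(1)] by (intro homologous_join) auto
      moreover have "homologous X (path_chain p1 + path_chain p2) (loop_sum n1 + loop_sum n2)"
        by (rule homologous_rel_add[OF n1(2) n2(2)])
      ultimately have "homologous X (path_chain p) (loop_sum n1 + loop_sum n2)"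
        using homologous_rel_trans by blast
      then show "homologous X (path_chain p) (loop_sum (n1 + n2))"
        by (simp add: loop_sum_def frag_extend_add)
      show "Poly_Mapping.keys (n1 + n2) \<subseteq> B" using n1(1) n2(1) keys_add[of n1 n2] by blast
    qed
  qed
  moreover have "loop_class X x0 p \<in> generate (fundamental_group X x0) ((\<lambda>i. loop_class X x0 (loop i)) ` B)"
    unfolding generates by (rule loop_class_carrier[OF assms])
  ultimately show ?thesis using assms by simp
qed

lemma path_system_exists: "\<exists>\<tau>. path_system X x0 \<tau>"
proof -
  have "\<exists>p. pathin X p \<and> p 0 = x0 \<and> p 1 = x" if "x \<in> topspace X" for x
    using bspec[OF bspec[OF path_connected[unfolded path_connected_space_def] base_point] that] .
  then have "\<forall>x\<in>topspace X. \<exists>p. pathin X p \<and> p 0 = x0 \<and> p 1 = x" by (intro ballI)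
  from bchoice[OF this] obtain \<tau> where "\<forall>x\<in>topspace X. pathin X (\<tau> x) \<and> \<tau> x 0 = x0 \<and> \<tau> x 1 = x" ..
  then show ?thesis using base_point by (auto simp: path_system_def)
qed

text \<open>Each 1-simplex is conjugated to a loop by the paths from the base point to its ends.\<close>

lemma chain_homologous_loop_sum:
  assumes \<tau>: "path_system X x0 \<tau>" and c: "singular_chain 1 X c"
  shows "\<exists>n. Poly_Mapping.keys n \<subseteq> B \<and> homologous X (c - transfer_chain \<tau> (chain_boundary 1 c)) (loop_sum n)"
  using c unfolding singular_chain_def
proof (induction c rule: frag_induction)
  case zero
  show ?case by (intro exI[of _ 0]) (simp add: loop_sum_def transfer_chain_def)
next
  case (one \<sigma>)
  then have \<sigma>: "singular_simplex 1 X \<sigma>" by simp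
  let ?q = "\<sigma> \<circ> segment_point"
  note q = simplex_path[OF \<sigma>]
  obtain n where n: "Poly_Mapping.keys n \<subseteq> B"
    "homologous X (path_chain (join_loops (join_loops (\<tau> (?q 0)) ?q) (reverse_path (\<tau> (?q 1))))) (loop_sum n)"
    using loop_homologous_loop_sum[OF path_class_loop[OF \<tau> q(1)]] by blast
  have "frag_of \<sigma> = path_chain ?q" by (simp only: path_chain_def q(2))
  moreover have "transfer_chain \<tau> (chain_boundary 1 (path_chain ?q)) = path_chain (\<tau> (?q 1)) - path_chain (\<tau> (?q 0))"
    unfolding chain_boundary_path_chain
    by (simp only: transfer_chain_point[symmetric]) (simp only: transfer_chain_def frag_extend_diff)
  ultimately have "homologous X (frag_of \<sigma> - transfer_chain \<tau> (chain_boundary 1 (frag_of \<sigma>))) (loop_sum n)"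
    using homologous_rel_trans[OF n(2) homologous_rel_sym[THEN iffD1, OF homologous_conjugate[OF \<tau> q(1)]]]
    by (simp only:)
  then show ?case using n(1) by blast
next
  case (diff a b)
  then obtain m n where mn: "Poly_Mapping.keys m \<subseteq> B" "homologous X (a - transfer_chain \<tau> (chain_boundary 1 a)) (loop_sum m)"
    "Poly_Mapping.keys n \<subseteq> B" "homologous X (b - transfer_chain \<tau> (chain_boundary 1 b)) (loop_sum n)" by blast
  have h: "homologous X ((a - transfer_chain \<tau> (chain_boundary 1 a)) - (b - transfer_chain \<tau> (chain_boundary 1 b))) (loop_sum m - loop_sum n)"
    by (rule homologous_rel_diff[OF mn(2,4)])
  have e1: "(a - transfer_chain \<tau> (chain_boundary 1 a)) - (b - transfer_chain \<tau> (chain_boundary 1 b)) =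
      (a - b) - transfer_chain \<tau> (chain_boundary 1 (a - b))"
    unfolding transfer_chain_def chain_boundary_diff frag_extend_diff by (simp add: algebra_simps)
  have e2: "loop_sum m - loop_sum n = loop_sum (m - n)" by (simp add: loop_sum_def frag_extend_diff)
  have "Poly_Mapping.keys (m - n) \<subseteq> B" using mn(1,3) keys_diff[of m n] by blast
  then show ?case using h[unfolded e1 e2] by (intro exI[of _ "m - n"] conjI)
qed

lemma cycle_homologous_loop_sum:
  assumes "singular_relcycle 1 X {} c"
  shows "\<exists>n. Poly_Mapping.keys n \<subseteq> B \<and> homologous X c (loop_sum n)"
proof -
  obtain \<tau> where "path_system X x0 \<tau>" using path_system_exists by blast
  then show ?thesis
    using chain_homologous_loop_sum[of \<tau> c] assms by (simp add: singular_cycle transfer_chain_def)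
qed

text \<open>Holonomy with values in an abelian group is a singular cocycle with prescribed values on the
  loops.\<close>

lemma dual_cochain:
  assumes F: "comm_group F" and g: "\<And>i. i \<in> B \<Longrightarrow> g i \<in> carrier F"
  obtains U where "U \<in> hom (chain_group 1 X) F"
    "\<And>d. singular_chain 2 X d \<Longrightarrow> U (chain_boundary 2 d) = \<one>\<^bsub>F\<^esub>"
    "\<And>i. i \<in> B \<Longrightarrow> U (path_chain (loop i)) = g i"
proof -
  interpret F: comm_group F by fact
  obtain hol H where hol: "\<And>p. pathin X p \<Longrightarrow> hol p \<in> carrier F"
    and join: "\<And>p q. pathin X p \<Longrightarrow> pathin X q \<Longrightarrow> p 1 = q 0 \<Longrightarrow> hol (join_loops p q) = hol p \<otimes>\<^bsub>F\<^esub> hol q"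
    and homot: "\<And>p q. path_homotopic X p q \<Longrightarrow> hol p = hol q"
    and l: "\<And>i. i \<in> B \<Longrightarrow> hol (loop i) = g i"
    and "H \<in> hom (fundamental_group X x0) F"
    and "\<And>i. i \<in> B \<Longrightarrow> H (loop_class X x0 (loop i)) = g i"
    by (rule holonomy_exists[OF F.group_axioms g], assumption, rule that)
  obtain U where U: "U \<in> hom (free_Abelian_group (singular_simplex_set 1 X)) F"
    "\<And>\<sigma>. \<sigma> \<in> singular_simplex_set 1 X \<Longrightarrow> U (frag_of \<sigma>) = hol (\<sigma> \<circ> segment_point)"
    by (rule F.free_Abelian_group_universal[of "\<lambda>\<sigma>. hol (\<sigma> \<circ> segment_point)" "singular_simplex_set 1 X"])
      (use hol simplex_path(1) in auto)
  have Uc: "U \<in> hom (chain_group 1 X) F" using U(1) by (simp add: chain_group_def)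
  interpret U: group_hom "chain_group 1 X" F U
    using Uc by (simp add: group_hom_def group_hom_axioms_def F.group_axioms)
  have Up: "U (path_chain p) = hol p" if p: "pathin X p" for p
  proof -
    have "U (path_chain p) = hol (path_simplex p \<circ> segment_point)"
      unfolding path_chain_def using singular_path_simplex[OF p] by (intro U(2)) simp
    also have "\<dots> = hol p"
    proof (rule homot[OF path_homotopic_sym[OF path_homotopic_cong[OF p]]])
      fix t :: real assume t: "t \<in> {0..1}"
      have "segment_point t 1 = t" by (simp add: segment_point_def)
      then show "p t = (path_simplex p \<circ> segment_point) t"
        using segment_point_in[OF t] by (simp add: path_simplex_def)
    qed
    finally show ?thesis .
  qed
  have Udiff: "U (a - b) = U a \<otimes>\<^bsub>F\<^esub> inv\<^bsub>F\<^esub> U b" if "singular_chain 1 X a" "singular_chain 1 X b" for a b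
  proof -
    have ab: "singular_chain 1 X (a - b)" using that by (rule singular_chain_diff)
    have "U ((a - b) + b) = U (a - b) \<otimes>\<^bsub>F\<^esub> U b"
      using hom_mult[OF Uc, of "a - b" b] ab that by (simp del: One_nat_def)
    then have "U a = U (a - b) \<otimes>\<^bsub>F\<^esub> U b" by simp
    then show ?thesis
      using F.inv_solve_right[of "U (a - b)" "U a" "U b"] hom_in_carrier[OF Uc] ab that
      by (simp del: One_nat_def)
  qed
  have "U (chain_boundary 2 d) = \<one>\<^bsub>F\<^esub>" if "singular_chain 2 X d" for d
  proof -
    have "singular_chain 1 X (chain_boundary 2 d) \<and> U (chain_boundary 2 d) = \<one>\<^bsub>F\<^esub>"
      using that unfolding singular_chain_def[of 2 X d]
    proof (induction d rule: frag_induction)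
      case zero
      then show ?case using U.hom_one by simp
    next
      case (diff a b)
      then show ?case using Udiff[of "chain_boundary 2 a" "chain_boundary 2 b"]
        by (simp add: chain_boundary_diff singular_chain_diff)
    next
      case (one \<sigma>)
      then have \<sigma>: "continuous_map (subtopology (powertop_real UNIV) (standard_simplex 2)) X \<sigma>"
        "singular_simplex 2 X \<sigma>"
        by (auto simp: singular_simplex_def)
      \<comment> \<open>In a triangle the concatenation of two edges is homotopic to the third edge, so the
        holonomies of the three edges cancel.\<close>
      define T where "T = {z::real \<times> real. 0 \<le> fst z \<and> 0 \<le> snd z \<and> fst z + snd z \<le> 1}"
      define \<psi> where "\<psi> z = (\<lambda>i::nat. if i = 0 then 1 - fst z - snd z else if i = 1 then fst z else if i = 2 then snd z else (0::real))" for z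
      have T: "convex T"
      proof -
        have "T = {z. inner (1, 0) z \<ge> 0} \<inter> {z. inner (0, 1) z \<ge> 0} \<inter> {z. inner (1, 1) z \<le> 1}"
          by (auto simp: T_def)
        then show ?thesis
          by (simp only:) (intro convex_Int convex_halfspace_ge convex_halfspace_le)
      qed
      have \<psi>in: "\<psi> z \<in> standard_simplex 2" if "z \<in> T" for z
        using that by (auto simp: \<psi>_def T_def standard_simplex_def numeral_2_eq_2)
      have "continuous_map (top_of_set T) euclideanreal (\<lambda>z. \<psi> z i)" for i
        unfolding \<psi>_def by (cases "i = 0"; cases "i = 1"; cases "i = 2") (auto intro!: continuous_intros)
      then have "continuous_map (top_of_set T) (subtopology (powertop_real UNIV) (standard_simplex 2)) \<psi>"
        using \<psi>in by (auto simp: continuous_map_in_subtopology continuous_map_componentwise_UNIV)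
      then have K: "continuous_map (top_of_set T) X (\<sigma> \<circ> \<psi>)" by (rule continuous_map_compose[OF _ \<sigma>(1)])
      let ?e0 = "\<lambda>t::real. (1 - t, t)" let ?e1 = "\<lambda>t::real. (0::real, t)" let ?e2 = "\<lambda>t::real. (t, 0::real)"
      have ein: "?e0 ` {0..1} \<subseteq> T" "?e1 ` {0..1} \<subseteq> T" "?e2 ` {0..1} \<subseteq> T" by (auto simp: T_def)
      have pe: "pathin X ((\<sigma> \<circ> \<psi>) \<circ> ?e0)" "pathin X ((\<sigma> \<circ> \<psi>) \<circ> ?e1)" "pathin X ((\<sigma> \<circ> \<psi>) \<circ> ?e2)"
        by (rule pathin_compose_map[OF K]; use ein in \<open>auto intro!: continuous_intros\<close>)+
      have cT: "continuous_on {0..1} (join_loops ?e2 ?e0)"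
      proof -
        have "pathin euclidean ?e2" "pathin euclidean ?e0"
          by (auto simp: pathin_def intro!: continuous_intros)
        then have "pathin euclidean (join_loops ?e2 ?e0)" by (rule pathin_join_loops) simp
        then show ?thesis by (simp add: pathin_def)
      qed
      have "path_homotopic X ((\<sigma> \<circ> \<psi>) \<circ> join_loops ?e2 ?e0) ((\<sigma> \<circ> \<psi>) \<circ> ?e1)"
        by (rule path_homotopic_convex[OF K T cT order_trans[OF join_loops_image Un_least[OF ein(3,1)]] _ ein(2)])
          (auto intro!: continuous_intros)
      then have h: "hol ((\<sigma> \<circ> \<psi>) \<circ> ?e2) \<otimes>\<^bsub>F\<^esub> hol ((\<sigma> \<circ> \<psi>) \<circ> ?e0) = hol ((\<sigma> \<circ> \<psi>) \<circ> ?e1)"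
        using homot join[OF pe(3,1)] by (simp add: join_loops_compose[symmetric])
      have face: "singular_face 2 k \<sigma> = path_simplex ((\<sigma> \<circ> \<psi>) \<circ> e)"
        if "k = 0 \<and> e = ?e0 \<or> k = 1 \<and> e = ?e1 \<or> k = 2 \<and> e = ?e2" for k e
      proof -
        have sf: "simplical_face k x = \<psi> (e (x 1))" if "x \<in> standard_simplex 1" for x :: "nat \<Rightarrow> real"
        proof -
          have "x 0 = 1 - x 1" "\<And>i. i > 1 \<Longrightarrow> x i = 0"
            using standard_simplex_1[OF that] by (metis segment_point_def, metis segment_point_def less_numeral_extra(3) less_irrefl not_one_less_zero)
          then show ?thesis
            using \<open>k = 0 \<and> e = ?e0 \<or> k = 1 \<and> e = ?e1 \<or> k = 2 \<and> e = ?e2\<close>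
            by (intro ext) (auto simp: simplical_face_def \<psi>_def not_less less_Suc_eq numeral_2_eq_2)
        qed
        have "standard_simplex (2 - Suc 0) = standard_simplex 1" by simp
        then show ?thesis
          unfolding singular_face_def path_simplex_def by (simp only:) (rule restrict_ext, simp only: o_apply sf)
      qed
      have "chain_boundary 2 (frag_of \<sigma>) = path_chain ((\<sigma> \<circ> \<psi>) \<circ> ?e0) - path_chain ((\<sigma> \<circ> \<psi>) \<circ> ?e1) + path_chain ((\<sigma> \<circ> \<psi>) \<circ> ?e2)"
        using face[of 0 ?e0] face[of 1 ?e1] face[of 2 ?e2]
        by (simp add: chain_boundary_of path_chain_def numeral_2_eq_2)
      also have "\<dots> = (path_chain ((\<sigma> \<circ> \<psi>) \<circ> ?e2) + path_chain ((\<sigma> \<circ> \<psi>) \<circ> ?e0)) - path_chain ((\<sigma> \<circ> \<psi>) \<circ> ?e1)"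
        by simp
      finally have bd: "chain_boundary 2 (frag_of \<sigma>) =
        (path_chain ((\<sigma> \<circ> \<psi>) \<circ> ?e2) + path_chain ((\<sigma> \<circ> \<psi>) \<circ> ?e0)) - path_chain ((\<sigma> \<circ> \<psi>) \<circ> ?e1)" .
      have pc: "singular_chain 1 X (path_chain ((\<sigma> \<circ> \<psi>) \<circ> ?e0))" "singular_chain 1 X (path_chain ((\<sigma> \<circ> \<psi>) \<circ> ?e1))"
         "singular_chain 1 X (path_chain ((\<sigma> \<circ> \<psi>) \<circ> ?e2))"
        using pe by (simp_all only: singular_chain_path_chain)
      have "U (path_chain ((\<sigma> \<circ> \<psi>) \<circ> ?e2) + path_chain ((\<sigma> \<circ> \<psi>) \<circ> ?e0)) = hol ((\<sigma> \<circ> \<psi>) \<circ> ?e1)"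
        using U.hom_mult[of "path_chain ((\<sigma> \<circ> \<psi>) \<circ> ?e2)" "path_chain ((\<sigma> \<circ> \<psi>) \<circ> ?e0)"] pc Up[OF pe(1)] Up[OF pe(3)] h by simp
      then have "U (chain_boundary 2 (frag_of \<sigma>)) = \<one>\<^bsub>F\<^esub>"
        unfolding bd using Udiff[OF singular_chain_add[OF pc(3,1)] pc(2)] Up[OF pe(2)] hol[OF pe(2)] by simp
      moreover have "singular_chain 1 X (chain_boundary 2 (frag_of \<sigma>))"
        unfolding bd by (intro singular_chain_diff singular_chain_add pc)
      ultimately show ?case by simp
    qed
    then show ?thesis by simp
  qed
  moreover have "U (path_chain (loop i)) = g i" if "i \<in> B" for i
    using Up[OF loop_pathin[OF that]] l[OF that] by simp
  ultimately show thesis using Uc that by blast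
qed

definition homology_basis_map :: "('i \<Rightarrow>\<^sub>0 int) \<Rightarrow> 'a chain set" where
  "homology_basis_map n = homologous_rel_set 1 X {} (loop_sum n)"

lemma loop_sum_cycle: "Poly_Mapping.keys n \<subseteq> B \<Longrightarrow> singular_relcycle 1 X {} (loop_sum n)"
proof (induction n rule: frag_induction)
  case (one i)
  then show ?case using path_chain_cycle[OF loop[OF one]] by (simp add: loop_sum_def)
next
  case (diff a b)
  then show ?case by (simp add: loop_sum_def frag_extend_diff singular_relcycle_diff)
qed (simp add: loop_sum_def)

text \<open>The integral cocycle dual to wall \<open>j\<close> reads off the coefficient of loop
  \<open>j\<close>.\<close>

lemma loop_sum_boundary:
  assumes n: "Poly_Mapping.keys n \<subseteq> B" and b: "singular_relboundary 1 X {} (loop_sum n)"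
  shows "n = 0"
proof (rule poly_mapping_eqI)
  fix j
  show "Poly_Mapping.lookup n j = Poly_Mapping.lookup 0 j"
  proof (cases "j \<in> B")
    case False then show ?thesis using n by (auto simp: in_keys_iff)
  next
    case True
    obtain U where U: "U \<in> hom (chain_group 1 X) integer_group"
      "\<And>d. singular_chain 2 X d \<Longrightarrow> U (chain_boundary 2 d) = \<one>\<^bsub>integer_group\<^esub>"
      "\<And>i. i \<in> B \<Longrightarrow> U (path_chain (loop i)) = (if i = j then 1 else 0)"
      by (rule dual_cochain[OF abelian_integer_group, of "\<lambda>i. if i = j then 1 else 0"], simp, rule that)
    have add: "U (a + c) = U a + U c" if "singular_chain 1 X a" "singular_chain 1 X c" for a c
      using hom_mult[OF U(1), of a c] that by simp
    have U0: "U 0 = 0" using add[of 0 0] by simp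
    have minus: "U (a - c) = U a - U c" if "singular_chain 1 X a" "singular_chain 1 X c" for a c
      using add[of "a - c" c] that by (simp add: singular_chain_diff)
    have "singular_chain 1 X (loop_sum n) \<and> U (loop_sum n) = Poly_Mapping.lookup n j"
      using n
    proof (induction n rule: frag_induction)
      case zero show ?case by (simp add: loop_sum_def U0)
    next
      case (one i)
      then show ?case using U(3)[OF one] singular_chain_path_chain[OF loop_pathin[OF one]]
        by (simp add: loop_sum_def lookup_single when_def)
    next
      case (diff a b)
      then show ?case using minus[of "loop_sum a" "loop_sum b"]
        by (simp add: loop_sum_def frag_extend_diff singular_chain_diff lookup_minus)
    qed
    moreover have "U (loop_sum n) = 0"
    proof -
      obtain d where "singular_chain (Suc 1) X d" "chain_boundary (Suc 1) d = loop_sum n"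
        using b by (auto simp: singular_boundary)
      then show ?thesis using U(2)[of d] by (simp add: numeral_2_eq_2)
    qed
    ultimately show ?thesis by simp
  qed
qed

lemma homology_basis_map_iso: "homology_basis_map \<in> iso (free_Abelian_group B) (homology_group 1 X)"
proof (rule hom_iso_if_kernel_trivial)
  have H: "homology_group 1 X = relative_homology_group (int 1) X {}" by simp
  have car: "homology_basis_map n \<in> carrier (homology_group 1 X)" if "Poly_Mapping.keys n \<subseteq> B" for n
    unfolding H carrier_relative_homology_group homology_basis_map_def using loop_sum_cycle[OF that] by (intro imageI) simp
  show "homology_basis_map \<in> hom (free_Abelian_group B) (homology_group 1 X)"
  proof (rule homI)
    fix a b :: "'i \<Rightarrow>\<^sub>0 int"
    assume "a \<in> carrier (free_Abelian_group B)" "b \<in> carrier (free_Abelian_group B)"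
    have s: "loop_sum (a + b) = loop_sum a + loop_sum b" by (simp add: loop_sum_def frag_extend_add)
    show "homology_basis_map (a \<otimes>\<^bsub>free_Abelian_group B\<^esub> b) = homology_basis_map a \<otimes>\<^bsub>homology_group 1 X\<^esub> homology_basis_map b"
      unfolding H mult_relative_homology_group mult_free_Abelian_group homology_basis_map_def s
    proof (intro subset_antisym subsetI)
      fix c assume "c \<in> homologous_rel_set 1 X {} (loop_sum a + loop_sum b)"
      then have "homologous X (loop_sum b) (c - loop_sum a)"
        by (simp add: homologous_rel_def algebra_simps)
      then show "c \<in> (\<Union>r\<in>homologous_rel_set 1 X {} (loop_sum a). \<Union>s\<in>homologous_rel_set 1 X {} (loop_sum b). {r + s})"
        by (intro UN_I[of "loop_sum a"] UN_I[of "c - loop_sum a"]) auto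
    next
      fix c assume "c \<in> (\<Union>r\<in>homologous_rel_set 1 X {} (loop_sum a). \<Union>s\<in>homologous_rel_set 1 X {} (loop_sum b). {r + s})"
      then show "c \<in> homologous_rel_set 1 X {} (loop_sum a + loop_sum b)"
        by (auto intro: homologous_rel_add)
    qed
  qed (use car in simp)
  show "homology_basis_map ` carrier (free_Abelian_group B) = carrier (homology_group 1 X)"
  proof (intro subset_antisym subsetI)
    fix y assume "y \<in> homology_basis_map ` carrier (free_Abelian_group B)"
    then show "y \<in> carrier (homology_group 1 X)" using car by auto
  next
    fix y assume "y \<in> carrier (homology_group 1 X)"
    then obtain c where c: "singular_relcycle 1 X {} c" "y = homologous_rel_set 1 X {} c"
      unfolding H carrier_relative_homology_group by auto
    obtain n where n: "Poly_Mapping.keys n \<subseteq> B" "homologous X c (loop_sum n)"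
      using cycle_homologous_loop_sum[OF c(1)] by blast
    then have "y = homology_basis_map n"
      unfolding c(2) homology_basis_map_def using homologous_rel_eq[of 1 X "{}" c "loop_sum n"] by simp
    then show "y \<in> homology_basis_map ` carrier (free_Abelian_group B)" using n(1) by simp
  qed
  fix n assume n: "n \<in> carrier (free_Abelian_group B)" "homology_basis_map n = \<one>\<^bsub>homology_group 1 X\<^esub>"
  then have eq: "homologous_rel_set 1 X {} (loop_sum n) = singular_relboundary_set 1 X {}"
    using one_relative_homology_group[of 1 X "{}"] by (simp add: homology_basis_map_def)
  have "loop_sum n \<in> homologous_rel_set 1 X {} (loop_sum n)" by simp
  then have "singular_relboundary 1 X {} (loop_sum n)" unfolding eq by (rule CollectD)
  then show "n = \<one>\<^bsub>free_Abelian_group B\<^esub>" using loop_sum_boundary n(1) by simp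
qed simp_all

lemma homology_group_free: "homology_group 1 X \<cong> free_Abelian_group {..<card B}"
proof -
  have "free_Abelian_group B \<cong> homology_group 1 X" using homology_basis_map_iso by (rule is_isoI)
  then have "homology_group 1 X \<cong> free_Abelian_group B" by (rule group.iso_sym[OF group_free_Abelian_group])
  moreover have "B \<approx> {..<card B}" using finite_walls by (simp add: eqpoll_iff_card)
  then have "free_Abelian_group B \<cong> free_Abelian_group {..<card B}" by (simp add: isomorphic_free_Abelian_groups)
  ultimately show ?thesis by (rule iso_trans)
qed

end

lemma iso_cancel_right:
  assumes \<Phi>: "\<Phi> \<in> iso A G" and \<Psi>: "\<Psi> \<in> iso A K" and f: "f \<in> hom G K"
    and eq: "\<And>a. a \<in> carrier A \<Longrightarrow> f (\<Phi> a) = \<Psi> a"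
  shows "f \<in> iso G K"
proof -
  have "bij_betw (f \<circ> \<Phi>) (carrier A) (carrier K)"
    using \<Psi> eq by (subst bij_betw_cong[of _ _ \<Psi>]) (auto simp: iso_def)
  then have "bij_betw f (carrier G) (carrier K)"
    using \<Phi> bij_betw_comp_iff[of \<Phi> "carrier A" "carrier G" f "carrier K"] by (simp add: iso_def)
  then show ?thesis using f by (simp add: iso_def)
qed

lemma loop_basis_homology_iso:
  assumes X: "loop_basis X B N M P x0 l" and Y: "loop_basis Y B N' M' P' (h x0) (\<lambda>i. h \<circ> l i)"
    and h: "continuous_map X Y h"
  shows "hom_induced 1 X {} Y {} h \<in> iso (homology_group 1 X) (homology_group 1 Y)"
proof -
  interpret X: loop_basis X B N M P x0 l by fact
  interpret Y: loop_basis Y B N' M' P' "h x0" "\<lambda>i. h \<circ> l i" by fact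
  show ?thesis
  proof (rule iso_cancel_right[OF X.homology_basis_map_iso Y.homology_basis_map_iso])
    fix n assume "n \<in> carrier (free_Abelian_group B)"
    then have n: "Poly_Mapping.keys n \<subseteq> B" by simp
    have "chain_map 1 h (frag_extend (\<lambda>i. path_chain (l i)) n) = frag_extend (\<lambda>i. path_chain (h \<circ> l i)) n"
      using n
    proof (induction n rule: frag_induction)
      case (one i) show ?case unfolding frag_extend_of by (rule chain_map_path_chain)
    next
      case (diff a b) then show ?case by (simp only: frag_extend_diff chain_map_diff)
    qed simp
    then have "chain_map 1 h (X.loop_sum n) = Y.loop_sum n" unfolding X.loop_sum_def Y.loop_sum_def .
    then show "hom_induced 1 X {} Y {} h (X.homology_basis_map n) = Y.homology_basis_map n"
      unfolding X.homology_basis_map_def Y.homology_basis_map_def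
      using hom_induced_chain_map[OF h, of "{}" "{}" 1 "X.loop_sum n"] X.loop_sum_cycle[OF n] by simp
  qed (rule hom_induced_hom)
qed

section \<open>First cohomology\<close>

lemma (in ring) comm_group_add: "comm_group (add_monoid R)"
  by (rule a_comm_group)

context
  fixes R :: "('r, 'm) ring_scheme" (structure)
  assumes R: "ring R"
begin

interpretation ring R by (rule R)

lemma cochainD:
  assumes "u \<in> carrier (cochains R p X)"
  shows "singular_chain p X c \<Longrightarrow> u c \<in> carrier R"
    and "singular_chain p X c \<Longrightarrow> singular_chain p X d \<Longrightarrow> u (c + d) = u c \<oplus> u d"
    and "\<not> singular_chain p X c \<Longrightarrow> u c = undefined"
  using assms by (auto simp: cochains_def hom_def extensional_def)

lemma cochainI:
  assumes "\<And>c. singular_chain p X c \<Longrightarrow> u c \<in> carrier R"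
    and "\<And>c d. singular_chain p X c \<Longrightarrow> singular_chain p X d \<Longrightarrow> u (c + d) = u c \<oplus> u d"
    and "\<And>c. \<not> singular_chain p X c \<Longrightarrow> u c = undefined"
  shows "u \<in> carrier (cochains R p X)"
  using assms by (auto simp: cochains_def hom_def extensional_def)

lemma cochain_0: "u \<in> carrier (cochains R p X) \<Longrightarrow> u 0 = \<zero>"
  using cochainD(2)[of u p X 0 0] cochainD(1)[of u p X 0] by (simp add: l_neg[symmetric])

lemma cochain_minus:
  assumes "u \<in> carrier (cochains R p X)" "singular_chain p X c"
  shows "u (- c) = \<ominus> u c"
proof -
  have "singular_chain p X (- c)" using assms(2) by (simp add: singular_chain_minus)
  then have "u (- c) \<oplus> u c = \<zero>" "u (- c) \<in> carrier R" "u c \<in> carrier R"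
    using cochainD(2)[OF assms(1), of "- c" c] cochain_0[OF assms(1)] cochainD(1)[OF assms(1)] assms(2) by auto
  then show ?thesis by (simp add: minus_equality)
qed

lemma cochain_diff:
  assumes "u \<in> carrier (cochains R p X)" "singular_chain p X c" "singular_chain p X d"
  shows "u (c - d) = u c \<ominus> u d"
  using cochainD(2)[OF assms(1), of c "- d"] cochain_minus[OF assms(1,3)] assms(2,3)
  by (simp add: singular_chain_minus minus_eq)

lemma cochain_eqI:
  assumes "u \<in> carrier (cochains R p X)" "v \<in> carrier (cochains R p X)"
    and "\<And>c. singular_chain p X c \<Longrightarrow> u c = v c"
  shows "u = v"
proof (rule ext)
  fix c show "u c = v c"
    by (cases "singular_chain p X c") (simp_all add: assms(3) cochainD(3)[OF assms(1)] cochainD(3)[OF assms(2)])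
qed

lemma cochains_zero: "\<zero>\<^bsub>cochains R p X\<^esub> = (\<lambda>c\<in>singular_chain_set p X. \<zero>)"
  and cochains_add: "u \<oplus>\<^bsub>cochains R p X\<^esub> v = (\<lambda>c\<in>singular_chain_set p X. u c \<oplus> v c)"
  and cochains_smult: "a \<odot>\<^bsub>cochains R p X\<^esub> u = (\<lambda>c\<in>singular_chain_set p X. a \<otimes> u c)"
  by (simp_all add: cochains_def)

lemma cochains_closed:
  shows "\<zero>\<^bsub>cochains R p X\<^esub> \<in> carrier (cochains R p X)"
    and "u \<in> carrier (cochains R p X) \<Longrightarrow> v \<in> carrier (cochains R p X) \<Longrightarrow> u \<oplus>\<^bsub>cochains R p X\<^esub> v \<in> carrier (cochains R p X)"
    and "a \<in> carrier R \<Longrightarrow> u \<in> carrier (cochains R p X) \<Longrightarrow> a \<odot>\<^bsub>cochains R p X\<^esub> u \<in> carrier (cochains R p X)"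
  unfolding cochains_zero cochains_add cochains_smult
  by (rule cochainI; simp add: singular_chain_add cochainD a_ac r_distr)+

lemma abelian_group_cochains: "abelian_group (cochains R p X)"
proof (rule abelian_groupI)
  fix u v w assume u: "u \<in> carrier (cochains R p X)" and v: "v \<in> carrier (cochains R p X)" and w: "w \<in> carrier (cochains R p X)"
  show "u \<oplus>\<^bsub>cochains R p X\<^esub> v \<oplus>\<^bsub>cochains R p X\<^esub> w = u \<oplus>\<^bsub>cochains R p X\<^esub> (v \<oplus>\<^bsub>cochains R p X\<^esub> w)"
    by (rule cochain_eqI[of _ p X]) (use u v w cochainD(1)[OF u] cochainD(1)[OF v] cochainD(1)[OF w] in \<open>simp_all add: cochains_closed, simp add: cochains_add a_assoc\<close>)
next
  fix u v assume u: "u \<in> carrier (cochains R p X)" and v: "v \<in> carrier (cochains R p X)"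
  show "u \<oplus>\<^bsub>cochains R p X\<^esub> v \<in> carrier (cochains R p X)" using u v by (rule cochains_closed)
  show "u \<oplus>\<^bsub>cochains R p X\<^esub> v = v \<oplus>\<^bsub>cochains R p X\<^esub> u"
    using cochainD(1)[OF u] cochainD(1)[OF v] unfolding cochains_add by (intro restrict_ext) (simp add: a_comm)
next
  fix u assume u: "u \<in> carrier (cochains R p X)"
  show "\<zero>\<^bsub>cochains R p X\<^esub> \<oplus>\<^bsub>cochains R p X\<^esub> u = u"
    by (rule cochain_eqI[of _ p X]) (use u cochainD(1)[OF u] in \<open>simp_all add: cochains_closed, simp add: cochains_add cochains_zero\<close>)
  let ?v = "\<lambda>c\<in>singular_chain_set p X. \<ominus> u c"
  have "?v \<in> carrier (cochains R p X)"
    by (rule cochainI) (simp_all add: cochainD[OF u] singular_chain_add minus_add)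
  moreover have "?v \<oplus>\<^bsub>cochains R p X\<^esub> u = \<zero>\<^bsub>cochains R p X\<^esub>"
    unfolding cochains_add cochains_zero by (intro restrict_ext) (simp add: cochainD(1)[OF u] l_neg)
  ultimately show "\<exists>y\<in>carrier (cochains R p X). y \<oplus>\<^bsub>cochains R p X\<^esub> u = \<zero>\<^bsub>cochains R p X\<^esub>" by blast
qed (rule cochains_closed)

lemma coboundary_map_closed:
  assumes u: "u \<in> carrier (cochains R p X)"
  shows "coboundary_map p X u \<in> carrier (cochains R (Suc p) X)"
  unfolding coboundary_map_def
  by (rule cochainI) (simp_all add: singular_chain_boundary_alt singular_chain_add chain_boundary_add cochainD[OF u])

lemma coboundary_map_linear:
  shows "coboundary_map p X (u \<oplus>\<^bsub>cochains R p X\<^esub> v) = coboundary_map p X u \<oplus>\<^bsub>cochains R (Suc p) X\<^esub> coboundary_map p X v"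
    and "coboundary_map p X (a \<odot>\<^bsub>cochains R p X\<^esub> u) = a \<odot>\<^bsub>cochains R (Suc p) X\<^esub> coboundary_map p X u"
  unfolding coboundary_map_def cochains_add cochains_smult
  by (intro restrict_ext; simp add: singular_chain_boundary_alt)+

definition cochain_map :: "nat \<Rightarrow> 'a topology \<Rightarrow> ('a \<Rightarrow> 'b) \<Rightarrow> ('b chain \<Rightarrow> 'r) \<Rightarrow> 'a chain \<Rightarrow> 'r" where
  "cochain_map p X h u = (\<lambda>c\<in>singular_chain_set p X. u (chain_map p h c))"

lemma cochain_map_closed:
  assumes h: "continuous_map X Y h" and u: "u \<in> carrier (cochains R p Y)"
  shows "cochain_map p X h u \<in> carrier (cochains R p X)"
  unfolding cochain_map_def
  by (rule cochainI) (simp_all add: singular_chain_chain_map[OF _ h] singular_chain_add chain_map_add cochainD[OF u])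

lemma cochain_map_linear:
  assumes h: "continuous_map X Y h"
  shows "cochain_map p X h (u \<oplus>\<^bsub>cochains R p Y\<^esub> v) = cochain_map p X h u \<oplus>\<^bsub>cochains R p X\<^esub> cochain_map p X h v"
    and "cochain_map p X h (a \<odot>\<^bsub>cochains R p Y\<^esub> u) = a \<odot>\<^bsub>cochains R p X\<^esub> cochain_map p X h u"
  unfolding cochain_map_def cochains_add cochains_smult
  by (intro restrict_ext; simp add: singular_chain_chain_map[OF _ h])+

lemma cochain_map_coboundary:
  assumes h: "continuous_map X Y h"
  shows "cochain_map (Suc p) X h (coboundary_map p Y u) = coboundary_map p X (cochain_map p X h u)"
  unfolding cochain_map_def coboundary_map_def
proof (intro restrict_ext)
  fix c assume "c \<in> singular_chain_set (Suc p) X"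
  then have c: "singular_chain (Suc p) X c" by simp
  have "chain_boundary (Suc p) (chain_map (Suc p) h c) = chain_map p h (chain_boundary (Suc p) c)"
    using chain_boundary_chain_map[OF c, of h] by simp
  then show "(\<lambda>c\<in>singular_chain_set (Suc p) Y. u (chain_boundary (Suc p) c)) (chain_map (Suc p) h c) =
     (\<lambda>c\<in>singular_chain_set p X. u (chain_map p h c)) (chain_boundary (Suc p) c)"
    using singular_chain_chain_map[OF c h] singular_chain_boundary_alt[OF c] by simp
qed

lemma cocycle_carrier: "u \<in> cocycles R p X \<Longrightarrow> u \<in> carrier (cochains R p X)"
  by (simp add: cocycles_def)

lemma cocycle_closed:
  shows "u \<in> cocycles R p X \<Longrightarrow> v \<in> cocycles R p X \<Longrightarrow> u \<oplus>\<^bsub>cochains R p X\<^esub> v \<in> cocycles R p X"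
    and "a \<in> carrier R \<Longrightarrow> u \<in> cocycles R p X \<Longrightarrow> a \<odot>\<^bsub>cochains R p X\<^esub> u \<in> cocycles R p X"
proof -
  have "a \<odot>\<^bsub>cochains R (Suc p) X\<^esub> \<zero>\<^bsub>cochains R (Suc p) X\<^esub> = \<zero>\<^bsub>cochains R (Suc p) X\<^esub>" if "a \<in> carrier R"
    unfolding cochains_smult cochains_zero using that by (intro restrict_ext) simp
  moreover have "\<zero>\<^bsub>cochains R (Suc p) X\<^esub> \<oplus>\<^bsub>cochains R (Suc p) X\<^esub> \<zero>\<^bsub>cochains R (Suc p) X\<^esub> = \<zero>\<^bsub>cochains R (Suc p) X\<^esub>"
    unfolding cochains_add cochains_zero by (intro restrict_ext) simp
  ultimately show "u \<in> cocycles R p X \<Longrightarrow> v \<in> cocycles R p X \<Longrightarrow> u \<oplus>\<^bsub>cochains R p X\<^esub> v \<in> cocycles R p X"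
    and "a \<in> carrier R \<Longrightarrow> u \<in> cocycles R p X \<Longrightarrow> a \<odot>\<^bsub>cochains R p X\<^esub> u \<in> cocycles R p X"
    by (simp_all add: cocycles_def cochains_closed coboundary_map_linear)
qed

lemma cocycle_map:
  assumes h: "continuous_map X Y h" and u: "u \<in> cocycles R p Y"
  shows "cochain_map p X h u \<in> cocycles R p X"
proof -
  have "coboundary_map p X (cochain_map p X h u) = cochain_map (Suc p) X h (\<zero>\<^bsub>cochains R (Suc p) Y\<^esub>)"
    using u cochain_map_coboundary[OF h, of p u] by (simp add: cocycles_def)
  also have "\<dots> = \<zero>\<^bsub>cochains R (Suc p) X\<^esub>"
    unfolding cochain_map_def cochains_zero by (intro restrict_ext) (simp add: singular_chain_chain_map[OF _ h])
  finally show ?thesis using cochain_map_closed[OF h cocycle_carrier[OF u]] by (simp add: cocycles_def)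
qed

lemma abelian_subgroup_coboundaries: "abelian_subgroup (coboundaries R (Suc k) X) (cochains R (Suc k) X)"
proof (rule abelian_subgroupI3[OF _ abelian_group_cochains])
  have "group_hom (add_monoid (cochains R k X)) (add_monoid (cochains R (Suc k) X)) (coboundary_map k X)"
    using abelian_group.a_group[OF abelian_group_cochains]
    by (intro group_hom.intro group_hom_axioms.intro homI)
      (simp_all add: coboundary_map_closed coboundary_map_linear)
  then have "subgroup (coboundary_map k X ` carrier (add_monoid (cochains R k X))) (add_monoid (cochains R (Suc k) X))"
    by (rule group_hom.img_is_subgroup)
  then show "additive_subgroup (coboundaries R (Suc k) X) (cochains R (Suc k) X)"
    by (simp add: additive_subgroup_def coboundaries_def)
qed

lemma coboundary_cochain: "w \<in> coboundaries R (Suc k) X \<Longrightarrow> w \<in> carrier (cochains R (Suc k) X)"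
  by (auto simp: coboundaries_def coboundary_map_closed)

lemma cohomology_class_iff:
  "w \<in> cohomology_class R (Suc k) X u \<longleftrightarrow> (\<exists>v\<in>coboundaries R (Suc k) X. w = v \<oplus>\<^bsub>cochains R (Suc k) X\<^esub> u)"
  by (auto simp: cohomology_class_def a_r_coset_def r_coset_def)

lemma cohomology_class_self:
  "u \<in> carrier (cochains R (Suc k) X) \<Longrightarrow> u \<in> cohomology_class R (Suc k) X u"
  unfolding cohomology_class_def by (rule abelian_subgroup.a_rcos_self[OF abelian_subgroup_coboundaries])

lemma cohomology_class_eqI:
  assumes "u \<in> carrier (cochains R (Suc k) X)" "v \<in> coboundaries R (Suc k) X"
  shows "cohomology_class R (Suc k) X (v \<oplus>\<^bsub>cochains R (Suc k) X\<^esub> u) = cohomology_class R (Suc k) X u"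
proof -
  have "v \<oplus>\<^bsub>cochains R (Suc k) X\<^esub> u \<in> coboundaries R (Suc k) X +>\<^bsub>cochains R (Suc k) X\<^esub> u"
    using assms(2) by (auto simp: a_r_coset_def r_coset_def)
  moreover have "subgroup (coboundaries R (Suc k) X) (add_monoid (cochains R (Suc k) X))"
    using abelian_subgroup_coboundaries[of k X] by (simp add: abelian_subgroup_def additive_subgroup_def)
  ultimately show ?thesis
    unfolding cohomology_class_def
    using abelian_group.a_repr_independence[OF abelian_group_cochains _ assms(1)] by metis
qed

lemma cohomology_add:
  assumes "u \<in> carrier (cochains R (Suc k) X)" "v \<in> carrier (cochains R (Suc k) X)"
  shows "cohomology_class R (Suc k) X u \<oplus>\<^bsub>cohomology R (Suc k) X\<^esub> cohomology_class R (Suc k) X v =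
    cohomology_class R (Suc k) X (u \<oplus>\<^bsub>cochains R (Suc k) X\<^esub> v)"
  using abelian_subgroup.a_rcos_sum[OF abelian_subgroup_coboundaries assms]
  by (simp add: cohomology_def cohomology_class_def)

text \<open>The operations on cohomology are defined as unions over all representatives of a class; such a
  union collapses to a single class.\<close>

lemma cohomology_operation:
  assumes u: "u \<in> carrier (cochains R (Suc k) Y)"
    and lin: "\<And>v. v \<in> coboundaries R (Suc k) Y \<Longrightarrow> T (v \<oplus>\<^bsub>cochains R (Suc k) Y\<^esub> u) = T v \<oplus>\<^bsub>cochains R (Suc k) X\<^esub> T u"
    and cob: "\<And>v. v \<in> coboundaries R (Suc k) Y \<Longrightarrow> T v \<in> coboundaries R (Suc k) X"
    and Tu: "T u \<in> carrier (cochains R (Suc k) X)"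
  shows "(\<Union>w\<in>cohomology_class R (Suc k) Y u. cohomology_class R (Suc k) X (T w)) = cohomology_class R (Suc k) X (T u)"
proof (rule UNION_constant[OF cohomology_class_self[OF u]])
  fix w assume "w \<in> cohomology_class R (Suc k) Y u"
  then obtain v where v: "v \<in> coboundaries R (Suc k) Y" "w = v \<oplus>\<^bsub>cochains R (Suc k) Y\<^esub> u"
    by (auto simp: cohomology_class_iff)
  show "cohomology_class R (Suc k) X (T w) = cohomology_class R (Suc k) X (T u)"
    unfolding v(2) lin[OF v(1)] by (rule cohomology_class_eqI[OF Tu cob[OF v(1)]])
qed

lemma cohomology_smult:
  assumes u: "u \<in> carrier (cochains R (Suc k) X)" and a: "a \<in> carrier R"
  shows "a \<odot>\<^bsub>cohomology R (Suc k) X\<^esub> cohomology_class R (Suc k) X u =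
    cohomology_class R (Suc k) X (a \<odot>\<^bsub>cochains R (Suc k) X\<^esub> u)"
proof -
  have "a \<odot>\<^bsub>cohomology R (Suc k) X\<^esub> cohomology_class R (Suc k) X u =
    (\<Union>w\<in>cohomology_class R (Suc k) X u. cohomology_class R (Suc k) X (a \<odot>\<^bsub>cochains R (Suc k) X\<^esub> w))"
    by (simp add: cohomology_def)
  also have "\<dots> = cohomology_class R (Suc k) X (a \<odot>\<^bsub>cochains R (Suc k) X\<^esub> u)"
  proof (rule cohomology_operation[OF u])
    fix v assume v: "v \<in> coboundaries R (Suc k) X"
    note vc = coboundary_cochain[OF v]
    show "a \<odot>\<^bsub>cochains R (Suc k) X\<^esub> (v \<oplus>\<^bsub>cochains R (Suc k) X\<^esub> u) =
      a \<odot>\<^bsub>cochains R (Suc k) X\<^esub> v \<oplus>\<^bsub>cochains R (Suc k) X\<^esub> (a \<odot>\<^bsub>cochains R (Suc k) X\<^esub> u)"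
      unfolding cochains_add cochains_smult using a cochainD(1)[OF u] cochainD(1)[OF vc]
      by (intro restrict_ext) (simp add: r_distr)
    obtain v' where v': "v' \<in> carrier (cochains R k X)" "v = coboundary_map k X v'"
      using v by (auto simp: coboundaries_def)
    show "a \<odot>\<^bsub>cochains R (Suc k) X\<^esub> v \<in> coboundaries R (Suc k) X"
      using cochains_closed(3)[OF a v'(1)] unfolding v'(2) coboundary_map_linear(2)[symmetric]
      by (simp add: coboundaries_def)
  qed (rule cochains_closed(3)[OF a u])
  finally show ?thesis .
qed

lemma cohomology_map_class:
  assumes h: "continuous_map X Y h" and u: "u \<in> carrier (cochains R (Suc k) Y)"
  shows "cohomology_map R (Suc k) X h (cohomology_class R (Suc k) Y u) = cohomology_class R (Suc k) X (cochain_map (Suc k) X h u)"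
proof -
  have "cohomology_map R (Suc k) X h (cohomology_class R (Suc k) Y u) =
     (\<Union>w\<in>cohomology_class R (Suc k) Y u. cohomology_class R (Suc k) X (cochain_map (Suc k) X h w))"
    by (simp add: cohomology_map_def cochain_map_def)
  also have "\<dots> = cohomology_class R (Suc k) X (cochain_map (Suc k) X h u)"
  proof (rule cohomology_operation[OF u])
    fix v assume v: "v \<in> coboundaries R (Suc k) Y"
    show "cochain_map (Suc k) X h (v \<oplus>\<^bsub>cochains R (Suc k) Y\<^esub> u) =
      cochain_map (Suc k) X h v \<oplus>\<^bsub>cochains R (Suc k) X\<^esub> cochain_map (Suc k) X h u"
      by (rule cochain_map_linear(1)[OF h])
    obtain v' where v': "v' \<in> carrier (cochains R k Y)" "v = coboundary_map k Y v'"
      using v by (auto simp: coboundaries_def)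
    show "cochain_map (Suc k) X h v \<in> coboundaries R (Suc k) X"
      unfolding v'(2) cochain_map_coboundary[OF h] using cochain_map_closed[OF h v'(1)]
      by (simp add: coboundaries_def)
  qed (rule cochain_map_closed[OF h u])
  finally show ?thesis .
qed

lemma cohomology_map_compose:
  assumes h: "continuous_map X Y h" and k: "continuous_map Y Z k" and a: "a \<in> carrier (cohomology R (Suc n) Z)"
  shows "cohomology_map R (Suc n) X (k \<circ> h) a = cohomology_map R (Suc n) X h (cohomology_map R (Suc n) Y k a)"
proof -
  obtain u where u: "u \<in> cocycles R (Suc n) Z" "a = cohomology_class R (Suc n) Z u"
    using a by (auto simp: cohomology_def)
  note uc = cocycle_carrier[OF u(1)]
  have "cochain_map (Suc n) X (k \<circ> h) u = cochain_map (Suc n) X h (cochain_map (Suc n) Y k u)"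
    unfolding cochain_map_def
    by (intro restrict_ext) (simp add: singular_chain_chain_map[OF _ h] chain_map_compose)
  then show ?thesis
    unfolding u(2) cohomology_map_class[OF continuous_map_compose[OF h k] uc] cohomology_map_class[OF k uc]
      cohomology_map_class[OF h cochain_map_closed[OF k uc]] by simp
qed

lemma cocycle_boundary:
  assumes u: "u \<in> cocycles R p X" and d: "singular_chain (Suc p) X d"
  shows "u (chain_boundary (Suc p) d) = \<zero>"
proof -
  have "coboundary_map p X u d = \<zero>\<^bsub>cochains R (Suc p) X\<^esub> d" using u by (simp add: cocycles_def)
  then show ?thesis using d by (simp add: coboundary_map_def cochains_zero)
qed

lemma cocycle_homologous:
  assumes u: "u \<in> cocycles R p X" and "singular_chain p X a" "singular_chain p X b" "homologous_rel p X {} a b"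
  shows "u a = u b"
proof -
  obtain d where d: "singular_chain (Suc p) X d" "chain_boundary (Suc p) d = a - b"
    using assms(4) by (auto simp: homologous_rel_def singular_boundary)
  have "u a \<ominus> u b = \<zero>"
    using cocycle_boundary[OF u d(1)] cochain_diff[OF cocycle_carrier[OF u] assms(2,3)] d(2) by simp
  then show ?thesis
    using cochainD(1)[OF cocycle_carrier[OF u]] assms(2,3) by simp
qed

end

text \<open>The coordinates of \<open>free_module R r\<close> are numbered by \<open>{..<r}\<close>, hence the
  enumeration \<open>\<beta>\<close> of the loops.\<close>

locale loop_basis_enum = loop_basis X B N M P x0 loop + ring R
  for X :: "'a topology" and B :: "'i set" and N M P x0 loop and R :: "('r, 'm) ring_scheme" (structure) +
  fixes \<beta> :: "nat \<Rightarrow> 'i"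
  assumes enum: "bij_betw \<beta> {..<card B} B"
begin

definition evaluate :: "('a chain \<Rightarrow> 'r) \<Rightarrow> nat \<Rightarrow> 'r" where
  "evaluate u = (\<lambda>k\<in>{..<card B}. u (path_chain (loop (\<beta> k))))"

lemma \<beta>: "k < card B \<Longrightarrow> \<beta> k \<in> B"
  using enum by (auto simp: bij_betw_def)

lemma \<beta>_loop: "k < card B \<Longrightarrow> singular_chain 1 X (path_chain (loop (\<beta> k)))"
  using loop_pathin[OF \<beta>] by (rule singular_chain_path_chain)

lemma evaluate_coboundary:
  assumes "v \<in> coboundaries R (Suc 0) X" shows "evaluate v = (\<lambda>k\<in>{..<card B}. \<zero>)"
  unfolding evaluate_def
proof (intro restrict_ext)
  fix k assume "k \<in> {..<card B}"
  then have k: "k < card B" by simp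
  obtain v' where v': "v' \<in> carrier (cochains R 0 X)" "v = coboundary_map 0 X v'"
    using assms by (auto simp: coboundaries_def)
  have "chain_boundary 1 (path_chain (loop (\<beta> k))) = 0"
    using loopsD[OF loop[OF \<beta>[OF k]]] unfolding chain_boundary_path_chain by simp
  then show "v (path_chain (loop (\<beta> k))) = \<zero>"
    using v' cochain_0[OF ring_axioms v'(1)] \<beta>_loop[OF k] by (simp add: coboundary_map_def)
qed

lemma evaluate_add:
  "evaluate (u \<oplus>\<^bsub>cochains R (Suc 0) X\<^esub> v) = (\<lambda>k\<in>{..<card B}. evaluate u k \<oplus> evaluate v k)"
  unfolding evaluate_def cochains_add[OF ring_axioms] using \<beta>_loop by (intro restrict_ext) simp

lemma evaluate_smult:
  "evaluate (a \<odot>\<^bsub>cochains R (Suc 0) X\<^esub> u) = (\<lambda>k\<in>{..<card B}. a \<otimes> evaluate u k)"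
  unfolding evaluate_def cochains_smult[OF ring_axioms] using \<beta>_loop by (intro restrict_ext) simp

lemma evaluate_closed: "u \<in> carrier (cochains R (Suc 0) X) \<Longrightarrow> evaluate u \<in> {..<card B} \<rightarrow>\<^sub>E carrier R"
  unfolding evaluate_def using cochainD(1)[OF ring_axioms, of u "Suc 0" X] \<beta>_loop by auto

text \<open>The holonomy with labels in the additive group of the ring is a cocycle with the required
  values.\<close>

lemma evaluate_surj:
  assumes a: "a \<in> {..<card B} \<rightarrow>\<^sub>E carrier R"
  obtains u where "u \<in> cocycles R (Suc 0) X" "evaluate u = a"
proof -
  let ?\<beta>' = "the_inv_into {..<card B} \<beta>"
  have inj: "inj_on \<beta> {..<card B}" using enum by (simp add: bij_betw_def)
  have \<beta>': "?\<beta>' i \<in> {..<card B}" if "i \<in> B" for i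
    using the_inv_into_into[OF inj, of i] enum that by (auto simp: bij_betw_def)
  obtain U where U: "U \<in> hom (chain_group 1 X) (add_monoid R)"
    "\<And>d. singular_chain 2 X d \<Longrightarrow> U (chain_boundary 2 d) = \<one>\<^bsub>add_monoid R\<^esub>"
    "\<And>i. i \<in> B \<Longrightarrow> U (path_chain (loop i)) = a (?\<beta>' i)"
  proof (rule dual_cochain[OF comm_group_add, of "\<lambda>i. a (?\<beta>' i)"])
    show "a (?\<beta>' i) \<in> carrier (add_monoid R)" if "i \<in> B" for i
      using PiE_mem[OF a \<beta>'[OF that]] by simp
  qed (rule that)
  let ?u = "restrict U (singular_chain_set (Suc 0) X)"
  have u: "?u \<in> carrier (cochains R (Suc 0) X)"
    by (rule cochainI[OF ring_axioms]) (use U(1) in \<open>auto simp: hom_def singular_chain_add\<close>)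
  have "coboundary_map (Suc 0) X ?u = \<zero>\<^bsub>cochains R (Suc (Suc 0)) X\<^esub>"
    unfolding coboundary_map_def cochains_zero[OF ring_axioms]
    by (intro restrict_ext) (use U(2) in \<open>simp add: singular_chain_boundary_alt numeral_2_eq_2\<close>)
  then have "?u \<in> cocycles R (Suc 0) X" using u by (simp add: cocycles_def)
  moreover have "evaluate ?u = a"
  proof (rule ext)
    fix k show "evaluate ?u k = a k"
      using U(3)[OF \<beta>] \<beta>_loop[of k] the_inv_into_f_f[OF inj, of k] PiE_arb[OF a, of k]
      by (cases "k < card B") (simp_all add: evaluate_def)
  qed
  ultimately show thesis by (rule that)
qed

lemma cocycle_loop_sum:
  assumes u: "u \<in> cocycles R (Suc 0) X" and 0: "evaluate u = (\<lambda>k\<in>{..<card B}. \<zero>)" and n: "Poly_Mapping.keys n \<subseteq> B"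
  shows "singular_chain (Suc 0) X (loop_sum n) \<and> u (loop_sum n) = \<zero>"
  using n
proof (induction n rule: frag_induction)
  case zero
  show ?case using cochain_0[OF ring_axioms cocycle_carrier[OF ring_axioms u]] by (simp add: loop_sum_def)
next
  case (one i)
  then obtain k where k: "k < card B" "i = \<beta> k" using enum by (auto simp: bij_betw_def)
  then show ?case using fun_cong[OF 0, of k] \<beta>_loop[OF k(1)] by (simp add: loop_sum_def evaluate_def)
next
  case (diff a b)
  then show ?case using cochain_diff[OF ring_axioms cocycle_carrier[OF ring_axioms u], of "loop_sum a" "loop_sum b"]
    by (simp add: loop_sum_def frag_extend_diff singular_chain_diff minus_eq)
qed

text \<open>A cocycle that vanishes on the basic loops vanishes on all loops, so integrating it along paths
  from the base point gives a function of which it is the coboundary.\<close>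

lemma evaluate_kernel:
  assumes u: "u \<in> cocycles R (Suc 0) X" and 0: "evaluate u = (\<lambda>k\<in>{..<card B}. \<zero>)"
  shows "u \<in> coboundaries R (Suc 0) X"
proof -
  note uc = cocycle_carrier[OF ring_axioms u]
  obtain \<tau> where \<tau>: "path_system X x0 \<tau>" using path_system_exists by blast
  have tc: "singular_chain (Suc 0) X (transfer_chain \<tau> c)" if "singular_chain 0 X c" for c
    using that unfolding singular_chain_def[of 0]
  proof (induction c rule: frag_induction)
    case (one v)
    then have "continuous_map (subtopology (powertop_real UNIV) (standard_simplex 0)) X v" by (simp add: singular_simplex_def)
    then have "v (\<lambda>j. if j = 0 then 1 else 0) \<in> topspace X"
      using basis_in_standard_simplex[of 0 0] by (auto simp: continuous_map_def)
    then have "singular_chain 1 X (path_chain (\<tau> (v (\<lambda>j. if j = 0 then 1 else 0))))"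
      using \<tau> by (intro singular_chain_path_chain) (simp add: path_system_def)
    then show ?case by (simp add: transfer_chain_def)
  next
    case (diff a b)
    then show ?case unfolding transfer_chain_def frag_extend_diff by (rule singular_chain_diff)
  qed (simp add: transfer_chain_def)
  let ?v = "\<lambda>c\<in>singular_chain_set 0 X. u (transfer_chain \<tau> c)"
  have add: "transfer_chain \<tau> (c + d) = transfer_chain \<tau> c + transfer_chain \<tau> d" for c d
    by (simp add: transfer_chain_def frag_extend_add)
  have v: "?v \<in> carrier (cochains R 0 X)"
    by (rule cochainI[OF ring_axioms]) (simp_all add: tc cochainD[OF ring_axioms uc] singular_chain_add add)
  have eq: "coboundary_map 0 X ?v = u"
  proof (rule cochain_eqI[OF ring_axioms coboundary_map_closed[OF ring_axioms v] uc])
    fix c assume c: "singular_chain (Suc 0) X c"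
    let ?t = "transfer_chain \<tau> (chain_boundary (Suc 0) c)"
    have t: "singular_chain (Suc 0) X ?t" using c by (intro tc singular_chain_boundary_alt)
    obtain n where n: "Poly_Mapping.keys n \<subseteq> B" "homologous_rel (Suc 0) X {} (c - ?t) (loop_sum n)"
      using chain_homologous_loop_sum[OF \<tau>, of c] c by auto
    note s = cocycle_loop_sum[OF u 0 n(1)]
    have "u (c - ?t) = \<zero>"
      using cocycle_homologous[OF ring_axioms u singular_chain_diff[OF c t] conjunct1[OF s] n(2)] s by simp
    then have "u c = u ?t"
      using cochain_diff[OF ring_axioms uc c t] cochainD(1)[OF ring_axioms uc] c t by simp
    then show "coboundary_map 0 X ?v c = u c"
      using c by (simp add: coboundary_map_def singular_chain_boundary_alt)
  qed
  have "u \<in> coboundary_map 0 X ` carrier (cochains R 0 X)" by (rule image_eqI[where f = "coboundary_map 0 X" and x = ?v]) (rule eq[symmetric], rule v)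
  then show ?thesis by (simp add: coboundaries_def)
qed

text \<open>Coboundaries vanish on loops, so the choice of the representative does not matter.\<close>

definition class_value :: "('a chain \<Rightarrow> 'r) set \<Rightarrow> nat \<Rightarrow> 'r" where
  "class_value a = evaluate (SOME u. u \<in> a)"

lemma class_value_class:
  assumes u: "u \<in> carrier (cochains R (Suc 0) X)"
  shows "class_value (cohomology_class R (Suc 0) X u) = evaluate u"
proof -
  let ?w = "SOME w. w \<in> cohomology_class R (Suc 0) X u"
  have "?w \<in> cohomology_class R (Suc 0) X u"
    by (rule someI[where P = "\<lambda>w. w \<in> cohomology_class R (Suc 0) X u", OF cohomology_class_self[OF ring_axioms u]])
  then obtain v where v: "v \<in> coboundaries R (Suc 0) X" "?w = v \<oplus>\<^bsub>cochains R (Suc 0) X\<^esub> u"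
    by (auto simp: cohomology_class_iff[OF ring_axioms])
  have "evaluate ?w = (\<lambda>k\<in>{..<card B}. \<zero> \<oplus> evaluate u k)"
    unfolding v(2) evaluate_add using evaluate_coboundary[OF v(1)] by (intro restrict_ext) simp
  also have "\<dots> = evaluate u"
    using evaluate_closed[OF u] by (auto simp: PiE_iff extensional_def fun_eq_iff)
  finally show ?thesis by (simp add: class_value_def)
qed

lemma class_value_inj:
  assumes u: "u \<in> cocycles R (Suc 0) X" and v: "v \<in> cocycles R (Suc 0) X" and eq: "evaluate u = evaluate v"
  shows "cohomology_class R (Suc 0) X u = cohomology_class R (Suc 0) X v"
proof -
  note uc = cocycle_carrier[OF ring_axioms u] and vc = cocycle_carrier[OF ring_axioms v]
  let ?n = "(\<ominus> \<one>) \<odot>\<^bsub>cochains R (Suc 0) X\<^esub> v"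
  let ?w = "u \<oplus>\<^bsub>cochains R (Suc 0) X\<^esub> ?n"
  have w: "?w \<in> cocycles R (Suc 0) X"
    using u v by (intro cocycle_closed[OF ring_axioms]) auto
  have "evaluate ?w = (\<lambda>k\<in>{..<card B}. \<zero>)"
    unfolding evaluate_add evaluate_smult eq
  proof (intro restrict_ext)
    fix k assume k: "k \<in> {..<card B}"
    have "evaluate v k \<in> carrier R" by (rule PiE_mem[OF evaluate_closed[OF vc] k])
    then show "evaluate v k \<oplus> (\<lambda>k\<in>{..<card B}. \<ominus> \<one> \<otimes> evaluate v k) k = \<zero>"
      using k by (simp add: l_minus r_neg)
  qed
  then have wb: "?w \<in> coboundaries R (Suc 0) X" by (rule evaluate_kernel[OF w])
  have "?w \<oplus>\<^bsub>cochains R (Suc 0) X\<^esub> v = u"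
  proof (rule cochain_eqI[OF ring_axioms _ uc])
    show "?w \<oplus>\<^bsub>cochains R (Suc 0) X\<^esub> v \<in> carrier (cochains R (Suc 0) X)"
      using cocycle_carrier[OF ring_axioms w] vc by (rule cochains_closed(2)[OF ring_axioms])
    fix c assume c: "singular_chain (Suc 0) X c"
    have "u c \<in> carrier R" "v c \<in> carrier R" using cochainD(1)[OF ring_axioms] uc vc c by auto
    then show "(?w \<oplus>\<^bsub>cochains R (Suc 0) X\<^esub> v) c = u c"
      using c by (simp add: cochains_add[OF ring_axioms] cochains_smult[OF ring_axioms] a_assoc l_minus l_neg)
  qed
  then show ?thesis using cohomology_class_eqI[OF ring_axioms vc wb] by simp
qed

lemma carrier_cohomology: "carrier (cohomology R (Suc 0) X) = cohomology_class R (Suc 0) X ` cocycles R (Suc 0) X"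
  by (simp add: cohomology_def)

lemma cohomology_class_cases:
  assumes "a \<in> carrier (cohomology R (Suc 0) X)"
  obtains u where "u \<in> cocycles R (Suc 0) X" "u \<in> carrier (cochains R (Suc 0) X)" "a = cohomology_class R (Suc 0) X u"
  using assms cocycle_carrier[OF ring_axioms] unfolding carrier_cohomology by blast

lemma class_value_bij: "bij_betw class_value (carrier (cohomology R (Suc 0) X)) ({..<card B} \<rightarrow>\<^sub>E carrier R)"
proof (rule bij_betw_imageI)
  show "inj_on class_value (carrier (cohomology R (Suc 0) X))"
  proof (rule inj_onI)
    fix a b assume "a \<in> carrier (cohomology R (Suc 0) X)" "b \<in> carrier (cohomology R (Suc 0) X)" and eq: "class_value a = class_value b"
    then obtain u v where u: "u \<in> cocycles R (Suc 0) X" "u \<in> carrier (cochains R (Suc 0) X)" "a = cohomology_class R (Suc 0) X u"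
      and v: "v \<in> cocycles R (Suc 0) X" "v \<in> carrier (cochains R (Suc 0) X)" "b = cohomology_class R (Suc 0) X v"
      by (elim cohomology_class_cases)
    have "evaluate u = evaluate v"
      using eq unfolding u(3) v(3) class_value_class[OF u(2)] class_value_class[OF v(2)] .
    then show "a = b" unfolding u(3) v(3) by (rule class_value_inj[OF u(1) v(1)])
  qed
  show "class_value ` carrier (cohomology R (Suc 0) X) = ({..<card B} \<rightarrow>\<^sub>E carrier R)"
  proof (intro subset_antisym subsetI)
    fix y assume "y \<in> class_value ` carrier (cohomology R (Suc 0) X)"
    then obtain a where a: "a \<in> carrier (cohomology R (Suc 0) X)" "y = class_value a" by auto
    obtain u where u: "u \<in> cocycles R (Suc 0) X" "u \<in> carrier (cochains R (Suc 0) X)" "a = cohomology_class R (Suc 0) X u"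
      using a(1) by (rule cohomology_class_cases)
    show "y \<in> {..<card B} \<rightarrow>\<^sub>E carrier R"
      unfolding a(2) u(3) class_value_class[OF u(2)] by (rule evaluate_closed[OF u(2)])
  next
    fix y assume "y \<in> {..<card B} \<rightarrow>\<^sub>E carrier R"
    then obtain u where u: "u \<in> cocycles R (Suc 0) X" "evaluate u = y" by (rule evaluate_surj)
    then show "y \<in> class_value ` carrier (cohomology R (Suc 0) X)"
      using class_value_class[OF cocycle_carrier[OF ring_axioms u(1)]] unfolding carrier_cohomology
      by (intro image_eqI[where x = "cohomology_class R (Suc 0) X u"]) simp_all
  qed
qed

lemma class_value_add:
  assumes "a \<in> carrier (cohomology R (Suc 0) X)" "b \<in> carrier (cohomology R (Suc 0) X)"
  shows "a \<oplus>\<^bsub>cohomology R (Suc 0) X\<^esub> b \<in> carrier (cohomology R (Suc 0) X)"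
    "class_value (a \<oplus>\<^bsub>cohomology R (Suc 0) X\<^esub> b) = (\<lambda>k\<in>{..<card B}. class_value a k \<oplus> class_value b k)"
proof -
  obtain u where u: "u \<in> cocycles R (Suc 0) X" "u \<in> carrier (cochains R (Suc 0) X)" "a = cohomology_class R (Suc 0) X u"
    using assms(1) by (rule cohomology_class_cases)
  obtain v where v: "v \<in> cocycles R (Suc 0) X" "v \<in> carrier (cochains R (Suc 0) X)" "b = cohomology_class R (Suc 0) X v"
    using assms(2) by (rule cohomology_class_cases)
  have s: "a \<oplus>\<^bsub>cohomology R (Suc 0) X\<^esub> b = cohomology_class R (Suc 0) X (u \<oplus>\<^bsub>cochains R (Suc 0) X\<^esub> v)"
    unfolding u(3) v(3) by (rule cohomology_add[OF ring_axioms u(2) v(2)])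
  show "a \<oplus>\<^bsub>cohomology R (Suc 0) X\<^esub> b \<in> carrier (cohomology R (Suc 0) X)"
    unfolding s carrier_cohomology by (intro imageI cocycle_closed(1)[OF ring_axioms] u v)
  show "class_value (a \<oplus>\<^bsub>cohomology R (Suc 0) X\<^esub> b) = (\<lambda>k\<in>{..<card B}. class_value a k \<oplus> class_value b k)"
  proof -
    have 1: "class_value a = evaluate u" "class_value b = evaluate v"
      unfolding u(3) v(3) by (rule class_value_class[OF u(2)], rule class_value_class[OF v(2)])
    show ?thesis
      unfolding s 1 class_value_class[OF cochains_closed(2)[OF ring_axioms u(2) v(2)]] by (rule evaluate_add)
  qed
qed

lemma class_value_smult:
  assumes "a \<in> carrier (cohomology R (Suc 0) X)" "c \<in> carrier R"
  shows "c \<odot>\<^bsub>cohomology R (Suc 0) X\<^esub> a \<in> carrier (cohomology R (Suc 0) X)"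
    "class_value (c \<odot>\<^bsub>cohomology R (Suc 0) X\<^esub> a) = (\<lambda>k\<in>{..<card B}. c \<otimes> class_value a k)"
proof -
  obtain u where u: "u \<in> cocycles R (Suc 0) X" "u \<in> carrier (cochains R (Suc 0) X)" "a = cohomology_class R (Suc 0) X u"
    using assms(1) by (rule cohomology_class_cases)
  have s: "c \<odot>\<^bsub>cohomology R (Suc 0) X\<^esub> a = cohomology_class R (Suc 0) X (c \<odot>\<^bsub>cochains R (Suc 0) X\<^esub> u)"
    unfolding u(3) by (rule cohomology_smult[OF ring_axioms u(2) assms(2)])
  show "c \<odot>\<^bsub>cohomology R (Suc 0) X\<^esub> a \<in> carrier (cohomology R (Suc 0) X)"
    unfolding s carrier_cohomology by (intro imageI cocycle_closed(2)[OF ring_axioms] u assms)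
  show "class_value (c \<odot>\<^bsub>cohomology R (Suc 0) X\<^esub> a) = (\<lambda>k\<in>{..<card B}. c \<otimes> class_value a k)"
  proof -
    have 1: "class_value a = evaluate u" unfolding u(3) by (rule class_value_class[OF u(2)])
    show ?thesis
      unfolding s 1 class_value_class[OF cochains_closed(3)[OF ring_axioms assms(2) u(2)]] by (rule evaluate_smult)
  qed
qed

theorem cohomology_free: "class_value \<in> module_iso R (cohomology R (Suc 0) X) (free_module R (card B))"
  unfolding module_iso_def iso_def hom_def
  using class_value_bij class_value_add(2) class_value_smult(2) bij_betw_imp_funcset[OF class_value_bij]
  by (auto simp: free_module_def)

end

text \<open>The value of the pulled back cocycle on \<open>l i\<close> is the value of the cocycle on \<open>h
  \<circ> l i\<close>, so in the coordinates given by the loops the induced map is the identity of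
  \<open>R\<^sup>r\<close>.\<close>

theorem loop_basis_cohomology_iso:
  assumes X: "loop_basis X B N M P x0 l" and Y: "loop_basis Y B N' M' P' (h x0) (\<lambda>i. h \<circ> l i)"
    and h: "continuous_map X Y h" and R: "ring R"
  shows "module_iso R (cohomology R (Suc 0) X) (free_module R (card B)) \<noteq> {}"
    and "module_iso R (cohomology R (Suc 0) Y) (free_module R (card B)) \<noteq> {}"
    and "cohomology_map R (Suc 0) X h \<in> module_iso R (cohomology R (Suc 0) Y) (cohomology R (Suc 0) X)"
proof -
  have fin: "finite B" using X by (simp add: loop_basis_def wall_system_def)
  obtain \<beta> where \<beta>: "bij_betw \<beta> {..<card B} B"
    using bij_betw_from_nat_into_finite[OF fin] by blast
  interpret X: loop_basis_enum X B N M P x0 l R \<beta>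
    using X R \<beta> by (simp add: loop_basis_enum_def loop_basis_enum_axioms_def)
  interpret Y: loop_basis_enum Y B N' M' P' "h x0" "\<lambda>i. h \<circ> l i" R \<beta>
    using Y R \<beta> by (simp add: loop_basis_enum_def loop_basis_enum_axioms_def)
  show "module_iso R (cohomology R (Suc 0) X) (free_module R (card B)) \<noteq> {}"
    "module_iso R (cohomology R (Suc 0) Y) (free_module R (card B)) \<noteq> {}"
    using X.cohomology_free Y.cohomology_free by blast+
  let ?f = "cohomology_map R (Suc 0) X h"
  let ?HX = "cohomology R (Suc 0) X" let ?HY = "cohomology R (Suc 0) Y"
  have f: "?f a \<in> carrier ?HX" "X.class_value (?f a) = Y.class_value a" if a: "a \<in> carrier ?HY" for a
  proof -
    obtain u where u: "u \<in> cocycles R (Suc 0) Y" "u \<in> carrier (cochains R (Suc 0) Y)" "a = cohomology_class R (Suc 0) Y u"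
      using a by (rule Y.cohomology_class_cases)
    have fa: "?f a = cohomology_class R (Suc 0) X (cochain_map (Suc 0) X h u)"
      unfolding u(3) by (rule cohomology_map_class[OF R h u(2)])
    show "?f a \<in> carrier ?HX"
      unfolding fa X.carrier_cohomology by (intro imageI cocycle_map[OF R h u(1)])
    have "X.evaluate (cochain_map (Suc 0) X h u) = Y.evaluate u"
      unfolding X.evaluate_def Y.evaluate_def cochain_map_def[OF R]
      using X.\<beta>_loop chain_map_path_chain[of h] by (intro restrict_ext) simp
    moreover have "X.class_value (?f a) = X.evaluate (cochain_map (Suc 0) X h u)"
      unfolding fa by (rule X.class_value_class[OF cochain_map_closed[OF R h u(2)]])
    moreover have "Y.class_value a = Y.evaluate u" unfolding u(3) by (rule Y.class_value_class[OF u(2)])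
    ultimately show "X.class_value (?f a) = Y.class_value a" by simp
  qed
  have inj: "a = b" if "a \<in> carrier ?HX" "b \<in> carrier ?HX" "X.class_value a = X.class_value b" for a b
    using bij_betw_imp_inj_on[OF X.class_value_bij] that by (auto dest: inj_onD)
  have "bij_betw (X.class_value \<circ> ?f) (carrier ?HY) ({..<card B} \<rightarrow>\<^sub>E carrier R)"
    using Y.class_value_bij f(2) by (subst bij_betw_cong[of _ _ Y.class_value]) auto
  then have "bij_betw ?f (carrier ?HY) (carrier ?HX)"
    using bij_betw_comp_iff2[OF X.class_value_bij, of ?f "carrier ?HY"] f(1) by auto
  moreover have "?f (a \<oplus>\<^bsub>?HY\<^esub> b) = ?f a \<oplus>\<^bsub>?HX\<^esub> ?f b" if "a \<in> carrier ?HY" "b \<in> carrier ?HY" for a b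
    using that f X.class_value_add Y.class_value_add by (intro inj) simp_all
  moreover have "?f (c \<odot>\<^bsub>?HY\<^esub> a) = c \<odot>\<^bsub>?HX\<^esub> ?f a" if "a \<in> carrier ?HY" "c \<in> carrier R" for a c
    using that f X.class_value_smult Y.class_value_smult by (intro inj) simp_all
  ultimately show "?f \<in> module_iso R ?HY ?HX"
    using f(1) by (simp add: module_iso_def iso_def hom_def)
qed

section \<open>Finite embedded graphs\<close>

definition subpath_in :: "(real \<Rightarrow> 'a) \<Rightarrow> real \<Rightarrow> real \<Rightarrow> real \<Rightarrow> 'a" where
  "subpath_in q s t = q \<circ> (\<lambda>u. s + (t - s) * u)"

lemma convex_combination_in_unit:
  fixes s t u :: real
  assumes "s \<in> {0..1}" "t \<in> {0..1}" "u \<in> {0..1}" shows "s + (t - s) * u \<in> {0..1}"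
proof -
  have "s + (t - s) * u = (1 - u) * s + u * t" by (simp add: algebra_simps)
  moreover have "0 \<le> (1 - u) * s + u * t" using assms by simp
  moreover have "(1 - u) * s + u * t \<le> (1 - u) * 1 + u * 1"
    using assms by (intro add_mono mult_left_mono) auto
  ultimately show ?thesis by simp
qed

lemma pathin_subpath_in:
  assumes "pathin X q" "s \<in> {0..1}" "t \<in> {0..1}" shows "pathin X (subpath_in q s t)"
  unfolding subpath_in_def
  by (rule pathin_compose_map[OF assms(1)[unfolded pathin_def]])
    (use convex_combination_in_unit[OF assms(2,3)] in \<open>auto simp del: atLeastAtMost_iff intro!: continuous_intros\<close>)

lemma subpath_in_ends [simp]: "subpath_in q s t 0 = q s" "subpath_in q s t 1 = q t"
  by (simp_all add: subpath_in_def)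

lemma subpath_in_full: "subpath_in q 0 1 = q"
  by (simp add: subpath_in_def o_def)

lemma subpath_in_const: "subpath_in q s s = (\<lambda>_. q s)"
  by (simp add: subpath_in_def o_def)

lemma reverse_subpath_in: "reverse_path (subpath_in q s t) = subpath_in q t s"
  by (simp add: reverse_path_def[abs_def] subpath_in_def o_def algebra_simps)

lemma path_homotopic_subpath_join:
  assumes q: "pathin X q" and s: "s \<in> {0..1}" "t \<in> {0..1}" "r \<in> {0..1}"
  shows "path_homotopic X (join_loops (subpath_in q s t) (subpath_in q t r)) (subpath_in q s r)"
proof -
  let ?a = "join_loops (\<lambda>u. s + (t - s) * u) (\<lambda>u. t + (r - t) * u)"
  have i: "(\<lambda>u. s + (t - s) * u) ` {0..1} \<subseteq> {0..1}" if "s \<in> {0..1}" "t \<in> {0..1}" for s t :: real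
    using convex_combination_in_unit[OF that] by (auto simp del: atLeastAtMost_iff)
  have p: "pathin (top_of_set {0..1}) (\<lambda>u. s + (t - s) * u)" if "s \<in> {0..1}" "t \<in> {0..1}" for s t :: real
    using i[OF that] by (auto simp: pathin_def intro!: continuous_intros)
  have "pathin (top_of_set {0..1}) ?a" using p s by (intro pathin_join_loops) auto
  then have a: "continuous_on {0..1} ?a" by (simp add: pathin_def)
  have "path_homotopic X (q \<circ> ?a) (q \<circ> (\<lambda>u. s + (r - s) * u))"
  proof (rule path_homotopic_reparametrize[OF q a])
    show "?a ` {0..1} \<subseteq> {0..1}"
      using join_loops_image i[OF s(1,2)] i[OF s(2,3)] by (rule order_trans[OF _ Un_least])
    show "(\<lambda>u. s + (r - s) * u) ` {0..1} \<subseteq> {0..1}" by (rule i[OF s(1,3)])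
  qed (auto intro!: continuous_intros)
  then show ?thesis unfolding subpath_in_def join_loops_compose .
qed

text \<open>As \<open>Z\<close> is a Hausdorff space and the edges are compact, edges are embedded closed
  arcs, and the topology is the one of a CW-complex.\<close>

locale finite_graph =
  fixes Z :: "'a topology" and V :: "'a set" and E :: "(real \<Rightarrow> 'a) set"
  assumes Hausdorff: "Hausdorff_space Z"
    and finite_V: "finite V" and V_subset: "V \<subseteq> topspace Z" and finite_E: "finite E"
    and edge: "\<And>e. e \<in> E \<Longrightarrow> pathin Z e" "\<And>e. e \<in> E \<Longrightarrow> inj_on e {0..1}"
      "\<And>e. e \<in> E \<Longrightarrow> e 0 \<in> V" "\<And>e. e \<in> E \<Longrightarrow> e 1 \<in> V" "\<And>e. e \<in> E \<Longrightarrow> e ` {0<..<1} \<inter> V = {}"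
    and edges_disjoint: "\<And>e e'. e \<in> E \<Longrightarrow> e' \<in> E \<Longrightarrow> e \<noteq> e' \<Longrightarrow> e ` {0<..<1} \<inter> e' ` {0<..<1} = {}"
    and cover: "topspace Z = V \<union> (\<Union>e\<in>E. e ` {0..1})"
begin

lemma edge_in: "e \<in> E \<Longrightarrow> t \<in> {0..1} \<Longrightarrow> e t \<in> topspace Z"
  using cover by blast

lemma edge_vertex:
  assumes "e \<in> E" "t \<in> {0..1}" "e t \<in> V" shows "t = 0 \<or> t = 1"
proof (rule ccontr)
  assume "\<not> ?thesis"
  then have "e t \<in> e ` {0<..<1}" using assms(2) by (intro imageI) auto
  then show False using edge(5)[OF assms(1)] assms(3) by blast
qed

lemma edge_ends_distinct: "e \<in> E \<Longrightarrow> e 0 \<noteq> e 1"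
  using inj_onD[OF edge(2), of e 0 1] by auto

lemma edge_eq:
  assumes "e \<in> E" "e' \<in> E" "s \<in> {0..1}" "t \<in> {0..1}" "e s = e' t" "e s \<notin> V"
  shows "e = e' \<and> s = t"
proof -
  have "s \<in> {0<..<1}" "t \<in> {0<..<1}"
    using assms edge(3,4)[OF assms(1)] edge(3,4)[OF assms(2)] by (cases "s = 0"; cases "s = 1"; cases "t = 0"; cases "t = 1"; auto)+
  then have "e s \<in> e ` {0<..<1}" and "e' t \<in> e' ` {0<..<1}" by (auto simp del: greaterThanLessThan_iff)
  then have "e s \<in> e ` {0<..<1} \<inter> e' ` {0<..<1}" unfolding assms(5) by (rule IntI)
  then have "e = e'" using edges_disjoint[OF assms(1,2)] by blast
  then show ?thesis using inj_onD[OF edge(2)[OF assms(1)], of s t] assms by auto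
qed

lemma edge_compact: "e \<in> E \<Longrightarrow> closedin Z (e ` {0..1})"
  by (intro compactin_imp_closedin[OF Hausdorff] compactin_path_image edge)

lemma V_closed: "W \<subseteq> V \<Longrightarrow> closedin Z W"
  using Hausdorff_imp_t1_space[OF Hausdorff] finite_subset[OF _ finite_V] V_subset
  by (auto simp: t1_space_closedin_finite)

text \<open>An injective continuous map from a compact space to a Hausdorff space is an embedding.\<close>

lemma edge_coordinate:
  assumes "e \<in> E"
  obtains c where "continuous_map (subtopology Z (e ` {0..1})) (top_of_set {0..1}) c" "\<And>t. t \<in> {0..1} \<Longrightarrow> c (e t) = t"
proof -
  have c: "continuous_map (top_of_set {0..1}) Z e" using edge(1)[OF assms] by (simp add: pathin_def)
  have "closed_map (top_of_set {0..1}) Z e"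
    by (rule continuous_imp_closed_map[OF c _ Hausdorff]) (simp add: compact_space_subtopology)
  then have "embedding_map (top_of_set {0..1}) Z e"
    using c edge(2)[OF assms] by (intro injective_closed_imp_embedding_map) auto
  then obtain g where "homeomorphic_maps (top_of_set {0..1}) (subtopology Z (e ` {0..1})) e g"
    by (auto simp: embedding_map_def homeomorphic_map_maps)
  then show thesis using that[of g] by (auto simp: homeomorphic_maps_def)
qed

subsection \<open>Stars\<close>

text \<open>The open star of \<open>v\<close>, written as a complement so that it is visibly open.\<close>

definition star :: "'a \<Rightarrow> 'a set" where
  "star v = topspace Z - ((V - {v}) \<union> (\<Union>e\<in>{e\<in>E. v \<noteq> e 0 \<and> v \<noteq> e 1}. e ` {0..1}))"

lemma openin_star: "openin Z (star v)"
proof -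
  have "closedin Z ((V - {v}) \<union> (\<Union>e\<in>{e\<in>E. v \<noteq> e 0 \<and> v \<noteq> e 1}. e ` {0..1}))"
  proof (rule closedin_Un)
    show "closedin Z (V - {v})" by (rule V_closed) auto
    show "closedin Z (\<Union>e\<in>{e\<in>E. v \<noteq> e 0 \<and> v \<noteq> e 1}. e ` {0..1})"
      using finite_E edge_compact by (intro closedin_Union) auto
  qed
  then show ?thesis unfolding star_def by (intro openin_diff) auto
qed

lemma vertex_in_star: "v \<in> V \<Longrightarrow> v \<in> star v"
proof -
  assume v: "v \<in> V"
  have "v \<noteq> e t" if "e \<in> E" "v \<noteq> e 0" "v \<noteq> e 1" "t \<in> {0..1}" for e t
    using edge_vertex[OF that(1,4)] v that by auto
  then show ?thesis unfolding star_def using v V_subset by blast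
qed

lemma star_cases:
  assumes "x \<in> star v"
  obtains "x = v" | e t where "e \<in> E" "t \<in> {0..1}" "x = e t" "v = e 0 \<or> v = e 1"
proof -
  have "x \<in> V \<union> (\<Union>e\<in>E. e ` {0..1})" "x \<notin> V - {v}" "\<And>e. e \<in> E \<Longrightarrow> v \<noteq> e 0 \<Longrightarrow> v \<noteq> e 1 \<Longrightarrow> x \<notin> e ` {0..1}"
    using assms cover by (auto simp: star_def)
  then show thesis using that by blast
qed

lemma in_some_star: "x \<in> topspace Z \<Longrightarrow> \<exists>v\<in>V. x \<in> star v"
proof -
  assume x: "x \<in> topspace Z"
  show ?thesis
  proof (cases "x \<in> V")
    case True then show ?thesis using vertex_in_star by blast
  next
    case False
    then obtain e t where e: "e \<in> E" "t \<in> {0..1}" "x = e t" using x cover by auto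
    have "x \<notin> e' ` {0..1}" if "e' \<in> E" "e 0 \<noteq> e' 0" for e'
    proof
      assume "x \<in> e' ` {0..1}"
      then obtain s where "s \<in> {0..1}" "x = e' s" by auto
      then have "e = e'" using edge_eq[OF e(1) that(1) e(2), of s] e(3) False by simp
      then show False using that(2) by simp
    qed
    then have "x \<in> star (e 0)" using x False by (auto simp: star_def)
    then show ?thesis using edge(3)[OF e(1)] by blast
  qed
qed

text \<open>The parameter at which \<open>e\<close> reaches \<open>v\<close>, if \<open>v\<close> is one of
  its ends.\<close>

definition end_toward :: "'a \<Rightarrow> (real \<Rightarrow> 'a) \<Rightarrow> real" where
  "end_toward v e = (if e 0 = v then 0 else 1)"

text \<open>Each point slides along its edge to the centre. The contractions of the finitely many closed edges
  at \<open>v\<close> agree in \<open>v\<close>, the only point that they share within the star, and are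
  pasted.\<close>

lemma star_contraction:
  assumes v: "v \<in> V"
  obtains H where "continuous_map (prod_topology (top_of_set {0..1}) (subtopology Z (star v))) Z H"
    "\<And>t. t \<in> {0..1} \<Longrightarrow> H (t, v) = v"
    "\<And>e t s. e \<in> E \<Longrightarrow> v = e 0 \<or> v = e 1 \<Longrightarrow> t \<in> {0..1} \<Longrightarrow> s \<in> {0..1} \<Longrightarrow> e t \<in> star v \<Longrightarrow>
       H (s, e t) = subpath_in e t (end_toward v e) s"
proof -
  have "\<exists>c. continuous_map (subtopology Z (e ` {0..1})) (top_of_set {0..1}) c \<and> (\<forall>t\<in>{0..1}. c (e t) = t)" if "e \<in> E" for e
    using edge_coordinate[OF that] by metis
  then have "\<forall>e\<in>E. \<exists>c. continuous_map (subtopology Z (e ` {0..1})) (top_of_set {0..1}) c \<and> (\<forall>t\<in>{0..1}. c (e t) = t)" by (intro ballI)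
  from bchoice[OF this] obtain c where c0: "\<forall>e\<in>E. continuous_map (subtopology Z (e ` {0..1})) (top_of_set {0..1}) (c e) \<and> (\<forall>t\<in>{0..1}. c e (e t) = t)" ..
  then have c: "continuous_map (subtopology Z (e ` {0..1})) (top_of_set {0..1}) (c e)" "\<And>t. t \<in> {0..1} \<Longrightarrow> c e (e t) = t" if "e \<in> E" for e
    using that by auto
  define I where "I = insert None (Some ` {e\<in>E. v = e 0 \<or> v = e 1})"
  define T where "T i = {0..1::real} \<times> (case i of None \<Rightarrow> {v} | Some e \<Rightarrow> e ` {0..1})" for i :: "(real \<Rightarrow> 'a) option"
  define f where "f i = (case i of None \<Rightarrow> (\<lambda>_. v) | Some e \<Rightarrow> (\<lambda>z. subpath_in e (c e (snd z)) (end_toward v e) (fst z)))"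
    for i :: "(real \<Rightarrow> 'a) option"
  define H where "H z = f (SOME i. i \<in> I \<and> z \<in> T i) z" for z
  let ?P = "prod_topology (top_of_set {0..1::real}) (subtopology Z (star v))"
  have k: "end_toward v e \<in> {0..1}" "v = e 0 \<or> v = e 1 \<Longrightarrow> e (end_toward v e) = v" for e
    by (auto simp: end_toward_def)
  have tP: "topspace ?P = {0..1} \<times> star v" by (auto simp: star_def)
  have agree: "f i z = f j z" if ij: "i \<in> I" "j \<in> I" "z \<in> T i" "z \<in> T j" "z \<in> {0..1} \<times> star v" for i j z
  proof -
    have vv: "f i z = v" if "i \<in> I" "snd z = v" for i
    proof (cases i)
      case (Some e)
      then have e: "e \<in> E" "v = e 0 \<or> v = e 1" using that by (auto simp: I_def)
      have "c e v = end_toward v e" using c(2)[OF e(1) k(1)[of e]] k(2)[OF e(2)] by simp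
      then show ?thesis using Some that(2) k(2)[OF e(2)] by (simp add: f_def subpath_in_const)
    qed (simp add: f_def)
    show ?thesis
    proof (cases "snd z = v")
      case True then show ?thesis using vv ij by simp
    next
      case False
      then have nV: "snd z \<notin> V" using ij(5) by (auto simp: star_def)
      obtain e where e: "i = Some e" "e \<in> E" "snd z \<in> e ` {0..1}" using ij(1,3) False by (cases i) (auto simp: I_def T_def)
      obtain e' where e': "j = Some e'" "e' \<in> E" "snd z \<in> e' ` {0..1}" using ij(2,4) False by (cases j) (auto simp: I_def T_def)
      obtain s where s: "s \<in> {0..1}" "snd z = e s" using e(3) by auto
      obtain t where t: "t \<in> {0..1}" "snd z = e' t" using e'(3) by auto
      have "e = e'" using edge_eq[OF e(2) e'(2) s(1) t(1)] s(2) t(2) nV by simp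
      then show ?thesis using e(1) e'(1) by simp
    qed
  qed
  have covers: "\<exists>i. i \<in> I \<and> z \<in> T i" if z: "z \<in> {0..1} \<times> star v" for z
  proof -
    have "snd z \<in> star v" using z by auto
    then show ?thesis
    proof (cases rule: star_cases)
      case 1 then show ?thesis using z by (intro exI[of _ None]) (auto simp: I_def T_def)
    next
      case (2 e t) then show ?thesis using z by (intro exI[of _ "Some e"]) (cases z, auto simp: I_def T_def)
    qed
  qed
  have Hf: "H z = f i z" if "i \<in> I" "z \<in> T i" and z: "z \<in> {0..1} \<times> star v" for i z
  proof -
    have s: "(SOME i. i \<in> I \<and> z \<in> T i) \<in> I \<and> z \<in> T (SOME i. i \<in> I \<and> z \<in> T i)"
      by (rule someI_ex[OF covers[OF z]])
    show ?thesis unfolding H_def by (rule agree[OF conjunct1[OF s] that(1) conjunct2[OF s] that(2) z])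
  qed
  have "continuous_map ?P Z H"
  proof (rule pasting_lemma_closed[where I = I and T = "\<lambda>i. topspace ?P \<inter> T i" and f = f])
    show "finite I" using finite_E by (simp add: I_def)
    show "closedin ?P (topspace ?P \<inter> T i)" if i: "i \<in> I" for i
    proof -
      have "closedin Z (case i of None \<Rightarrow> {v} | Some e \<Rightarrow> e ` {0..1})"
        using i edge_compact V_closed[of "{v}"] v by (auto simp: I_def split: option.splits)
      then have "closedin (subtopology Z (star v)) ((case i of None \<Rightarrow> {v} | Some e \<Rightarrow> e ` {0..1}) \<inter> star v)"
        by (auto simp: closedin_subtopology)
      then have "closedin ?P ({0..1} \<times> ((case i of None \<Rightarrow> {v} | Some e \<Rightarrow> e ` {0..1}) \<inter> star v))"
        by (simp add: closedin_prod_Times_iff)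
      moreover have "topspace ?P \<inter> T i = {0..1} \<times> ((case i of None \<Rightarrow> {v} | Some e \<Rightarrow> e ` {0..1}) \<inter> star v)"
        unfolding tP by (auto simp: T_def)
      ultimately show ?thesis by simp
    qed
    show "continuous_map (subtopology ?P (topspace ?P \<inter> T i)) Z (f i)" if i: "i \<in> I" for i
    proof (cases i)
      case None
      then show ?thesis using v V_subset by (auto simp: f_def)
    next
      case (Some e)
      then have e: "e \<in> E" using i by (auto simp: I_def)
      let ?Q = "subtopology ?P (topspace ?P \<inter> T i)"
      have "continuous_map ?Q (subtopology Z (e ` {0..1})) snd"
        unfolding continuous_map_in_subtopology
      proof (intro conjI)
        have "continuous_map ?P (subtopology Z (star v)) snd" by (rule continuous_map_snd)
        then show "continuous_map ?Q Z snd"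
          by (intro continuous_map_from_subtopology) (simp add: continuous_map_in_subtopology)
        show "snd \<in> topspace ?Q \<rightarrow> e ` {0..1}" using Some by (auto simp: T_def)
      qed
      then have cm: "continuous_map ?Q (top_of_set {0..1}) (c e \<circ> snd)"
        by (rule continuous_map_compose[OF _ c(1)[OF e]])
      have 1: "continuous_map ?Q euclideanreal (\<lambda>z. c e (snd z))" "\<And>z. z \<in> topspace ?Q \<Longrightarrow> c e (snd z) \<in> {0..1}"
        using conjunct1[OF cm[unfolded continuous_map_in_subtopology]]
          funcset_mem[OF conjunct2[OF cm[unfolded continuous_map_in_subtopology]]]
        by (simp_all only: o_def)
      have 2: "continuous_map ?Q euclideanreal fst"
      proof -
        have "continuous_map ?P (top_of_set {0..1}) fst" by (rule continuous_map_fst)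
        then show ?thesis by (intro continuous_map_from_subtopology) (simp add: continuous_map_in_subtopology)
      qed
      have 3: "fst z \<in> {0..1}" if "z \<in> topspace ?Q" for z using that by auto
      have "continuous_map ?Q euclideanreal (\<lambda>z. c e (snd z) + (end_toward v e - c e (snd z)) * fst z)"
        by (intro continuous_map_add continuous_map_real_mult continuous_map_diff 1 2) auto
      moreover have "c e (snd z) + (end_toward v e - c e (snd z)) * fst z \<in> {0..1}" if "z \<in> topspace ?Q" for z
        by (rule convex_combination_in_unit[OF 1(2)[OF that] k(1) 3[OF that]])
      ultimately have "continuous_map ?Q (top_of_set {0..1}) (\<lambda>z. c e (snd z) + (end_toward v e - c e (snd z)) * fst z)"
        by (auto simp: continuous_map_in_subtopology simp del: atLeastAtMost_iff)
      then have "continuous_map ?Q Z (e \<circ> (\<lambda>z. c e (snd z) + (end_toward v e - c e (snd z)) * fst z))"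
        using edge(1)[OF e] unfolding pathin_def by (rule continuous_map_compose)
      then show ?thesis using Some by (simp add: f_def subpath_in_def o_def)
    qed
    show "f i z = f j z" if "i \<in> I" "j \<in> I" "z \<in> topspace ?P \<inter> (topspace ?P \<inter> T i) \<inter> (topspace ?P \<inter> T j)" for i j z
      using agree that unfolding tP by blast
    show "\<exists>j. j \<in> I \<and> z \<in> topspace ?P \<inter> T j \<and> H z = f j z" if "z \<in> topspace ?P" for z
      using covers[of z] Hf[of _ z] that unfolding tP by blast
  qed
  moreover have "H (t, v) = v" if "t \<in> {0..1}" for t
    using Hf[of None "(t, v)"] that vertex_in_star[OF v] by (auto simp: I_def T_def f_def)
  moreover have "H (s, e t) = subpath_in e t (end_toward v e) s"
    if "e \<in> E" "v = e 0 \<or> v = e 1" "t \<in> {0..1}" "s \<in> {0..1}" "e t \<in> star v" for e t s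
    using Hf[of "Some e" "(s, e t)"] that c(2)[OF that(1,3)] by (auto simp: I_def T_def f_def)
  ultimately show thesis using that by blast
qed

subsection \<open>Generators of the fundamental group\<close>

text \<open>The paths from the base point to the vertices are extended over the edges, so that the initial
  segments of edges become trivial in the fundamental group.\<close>

lemma path_system_extend:
  assumes z0: "z0 \<in> V" and \<tau>: "\<And>v. v \<in> V \<Longrightarrow> pathin Z (\<tau> v) \<and> \<tau> v 0 = z0 \<and> \<tau> v 1 = v"
  obtains \<tau>' where "path_system Z z0 \<tau>'" "\<And>v. v \<in> V \<Longrightarrow> \<tau>' v = \<tau> v"
    "\<And>e t. e \<in> E \<Longrightarrow> t \<in> {0..<1} \<Longrightarrow> path_class Z z0 \<tau>' (subpath_in e 0 t) = \<one>\<^bsub>fundamental_group Z z0\<^esub>"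
proof -
  define A where "A x p \<longleftrightarrow> (\<exists>e t. e \<in> E \<and> t \<in> {0..1} \<and> x = e t \<and> p = join_loops (\<tau> (e 0)) (subpath_in e 0 t))" for x p
  define \<tau>' where "\<tau>' x = (if x \<in> V then \<tau> x else (SOME p. A x p))" for x
  have in_edge: "\<tau>' (e t) = join_loops (\<tau> (e 0)) (subpath_in e 0 t)"
    if "e \<in> E" "t \<in> {0..1}" "e t \<notin> V" for e t
  proof -
    have "\<exists>p. A (e t) p" using that unfolding A_def by blast
    then have "A (e t) (SOME p. A (e t) p)" by (rule someI_ex)
    then obtain e' t' where e': "e' \<in> E" "t' \<in> {0..1}" "e t = e' t'"
      "(SOME p. A (e t) p) = join_loops (\<tau> (e' 0)) (subpath_in e' 0 t')" by (auto simp: A_def)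
    then show ?thesis using edge_eq[OF that(1) e'(1) that(2) e'(2,3) that(3)] that(3) by (simp add: \<tau>'_def)
  qed
  have ps: "path_system Z z0 \<tau>'"
    unfolding path_system_def
  proof (intro conjI ballI)
    show "z0 \<in> topspace Z" using z0 V_subset by blast
    fix x assume x: "x \<in> topspace Z"
    have "pathin Z (\<tau>' x) \<and> \<tau>' x 0 = z0 \<and> \<tau>' x 1 = x"
    proof (cases "x \<in> V")
      case True then show ?thesis using \<tau>[OF True] by (simp add: \<tau>'_def)
    next
      case False
      then obtain e t where e: "e \<in> E" "t \<in> {0..1}" "x = e t" using x cover by auto
      have "pathin Z (subpath_in e 0 t)" by (rule pathin_subpath_in[OF edge(1)[OF e(1)]]) (use e in auto)
      then show ?thesis using in_edge[OF e(1,2)] False e(3) \<tau>[OF edge(3)[OF e(1)]] by (auto intro: pathin_join_loops)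
    qed
    then show "pathin Z (\<tau>' x)" "\<tau>' x 0 = z0" "\<tau>' x 1 = x" by auto
  qed
  have "path_class Z z0 \<tau>' (subpath_in e 0 t) = \<one>\<^bsub>fundamental_group Z z0\<^esub>" if e: "e \<in> E" "t \<in> {0..<1}" for e t
  proof (cases "t = 0")
    case True
    then show ?thesis using path_class_const[OF ps edge_in[OF e(1), of 0]] by (simp add: subpath_in_const)
  next
    case False
    then have nV: "e t \<notin> V" using edge_vertex[OF e(1), of t] e(2) by auto
    let ?q = "subpath_in e 0 t" let ?a = "join_loops (\<tau> (e 0)) ?q"
    have t: "t \<in> {0..1}" using e(2) by auto
    have q: "pathin Z ?q" by (rule pathin_subpath_in[OF edge(1)[OF e(1)]]) (use t in auto)
    have a: "pathin Z ?a" using \<tau>[OF edge(3)[OF e(1)]] q by (auto intro: pathin_join_loops)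
    have e0: "\<tau>' (e 0) = \<tau> (e 0)" using edge(3)[OF e(1)] by (simp add: \<tau>'_def)
    have l: "join_loops ?a (reverse_path ?a) \<in> loops Z z0"
      using a \<tau>[OF edge(3)[OF e(1)]] by (auto simp: loops_def intro!: pathin_join_loops pathin_reverse_path)
    have "path_class Z z0 \<tau>' ?q = loop_class Z z0 (join_loops ?a (reverse_path ?a))"
      using in_edge[OF e(1) t nV] e0 by (simp add: path_class_def)
    also have "\<dots> = loop_class Z z0 (\<lambda>_. z0)"
      using path_homotopic_inverse_right[OF a] \<tau>[OF edge(3)[OF e(1)]] l z0 V_subset
      by (subst loop_class_eq_iff) (auto intro: const_loop)
    finally show ?thesis by (simp add: one_fundamental_group)
  qed
  moreover have "\<tau>' v = \<tau> v" if "v \<in> V" for v using that by (simp add: \<tau>'_def)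
  ultimately show thesis using ps that by blast
qed

text \<open>A path is subdivided into pieces in open stars, by bisection. Such a piece is homotopic to the
  tracks of its two ends under the contraction of the star; and a track runs along part of an edge, so that
  its class is either trivial or the class of the whole edge.\<close>

theorem fundamental_group_generated_by_edges:
  assumes z0: "z0 \<in> V" and \<tau>: "\<And>v. v \<in> V \<Longrightarrow> pathin Z (\<tau> v) \<and> \<tau> v 0 = z0 \<and> \<tau> v 1 = v"
    and \<tau>0: "\<tau> z0 = (\<lambda>_. z0)"
  shows "generate (fundamental_group Z z0) (path_class Z z0 \<tau> ` E) = carrier (fundamental_group Z z0)"
proof -
  obtain \<tau>' where ps: "path_system Z z0 \<tau>'" and \<tau>': "\<And>v. v \<in> V \<Longrightarrow> \<tau>' v = \<tau> v"
    and triv: "\<And>e t. e \<in> E \<Longrightarrow> t \<in> {0..<1} \<Longrightarrow> path_class Z z0 \<tau>' (subpath_in e 0 t) = \<one>\<^bsub>fundamental_group Z z0\<^esub>"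
    by (rule path_system_extend[OF z0 \<tau>], assumption, rule that)
  let ?G = "fundamental_group Z z0" let ?c = "path_class Z z0 \<tau>'"
  have z0Z: "z0 \<in> topspace Z" using z0 V_subset by blast
  interpret group ?G by (rule group_fundamental_group[OF z0Z])
  have ce: "path_class Z z0 \<tau> e = ?c e" if "e \<in> E" for e
    using \<tau>'[OF edge(3)[OF that]] \<tau>'[OF edge(4)[OF that]] by (simp add: path_class_def)
  then have img: "path_class Z z0 \<tau> ` E = ?c ` E" by simp
  have cE: "?c ` E \<subseteq> carrier ?G" using path_class_carrier[OF ps edge(1)] by auto
  define K where "K = generate ?G (?c ` E)"
  have K: "subgroup K ?G" unfolding K_def by (rule generate_is_subgroup[OF cE])
  have Ke: "?c e \<in> K" if "e \<in> E" for e unfolding K_def by (rule generate.incl) (use that in auto)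
  have track: "?c (subpath_in e t (end_toward v e)) \<in> K"
    if e: "e \<in> E" "v = e 0 \<or> v = e 1" "t \<in> {0..1}" "e t \<in> star v" "v \<in> V" for e v t
  proof -
    have pe: "pathin Z (subpath_in e s t)" if "s \<in> {0..1}" "t \<in> {0..1}" for s t
      by (rule pathin_subpath_in[OF edge(1)[OF e(1)] that])
    show ?thesis
    proof (cases "e t = v")
      case True
      then have "e t = e (end_toward v e)" using e(2) by (auto simp: end_toward_def)
      then have "t = end_toward v e"
        using inj_onD[OF edge(2)[OF e(1)], of t "end_toward v e"] e(3) by (auto simp: end_toward_def)
      then have "subpath_in e t (end_toward v e) = (\<lambda>_. e t)" by (simp add: subpath_in_const)
      then have "?c (subpath_in e t (end_toward v e)) = \<one>\<^bsub>?G\<^esub>" using path_class_const[OF ps edge_in[OF e(1,3)]] by simp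
      then show ?thesis using subgroup.one_closed[OF K] by simp
    next
      case False
      then have nV: "e t \<notin> V" using e(4) by (auto simp: star_def)
      then have t: "t \<in> {0..<1}" using edge(4)[OF e(1)] e(3) by (cases "t = 1") auto
      show ?thesis
      proof (cases "e 0 = v")
        case True
        have "?c (subpath_in e t 0) = inv\<^bsub>?G\<^esub> (?c (subpath_in e 0 t))"
          using path_class_reverse[OF ps pe[of 0 t]] e(3) by (simp add: reverse_subpath_in)
        then show ?thesis using True triv[OF e(1) t] subgroup.one_closed[OF K] by (simp add: end_toward_def)
      next
        case False
        have "?c e = ?c (join_loops (subpath_in e 0 t) (subpath_in e t 1))"
          using path_class_eqI[OF ps path_homotopic_subpath_join[OF edge(1)[OF e(1)], of 0 t 1]] e(3)
          by (simp add: subpath_in_full)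
        also have "\<dots> = ?c (subpath_in e 0 t) \<otimes>\<^bsub>?G\<^esub> ?c (subpath_in e t 1)"
          using e(3) by (intro path_class_join[OF ps] pe) auto
        also have "\<dots> = ?c (subpath_in e t 1)"
          using triv[OF e(1) t] path_class_carrier[OF ps pe[of t 1]] e(3) by simp
        finally show ?thesis using Ke[OF e(1)] False by (simp add: end_toward_def)
      qed
    qed
  qed
  have star_path: "?c p \<in> K" if v: "v \<in> V" and p: "pathin Z p" "p ` {0..1} \<subseteq> star v" for v p
  proof -
    obtain H where H: "continuous_map (prod_topology (top_of_set {0..1}) (subtopology Z (star v))) Z H"
      and Hv: "\<And>t. t \<in> {0..1} \<Longrightarrow> H (t, v) = v"
      and He: "\<And>e t s. e \<in> E \<Longrightarrow> v = e 0 \<or> v = e 1 \<Longrightarrow> t \<in> {0..1} \<Longrightarrow> s \<in> {0..1} \<Longrightarrow> e t \<in> star v \<Longrightarrow>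
       H (s, e t) = subpath_in e t (end_toward v e) s"
      by (rule star_contraction[OF v], rule that)
    have H01: "H (0, x) = x \<and> H (1, x) = v \<and> pathin Z (\<lambda>t. H (t, x)) \<and> ?c (\<lambda>t. H (t, x)) \<in> K" if x: "x \<in> star v" for x
      using x
    proof (cases rule: star_cases)
      case 1
      have vZ: "v \<in> topspace Z" using v V_subset by blast
      have h: "path_homotopic Z (\<lambda>_. v) (\<lambda>t. H (t, v))"
        by (rule path_homotopic_cong) (use vZ Hv in auto)
      then have "?c (\<lambda>t. H (t, v)) = \<one>\<^bsub>?G\<^esub>"
        using path_class_eqI[OF ps h] path_class_const[OF ps vZ] by simp
      then show ?thesis using 1 Hv path_homotopic_pathin[OF h] subgroup.one_closed[OF K] by simp
    next
      case (2 e t)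
      have xs: "e t \<in> star v" using x 2 by simp
      have pe: "pathin Z (subpath_in e t (end_toward v e))"
        by (rule pathin_subpath_in[OF edge(1)[OF 2(1)] 2(2)]) (simp add: end_toward_def)
      have h: "path_homotopic Z (subpath_in e t (end_toward v e)) (\<lambda>s. H (s, x))"
        by (rule path_homotopic_cong[OF pe]) (use He[OF 2(1,4,2) _ xs] 2(3) in simp)
      have "?c (\<lambda>s. H (s, x)) \<in> K"
        using path_class_eqI[OF ps h] track[OF 2(1,4,2) xs v] by simp
      moreover have "H (0, x) = x" "H (1, x) = v"
        using He[OF 2(1,4,2) _ xs, of 0] He[OF 2(1,4,2) _ xs, of 1] 2(3,4) by (auto simp: end_toward_def)
      ultimately show ?thesis using path_homotopic_pathin[OF h] by simp
    qed
    have p01: "p 0 \<in> star v" "p 1 \<in> star v" using p(2) by auto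
    let ?t = "\<lambda>x t. H (t, x)"
    have "path_homotopic Z p (join_loops (?t (p 0)) (reverse_path (?t (p 1))))"
      by (rule path_homotopic_tracks[OF H p]) (use H01 in auto)
    then have "?c p = ?c (join_loops (?t (p 0)) (reverse_path (?t (p 1))))" by (rule path_class_eqI[OF ps])
    also have "\<dots> = ?c (?t (p 0)) \<otimes>\<^bsub>?G\<^esub> ?c (reverse_path (?t (p 1)))"
      using H01[OF p01(1)] H01[OF p01(2)] by (intro path_class_join[OF ps] pathin_reverse_path) auto
    also have "?c (reverse_path (?t (p 1))) = inv\<^bsub>?G\<^esub> (?c (?t (p 1)))"
      using H01[OF p01(2)] by (intro path_class_reverse[OF ps]) auto
    finally show ?thesis
      using H01[OF p01(1)] H01[OF p01(2)] subgroup.m_closed[OF K] subgroup.m_inv_closed[OF K] by simp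
  qed
  have all: "?c q \<in> K" if q: "pathin Z q" for q
  proof -
    have "0 \<le> (0::real) \<and> 1 \<le> (1::real) \<longrightarrow> ?c (subpath_in q 0 1) \<in> K"
    proof (rule Bolzano[OF zero_le_one, of "\<lambda>a b. 0 \<le> a \<and> b \<le> 1 \<longrightarrow> ?c (subpath_in q a b) \<in> K"])
      fix a b c :: real
      assume 1: "0 \<le> a \<and> b \<le> 1 \<longrightarrow> ?c (subpath_in q a b) \<in> K" "0 \<le> b \<and> c \<le> 1 \<longrightarrow> ?c (subpath_in q b c) \<in> K" "a \<le> b" "b \<le> c"
      show "0 \<le> a \<and> c \<le> 1 \<longrightarrow> ?c (subpath_in q a c) \<in> K"
      proof
        assume ac: "0 \<le> a \<and> c \<le> 1"
        then have i: "a \<in> {0..1}" "b \<in> {0..1}" "c \<in> {0..1}" using 1 by auto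
        have "?c (subpath_in q a c) = ?c (join_loops (subpath_in q a b) (subpath_in q b c))"
          by (rule path_class_eqI[OF ps path_homotopic_subpath_join[OF q i], symmetric])
        also have "\<dots> = ?c (subpath_in q a b) \<otimes>\<^bsub>?G\<^esub> ?c (subpath_in q b c)"
          by (rule path_class_join[OF ps]) (simp_all add: pathin_subpath_in[OF q] i del: atLeastAtMost_iff)
        finally show "?c (subpath_in q a c) \<in> K" using 1 ac i subgroup.m_closed[OF K] by simp
      qed
    next
      fix s :: real assume s: "0 \<le> s" "s \<le> 1"
      then have "q s \<in> topspace Z" using path_image_subset_topspace[OF q] by auto
      then obtain v where v: "v \<in> V" "q s \<in> star v" using in_some_star by blast
      have "openin (top_of_set {0..1}) {t \<in> topspace (top_of_set {0..1}). q t \<in> star v}"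
        using q unfolding pathin_def by (rule openin_continuous_map_preimage[OF _ openin_star])
      then have "openin (top_of_set {0..1}) {t \<in> {0..1}. q t \<in> star v}" by simp
      then obtain d where d: "d > 0" "ball s d \<inter> {0..1} \<subseteq> {t \<in> {0..1}. q t \<in> star v}"
        using s v(2) unfolding openin_contains_ball by auto
      have "?c (subpath_in q a b) \<in> K" if ab: "a \<le> s" "s \<le> b" "b - a < d" "0 \<le> a" "b \<le> 1" for a b
      proof (rule star_path[OF v(1)])
        show "pathin Z (subpath_in q a b)" by (rule pathin_subpath_in[OF q]) (use ab in auto)
        show "subpath_in q a b ` {0..1} \<subseteq> star v"
        proof
          fix x assume "x \<in> subpath_in q a b ` {0..1}"
          then obtain u where u: "u \<in> {0..1}" "x = q (a + (b - a) * u)" by (auto simp: subpath_in_def)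
          have "0 \<le> (b - a) * u" "(b - a) * u \<le> (b - a) * 1"
            using ab u by (auto intro!: mult_left_mono simp del: mult_1_right)
          then have "a + (b - a) * u \<in> ball s d \<inter> {0..1}"
            using ab by (auto simp: dist_real_def)
          then show "x \<in> star v" using d(2) u(2) by auto
        qed
      qed
      then show "\<exists>d>0. \<forall>a b. a \<le> s \<and> s \<le> b \<and> b - a < d \<longrightarrow> 0 \<le> a \<and> b \<le> 1 \<longrightarrow> ?c (subpath_in q a b) \<in> K"
        using d(1) by blast
    qed
    then show ?thesis by (simp add: subpath_in_full)
  qed
  have "carrier ?G \<subseteq> K"
  proof
    fix a assume "a \<in> carrier ?G"
    then obtain p where p: "p \<in> loops Z z0" "a = loop_class Z z0 p" unfolding carrier_fundamental_group by (rule imageE)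
    have "?c p = a" unfolding p(2) by (rule path_class_based_loop[OF ps _ p(1)]) (simp add: \<tau>' z0 \<tau>0)
    then show "a \<in> K" using all[of p] loopsD[OF p(1)] by simp
  qed
  then show ?thesis using subgroup.subset[OF K] unfolding img K_def by (rule subset_antisym[rotated])
qed

end

subsection \<open>Connectedness and trees\<close>

text \<open>Otherwise the vertices in \<open>W\<close> and those outside \<open>W\<close> would span two
  disjoint closed subgraphs.\<close>

lemma (in finite_graph) connected_crossing_edge:
  assumes conn: "connected_space Z" and W: "W \<subseteq> V" "W \<noteq> {}" "W \<noteq> V"
  shows "\<exists>e\<in>E. \<exists>a b. (a = e 0 \<and> b = e 1 \<or> a = e 1 \<and> b = e 0) \<and> a \<in> W \<and> b \<in> V - W"
proof (rule ccontr)
  assume "\<not> ?thesis"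
  then have sides: "e 0 \<in> W \<longleftrightarrow> e 1 \<in> W" if "e \<in> E" for e
    using that edge(3)[OF that] edge(4)[OF that] by blast
  define A where "A U = U \<union> (\<Union>e\<in>{e\<in>E. e 0 \<in> U}. e ` {0..1})" for U
  have A_vertex: "x \<in> U" if x: "x \<in> A U" "x \<in> V" and U: "U = W \<or> U = V - W" for x U
  proof (cases "x \<in> U")
    case False
    then obtain e t where e: "e \<in> E" "e 0 \<in> U" "t \<in> {0..1}" "x = e t" using x(1) by (auto simp: A_def)
    then show ?thesis
      using edge_vertex[OF e(1,3)] x(2) sides[OF e(1)] U edge(4)[OF e(1)] by auto
  qed
  have clo: "closedin Z (A U)" if "U \<subseteq> V" for U
    unfolding A_def
  proof (rule closedin_Un)
    show "closedin Z U" by (rule V_closed[OF that])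
    show "closedin Z (\<Union>e\<in>{e\<in>E. e 0 \<in> U}. e ` {0..1})"
      using finite_E edge_compact by (intro closedin_Union) auto
  qed
  have disj: "A W \<inter> A (V - W) = {}"
  proof (rule ccontr)
    assume "A W \<inter> A (V - W) \<noteq> {}"
    then obtain x where x: "x \<in> A W" "x \<in> A (V - W)" by blast
    show False
    proof (cases "x \<in> V")
      case True
      then show False using A_vertex[OF x(1) True] A_vertex[OF x(2) True] by simp
    next
      case False
      obtain e t where e: "e \<in> E" "e 0 \<in> W" "t \<in> {0..1}" "x = e t" using x(1) False W(1) by (auto simp: A_def)
      obtain e' s where e': "e' \<in> E" "e' 0 \<in> V - W" "s \<in> {0..1}" "x = e' s" using x(2) False by (auto simp: A_def)
      have "e = e'" using edge_eq[OF e(1) e'(1) e(3) e'(3)] e(4) e'(4) False by simp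
      then show False using e(2) e'(2) by simp
    qed
  qed
  have cov: "topspace Z \<subseteq> A W \<union> A (V - W)"
  proof
    fix x assume x: "x \<in> topspace Z"
    show "x \<in> A W \<union> A (V - W)"
    proof (cases "x \<in> V")
      case False
      then obtain e t where e: "e \<in> E" "t \<in> {0..1}" "x = e t" using x cover by auto
      then show ?thesis using edge(3)[OF e(1)] unfolding A_def by blast
    qed (auto simp: A_def)
  qed
  have ne: "A W \<noteq> {}" "A (V - W) \<noteq> {}" using W by (auto simp: A_def)
  have cl: "closedin Z (A W)" "closedin Z (A (V - W))" using clo W(1) by auto
  have "\<not> (\<exists>E1 E2. closedin Z E1 \<and> closedin Z E2 \<and> topspace Z \<subseteq> E1 \<union> E2 \<and> E1 \<inter> E2 = {} \<and> E1 \<noteq> {} \<and> E2 \<noteq> {})"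
    using conn unfolding connected_space_closedin .
  then show False
    by (rule notE) (intro exI[of _ "A W"] exI[of _ "A (V - W)"] conjI cl cov disj ne)
qed

text \<open>A spanning tree is grown from a vertex by adding edges that lead out of the set of vertices
  reached so far. The property \<open>P\<close> carries the data built along the way; \<open>J e a b\<close>
  says that \<open>e\<close> joins \<open>a\<close> and \<open>b\<close>.\<close>

lemma spanning_growth:
  assumes fin: "finite V" and v0: "v0 \<in> V"
    and cross: "\<And>W. v0 \<in> W \<Longrightarrow> W \<subseteq> V \<Longrightarrow> W \<noteq> V \<Longrightarrow> \<exists>e\<in>E. \<exists>a b. J e a b \<and> a \<in> W \<and> b \<in> V - W"
    and base: "P {v0} {}"
    and step: "\<And>W S e a b. P W S \<Longrightarrow> v0 \<in> W \<Longrightarrow> W \<subseteq> V \<Longrightarrow> S \<subseteq> E \<Longrightarrow> e \<in> E \<Longrightarrow> J e a b \<Longrightarrow> a \<in> W \<Longrightarrow> b \<in> V - W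
      \<Longrightarrow> P (insert b W) (insert e S)"
  shows "\<exists>S\<subseteq>E. P V S"
proof -
  have "\<exists>S\<subseteq>E. P V S" if "P W S" "v0 \<in> W" "W \<subseteq> V" "S \<subseteq> E" for W S
    using that
  proof (induction "card (V - W)" arbitrary: W S rule: less_induct)
    case less
    show ?case
    proof (cases "W = V")
      case True then show ?thesis using less.prems by auto
    next
      case False
      obtain e a b where e: "e \<in> E" "J e a b" "a \<in> W" "b \<in> V - W" using cross[OF less.prems(2,3) False] by blast
      have "card (V - insert b W) < card (V - W)" using e fin by (intro psubset_card_mono) auto
      moreover have "P (insert b W) (insert e S)" using step less.prems e by blast
      ultimately show ?thesis using less.hyps[of "insert b W" "insert e S"] less.prems e by blast
    qed
  qed
  from this[OF base] show ?thesis using v0 by auto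
qed

lemma inj_on_join_loops:
  assumes p: "inj_on p {0..1}" and q: "inj_on q {0..1}" and pq: "p 1 = q 0"
    and disj: "\<And>s t. s \<in> {0..1} \<Longrightarrow> t \<in> {0..1} \<Longrightarrow> p s = q t \<Longrightarrow> (s = 1 \<and> t = 0) \<or> (s = 0 \<and> t = 1)"
  shows "inj_on (join_loops p q) {0..<1}" "q 1 \<noteq> p 0 \<Longrightarrow> inj_on (join_loops p q) {0..1}"
proof -
  have key: "s = t \<or> s = 0 \<and> t = 1 \<and> q 1 = p 0 \<or> t = 0 \<and> s = 1 \<and> q 1 = p 0"
    if st: "s \<in> {0..1}" "t \<in> {0..1}" and eq: "join_loops p q s = join_loops p q t" for s t
  proof -
    consider "s \<le> 1/2" "t \<le> 1/2" | "\<not> s \<le> 1/2" "\<not> t \<le> 1/2" | "s \<le> 1/2" "\<not> t \<le> 1/2" | "\<not> s \<le> 1/2" "t \<le> 1/2" by blast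
    then show ?thesis
    proof cases
      case 1 then show ?thesis using inj_onD[OF p, of "2 * s" "2 * t"] eq st by (simp add: join_loops_def)
    next
      case 2 then show ?thesis using inj_onD[OF q, of "2 * s - 1" "2 * t - 1"] eq st by (simp add: join_loops_def)
    next
      case 3
      then have "p (2 * s) = q (2 * t - 1)" using eq by (simp add: join_loops_def)
      then show ?thesis using disj[of "2 * s" "2 * t - 1"] 3 st by auto
    next
      case 4
      then have "p (2 * t) = q (2 * s - 1)" using eq by (simp add: join_loops_def)
      then show ?thesis using disj[of "2 * t" "2 * s - 1"] 4 st by auto
    qed
  qed
  show "inj_on (join_loops p q) {0..<1}"
  proof (rule inj_onI)
    fix s t :: real assume "s \<in> {0..<1}" "t \<in> {0..<1}" "join_loops p q s = join_loops p q t"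
    then show "s = t" using key[of s t] by auto
  qed
  assume "q 1 \<noteq> p 0"
  then show "inj_on (join_loops p q) {0..1}" using key by (intro inj_onI) blast
qed

text \<open>The path factors through the quotient map from the interval to the circle.\<close>

lemma simple_closed_path_circle:
  assumes Z: "Hausdorff_space Z" and \<gamma>: "pathin Z \<gamma>" "inj_on \<gamma> {0..<1}" "\<gamma> 0 = \<gamma> 1"
  shows "subtopology Z (\<gamma> ` {0..1}) homeomorphic_space top_of_set (sphere (0::complex) 1)"
proof -
  let ?c = "circlepath (0::complex) 1"
  have c: "path ?c" "path_image ?c = sphere 0 1" by simp_all
  have cs: "continuous_map (top_of_set {0..1}) (top_of_set (sphere (0::complex) 1)) ?c"
    using c by (auto simp: path_def path_image_def)
  have img: "?c ` topspace (top_of_set {0..1}) = topspace (top_of_set (sphere (0::complex) 1))"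
    using c(2) by (simp add: path_image_def)
  have q: "quotient_map (top_of_set {0..1}) (top_of_set (sphere (0::complex) 1)) ?c"
    by (rule continuous_imp_quotient_map[OF cs _ _ img]) (auto simp: compact_space_subtopology Hausdorff_space_subtopology)
  have sp: "x = y \<or> x = 0 \<and> y = 1 \<or> x = 1 \<and> y = 0" if "x \<in> {0..1}" "y \<in> {0..1}" "?c x = ?c y" for x y
    using simple_path_circlepath[of 0 1] that by (auto simp: simple_path_def loop_free_def)
  have \<gamma>c: "continuous_map (top_of_set {0..1}) Z \<gamma>" using \<gamma>(1) by (simp add: pathin_def)
  have fib: "\<gamma> x = \<gamma> y" if "x \<in> topspace (top_of_set {0..1})" "y \<in> topspace (top_of_set {0..1})" "?c x = ?c y" for x y
    using sp[of x y] that \<gamma>(3) by auto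
  obtain g where g: "continuous_map (top_of_set (sphere (0::complex) 1)) Z g"
    "g ` topspace (top_of_set (sphere (0::complex) 1)) = \<gamma> ` topspace (top_of_set {0..1})"
    "\<And>x. x \<in> topspace (top_of_set {0..1}) \<Longrightarrow> g (?c x) = \<gamma> x"
    by (rule quotient_map_lift_exists[OF q \<gamma>c fib], assumption+, rule that)
  have "inj_on g (sphere 0 1)"
  proof (rule inj_onI)
    fix a b assume ab: "a \<in> sphere (0::complex) 1" "b \<in> sphere 0 1" "g a = g b"
    have "a \<in> ?c ` {0..1}" "b \<in> ?c ` {0..1}" using ab(1,2) c(2) by (simp_all add: path_image_def)
    then obtain x y where x: "x \<in> {0..1}" "a = ?c x" and y: "y \<in> {0..1}" "b = ?c y" by (elim imageE) blast
    have \<gamma>xy: "\<gamma> x = \<gamma> y" using ab(3) g(3) x y by simp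
    have c01: "?c 0 = ?c 1" by (simp add: circlepath)
    define r where "r t = (if t = 1 then 0 else t)" for t :: real
    have r: "r t \<in> {0..<1}" "\<gamma> (r t) = \<gamma> t" "?c (r t) = ?c t" if "t \<in> {0..1}" for t
      using that \<gamma>(3) c01 by (auto simp: r_def)
    have "r x = r y" by (rule inj_onD[OF \<gamma>(2)]) (use r[OF x(1)] r[OF y(1)] \<gamma>xy in auto)
    then show "a = b" using r(3)[OF x(1)] r(3)[OF y(1)] x(2) y(2) by simp
  qed
  moreover have "closed_map (top_of_set (sphere (0::complex) 1)) Z g"
    by (rule T1_Spaces.continuous_imp_closed_map[OF g(1) _ Z]) (simp add: compact_space_subtopology)
  ultimately have "embedding_map (top_of_set (sphere (0::complex) 1)) Z g"
    using g(1) by (intro injective_closed_imp_embedding_map) auto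
  then have "top_of_set (sphere (0::complex) 1) homeomorphic_space subtopology Z (g ` topspace (top_of_set (sphere (0::complex) 1)))"
    by (rule embedding_map_imp_homeomorphic_space)
  moreover have "g ` topspace (top_of_set (sphere (0::complex) 1)) = \<gamma> ` {0..1}" using g(2) by simp
  ultimately show ?thesis by (simp only: homeomorphic_space_sym[THEN iffD1])
qed

text \<open>In a tree every edge lies in the growing subtree: otherwise the edge and the arc joining its end
  points in the subtree would form a circle.\<close>

theorem (in finite_graph) tree_contracts:
  assumes conn: "connected_space Z" and v0: "v0 \<in> V"
    and tree: "\<not> (\<exists>S\<subseteq>topspace Z. subtopology Z S homeomorphic_space top_of_set (sphere (0::complex) 1))"
  obtains \<tau> where "\<tau> v0 = (\<lambda>_. v0)" "\<And>v. v \<in> V \<Longrightarrow> pathin Z (\<tau> v) \<and> \<tau> v 0 = v0 \<and> \<tau> v 1 = v"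
    "\<And>e. e \<in> E \<Longrightarrow> path_homotopic Z (join_loops (\<tau> (e 0)) e) (\<tau> (e 1))"
proof -
  define J :: "(real \<Rightarrow> 'a) \<Rightarrow> 'a \<Rightarrow> 'a \<Rightarrow> bool" where "J e a b \<longleftrightarrow> a = e 0 \<and> b = e 1 \<or> a = e 1 \<and> b = e 0" for e a b
  define \<Theta> where "\<Theta> W S \<tau> \<longleftrightarrow> \<tau> v0 = (\<lambda>_. v0) \<and> (\<forall>v\<in>W. pathin Z (\<tau> v) \<and> \<tau> v 0 = v0 \<and> \<tau> v 1 = v) \<and>
     (\<forall>e\<in>S. path_homotopic Z (join_loops (\<tau> (e 0)) e) (\<tau> (e 1)))" for W and S :: "(real \<Rightarrow> 'a) set" and \<tau>
  define arc where "arc W S u w \<alpha> \<longleftrightarrow> pathin Z \<alpha> \<and> inj_on \<alpha> {0..1} \<and> \<alpha> 0 = u \<and> \<alpha> 1 = w \<and>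
     \<alpha> ` {0..1} \<subseteq> W \<union> (\<Union>e\<in>S. e ` {0..1})" for W and S :: "(real \<Rightarrow> 'a) set" and u w \<alpha>
  define P where "P W S \<longleftrightarrow> (\<exists>\<tau>. \<Theta> W S \<tau>) \<and> (\<forall>e\<in>S. e 0 \<in> W \<and> e 1 \<in> W) \<and>
     (\<forall>u\<in>W. \<forall>w\<in>W. u \<noteq> w \<longrightarrow> (\<exists>\<alpha>. arc W S u w \<alpha>))" for W S
  have v0Z: "v0 \<in> topspace Z" using v0 V_subset by blast
  have arc_reverse: "arc W S w u (reverse_path \<alpha>)" if "arc W S u w \<alpha>" for W S u w \<alpha>
  proof -
    have a: "pathin Z \<alpha>" "inj_on \<alpha> {0..1}" "\<alpha> 0 = u" "\<alpha> 1 = w" "\<alpha> ` {0..1} \<subseteq> W \<union> (\<Union>e\<in>S. e ` {0..1})"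
      using that by (auto simp: arc_def)
    have "inj_on (reverse_path \<alpha>) {0..1}"
      by (rule inj_onI) (use inj_onD[OF a(2)] in \<open>force simp: reverse_path_def\<close>)
    then show ?thesis using a pathin_reverse_path[OF a(1)] by (simp add: arc_def reverse_path_image)
  qed
  have "\<exists>S\<subseteq>E. P V S"
  proof (rule spanning_growth[of V v0 E J P, OF finite_V v0])
    show "\<exists>e\<in>E. \<exists>a b. J e a b \<and> a \<in> W \<and> b \<in> V - W" if "v0 \<in> W" "W \<subseteq> V" "W \<noteq> V" for W
      using connected_crossing_edge[OF conn that(2) _ that(3)] that(1) unfolding J_def by blast
    have "\<Theta> {v0} {} (\<lambda>_ _. v0)" using v0Z by (simp add: \<Theta>_def)
    then show "P {v0} {}" by (auto simp: P_def)
    fix W S e a b assume PWS: "P W S" and v0W: "v0 \<in> W" and WV: "W \<subseteq> V" and SE: "S \<subseteq> E" and e: "e \<in> E"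
      and Jab: "J e a b" and a: "a \<in> W" and b: "b \<in> V - W"
    obtain \<tau> where \<tau>: "\<Theta> W S \<tau>" using PWS by (auto simp: P_def)
    have S_ends: "f 0 \<in> W \<and> f 1 \<in> W" if "f \<in> S" for f using PWS that by (auto simp: P_def)
    have eS: "e \<notin> S" using S_ends b Jab unfolding J_def by auto
    define \<epsilon> where "\<epsilon> = (if a = e 0 then e else reverse_path e)"
    have ab: "a \<noteq> b" using a b by auto
    have \<epsilon>: "pathin Z \<epsilon>" "inj_on \<epsilon> {0..1}" "\<epsilon> 0 = a" "\<epsilon> 1 = b" "\<epsilon> ` {0..1} = e ` {0..1}"
    proof -
      have "inj_on (reverse_path e) {0..1}"
        by (rule inj_onI) (use inj_onD[OF edge(2)[OF e]] in \<open>force simp: reverse_path_def\<close>)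
      then show "pathin Z \<epsilon>" "inj_on \<epsilon> {0..1}" "\<epsilon> 0 = a" "\<epsilon> 1 = b" "\<epsilon> ` {0..1} = e ` {0..1}"
        using edge(1,2)[OF e] pathin_reverse_path[OF edge(1)[OF e]] Jab ab reverse_path_image[of e]
        by (auto simp: \<epsilon>_def J_def)
    qed
    have \<tau>a: "pathin Z (\<tau> a)" "\<tau> a 0 = v0" "\<tau> a 1 = a" using \<tau> a by (auto simp: \<Theta>_def)
    have "\<Theta> (insert b W) (insert e S) (\<tau>(b := join_loops (\<tau> a) \<epsilon>))"
      unfolding \<Theta>_def
    proof (intro conjI ballI)
      let ?\<tau> = "\<tau>(b := join_loops (\<tau> a) \<epsilon>)"
      show "?\<tau> v0 = (\<lambda>_. v0)" using \<tau> v0W b by (auto simp: \<Theta>_def)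
      fix v assume v: "v \<in> insert b W"
      have "pathin Z (?\<tau> v) \<and> ?\<tau> v 0 = v0 \<and> ?\<tau> v 1 = v"
      proof (cases "v = b")
        case True then show ?thesis using \<tau>a \<epsilon> by (auto intro: pathin_join_loops)
      next
        case False then show ?thesis using \<tau> v by (auto simp: \<Theta>_def)
      qed
      then show "pathin Z (?\<tau> v)" "?\<tau> v 0 = v0" "?\<tau> v 1 = v" by auto
    next
      let ?\<tau> = "\<tau>(b := join_loops (\<tau> a) \<epsilon>)"
      fix f assume f: "f \<in> insert e S"
      show "path_homotopic Z (join_loops (?\<tau> (f 0)) f) (?\<tau> (f 1))"
      proof (cases "f = e")
        case False
        then have "f \<in> S" "f 0 \<noteq> b" "f 1 \<noteq> b" using f S_ends b by auto
        then show ?thesis using \<tau> by (auto simp: \<Theta>_def)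
      next
        case True
        show ?thesis
        proof (cases "a = e 0")
          case a0: True
          then have "e 1 = b" using Jab ab by (auto simp: J_def)
          then show ?thesis using True a0 ab \<tau>a \<epsilon> by (auto simp: \<epsilon>_def intro!: path_homotopic_refl pathin_join_loops)
        next
          case False
          then have e01: "e 1 = a" "e 0 = b" "\<epsilon> = reverse_path e" using Jab by (auto simp: J_def \<epsilon>_def)
          note pe = edge(1)[OF e]
          have "path_homotopic Z (join_loops (join_loops (\<tau> a) (reverse_path e)) e)
              (join_loops (\<tau> a) (join_loops (reverse_path e) e))"
            using \<tau>a e01 pe by (intro path_homotopic_assoc pathin_reverse_path) auto
          also have "path_homotopic Z \<dots> (join_loops (\<tau> a) (\<lambda>_. e 1))"
            using \<tau>a e01 pe by (intro path_homotopic_join path_homotopic_refl path_homotopic_inverse_left) auto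
          also have "path_homotopic Z \<dots> (\<tau> a)"
            using \<tau>a e01 by (intro path_homotopic_unit_right) auto
          finally show ?thesis using True e01 ab by simp
        qed
      qed
    qed
    moreover have "\<forall>f\<in>insert e S. f 0 \<in> insert b W \<and> f 1 \<in> insert b W"
      using S_ends Jab a by (auto simp: J_def)
    moreover have old: "\<exists>\<alpha>. arc (insert b W) (insert e S) u w \<alpha>" if uw: "u \<in> W" "w \<in> W" "u \<noteq> w" for u w
    proof -
      obtain \<alpha> where "arc W S u w \<alpha>" using PWS uw unfolding P_def by blast
      then have "arc (insert b W) (insert e S) u w \<alpha>" unfolding arc_def by blast
      then show ?thesis by blast
    qed
    have new: "\<exists>\<alpha>. arc (insert b W) (insert e S) u b \<alpha>" if u: "u \<in> W" for u
    proof (cases "u = a")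
      case True
      then have "arc (insert b W) (insert e S) u b \<epsilon>" using \<epsilon> by (auto simp: arc_def)
      then show ?thesis by blast
    next
      case False
      then obtain \<alpha> where "arc W S u a \<alpha>" using PWS u a unfolding P_def by blast
      then have \<alpha>: "pathin Z \<alpha>" "inj_on \<alpha> {0..1}" "\<alpha> 0 = u" "\<alpha> 1 = a" "\<alpha> ` {0..1} \<subseteq> W \<union> (\<Union>e\<in>S. e ` {0..1})"
        by (auto simp: arc_def)
      have meet: "s = 1 \<and> t = 0 \<or> s = 0 \<and> t = 1" if st: "s \<in> {0..1}" "t \<in> {0..1}" "\<alpha> s = \<epsilon> t" for s t
      proof -
        have old_region: "\<alpha> s \<in> W \<union> (\<Union>e\<in>S. e ` {0..1})" using \<alpha>(5) st(1) by blast
        have "\<epsilon> t \<in> e ` {0..1}" using \<epsilon>(5) st(2) by blast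
        then obtain t' where t': "t' \<in> {0..1}" "\<epsilon> t = e t'" by auto
        have "\<epsilon> t \<in> V"
        proof (rule ccontr)
          assume nV: "\<epsilon> t \<notin> V"
          then obtain f r where f: "f \<in> S" "r \<in> {0..1}" "\<alpha> s = f r" using old_region st(3) WV by auto
          have "e = f" using edge_eq[OF e _ t'(1) f(2), of f] f SE t' st(3) nV by auto
          then show False using f(1) eS by simp
        qed
        moreover have "\<epsilon> t \<noteq> b"
        proof
          assume "\<epsilon> t = b"
          then obtain f r where f: "f \<in> S" "r \<in> {0..1}" "b = f r" using old_region st(3) b by auto
          then have "b \<in> W" using edge_vertex[of f r] SE S_ends[OF f(1)] b by auto
          then show False using b by simp
        qed
        moreover have "t' = 0 \<or> t' = 1" using edge_vertex[OF e t'(1)] t'(2) calculation(1) by simp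
        ultimately have "\<epsilon> t = a" using t'(2) Jab by (auto simp: J_def)
        then have "t = 0" using inj_onD[OF \<epsilon>(2), of t 0] \<epsilon>(3) st(2) by simp
        moreover have "s = 1" using inj_onD[OF \<alpha>(2), of s 1] \<alpha>(4) st \<open>\<epsilon> t = a\<close> by simp
        ultimately show ?thesis by simp
      qed
      have "inj_on (join_loops \<alpha> \<epsilon>) {0..1}"
        by (rule inj_on_join_loops(2)[OF \<alpha>(2) \<epsilon>(2) _ meet]) (use \<alpha> \<epsilon> u b in auto)
      moreover have "pathin Z (join_loops \<alpha> \<epsilon>)" using \<alpha> \<epsilon> by (intro pathin_join_loops) auto
      moreover have "join_loops \<alpha> \<epsilon> ` {0..1} \<subseteq> insert b W \<union> (\<Union>e\<in>insert e S. e ` {0..1})"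
      proof (rule subset_trans[OF join_loops_image], rule Un_least)
        show "\<alpha> ` {0..1} \<subseteq> insert b W \<union> (\<Union>e\<in>insert e S. e ` {0..1})" using \<alpha>(5) by (rule subset_trans) auto
        show "\<epsilon> ` {0..1} \<subseteq> insert b W \<union> (\<Union>e\<in>insert e S. e ` {0..1})" unfolding \<epsilon>(5) by auto
      qed
      ultimately have "arc (insert b W) (insert e S) u b (join_loops \<alpha> \<epsilon>)" using \<alpha>(3) \<epsilon>(4) by (simp add: arc_def)
      then show ?thesis by blast
    qed
    have "\<exists>\<alpha>. arc (insert b W) (insert e S) u w \<alpha>" if uw: "u \<in> insert b W" "w \<in> insert b W" "u \<noteq> w" for u w
    proof (cases "u = b")
      case True
      then have "w \<in> W" using uw by auto
      from new[OF this] obtain \<alpha> where "arc (insert b W) (insert e S) w b \<alpha>" ..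
      from arc_reverse[OF this] show ?thesis using True by (intro exI[of _ "reverse_path \<alpha>"]) simp
    next
      case False
      then have u: "u \<in> W" using uw by auto
      show ?thesis
      proof (cases "w = b")
        case True then show ?thesis using new[OF u] by simp
      next
        case False
        then show ?thesis using old[OF u _ uw(3)] uw(2) by simp
      qed
    qed
    then have "\<forall>u\<in>insert b W. \<forall>w\<in>insert b W. u \<noteq> w \<longrightarrow> (\<exists>\<alpha>. arc (insert b W) (insert e S) u w \<alpha>)"
      by (intro ballI impI)
    ultimately show "P (insert b W) (insert e S)" unfolding P_def by blast
  qed
  then obtain S \<tau> where S: "S \<subseteq> E" "P V S" "\<Theta> V S \<tau>" by (auto simp: P_def)
  have "S = E"
  proof (rule ccontr)
    assume "S \<noteq> E"
    then obtain e where e: "e \<in> E" "e \<notin> S" using S(1) by blast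
    obtain \<alpha> where "arc V S (e 1) (e 0) \<alpha>"
      using S(2) edge(3,4)[OF e(1)] edge_ends_distinct[OF e(1)] unfolding P_def by metis
    then have \<alpha>: "pathin Z \<alpha>" "inj_on \<alpha> {0..1}" "\<alpha> 0 = e 1" "\<alpha> 1 = e 0" "\<alpha> ` {0..1} \<subseteq> V \<union> (\<Union>e\<in>S. e ` {0..1})"
      by (auto simp: arc_def)
    have meet: "s = 1 \<and> t = 0 \<or> s = 0 \<and> t = 1" if st: "s \<in> {0..1}" "t \<in> {0..1}" "e s = \<alpha> t" for s t
    proof -
      have "e s \<in> V"
      proof (rule ccontr)
        assume nV: "e s \<notin> V"
        have "\<alpha> t \<in> V \<union> (\<Union>e\<in>S. e ` {0..1})" using \<alpha>(5) st(2) by blast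
        then obtain f r where f: "f \<in> S" "r \<in> {0..1}" "\<alpha> t = f r" using nV st(3) by auto
        have "e = f" using edge_eq[OF e(1) _ st(1) f(2), of f] f S(1) st(3) nV by auto
        then show False using f(1) e(2) by simp
      qed
      then consider "s = 0" | "s = 1" using edge_vertex[OF e(1) st(1)] by blast
      then show ?thesis
      proof cases
        case 1 then show ?thesis using inj_onD[OF \<alpha>(2), of t 1] \<alpha>(4) st by simp
      next
        case 2 then show ?thesis using inj_onD[OF \<alpha>(2), of t 0] \<alpha>(3) st by simp
      qed
    qed
    let ?\<gamma> = "join_loops e \<alpha>"
    have "inj_on ?\<gamma> {0..<1}" by (rule inj_on_join_loops(1)[OF edge(2)[OF e(1)] \<alpha>(2) _ meet]) (use \<alpha> in auto)
    moreover have p: "pathin Z ?\<gamma>" using edge(1)[OF e(1)] \<alpha> by (intro pathin_join_loops) auto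
    ultimately have "subtopology Z (?\<gamma> ` {0..1}) homeomorphic_space top_of_set (sphere (0::complex) 1)"
      using \<alpha>(4) by (intro simple_closed_path_circle[OF Hausdorff]) auto
    moreover have "?\<gamma> ` {0..1} \<subseteq> topspace Z" using path_image_subset_topspace[OF p] by blast
    ultimately show False using tree by blast
  qed
  then show thesis using S(3) that[of \<tau>] by (auto simp: \<Theta>_def)
qed

section \<open>Local structure of a function near a regular point\<close>

text \<open>If the derivative of \<open>g\<close> at \<open>a\<close> does not vanish on the unit vector
  \<open>e\<close>, replacing the coordinate along \<open>e\<close> by \<open>g\<close> itself gives a map
  with invertible derivative, to which the inverse function theorem applies.\<close>

lemma regular_point_straightening:
  fixes g :: "'e::euclidean_space \<Rightarrow> real"
  assumes g: "C1_on g S" and S: "open S" "a \<in> S" and reg: "\<not> (g has_derivative (\<lambda>_. 0)) (at a)"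
  obtains W T \<Phi> \<Psi> and e :: 'e where "open W" "a \<in> W" "W \<subseteq> S" "open T" "homeomorphism W T \<Phi> \<Psi>"
    "norm e = 1" "\<And>x. x \<in> W \<Longrightarrow> g x = \<Phi> x \<bullet> e"
proof -
  obtain g' where g': "\<And>x. x \<in> S \<Longrightarrow> (g has_derivative blinfun_apply (g' x)) (at x)" "continuous_on S g'"
    using g unfolding C1_on_def by blast
  have "\<exists>h. blinfun_apply (g' a) h \<noteq> 0"
  proof (rule ccontr)
    assume "\<not> ?thesis"
    then have "blinfun_apply (g' a) = (\<lambda>_. 0)" by auto
    then show False using g'(1)[OF S(2)] reg by simp
  qed
  then obtain h where h: "blinfun_apply (g' a) h \<noteq> 0" by blast
  define e where "e = h /\<^sub>R norm h"
  have "h \<noteq> 0" using h by (auto simp: blinfun.zero_right)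
  then have e: "norm e = 1" "e \<bullet> e = 1" by (simp_all add: e_def dot_square_norm power2_eq_square)
  define \<mu> where "\<mu> = blinfun_apply (g' a) e"
  have \<mu>: "\<mu> \<noteq> 0" using h \<open>h \<noteq> 0\<close> by (simp add: \<mu>_def e_def blinfun.scaleR_right)
  define \<Phi> where "\<Phi> x = x + (g x - x \<bullet> e) *\<^sub>R e" for x
  define \<Phi>' where "\<Phi>' x = id_blinfun + (blinfun_scaleR_left e o\<^sub>L (g' x - blinfun_inner_left e))" for x
  \<comment> \<open>The explicit inverse of the derivative at \<open>a\<close>, a rank one perturbation of
    the identity.\<close>
  define J where "J = id_blinfun - (blinfun_scaleR_left e o\<^sub>L ((1 / \<mu>) *\<^sub>R (g' a - blinfun_inner_left e)))"
  have \<Phi>'_apply: "blinfun_apply (\<Phi>' x) v = v + (blinfun_apply (g' x) v - v \<bullet> e) *\<^sub>R e" for x v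
    by (simp add: \<Phi>'_def blinfun.add_left blinfun.diff_left)
  have J_apply: "blinfun_apply J v = v - ((1 / \<mu>) * (blinfun_apply (g' a) v - v \<bullet> e)) *\<^sub>R e" for v
    by (simp add: J_def blinfun.diff_left blinfun.scaleR_left)
  have der: "(\<Phi> has_derivative blinfun_apply (\<Phi>' x)) (at x)" if "x \<in> S" for x
    unfolding \<Phi>_def \<Phi>'_apply[abs_def] by (rule derivative_eq_intros g'(1)[OF that] refl | simp)+
  have cont: "continuous_on S \<Phi>'"
    unfolding \<Phi>'_def
    by (intro continuous_on_add continuous_on_const bounded_bilinear.continuous_on[OF bounded_bilinear_blinfun_compose]
        continuous_on_diff g'(2))
  have inv: "J o\<^sub>L \<Phi>' a = id_blinfun"
  proof (rule blinfun_eqI)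
    fix v
    let ?k = "blinfun_apply (\<Phi>' a) v" let ?d = "blinfun_apply (g' a) v - v \<bullet> e"
    have "?k \<bullet> e = blinfun_apply (g' a) v"
      by (simp add: \<Phi>'_apply inner_add_left e)
    moreover have "blinfun_apply (g' a) ?k = blinfun_apply (g' a) v + ?d * \<mu>"
      by (simp add: \<Phi>'_apply blinfun.add_right blinfun.scaleR_right \<mu>_def)
    ultimately have "blinfun_apply J ?k = ?k - ?d *\<^sub>R e"
      using \<mu> by (simp add: J_apply)
    then show "blinfun_apply (J o\<^sub>L \<Phi>' a) v = blinfun_apply id_blinfun v"
      by (simp add: \<Phi>'_apply)
  qed
  obtain W T \<Psi> \<Psi>' where W: "open W" "W \<subseteq> S" "a \<in> W" "open T" "\<Phi> a \<in> T" "homeomorphism W T \<Phi> \<Psi>"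
    by (rule inverse_function_theorem[OF S(1) der cont S(2) inv], assumption, rule that)
  show thesis
    by (rule that[OF W(1,3,2,4,6) e(1)]) (simp add: \<Phi>_def inner_add_left e)
qed

locale closed_C1_function =
  fixes M :: "'a topology" and A :: "('a, real ^ 'n) chart set" and f :: "'a \<Rightarrow> real"
  assumes manifold: "closed_connected_C1_manifold M A"
    and smooth: "C1_function A f"
    and isolated: "isolated_points M (critical_points A f)"
begin

abbreviation "Cr \<equiv> critical_points A f"

lemma M_Hausdorff: "Hausdorff_space M" and M_compact: "compact_space M" and M_connected: "connected_space M"
  using manifold by (auto simp: closed_connected_C1_manifold_def)

lemma chart:
  assumes "(U, \<phi>) \<in> A"
  shows "openin M U" "open (\<phi> ` U)" "homeomorphic_map (subtopology M U) (top_of_set (\<phi> ` U)) \<phi>"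
    "C1_on (f \<circ> inv_into U \<phi>) (\<phi> ` U)"
  using assms manifold smooth by (auto simp: closed_connected_C1_manifold_def C1_atlas_def C1_function_def)

lemma chart_at: "x \<in> topspace M \<Longrightarrow> \<exists>U \<phi>. (U, \<phi>) \<in> A \<and> x \<in> U"
proof -
  assume x: "x \<in> topspace M"
  have "(\<Union>(U, \<phi>)\<in>A. U) = topspace M"
    using manifold by (simp add: closed_connected_C1_manifold_def C1_atlas_def)
  then have "x \<in> (\<Union>(U, \<phi>)\<in>A. U)" using x by (rule ssubst)
  then show ?thesis by force
qed

lemma Cr_subset: "Cr \<subseteq> topspace M"
proof
  fix x assume "x \<in> Cr"
  then obtain U \<phi> where "(U, \<phi>) \<in> A" "x \<in> U" by (auto simp: critical_points_def)
  then show "x \<in> topspace M" using openin_subset[OF chart(1)] by blast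
qed

lemma chart_inverse:
  assumes "(U, \<phi>) \<in> A"
  shows "inj_on \<phi> U" "continuous_map (subtopology M U) (top_of_set (\<phi> ` U)) \<phi>"
    "continuous_map (top_of_set (\<phi> ` U)) M (inv_into U \<phi>)"
proof -
  have U: "topspace (subtopology M U) = U" using openin_subset[OF chart(1)[OF assms]] by auto
  note h = chart(3)[OF assms]
  show inj: "inj_on \<phi> U" using homeomorphic_imp_injective_map[OF h] U by simp
  show "continuous_map (subtopology M U) (top_of_set (\<phi> ` U)) \<phi>" by (rule homeomorphic_imp_continuous_map[OF h])
  obtain k where k: "homeomorphic_maps (subtopology M U) (top_of_set (\<phi> ` U)) \<phi> k"
    using h by (auto simp: homeomorphic_map_maps)
  then have "continuous_map (top_of_set (\<phi> ` U)) (subtopology M U) k" "\<And>x. x \<in> U \<Longrightarrow> k (\<phi> x) = x"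
    using U by (auto simp: homeomorphic_maps_def)
  then have "continuous_map (top_of_set (\<phi> ` U)) (subtopology M U) (inv_into U \<phi>)"
    by (rule_tac continuous_map_eq[of _ _ k]) (use inj in auto)
  then show "continuous_map (top_of_set (\<phi> ` U)) M (inv_into U \<phi>)" by (simp add: continuous_map_in_subtopology)
qed

lemma chart_image_open:
  assumes c: "(U, \<phi>) \<in> A" and W: "openin M W"
  shows "open (\<phi> ` (U \<inter> W))"
proof -
  have "openin (top_of_set (\<phi> ` U)) {y \<in> topspace (top_of_set (\<phi> ` U)). inv_into U \<phi> y \<in> W}"
    by (rule openin_continuous_map_preimage[OF chart_inverse(3)[OF c] W])
  moreover have "{y \<in> topspace (top_of_set (\<phi> ` U)). inv_into U \<phi> y \<in> W} = \<phi> ` (U \<inter> W)"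
    using chart_inverse(1)[OF c] by (auto simp: inv_into_f_f)
  ultimately show ?thesis using chart(2)[OF c] by (auto intro: openin_open_trans)
qed

lemma chart_preimage_open:
  assumes c: "(U, \<phi>) \<in> A" and T: "open T" shows "openin M {x \<in> U. \<phi> x \<in> T}"
proof -
  have "openin (top_of_set (\<phi> ` U)) (\<phi> ` U \<inter> T)" using T by (auto simp: openin_open)
  then have "openin (subtopology M U) {x \<in> topspace (subtopology M U). \<phi> x \<in> \<phi> ` U \<inter> T}"
    by (rule openin_continuous_map_preimage[OF chart_inverse(2)[OF c]])
  moreover have "{x \<in> topspace (subtopology M U). \<phi> x \<in> \<phi> ` U \<inter> T} = {x \<in> U. \<phi> x \<in> T}"
    using openin_subset[OF chart(1)[OF c]] by auto
  ultimately show ?thesis using openin_trans_full[OF _ chart(1)[OF c]] by simp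
qed

lemma f_continuous: "continuous_map M euclideanreal f"
proof (rule pasting_lemma[where I = A and T = fst and f = "\<lambda>_. f"])
  fix c assume "c \<in> A"
  then obtain U \<phi> where c: "c = (U, \<phi>)" "(U, \<phi>) \<in> A" by (cases c) auto
  show "openin M (fst c)" using chart(1)[OF c(2)] c(1) by simp
  obtain g' where g': "\<And>y. y \<in> \<phi> ` U \<Longrightarrow> ((f \<circ> inv_into U \<phi>) has_derivative blinfun_apply (g' y)) (at y)"
    using chart(4)[OF c(2)] unfolding C1_on_def by blast
  have "continuous_on (\<phi> ` U) (f \<circ> inv_into U \<phi>)"
    by (intro continuous_at_imp_continuous_on ballI has_derivative_continuous[OF g'])
  then have "continuous_map (subtopology M U) euclideanreal ((f \<circ> inv_into U \<phi>) \<circ> \<phi>)"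
    by (intro continuous_map_compose[OF chart_inverse(2)[OF c(2)]]) simp
  then have "continuous_map (subtopology M U) euclideanreal f"
    by (rule continuous_map_eq) (use chart_inverse(1)[OF c(2)] in auto)
  then show "continuous_map (subtopology M (fst c)) euclideanreal f" using c(1) by simp
next
  fix x assume "x \<in> topspace M"
  then show "\<exists>j. j \<in> A \<and> x \<in> fst j \<and> f x = f x" using chart_at[of x] by force
qed auto

lemma open_strip: "openin M {x \<in> topspace M. f x \<in> S}" if "open S"
  using openin_continuous_map_preimage[OF f_continuous, of S] that by simp

text \<open>By the chain rule, as the transition maps are differentiable.\<close>

lemma critical_in_chart:
  assumes c: "(U, \<phi>) \<in> A" and x: "x \<in> U" "x \<in> Cr"
  shows "((f \<circ> inv_into U \<phi>) has_derivative (\<lambda>_. 0)) (at (\<phi> x))"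
proof -
  obtain V \<psi> where v: "(V, \<psi>) \<in> A" "x \<in> V" "((f \<circ> inv_into V \<psi>) has_derivative (\<lambda>_. 0)) (at (\<psi> x))"
    using x(2) by (auto simp: critical_points_def)
  have "C1_on (\<psi> \<circ> inv_into U \<phi>) (\<phi> ` (U \<inter> V))"
    using manifold c v(1) by (fastforce simp: closed_connected_C1_manifold_def C1_atlas_def)
  then obtain D where D: "((\<psi> \<circ> inv_into U \<phi>) has_derivative D) (at (\<phi> x))"
    using x(1) v(2) unfolding C1_on_def by blast
  have inv: "inv_into U \<phi> (\<phi> x) = x" using chart_inverse(1)[OF c] x(1) by simp
  have "((f \<circ> inv_into V \<psi>) has_derivative (\<lambda>_. 0)) (at ((\<psi> \<circ> inv_into U \<phi>) (\<phi> x)))" using v(3) inv by simp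
  then have d: "((f \<circ> inv_into V \<psi>) \<circ> (\<psi> \<circ> inv_into U \<phi>) has_derivative (\<lambda>_. 0) \<circ> D) (at (\<phi> x))"
    by (rule diff_chain_at[OF D])
  show ?thesis
  proof (rule has_derivative_transform_within_open)
    show "((f \<circ> inv_into V \<psi>) \<circ> (\<psi> \<circ> inv_into U \<phi>) has_derivative (\<lambda>_. 0)) (at (\<phi> x))" using d by (simp add: o_def)
    show "open (\<phi> ` (U \<inter> V))" by (rule chart_image_open[OF c chart(1)[OF v(1)]])
    show "\<phi> x \<in> \<phi> ` (U \<inter> V)" using x(1) v(2) by blast
    fix y assume "y \<in> \<phi> ` (U \<inter> V)"
    then show "((f \<circ> inv_into V \<psi>) \<circ> (\<psi> \<circ> inv_into U \<phi>)) y = (f \<circ> inv_into U \<phi>) y"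
      using chart_inverse(1)[OF c] chart_inverse(1)[OF v(1)] by auto
  qed
qed

text \<open>In a straightened ball \<open>f\<close> is a linear function: its level sets in the ball are
  convex, hence connected, and it is an open map.\<close>

lemma regular_nbhd:
  assumes x: "x \<in> topspace M" "x \<notin> Cr"
  obtains U where "openin M U" "x \<in> U"
    "\<And>y z. y \<in> U \<Longrightarrow> z \<in> U \<Longrightarrow> f y = f z \<Longrightarrow> \<exists>C. connectedin M C \<and> y \<in> C \<and> z \<in> C \<and> (\<forall>w\<in>C. f w = f y)"
    "\<And>V. openin M V \<Longrightarrow> x \<in> V \<Longrightarrow> \<exists>d>0. {f x - d<..<f x + d} \<subseteq> f ` V"
proof -
  obtain U \<phi> where c: "(U, \<phi>) \<in> A" "x \<in> U" using chart_at[OF x(1)] by blast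
  let ?g = "f \<circ> inv_into U \<phi>"
  note inj = chart_inverse(1)[OF c(1)]
  have fg: "f y = ?g (\<phi> y)" if "y \<in> U" for y using inj that by simp
  have reg: "\<not> (?g has_derivative (\<lambda>_. 0)) (at (\<phi> x))" using x(2) c by (auto simp: critical_points_def)
  have "\<phi> x \<in> \<phi> ` U" using c(2) by blast
  obtain W T \<Phi> \<Psi> and e :: "real ^ 'n" where W: "open W" "\<phi> x \<in> W" "W \<subseteq> \<phi> ` U" "open T" "homeomorphism W T \<Phi> \<Psi>"
    and e: "norm e = 1" and ge: "\<And>w. w \<in> W \<Longrightarrow> ?g w = \<Phi> w \<bullet> e"
    by (rule regular_point_straightening[OF chart(4)[OF c(1)] chart(2)[OF c(1)] \<open>\<phi> x \<in> \<phi> ` U\<close> reg], rule that)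
  note hm = W(5)[unfolded homeomorphism_def]
  have \<Psi>W: "\<Psi> t \<in> W" "\<Phi> (\<Psi> t) = t" if "t \<in> T" for t using hm that by auto
  have \<Phi>T: "\<Phi> w \<in> T" "\<Psi> (\<Phi> w) = w" if "w \<in> W" for w using hm that by auto
  obtain r where r: "r > 0" "ball (\<Phi> (\<phi> x)) r \<subseteq> T"
    using W(4) \<Phi>T(1)[OF W(2)] open_contains_ball by blast
  define B where "B = ball (\<Phi> (\<phi> x)) r"
  have BT: "B \<subseteq> T" using r by (simp add: B_def)
  have open\<Psi>: "open (\<Psi> ` D)" if "open D" "D \<subseteq> T" for D
  proof -
    have "\<Psi> ` D = W \<inter> \<Phi> -` D" using \<Psi>W \<Phi>T that(2) by force
    moreover have "open (W \<inter> \<Phi> -` D)" using hm that(1) W(1) continuous_open_preimage by blast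
    ultimately show ?thesis by simp
  qed
  define U0 where "U0 = {y \<in> U. \<phi> y \<in> \<Psi> ` B}"
  have "openin M U0" unfolding U0_def by (rule chart_preimage_open[OF c(1) open\<Psi>[OF _ BT]]) (simp add: B_def)
  moreover have "x \<in> U0"
    unfolding U0_def using c(2) \<Phi>T(2)[OF W(2)] r(1) by (auto simp: B_def intro!: image_eqI[of _ _ "\<Phi> (\<phi> x)"])
  moreover have "\<exists>C. connectedin M C \<and> y \<in> C \<and> z \<in> C \<and> (\<forall>w\<in>C. f w = f y)" if yz: "y \<in> U0" "z \<in> U0" "f y = f z" for y z
  proof -
    let ?D = "B \<inter> {t. e \<bullet> t = f y}"
    let ?C = "inv_into U \<phi> ` \<Psi> ` ?D"
    have mem: "v \<in> ?C" if v: "v \<in> U0" "f v = f y" for v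
    proof -
      obtain t where t: "t \<in> B" "\<phi> v = \<Psi> t" using v(1) by (auto simp: U0_def)
      have "f v = t \<bullet> e" using fg[of v] v(1) t ge[of "\<Psi> t"] \<Psi>W BT by (auto simp: U0_def)
      then have "t \<in> ?D" using t(1) v(2) by (simp add: inner_commute)
      moreover have "v = inv_into U \<phi> (\<Psi> t)" using t(2) v(1) inj by (auto simp: U0_def simp flip: t(2))
      ultimately show ?thesis by blast
    qed
    have "convex ?D" unfolding B_def by (intro convex_Int convex_ball convex_hyperplane)
    then have "connected ?D" by (rule convex_connected)
    moreover have "continuous_on ?D \<Psi>" using hm BT by (auto intro: continuous_on_subset)
    ultimately have "connected (\<Psi> ` ?D)" by (rule connected_continuous_image[rotated])
    moreover have "\<Psi> ` ?D \<subseteq> W" using \<Psi>W BT by blast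
    then have "\<Psi> ` ?D \<subseteq> \<phi> ` U" using W(3) by (rule subset_trans)
    ultimately have "connectedin (top_of_set (\<phi> ` U)) (\<Psi> ` ?D)"
      by (simp add: connectedin_subtopology)
    then have "connectedin M ?C"
      by (rule connectedin_continuous_map_image[OF chart_inverse(3)[OF c(1)]])
    moreover have "f w = f y" if w: "w \<in> ?C" for w
    proof -
      obtain t where t: "t \<in> B" "e \<bullet> t = f y" "w = inv_into U \<phi> (\<Psi> t)" using w by auto
      have "?g (\<Psi> t) = t \<bullet> e" using ge[of "\<Psi> t"] \<Psi>W BT t(1) by auto
      then show ?thesis using t by (simp add: inner_commute)
    qed
    moreover have "y \<in> ?C" "z \<in> ?C" using mem[OF yz(1)] mem[OF yz(2)] yz(3) by simp_all
    ultimately show ?thesis by (intro exI[of _ ?C] conjI ballI)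
  qed
  moreover have "\<exists>d>0. {f x - d<..<f x + d} \<subseteq> f ` V" if V: "openin M V" "x \<in> V" for V
  proof -
    have "open (\<phi> ` (U \<inter> V))" by (rule chart_image_open[OF c(1) V(1)])
    then have o: "open (W \<inter> \<phi> ` (U \<inter> V))" using W(1) by auto
    have "T \<inter> \<Psi> -` Q = \<Phi> ` Q" if "Q \<subseteq> W" for Q using \<Psi>W \<Phi>T that by force
    from this[of "W \<inter> \<phi> ` (U \<inter> V)"]
    have "T \<inter> \<Psi> -` (W \<inter> \<phi> ` (U \<inter> V)) = \<Phi> ` (W \<inter> \<phi> ` (U \<inter> V))" by simp
    moreover have "open (T \<inter> \<Psi> -` (W \<inter> \<phi> ` (U \<inter> V)))" using hm o W(4) continuous_open_preimage by blast
    ultimately have "open (\<Phi> ` (W \<inter> \<phi> ` (U \<inter> V)))" by simp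
    moreover have "\<Phi> (\<phi> x) \<in> \<Phi> ` (W \<inter> \<phi> ` (U \<inter> V))" using W(2) c(2) V(2) by blast
    ultimately obtain d where d: "d > 0" "ball (\<Phi> (\<phi> x)) d \<subseteq> \<Phi> ` (W \<inter> \<phi> ` (U \<inter> V))"
      using open_contains_ball by blast
    have "s \<in> f ` V" if s: "s \<in> {f x - d<..<f x + d}" for s
    proof -
      let ?t = "\<Phi> (\<phi> x) + (s - f x) *\<^sub>R e"
      have "?t \<in> ball (\<Phi> (\<phi> x)) d" using s e by (auto simp: dist_norm)
      then obtain v where v: "v \<in> U" "v \<in> V" "\<phi> v \<in> W" "?t = \<Phi> (\<phi> v)" using d(2) by auto
      have "f v = ?t \<bullet> e" using fg[OF v(1)] ge[OF v(3)] v(4) by simp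
      also have "\<dots> = f x + (s - f x) * (e \<bullet> e)"
        using fg[OF c(2)] ge[OF W(2)] by (simp add: inner_add_left)
      also have "\<dots> = s" using e by (simp add: dot_square_norm)
      finally show ?thesis using v(2) by auto
    qed
    then show ?thesis using d(1) by blast
  qed
  ultimately show thesis by (rule that)
qed

text \<open>The derivative in a chart is continuous, so it stays nonzero near a regular point.\<close>

lemma regular_open: "openin M (topspace M - Cr)"
proof (subst openin_subopen, intro ballI)
  fix x assume x: "x \<in> topspace M - Cr"
  obtain U \<phi> where c: "(U, \<phi>) \<in> A" "x \<in> U" using chart_at x by blast
  let ?g = "f \<circ> inv_into U \<phi>"
  obtain g' where g': "\<And>y. y \<in> \<phi> ` U \<Longrightarrow> (?g has_derivative blinfun_apply (g' y)) (at y)" "continuous_on (\<phi> ` U) g'"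
    using chart(4)[OF c(1)] unfolding C1_on_def by blast
  have "g' (\<phi> x) \<noteq> 0"
  proof
    assume "g' (\<phi> x) = 0"
    then have "(?g has_derivative (\<lambda>_. 0)) (at (\<phi> x))" using g'(1)[of "\<phi> x"] c(2) by (simp add: zero_blinfun.rep_eq)
    then show False using x c by (auto simp: critical_points_def)
  qed
  let ?T = "\<phi> ` U \<inter> g' -` (- {0})"
  have T: "open ?T" by (rule continuous_open_preimage[OF g'(2) chart(2)[OF c(1)]]) auto
  show "\<exists>T. openin M T \<and> x \<in> T \<and> T \<subseteq> topspace M - Cr"
  proof (intro exI[of _ "{y \<in> U. \<phi> y \<in> ?T}"] conjI)
    show "openin M {y \<in> U. \<phi> y \<in> ?T}" by (rule chart_preimage_open[OF c(1) T])
    show "x \<in> {y \<in> U. \<phi> y \<in> ?T}" using c(2) \<open>g' (\<phi> x) \<noteq> 0\<close> by simp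
    show "{y \<in> U. \<phi> y \<in> ?T} \<subseteq> topspace M - Cr"
    proof
      fix y assume y: "y \<in> {y \<in> U. \<phi> y \<in> ?T}"
      have "y \<notin> Cr"
      proof
        assume "y \<in> Cr"
        then have "(?g has_derivative (\<lambda>_. 0)) (at (\<phi> y))" using critical_in_chart[OF c(1)] y by auto
        moreover have "(?g has_derivative blinfun_apply (g' (\<phi> y))) (at (\<phi> y))" using g'(1) y by auto
        ultimately have "blinfun_apply (g' (\<phi> y)) = (\<lambda>_. 0)" by (rule has_derivative_unique[symmetric])
        then have "g' (\<phi> y) = 0" by (intro blinfun_eqI) (simp add: zero_blinfun.rep_eq)
        then show False using y by simp
      qed
      then show "y \<in> topspace M - Cr" using y openin_subset[OF chart(1)[OF c(1)]] by auto
    qed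
  qed
qed

lemma closedin_Cr: "closedin M Cr"
  using regular_open Cr_subset by (simp add: closedin_def)

text \<open>The set of critical points is closed in a compact space, and its points are isolated.\<close>

lemma finite_Cr: "finite Cr"
proof -
  have "compactin M Cr" by (rule closedin_compact_space[OF M_compact closedin_Cr])
  let ?\<U> = "{U. openin M U \<and> (\<exists>x. U \<inter> Cr \<subseteq> {x})}"
  have "Cr \<subseteq> \<Union>?\<U>"
  proof
    fix x assume x: "x \<in> Cr"
    then obtain U where U: "openin M U" "U \<inter> Cr = {x}" using isolated by (auto simp: isolated_points_def)
    then have "U \<in> ?\<U>" "x \<in> U" by auto
    then show "x \<in> \<Union>?\<U>" by blast
  qed
  then obtain \<F> where F: "finite \<F>" "\<F> \<subseteq> ?\<U>" "Cr \<subseteq> \<Union>\<F>"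
    using compactinD[OF \<open>compactin M Cr\<close>, of ?\<U>] by auto
  have "Cr = (\<Union>U\<in>\<F>. U \<inter> Cr)" using F(3) by blast
  moreover have "finite (\<Union>U\<in>\<F>. U \<inter> Cr)"
  proof (rule finite_UN_I[OF F(1)])
    fix U assume "U \<in> \<F>"
    then obtain x where "U \<inter> Cr \<subseteq> {x}" using F(2) by blast
    then show "finite (U \<inter> Cr)" by (rule finite_subset) simp
  qed
  ultimately show ?thesis by simp
qed

section \<open>The Reeb space\<close>

abbreviation "\<pi> \<equiv> reeb_projection M f"
abbreviation "Y \<equiv> reeb_graph M f"

lemma quotient_\<pi>: "quotient_map M Y \<pi>"
  unfolding reeb_graph_def by (rule quotient_map_quotient_topology)

lemma continuous_\<pi>: "continuous_map M Y \<pi>"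
  by (rule quotient_imp_continuous_map[OF quotient_\<pi>])

lemma topspace_Y: "topspace Y = \<pi> ` topspace M"
  by (simp add: reeb_graph_def topspace_quotient_topology)

lemma fibre:
  assumes "x \<in> topspace M"
  shows "x \<in> \<pi> x" "connectedin M (\<pi> x)" "\<And>y. y \<in> \<pi> x \<Longrightarrow> y \<in> topspace M \<and> f y = f x \<and> \<pi> y = \<pi> x"
proof -
  let ?Q = "subtopology M (level_set M f (f x))"
  have xQ: "x \<in> topspace ?Q" using assms by (simp add: level_set_def)
  show "x \<in> \<pi> x" using xQ by (simp add: reeb_projection_def connected_component_of_refl)
  have "connectedin ?Q (\<pi> x)" unfolding reeb_projection_def by (rule connectedin_connected_component_of)
  then show "connectedin M (\<pi> x)" by (simp add: connectedin_subtopology)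
  fix y assume y: "y \<in> \<pi> x"
  then have c: "connected_component_of ?Q x y" by (simp add: reeb_projection_def)
  then have "y \<in> topspace ?Q" by (simp add: connected_component_of_equiv)
  then have "y \<in> topspace M" "f y = f x" by (auto simp: level_set_def)
  moreover have "connected_component_of ?Q x = connected_component_of ?Q y" using c by (simp add: connected_component_of_equiv)
  ultimately show "y \<in> topspace M \<and> f y = f x \<and> \<pi> y = \<pi> x" by (simp add: reeb_projection_def)
qed

lemma fibre_connected:
  assumes "connectedin M C" "x \<in> C" "y \<in> C" "\<And>w. w \<in> C \<Longrightarrow> f w = f x"
  shows "\<pi> x = \<pi> y"
proof -
  have "C \<subseteq> level_set M f (f x)"
  proof
    fix w assume w: "w \<in> C"
    then have "w \<in> topspace M" using connectedin_subset_topspace[OF assms(1)] by blast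
    then show "w \<in> level_set M f (f x)" using assms(4)[OF w] by (simp add: level_set_def)
  qed
  then have "connectedin (subtopology M (level_set M f (f x))) C"
    using assms(1) by (simp add: connectedin_subtopology)
  then have "C \<subseteq> \<pi> x" unfolding reeb_projection_def by (rule connected_component_of_maximal[OF _ assms(2)])
  then have "y \<in> \<pi> x" using assms(3) by (rule subsetD)
  moreover have "x \<in> topspace M" using assms(2) connectedin_subset_topspace[OF assms(1)] by blast
  ultimately show ?thesis using fibre(3)[of x y] by simp
qed

text \<open>The function induced by \<open>f\<close> on the Reeb space; all points of a class have the same
  value.\<close>

definition fbar :: "'a set \<Rightarrow> real" where "fbar K = f (SOME x. x \<in> K)"

lemma fbar: "x \<in> topspace M \<Longrightarrow> fbar (\<pi> x) = f x"
proof -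
  assume x: "x \<in> topspace M"
  have "(SOME y. y \<in> \<pi> x) \<in> \<pi> x" by (rule someI[where P = "\<lambda>y. y \<in> \<pi> x", OF fibre(1)[OF x]])
  then show ?thesis using fibre(3)[OF x] by (simp add: fbar_def)
qed

lemma continuous_fbar: "continuous_map Y euclideanreal fbar"
proof (rule continuous_compose_quotient_map[OF quotient_\<pi>])
  show "continuous_map M euclideanreal (fbar \<circ> \<pi>)"
    using f_continuous by (rule continuous_map_eq) (simp add: fbar)
qed

lemma open_fbar: "open S \<Longrightarrow> openin Y {y \<in> topspace Y. fbar y \<in> S}"
  using openin_continuous_map_preimage[OF continuous_fbar, of S] by simp

lemma openin_Y: "openin Y V \<longleftrightarrow> V \<subseteq> topspace Y \<and> openin M {x \<in> topspace M. \<pi> x \<in> V}"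
  unfolding reeb_graph_def openin_quotient_topology topspace_quotient_topology ..

lemma saturated_image_open:
  assumes P: "openin M P" and sat: "\<And>x. x \<in> P \<Longrightarrow> \<pi> x \<subseteq> P"
  shows "openin Y (\<pi> ` P)"
proof -
  have "{x \<in> topspace M. \<pi> x \<in> \<pi> ` P} = P"
  proof (intro subset_antisym subsetI)
    fix x assume "x \<in> {x \<in> topspace M. \<pi> x \<in> \<pi> ` P}"
    then obtain p where "x \<in> topspace M" "p \<in> P" "\<pi> x = \<pi> p" by auto
    then show "x \<in> P" using fibre(1)[of x] sat[of p] by auto
  qed (use openin_subset[OF P] in auto)
  then show ?thesis using P openin_subset[OF P] by (auto simp: openin_Y topspace_Y)
qed

text \<open>Classes on different levels are separated by \<open>fbar\<close>. Two classes on one level are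
  distinct components, hence distinct quasi-components, of a compact Hausdorff space, so a clopen partition of
  the level separates them. Disjoint neighbourhoods of the two parts contain all nearby levels by compactness;
  restricted to nearby levels they are unions of classes.\<close>

lemma Y_Hausdorff: "Hausdorff_space Y"
  unfolding Hausdorff_space_def
proof (intro allI impI)
  fix y1 y2 assume "y1 \<in> topspace Y \<and> y2 \<in> topspace Y \<and> y1 \<noteq> y2"
  then obtain x1 x2 where x: "x1 \<in> topspace M" "y1 = \<pi> x1" "x2 \<in> topspace M" "y2 = \<pi> x2" and ne: "\<pi> x1 \<noteq> \<pi> x2"
    unfolding topspace_Y by auto
  show "\<exists>U V. openin Y U \<and> openin Y V \<and> y1 \<in> U \<and> y2 \<in> V \<and> disjnt U V"
  proof (cases "f x1 = f x2")
    case False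
    then obtain S T where ST: "open S" "open T" "f x1 \<in> S" "f x2 \<in> T" "S \<inter> T = {}" using hausdorff by metis
    show ?thesis
      by (rule exI[of _ "{y \<in> topspace Y. fbar y \<in> S}"], rule exI[of _ "{y \<in> topspace Y. fbar y \<in> T}"])
        (use ST x open_fbar in \<open>auto simp: disjnt_def topspace_Y fbar\<close>)
  next
    case True
    define c where "c = f x1"
    let ?Q = "subtopology M (level_set M f c)"
    have clQ: "closedin M (level_set M f c)"
      using closedin_continuous_map_preimage[OF f_continuous, of "{c}"] by (simp add: level_set_def)
    have xQ: "x1 \<in> topspace ?Q" "x2 \<in> topspace ?Q" using x True by (auto simp: c_def level_set_def)
    have Qc: "compact_space ?Q"
      using closedin_compact_space[OF M_compact clQ] by (simp add: compact_space_subtopology)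
    have Qh: "Hausdorff_space ?Q" using M_Hausdorff by (rule Hausdorff_space_subtopology)
    have "\<not> connected_component_of ?Q x1 x2"
      using fibre(3)[of x1 x2] x ne by (auto simp: reeb_projection_def c_def)
    then have "\<not> quasi_component_of ?Q x1 x2"
    proof -
      have qc: "quasi_component_of_set ?Q x1 \<in> quasi_components_of ?Q" using xQ by (simp add: quasi_components_of_def)
      have "compactin ?Q (quasi_component_of_set ?Q x1)"
        by (rule closedin_compact_space[OF Qc closedin_quasi_component_of])
      then have "quasi_component_of_set ?Q x1 \<in> connected_components_of ?Q"
        using compact_quasi_eq_connected_components_of[OF _ Qh] qc compact_imp_locally_compact_space[OF Qc] by blast
      then have "connectedin ?Q (quasi_component_of_set ?Q x1)" by (rule connectedin_connected_components_of)
      then show "\<not> connected_component_of ?Q x1 x2 \<Longrightarrow> \<not> quasi_component_of ?Q x1 x2"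
        using quasi_eq_connected_component_of_eq by metis
    qed
    then obtain T where T: "x1 \<in> T" "closedin ?Q T" "openin ?Q T" "x2 \<notin> T"
      using xQ by (auto simp: quasi_component_of)
    define T' where "T' = level_set M f c - T"
    have T': "closedin ?Q T'"
      using T(3) xQ by (auto simp: T'_def closedin_def level_set_def openin_subtopology)
    have cl: "closedin M T" "closedin M T'" using T(2) T' clQ closedin_trans_full by blast+
    have "compactin M T" "compactin M T'" using cl closedin_compact_space[OF M_compact] by auto
    moreover have "disjnt T T'" by (auto simp: disjnt_def T'_def)
    ultimately obtain O1 O2 where O: "openin M O1" "openin M O2" "T \<subseteq> O1" "T' \<subseteq> O2" "disjnt O1 O2"
      by (rule Hausdorff_space_compact_separation[OF M_Hausdorff])
    have "closedin M (topspace M - (O1 \<union> O2))" using O by (intro closedin_diff) auto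
    then have "compactin M (topspace M - (O1 \<union> O2))" by (rule closedin_compact_space[OF M_compact])
    then have "compact (f ` (topspace M - (O1 \<union> O2)))"
      using image_compactin[OF _ f_continuous] by auto
    then have clf: "closed (f ` (topspace M - (O1 \<union> O2)))" by (rule compact_imp_closed)
    have cO: "c \<notin> f ` (topspace M - (O1 \<union> O2))"
    proof
      assume "c \<in> f ` (topspace M - (O1 \<union> O2))"
      then obtain z where z: "z \<in> topspace M" "z \<notin> O1" "z \<notin> O2" "f z = c" by auto
      then have "z \<in> T \<or> z \<in> T'" by (auto simp: T'_def level_set_def)
      then show False using z O by auto
    qed
    have oN: "open (- f ` (topspace M - (O1 \<union> O2)))" by (rule open_Compl[OF clf])
    define N where "N = {x \<in> topspace M. f x \<in> - f ` (topspace M - (O1 \<union> O2))}"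
    have N: "openin M N" unfolding N_def by (rule open_strip[OF oN])
    have NO: "N \<subseteq> O1 \<union> O2" by (auto simp: N_def)
    have sat: "\<pi> x \<subseteq> N \<inter> G" if x: "x \<in> N \<inter> G" and G: "G = O1 \<or> G = O2" for x G
    proof -
      have xM: "x \<in> topspace M" using x by (auto simp: N_def)
      have 1: "\<pi> x \<subseteq> N" using fibre(3)[OF xM] x by (auto simp: N_def)
      have "\<not> (\<exists>E1 E2. openin M E1 \<and> openin M E2 \<and> \<pi> x \<subseteq> E1 \<union> E2 \<and> E1 \<inter> E2 \<inter> \<pi> x = {} \<and> E1 \<inter> \<pi> x \<noteq> {} \<and> E2 \<inter> \<pi> x \<noteq> {})"
        using fibre(2)[OF xM] unfolding connectedin by blast
      then have "O1 \<inter> \<pi> x = {} \<or> O2 \<inter> \<pi> x = {}"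
        using O(1,2,5) 1 NO unfolding disjnt_def by blast
      then have "\<pi> x \<subseteq> G" using G x fibre(1)[OF xM] 1 NO by blast
      then show ?thesis using 1 by blast
    qed
    have o: "openin Y (\<pi> ` (N \<inter> O1))" "openin Y (\<pi> ` (N \<inter> O2))"
      by (rule saturated_image_open; use N O sat in blast)+
    have "x1 \<in> N \<inter> O1" "x2 \<in> N \<inter> O2"
      using x T O cO True by (auto simp: N_def c_def T'_def level_set_def)
    moreover have "disjnt (\<pi> ` (N \<inter> O1)) (\<pi> ` (N \<inter> O2))"
    proof (rule ccontr)
      assume "\<not> ?thesis"
      then obtain p q where pq: "p \<in> N \<inter> O1" "q \<in> N \<inter> O2" "\<pi> p = \<pi> q" by (auto simp: disjnt_def)
      have "q \<in> topspace M" using pq by (auto simp: N_def)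
      then have "q \<in> \<pi> p" using fibre(1) pq(3) by simp
      then show False using sat[OF pq(1)] pq(2) O(5) by (auto simp: disjnt_def)
    qed
    ultimately show ?thesis using o x by blast
  qed
qed

lemma closed_\<pi>: "closed_map M Y \<pi>"
  by (rule continuous_imp_closed_map[OF continuous_\<pi> M_compact Y_Hausdorff])

lemma Y_compact: "compact_space Y"
  using image_compactin[OF _ continuous_\<pi>, of "topspace M"] M_compact by (simp add: compact_space_def topspace_Y)

lemma Y_connected: "connected_space Y"
  by (rule connected_space_quotient_map_image[OF quotient_\<pi> M_connected])

abbreviation "V \<equiv> \<pi> ` Cr"

lemma V_subset: "V \<subseteq> topspace Y" using Cr_subset by (auto simp: topspace_Y)

text \<open>Near a regular point \<open>f\<close> takes all nearby values.\<close>

lemma fbar_open_map: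
  assumes O: "openin Y S" "S \<inter> V = {}" shows "open (fbar ` S)"
proof (rule openI)
  fix s assume "s \<in> fbar ` S"
  then obtain y where y: "y \<in> S" "s = fbar y" by auto
  then obtain x where x: "x \<in> topspace M" "y = \<pi> x" using openin_subset[OF O(1)] by (auto simp: topspace_Y)
  have "x \<notin> Cr" using y x O(2) by auto
  then obtain U where "\<And>W. openin M W \<Longrightarrow> x \<in> W \<Longrightarrow> \<exists>d>0. {f x - d<..<f x + d} \<subseteq> f ` W"
    using regular_nbhd[OF x(1)] by metis
  moreover have "openin M {z \<in> topspace M. \<pi> z \<in> S}" using O(1) by (simp add: openin_Y)
  ultimately obtain d where d: "d > 0" "{f x - d<..<f x + d} \<subseteq> f ` {z \<in> topspace M. \<pi> z \<in> S}"
    using x y by blast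
  have "f ` {z \<in> topspace M. \<pi> z \<in> S} \<subseteq> fbar ` S"
  proof (intro image_subsetI)
    fix z assume "z \<in> {z \<in> topspace M. \<pi> z \<in> S}"
    then show "f z \<in> fbar ` S" using fbar[of z] by (intro image_eqI[of _ _ "\<pi> z"]) auto
  qed
  with d(2) have "{f x - d<..<f x + d} \<subseteq> fbar ` S" by (rule subset_trans)
  moreover have "ball s d = {f x - d<..<f x + d}" using fbar[OF x(1)] x y by (auto simp: dist_real_def)
  ultimately have "ball s d \<subseteq> fbar ` S" by simp
  then show "\<exists>e>0. ball s e \<subseteq> fbar ` S" using d(1) by blast
qed

end

context closed_C1_function
begin

lemma regular_fibre_nbhd:
  assumes z: "z \<in> topspace M" "z \<notin> Cr"
  obtains U where "openin M U" "z \<in> U" "\<And>w w'. w \<in> U \<Longrightarrow> w' \<in> U \<Longrightarrow> f w = f w' \<Longrightarrow> \<pi> w = \<pi> w'"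
    "\<And>S. openin M S \<Longrightarrow> z \<in> S \<Longrightarrow> \<exists>d>0. {f z - d<..<f z + d} \<subseteq> f ` S"
proof -
  obtain U where U: "openin M U" "z \<in> U"
    "\<And>w w'. w \<in> U \<Longrightarrow> w' \<in> U \<Longrightarrow> f w = f w' \<Longrightarrow> \<exists>C. connectedin M C \<and> w \<in> C \<and> w' \<in> C \<and> (\<forall>v\<in>C. f v = f w)"
    "\<And>S. openin M S \<Longrightarrow> z \<in> S \<Longrightarrow> \<exists>d>0. {f z - d<..<f z + d} \<subseteq> f ` S"
    by (rule regular_nbhd[OF z], rule that)
  have "\<pi> w = \<pi> w'" if w: "w \<in> U" "w' \<in> U" "f w = f w'" for w w'
  proof -
    obtain C where C: "connectedin M C" "w \<in> C" "w' \<in> C" "\<forall>v\<in>C. f v = f w" using U(3)[OF w] by blast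
    show ?thesis by (rule fibre_connected[OF C(1-3)]) (use C(4) in blast)
  qed
  then show thesis by (rule that[OF U(1,2) _ U(4)])
qed

lemma open_near_level: "openin M (S \<inter> {w \<in> topspace M. f w \<in> {c - d<..<c + d}})" if "openin M S"
  using open_strip[of "{c - d<..<c + d}"] that by (intro openin_Int) auto

text \<open>The relation \<open>Q z\<close> says that points near \<open>x\<close> and points near
  \<open>z\<close> with the same value of \<open>f\<close> are in the same class. It holds for \<open>z =
  x\<close> by the local structure at a regular point and is open and closed in \<open>z\<close>, hence holds
  on the whole connected class. By compactness of the class there is a neighbourhood of the class on which
  points with equal values are in the same class; as \<open>\<pi>\<close> is a closed map, it contains the
  preimage of a neighbourhood in the Reeb space.\<close>

lemma fbar_locally_injective:
  assumes x: "x \<in> topspace M" and reg: "\<pi> x \<inter> Cr = {}"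
  obtains S where "openin Y S" "\<pi> x \<in> S" "inj_on fbar S" "S \<inter> \<pi> ` Cr = {}"
proof -
  define compat where "compat N N' \<longleftrightarrow> (\<forall>w\<in>N. \<forall>w'\<in>N'. f w = f w' \<longrightarrow> \<pi> w = \<pi> w')" for N N'
  define Q where "Q z \<longleftrightarrow> (\<exists>N N'. openin M N \<and> x \<in> N \<and> openin M N' \<and> z \<in> N' \<and> compat N N')" for z
  have K: "w \<in> topspace M" "f w = f x" "\<pi> w = \<pi> x" "w \<notin> Cr" if "w \<in> \<pi> x" for w
    using fibre(3)[OF x that] reg that by auto
  have trans: "Q z" if z': "z' \<in> \<pi> x" "Q z'" and U: "openin M U" "z' \<in> U" "compat U U" "z \<in> U" for z z' U
  proof -
    obtain N N' where N: "openin M N" "x \<in> N" "openin M N'" "z' \<in> N'" "compat N N'" using z'(2) by (auto simp: Q_def)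
    obtain U0 where U0: "\<And>S. openin M S \<Longrightarrow> z' \<in> S \<Longrightarrow> \<exists>d>0. {f z' - d<..<f z' + d} \<subseteq> f ` S"
      using regular_fibre_nbhd[OF K(1)[OF z'(1)] K(4)[OF z'(1)]] by blast
    have "openin M (N' \<inter> U)" "z' \<in> N' \<inter> U" using N U by auto
    from U0[OF this] obtain d where d: "d > 0" "{f x - d<..<f x + d} \<subseteq> f ` (N' \<inter> U)" using K(2)[OF z'(1)] by auto
    let ?N1 = "N \<inter> {w \<in> topspace M. f w \<in> {f x - d<..<f x + d}}"
    have "compat ?N1 U"
      unfolding compat_def
    proof (intro ballI impI)
      fix w w' assume w: "w \<in> ?N1" "w' \<in> U" "f w = f w'"
      then obtain u where u: "u \<in> N'" "u \<in> U" "f w = f u" using d(2) by auto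
      have 1: "\<pi> w = \<pi> u" using N(5) w u unfolding compat_def by blast
      have "f u = f w'" using u(3) w(3) by (metis)
      then have "\<pi> u = \<pi> w'" using U(3) u(2) w(2) unfolding compat_def by blast
      with 1 show "\<pi> w = \<pi> w'" by simp
    qed
    moreover have "openin M ?N1" by (rule open_near_level[OF N(1)])
    moreover have "x \<in> ?N1" using N(2) x d(1) by simp
    ultimately show ?thesis using U(1,4) unfolding Q_def by blast
  qed
  have refl: "\<exists>U. openin M U \<and> z \<in> U \<and> compat U U" if z: "z \<in> \<pi> x" for z
  proof -
    obtain U where "openin M U" "z \<in> U" "\<And>w w'. w \<in> U \<Longrightarrow> w' \<in> U \<Longrightarrow> f w = f w' \<Longrightarrow> \<pi> w = \<pi> w'"
      by (rule regular_fibre_nbhd[OF K(1)[OF z] K(4)[OF z]], rule that)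
    then show ?thesis unfolding compat_def by blast
  qed
  have allQ: "Q z" if z: "z \<in> \<pi> x" for z
  proof (rule ccontr)
    assume nQ: "\<not> Q z"
    let ?E1 = "\<Union>{N. openin M N \<and> (\<forall>w\<in>N. Q w)}"
    let ?E2 = "\<Union>{U. openin M U \<and> (\<forall>w\<in>U \<inter> \<pi> x. \<not> Q w)}"
    have "openin M ?E1" "openin M ?E2" by (auto intro: openin_Union)
    moreover have "\<pi> x \<subseteq> ?E1 \<union> ?E2"
    proof
      fix w assume w: "w \<in> \<pi> x"
      show "w \<in> ?E1 \<union> ?E2"
      proof (cases "Q w")
        case True
        then obtain N N' where N: "openin M N" "x \<in> N" "openin M N'" "w \<in> N'" "compat N N'" by (auto simp: Q_def)
        then have "\<forall>v\<in>N'. Q v" unfolding Q_def by blast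
        then show ?thesis using N(3,4) by blast
      next
        case False
        obtain U where U: "openin M U" "w \<in> U" "compat U U" using refl[OF w] by blast
        have "\<not> Q v" if "v \<in> U \<inter> \<pi> x" for v
          using trans[of v U w] that U False by blast
        then show ?thesis using U(1,2) by blast
      qed
    qed
    moreover have "?E1 \<inter> ?E2 \<inter> \<pi> x = {}" by blast
    moreover have "?E1 \<inter> \<pi> x \<noteq> {}"
    proof -
      obtain U where U: "openin M U" "x \<in> U" "compat U U" using refl[OF fibre(1)[OF x]] by blast
      then have "\<forall>w\<in>U. Q w" unfolding Q_def by blast
      then show ?thesis using U fibre(1)[OF x] by blast
    qed
    moreover have "?E2 \<inter> \<pi> x \<noteq> {}"
    proof -
      obtain U where U: "openin M U" "z \<in> U" "compat U U" using refl[OF z] by blast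
      have "\<not> Q v" if "v \<in> U \<inter> \<pi> x" for v using trans[of v U z] that U nQ by blast
      then show ?thesis using U z by blast
    qed
    ultimately have "\<exists>E1 E2. openin M E1 \<and> openin M E2 \<and> \<pi> x \<subseteq> E1 \<union> E2 \<and> E1 \<inter> E2 \<inter> \<pi> x = {} \<and> E1 \<inter> \<pi> x \<noteq> {} \<and> E2 \<inter> \<pi> x \<noteq> {}"
      by (intro exI[of _ ?E1] exI[of _ ?E2] conjI)
    then show False using fibre(2)[OF x] unfolding connectedin by blast
  qed
  have "closedin Y {\<pi> x}" using closedin_Hausdorff_singleton[OF Y_Hausdorff] x by (auto simp: topspace_Y)
  then have "closedin M {w \<in> topspace M. \<pi> w \<in> {\<pi> x}}" by (rule closedin_continuous_map_preimage[OF continuous_\<pi>])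
  moreover have "{w \<in> topspace M. \<pi> w \<in> {\<pi> x}} = \<pi> x"
  proof (intro subset_antisym subsetI)
    fix w assume "w \<in> {w \<in> topspace M. \<pi> w \<in> {\<pi> x}}"
    then show "w \<in> \<pi> x" using fibre(1)[of w] by simp
  qed (use K in blast)
  ultimately have "compactin M (\<pi> x)" using closedin_compact_space[OF M_compact] by simp
  let ?\<U> = "{N'. openin M N' \<and> (\<exists>N. openin M N \<and> x \<in> N \<and> compat N N')}"
  have cov: "\<pi> x \<subseteq> \<Union>?\<U>"
  proof
    fix z assume "z \<in> \<pi> x"
    from allQ[OF this] obtain N N' where "openin M N" "x \<in> N" "openin M N'" "z \<in> N'" "compat N N'" by (auto simp: Q_def)
    then show "z \<in> \<Union>?\<U>" by blast
  qed
  have "\<exists>\<F>. finite \<F> \<and> \<F> \<subseteq> ?\<U> \<and> \<pi> x \<subseteq> \<Union>\<F>"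
    by (rule compactinD[OF \<open>compactin M (\<pi> x)\<close> _ cov]) blast
  then obtain \<F> where F: "finite \<F>" "\<F> \<subseteq> ?\<U>" "\<pi> x \<subseteq> \<Union>\<F>" by blast
  have "\<forall>N'\<in>\<F>. \<exists>N. openin M N \<and> x \<in> N \<and> compat N N'" using F(2) by blast
  from bchoice[OF this] obtain g where g: "\<And>N'. N' \<in> \<F> \<Longrightarrow> openin M (g N') \<and> x \<in> g N' \<and> compat (g N') N'" by blast
  define N where "N = topspace M \<inter> (\<Inter>N'\<in>\<F>. g N')"
  have "openin M N" unfolding N_def
    by (rule openin_Int_Inter) (use F(1) g in auto)
  moreover have "x \<in> N" using g x unfolding N_def by blast
  ultimately have N: "openin M N" "x \<in> N" .
  have NF: "\<pi> w = \<pi> w'" if w: "w \<in> N" "w' \<in> \<Union>\<F>" "f w = f w'" for w w'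
  proof -
    obtain N' where N': "N' \<in> \<F>" "w' \<in> N'" using w(2) by blast
    have "w \<in> g N'" using w(1) N'(1) by (auto simp: N_def)
    then show ?thesis using g[OF N'(1)] N'(2) w(3) unfolding compat_def by blast
  qed
  obtain U0 where "\<And>S. openin M S \<Longrightarrow> x \<in> S \<Longrightarrow> \<exists>d>0. {f x - d<..<f x + d} \<subseteq> f ` S"
    using regular_fibre_nbhd[OF K(1,4)[OF fibre(1)[OF x]]] by blast
  from this[OF N] obtain d where d: "d > 0" "{f x - d<..<f x + d} \<subseteq> f ` N" by blast
  define W where "W = (\<Union>\<F> - Cr) \<inter> {w \<in> topspace M. f w \<in> {f x - d<..<f x + d}}"
  have "openin M (\<Union>\<F>)" using F(2) by (intro openin_Union) auto
  then have "openin M W" unfolding W_def by (intro open_near_level openin_diff closedin_Cr)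
  then have "closedin M (topspace M - W)" by (intro closedin_diff) auto
  then have "closedin Y (\<pi> ` (topspace M - W))" using closed_\<pi> by (simp add: closed_map_def)
  then have "openin Y (topspace Y - \<pi> ` (topspace M - W))" by (intro openin_diff) auto
  moreover have "\<pi> x \<in> topspace Y - \<pi> ` (topspace M - W)"
  proof -
    have "\<pi> x \<subseteq> W" using F(3) K d(1) by (auto simp: W_def)
    then have "\<pi> w \<noteq> \<pi> x" if "w \<in> topspace M - W" for w using that fibre(1)[of w] by auto
    then show ?thesis using x by (auto simp: topspace_Y)
  qed
  moreover have "inj_on fbar (topspace Y - \<pi> ` (topspace M - W))"
  proof (rule inj_onI)
    fix y y' assume y: "y \<in> topspace Y - \<pi> ` (topspace M - W)" "y' \<in> topspace Y - \<pi> ` (topspace M - W)" "fbar y = fbar y'"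
    then obtain w w' where w: "w \<in> topspace M" "y = \<pi> w" "w' \<in> topspace M" "y' = \<pi> w'" by (auto simp: topspace_Y)
    then have ww: "w \<in> W" "w' \<in> W" "f w = f w'" using y by (auto simp: fbar)
    then obtain u where u: "u \<in> N" "f w = f u" using d(2) by (auto simp: W_def)
    have "\<pi> u = \<pi> w" "\<pi> u = \<pi> w'" using NF[OF u(1)] u(2) ww by (auto simp: W_def)
    then show "y = y'" using w by simp
  qed
  moreover have "(topspace Y - \<pi> ` (topspace M - W)) \<inter> \<pi> ` Cr = {}"
    using Cr_subset by (auto simp: W_def)
  ultimately show thesis by (rule that)
qed

text \<open>A piece of an open edge of the Reeb space, with \<open>fbar\<close> as coordinate.\<close>

definition branch :: "'a set set \<Rightarrow> bool" where
  "branch S \<longleftrightarrow> openin Y S \<and> S \<inter> V = {} \<and> inj_on fbar S \<and> connected (fbar ` S)"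

lemma branch_at:
  assumes y: "y \<in> topspace Y - V"
  obtains S where "branch S" "y \<in> S"
proof -
  obtain x where x: "x \<in> topspace M" "y = \<pi> x" using y by (auto simp: topspace_Y)
  have "\<pi> x \<inter> Cr = {}"
  proof (rule ccontr)
    assume "\<pi> x \<inter> Cr \<noteq> {}"
    then obtain k where k: "k \<in> \<pi> x" "k \<in> Cr" by blast
    then have "y = \<pi> k" using fibre(3)[OF x(1)] x(2) by simp
    then show False using y k(2) by blast
  qed
  then obtain S where S: "openin Y S" "\<pi> x \<in> S" "inj_on fbar S" "S \<inter> \<pi> ` Cr = {}"
    by (rule fbar_locally_injective[OF x(1)])
  have "open (fbar ` S)" by (rule fbar_open_map[OF S(1,4)])
  then obtain d where d: "d > 0" "ball (fbar y) d \<subseteq> fbar ` S" using S(2) x(2) open_contains_ball by blast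
  let ?S = "S \<inter> {z \<in> topspace Y. fbar z \<in> ball (fbar y) d}"
  have "openin Y ?S" by (rule openin_Int[OF S(1) open_fbar[OF open_ball]])
  moreover have "fbar ` ?S = ball (fbar y) d"
  proof (intro subset_antisym subsetI)
    fix s assume s: "s \<in> ball (fbar y) d"
    then obtain z where "z \<in> S" "s = fbar z" using d(2) by blast
    then show "s \<in> fbar ` ?S" using s openin_subset[OF S(1)] by blast
  qed blast
  moreover have "inj_on fbar ?S" using S(3) by (rule inj_on_subset) blast
  ultimately have "branch ?S" using S(4) by (auto simp: branch_def)
  moreover have "y \<in> ?S" using S(2) x d(1) y by auto
  ultimately show thesis by (rule that)
qed

text \<open>On the interval of common values, the set of values at which the two branches coincide is open
  because \<open>fbar\<close> is open, and its complement is open because the Reeb space is a Hausdorff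
  space.\<close>

lemma branch_agree:
  assumes b: "branch S" "branch S'" and meet: "S \<inter> S' \<noteq> {}" and y: "y \<in> S" "y' \<in> S'" "fbar y = fbar y'"
  shows "y = y'"
proof -
  have S: "openin Y S" "S \<inter> V = {}" "inj_on fbar S" "connected (fbar ` S)"
    and S': "openin Y S'" "S' \<inter> V = {}" "inj_on fbar S'" "connected (fbar ` S')"
    using b by (auto simp: branch_def)
  let ?I = "fbar ` S \<inter> fbar ` S'"
  let ?G = "fbar ` (S \<inter> S')"
  let ?D = "\<Union>{D. open D \<and> D \<inter> ?G = {}}"
  have cov: "?I \<subseteq> ?G \<union> ?D"
  proof
    fix s assume "s \<in> ?I"
    then obtain z z' where z: "z \<in> S" "z' \<in> S'" "s = fbar z" "s = fbar z'" by auto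
    show "s \<in> ?G \<union> ?D"
    proof (cases "z = z'")
      case True then show ?thesis using z by auto
    next
      case False
      have "z \<in> topspace Y" "z' \<in> topspace Y" using z openin_subset S(1) S'(1) by blast+
      then obtain P P' where P: "openin Y P" "openin Y P'" "z \<in> P" "z' \<in> P'" "disjnt P P'"
        using Y_Hausdorff False unfolding Hausdorff_space_def by metis
      let ?D1 = "fbar ` (P \<inter> S) \<inter> fbar ` (P' \<inter> S')"
      have "open ?D1" using P S S' by (intro open_Int fbar_open_map) auto
      moreover have "?D1 \<inter> ?G = {}"
      proof (rule ccontr)
        assume "?D1 \<inter> ?G \<noteq> {}"
        then obtain v where v: "v \<in> fbar ` (P \<inter> S)" "v \<in> fbar ` (P' \<inter> S')" "v \<in> ?G" by blast
        obtain w1 where w1: "w1 \<in> P" "w1 \<in> S" "v = fbar w1" using v(1) by blast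
        obtain w2 where w2: "w2 \<in> P'" "w2 \<in> S'" "v = fbar w2" using v(2) by blast
        obtain w where w: "w \<in> S" "w \<in> S'" "v = fbar w" using v(3) by blast
        have "w1 = w" by (rule inj_onD[OF S(3) _ w1(2) w(1)]) (use w1(3) w(3) in simp)
        moreover have "w2 = w" by (rule inj_onD[OF S'(3) _ w2(2) w(2)]) (use w2(3) w(3) in simp)
        ultimately have "w \<in> P" "w \<in> P'" using w1(1) w2(1) by simp_all
        then show False using P(5) unfolding disjnt_def by blast
      qed
      moreover have "s \<in> ?D1" using z P by blast
      ultimately show ?thesis by blast
    qed
  qed
  have "connected ?I" using S(4) S'(4) by (simp add: is_interval_connected_1[symmetric] is_interval_Int)
  moreover have "open ?G" using S S' by (intro fbar_open_map) auto
  moreover have "open ?D" by auto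
  moreover have "?G \<inter> ?D \<inter> ?I = {}" by auto
  moreover note cov
  ultimately have "?G \<inter> ?I = {} \<or> ?D \<inter> ?I = {}" by (rule connectedD)
  moreover have "?G \<inter> ?I \<noteq> {}" using meet by blast
  ultimately have "?D \<inter> ?I = {}" by simp
  moreover have "K \<subseteq> G" if "K \<subseteq> G \<union> D" "D \<inter> K = {}" for K G D :: "real set" using that by blast
  ultimately have "?I \<subseteq> ?G" using cov by simp
  moreover have "fbar y \<in> ?I" using imageI[OF y(1), of fbar] imageI[OF y(2), of fbar] y(3) by simp
  ultimately obtain w where w: "w \<in> S" "w \<in> S'" "fbar y = fbar w" by auto
  have "y = w" by (rule inj_onD[OF S(3) w(3) y(1) w(1)])
  moreover have "y' = w" by (rule inj_onD[OF S'(3) _ y(2) w(2)]) (use y w in simp)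
  ultimately show ?thesis by simp
qed

lemma branch_Union:
  assumes "\<And>S. S \<in> \<A> \<Longrightarrow> branch S" and meet: "\<And>S S'. S \<in> \<A> \<Longrightarrow> S' \<in> \<A> \<Longrightarrow> S \<inter> S' \<noteq> {}"
  shows "branch (\<Union>\<A>)"
  unfolding branch_def
proof (intro conjI)
  show "openin Y (\<Union>\<A>)" "\<Union>\<A> \<inter> V = {}" using assms(1) by (auto simp: branch_def)
  show "inj_on fbar (\<Union>\<A>)"
  proof (rule inj_onI)
    fix y y' assume "y \<in> \<Union>\<A>" "y' \<in> \<Union>\<A>" and eq: "fbar y = fbar y'"
    then obtain S S' where S: "S \<in> \<A>" "S' \<in> \<A>" "y \<in> S" "y' \<in> S'" by blast
    show "y = y'" by (rule branch_agree[OF assms(1)[OF S(1)] assms(1)[OF S(2)] meet[OF S(1,2)] S(3,4) eq])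
  qed
  have "connected (\<Union>((`) fbar ` \<A>))"
  proof (cases "\<A> = {}")
    case False
    then obtain S0 where S0: "S0 \<in> \<A>" by blast
    show ?thesis
    proof (rule connectedI)
      fix A1 A2 assume A: "open A1" "open A2" "A1 \<inter> \<Union>((`) fbar ` \<A>) \<noteq> {}" "A2 \<inter> \<Union>((`) fbar ` \<A>) \<noteq> {}"
        "A1 \<inter> A2 \<inter> \<Union>((`) fbar ` \<A>) = {}" "\<Union>((`) fbar ` \<A>) \<subseteq> A1 \<union> A2"
      have side: "fbar ` S \<subseteq> A1 \<or> fbar ` S \<subseteq> A2" if S: "S \<in> \<A>" for S
      proof -
        have "connected (fbar ` S)" using assms(1)[OF S] by (simp add: branch_def)
        moreover have "A1 \<inter> A2 \<inter> fbar ` S = {}" and sub: "fbar ` S \<subseteq> A1 \<union> A2" using A(5,6) S by blast+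
        ultimately have "A1 \<inter> fbar ` S = {} \<or> A2 \<inter> fbar ` S = {}" by (rule connectedD[OF _ A(1,2)])
        then show ?thesis using sub by blast
      qed
      have same: "False" if SS: "S \<in> \<A>" "S' \<in> \<A>" "fbar ` S \<subseteq> A1" "fbar ` S' \<subseteq> A2" for S S'
      proof -
        obtain z where "z \<in> S" "z \<in> S'" using meet[OF SS(1,2)] by blast
        then have "fbar z \<in> A1 \<inter> A2 \<inter> \<Union>((`) fbar ` \<A>)" using SS by blast
        then show False using A(5) by blast
      qed
      obtain S1 where "S1 \<in> \<A>" "A1 \<inter> fbar ` S1 \<noteq> {}" using A(3) by blast
      then have S1: "S1 \<in> \<A>" "fbar ` S1 \<subseteq> A1" using side[of S1] A(5) by blast+
      obtain S2 where "S2 \<in> \<A>" "A2 \<inter> fbar ` S2 \<noteq> {}" using A(4) by blast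
      then have S2: "S2 \<in> \<A>" "fbar ` S2 \<subseteq> A2" using side[of S2] A(5) by blast+
      show False by (rule same[OF S1(1) S2(1) S1(2) S2(2)])
    qed
  qed simp
  then show "connected (fbar ` \<Union>\<A>)" by (simp add: image_Union)
qed

text \<open>The union of all branches through \<open>y0\<close>. If a limit point of it over an end of the
  interval of values were not a vertex, the branch could be prolonged through that point.\<close>

lemma maximal_branch:
  assumes y0: "y0 \<in> topspace Y - V"
  obtains S c c' where "branch S" "y0 \<in> S" "fbar ` S = {c<..<c'}"
    "\<And>y. y \<in> Y closure_of S \<Longrightarrow> c < fbar y \<Longrightarrow> fbar y < c' \<Longrightarrow> y \<in> S"
    "\<exists>y\<in>V. y \<in> Y closure_of S \<and> fbar y = c" "\<exists>y\<in>V. y \<in> Y closure_of S \<and> fbar y = c'"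
proof -
  define S where "S = \<Union>{S. branch S \<and> y0 \<in> S}"
  have bS: "branch S" unfolding S_def by (rule branch_Union) auto
  then have S: "openin Y S" "S \<inter> V = {}" "inj_on fbar S" "connected (fbar ` S)" by (auto simp: branch_def)
  have y0S: "y0 \<in> S" unfolding S_def by (rule branch_at[OF y0]) blast
  have max: "S' \<subseteq> S" if S': "branch S'" "S \<inter> S' \<noteq> {}" for S'
  proof -
    have "branch (\<Union>{S, S'})" by (rule branch_Union) (use bS S' y0S in auto)
    then have "branch (S \<union> S')" by simp
    moreover have "y0 \<in> S \<union> S'" using y0S by simp
    ultimately have "S \<union> S' \<in> {S. branch S \<and> y0 \<in> S}" by simp
    then have "S \<union> S' \<subseteq> S" unfolding S_def[abs_def] by blast
    then show ?thesis by blast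
  qed
  define L where "L = fbar ` (Y closure_of S)"
  have "compactin Y (Y closure_of S)" by (rule closedin_compact_space[OF Y_compact closedin_closure_of])
  then have L: "compact L" unfolding L_def using image_compactin[OF _ continuous_fbar] by auto
  have SL: "fbar ` S \<subseteq> L" unfolding L_def using closure_of_subset[OF openin_subset[OF S(1)]] by blast
  have oS: "open (fbar ` S)" by (rule fbar_open_map[OF S(1,2)])
  have ne: "fbar ` S \<noteq> {}" using y0S by blast
  have bd: "bdd_below (fbar ` S)" "bdd_above (fbar ` S)"
    using bounded_subset[OF compact_imp_bounded[OF L] SL] bounded_imp_bdd_below bounded_imp_bdd_above by auto
  define c c' where "c = Inf (fbar ` S)" and "c' = Sup (fbar ` S)"
  have int: "fbar ` S = {c<..<c'}"
  proof (intro subset_antisym subsetI)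
    fix s assume s: "s \<in> fbar ` S"
    then obtain d where d: "d > 0" "cball s d \<subseteq> fbar ` S" using oS open_contains_cball by blast
    have "s - d \<in> fbar ` S" "s + d \<in> fbar ` S" using d by (auto simp: dist_real_def subset_iff)
    then have "c \<le> s - d" "s + d \<le> c'" using bd unfolding c_def c'_def by (auto intro: cInf_lower cSup_upper)
    then show "s \<in> {c<..<c'}" using d(1) by auto
  next
    fix s assume s: "s \<in> {c<..<c'}"
    obtain a where a: "a \<in> fbar ` S" "a < s" using cInf_lessD[OF ne, of s] s by (auto simp: c_def)
    obtain b where b: "b \<in> fbar ` S" "s < b" using less_cSupD[OF ne, of s] s by (auto simp: c'_def)
    have "{a..b} \<subseteq> fbar ` S" by (rule connected_contains_Icc[OF S(4) a(1) b(1)])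
    then show "s \<in> fbar ` S" using a b by auto
  qed
  have cc: "c < c'" using ne int by auto
  have meets: "S \<inter> P \<noteq> {}" if "y \<in> Y closure_of S" "openin Y P" "y \<in> P" for y P
    using that unfolding in_closure_of by blast
  have closed: "y \<in> S" if y: "y \<in> Y closure_of S" "c < fbar y" "fbar y < c'" for y
  proof -
    have "fbar y \<in> fbar ` S" using y int by simp
    then obtain a where a: "a \<in> S" "fbar y = fbar a" by auto
    have "y = a"
    proof (rule ccontr)
      assume "y \<noteq> a"
      moreover have aY: "a \<in> topspace Y" "y \<in> topspace Y" using a(1) openin_subset[OF S(1)] y(1) subsetD[OF closure_of_subset_topspace] by auto
      ultimately obtain P P' where P: "openin Y P" "openin Y P'" "y \<in> P" "a \<in> P'" "disjnt P P'"
        using Y_Hausdorff unfolding Hausdorff_space_def by metis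
      have o: "open (fbar ` (S \<inter> P'))" using S P by (intro fbar_open_map) auto
      let ?Q = "P \<inter> {z \<in> topspace Y. fbar z \<in> fbar ` (S \<inter> P')}"
      have "openin Y ?Q" using P(1) open_fbar[OF o] by (rule openin_Int)
      moreover have "fbar y \<in> fbar ` (S \<inter> P')" using a P(4) by simp
      then have "y \<in> ?Q" using P(3) aY(2) by simp
      ultimately obtain z where z: "z \<in> S" "z \<in> ?Q" using meets[OF y(1)] by blast
      then obtain a' where a': "a' \<in> S" "a' \<in> P'" "fbar z = fbar a'" by auto
      have "z = a'" by (rule inj_onD[OF S(3) a'(3) z(1) a'(1)])
      then show False using z(2) a'(2) P(5) by (auto simp: disjnt_def)
    qed
    then show ?thesis using a(1) by simp
  qed
  have ends: "\<exists>y\<in>V. y \<in> Y closure_of S \<and> fbar y = d" if d: "d = c \<or> d = c'" for d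
  proof -
    have "closure (fbar ` S) \<subseteq> L" by (rule closure_minimal[OF SL compact_imp_closed[OF L]])
    then have "d \<in> L" using int cc d by auto
    then obtain y where y: "y \<in> Y closure_of S" "fbar y = d" by (auto simp: L_def)
    have "y \<in> V"
    proof (rule ccontr)
      assume nV: "y \<notin> V"
      have "y \<in> topspace Y" using y(1) by (rule subsetD[OF closure_of_subset_topspace])
      then have "y \<in> topspace Y - V" using nV by blast
      then obtain S' where S': "branch S'" "y \<in> S'" by (rule branch_at)
      have "S \<inter> S' \<noteq> {}" using S' by (intro meets[OF y(1)]) (auto simp: branch_def)
      then have "y \<in> S" using max[OF S'(1)] S'(2) by blast
      then have "d \<in> {c<..<c'}" using y(2) int by blast
      then show False using d by auto
    qed
    then show ?thesis using y by blast
  qed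
  show thesis
    by (rule that[of S c c', OF bS y0S int], rule closed, assumption+) (rule ends, simp)+
qed

end

section \<open>The components of type (IIa) are the open edges of the Reeb space\<close>

lemma clopen_connected_component:
  assumes "connectedin X C" "C \<noteq> {}" "openin X C" "closedin X C"
  shows "C \<in> connected_components_of X"
proof -
  obtain x where x: "x \<in> C" using assms(2) by blast
  have "connected_component_of_set X x = C"
  proof
    show "C \<subseteq> connected_component_of_set X x" by (rule connected_component_of_maximal[OF assms(1) x])
    have "x \<in> connected_component_of_set X x" using x \<open>C \<subseteq> connected_component_of_set X x\<close> by blast
    then have "\<not> disjnt (connected_component_of_set X x) C" using x by (auto simp: disjnt_def)
    then show "connected_component_of_set X x \<subseteq> C"
      using connectedin_clopen_cases[OF connectedin_connected_component_of assms(4,3)] by blast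
  qed
  moreover have "x \<in> topspace X" using x openin_subset[OF assms(3)] by blast
  ultimately show ?thesis unfolding connected_components_of_def by blast
qed

context closed_C1_function
begin

text \<open>Essential components are the vertices of the Reeb graph, together with their levels.\<close>

lemma essential_component_iff: "essential_component M A f c K \<longleftrightarrow> (\<exists>k\<in>Cr. f k = c \<and> K = \<pi> k)"
proof
  assume e: "essential_component M A f c K"
  then obtain k x where k: "k \<in> K" "k \<in> Cr" and K: "K = connected_component_of_set (subtopology M (level_set M f c)) x"
    by (auto simp: essential_component_def connected_components_of_def)
  have xk: "connected_component_of (subtopology M (level_set M f c)) x k" using k K by simp
  then have "k \<in> topspace (subtopology M (level_set M f c))" by (simp add: connected_component_of_equiv)
  then have fk: "f k = c" by (simp add: level_set_def)
  have "connected_component_of (subtopology M (level_set M f c)) x = connected_component_of (subtopology M (level_set M f c)) k"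
    using xk by (simp add: connected_component_of_equiv)
  then have "K = \<pi> k" using K fk by (simp add: reeb_projection_def)
  then show "\<exists>k\<in>Cr. f k = c \<and> K = \<pi> k" using k fk by blast
next
  assume "\<exists>k\<in>Cr. f k = c \<and> K = \<pi> k"
  then obtain k where k: "k \<in> Cr" "f k = c" "K = \<pi> k" by blast
  then have kM: "k \<in> topspace M" using Cr_subset by blast
  have "K \<in> connected_components_of (subtopology M (level_set M f c))"
    unfolding connected_components_of_def using k kM by (auto simp: reeb_projection_def level_set_def)
  moreover have "k \<in> K" using fibre(1)[OF kM] k(3) by simp
  ultimately show "essential_component M A f c K" using k(1) by (auto simp: essential_component_def)
qed

text \<open>The preimage of a maximal branch is connected, as a partition into two open sets would consist of
  unions of classes and thereby split the interval of values. It is clopen in the strip between the two end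
  levels, because the branch is closed there.\<close>

lemma regular_in_IIa:
  assumes y0: "y0 \<in> topspace Y - V"
  obtains c c' S where "type_IIa M A f c c' {x \<in> topspace M. \<pi> x \<in> S}" "y0 \<in> S" "c < fbar y0" "fbar y0 < c'" "inj_on fbar S"
proof -
  obtain S c c' where bS: "branch S" and y0S: "y0 \<in> S" and int: "fbar ` S = {c<..<c'}"
    and cl: "\<And>y. y \<in> Y closure_of S \<Longrightarrow> c < fbar y \<Longrightarrow> fbar y < c' \<Longrightarrow> y \<in> S"
    and ends: "\<exists>y\<in>V. y \<in> Y closure_of S \<and> fbar y = c" "\<exists>y\<in>V. y \<in> Y closure_of S \<and> fbar y = c'"
    by (rule maximal_branch[OF y0], rule that)
  have S: "openin Y S" "S \<inter> V = {}" "inj_on fbar S" using bS by (auto simp: branch_def)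
  have y0c: "c < fbar y0" "fbar y0 < c'" using int y0S by (auto simp: set_eq_iff image_iff)
  define C where "C = {x \<in> topspace M. \<pi> x \<in> S}"
  define strip where "strip = {x \<in> topspace M. c < f x \<and> f x < c'}"
  have C_strip: "C \<subseteq> strip"
  proof
    fix x assume x: "x \<in> C"
    then have "fbar (\<pi> x) \<in> {c<..<c'}" using int by (auto simp: C_def)
    then show "x \<in> strip" using x fbar[of x] by (simp add: C_def strip_def)
  qed
  have oC: "openin M C" unfolding C_def using S(1) by (simp add: openin_Y)
  have \<pi>C: "\<pi> ` C = S" using openin_subset[OF S(1)] by (auto simp: C_def topspace_Y)
  have Cne: "C \<noteq> {}" using \<pi>C y0S by blast
  have conn: "connectedin M C"
    unfolding connectedin
  proof (intro conjI notI)
    show "C \<subseteq> topspace M" by (auto simp: C_def)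
    assume "\<exists>E1 E2. openin M E1 \<and> openin M E2 \<and> C \<subseteq> E1 \<union> E2 \<and> E1 \<inter> E2 \<inter> C = {} \<and> E1 \<inter> C \<noteq> {} \<and> E2 \<inter> C \<noteq> {}"
    then obtain E1 E2 where E: "openin M E1" "openin M E2" "C \<subseteq> E1 \<union> E2" "E1 \<inter> E2 \<inter> C = {}" "E1 \<inter> C \<noteq> {}" "E2 \<inter> C \<noteq> {}"
      by blast
    have fib: "\<pi> x \<subseteq> C \<and> (\<pi> x \<inter> E1 = {} \<or> \<pi> x \<inter> E2 = {})" if x: "x \<in> C" for x
    proof -
      have xM: "x \<in> topspace M" using x by (simp add: C_def)
      have 1: "\<pi> x \<subseteq> C" using fibre(3)[OF xM] x by (auto simp: C_def)
      have "\<not> (\<exists>E1 E2. openin M E1 \<and> openin M E2 \<and> \<pi> x \<subseteq> E1 \<union> E2 \<and> E1 \<inter> E2 \<inter> \<pi> x = {} \<and> E1 \<inter> \<pi> x \<noteq> {} \<and> E2 \<inter> \<pi> x \<noteq> {})"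
        using fibre(2)[OF xM] unfolding connectedin by blast
      then have "\<not> (\<pi> x \<subseteq> E1 \<union> E2 \<and> E1 \<inter> E2 \<inter> \<pi> x = {} \<and> E1 \<inter> \<pi> x \<noteq> {} \<and> E2 \<inter> \<pi> x \<noteq> {})"
        using E(1,2) by blast
      then show ?thesis using 1 E(3,4) by blast
    qed
    have sat: "\<pi> x \<subseteq> C \<inter> E" if "x \<in> C \<inter> E" "E = E1 \<or> E = E2" for x E
    proof -
      have x: "x \<in> C" "x \<in> E" using that(1) by auto
      then have "x \<in> \<pi> x" using fibre(1) by (simp add: C_def)
      then show ?thesis using fib[OF x(1)] E(3) that(2) x(2) by blast
    qed
    have o: "openin Y (\<pi> ` (C \<inter> E))" if "E = E1 \<or> E = E2" for E
    proof (rule saturated_image_open)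
      show "openin M (C \<inter> E)" using oC E(1,2) that by auto
      show "\<pi> x \<subseteq> C \<inter> E" if "x \<in> C \<inter> E" for x by (rule sat[OF that \<open>E = E1 \<or> E = E2\<close>])
    qed
    let ?J1 = "fbar ` \<pi> ` (C \<inter> E1)" and ?J2 = "fbar ` \<pi> ` (C \<inter> E2)"
    have sub: "\<pi> ` (C \<inter> E) \<subseteq> S" for E using \<pi>C by blast
    have "open ?J1" by (rule fbar_open_map[OF o]) (use sub[of E1] S(2) in auto)
    moreover have "open ?J2" by (rule fbar_open_map[OF o]) (use sub[of E2] S(2) in auto)
    moreover have "{c<..<c'} \<subseteq> ?J1 \<union> ?J2"
    proof
      fix s assume "s \<in> {c<..<c'}"
      then obtain y where "y \<in> S" "s = fbar y" using int by blast
      then obtain x where "x \<in> C" "s = fbar (\<pi> x)" using \<pi>C by blast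
      then show "s \<in> ?J1 \<union> ?J2" using E(3) by blast
    qed
    moreover have "?J1 \<inter> ?J2 \<inter> {c<..<c'} = {}"
    proof (rule ccontr)
      assume "\<not> ?thesis"
      then obtain x1 x2 where x: "x1 \<in> C \<inter> E1" "x2 \<in> C \<inter> E2" "fbar (\<pi> x1) = fbar (\<pi> x2)" by auto
      have "\<pi> x1 = \<pi> x2" by (rule inj_onD[OF S(3) x(3)]) (use x sub in auto)
      moreover have "x2 \<in> \<pi> x2" using x(2) fibre(1) by (simp add: C_def)
      ultimately have "x2 \<in> C \<inter> E1" using sat[OF x(1)] by blast
      then show False using x(2) E(4) by blast
    qed
    ultimately have "?J1 \<inter> {c<..<c'} = {} \<or> ?J2 \<inter> {c<..<c'} = {}"
      using connectedD[OF connected_Ioo[of c c'], of ?J1 ?J2] by blast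
    moreover have "?J1 \<subseteq> {c<..<c'}" "?J2 \<subseteq> {c<..<c'}" using int sub by blast+
    ultimately show False using E(5,6) by blast
  qed
  have C_cl: "C = strip \<inter> {x \<in> topspace M. \<pi> x \<in> Y closure_of S}"
  proof (intro subset_antisym subsetI)
    fix x assume "x \<in> C"
    then show "x \<in> strip \<inter> {x \<in> topspace M. \<pi> x \<in> Y closure_of S}"
      using C_strip closure_of_subset[OF openin_subset[OF S(1)]] by (auto simp: C_def)
  next
    fix x assume "x \<in> strip \<inter> {x \<in> topspace M. \<pi> x \<in> Y closure_of S}"
    then show "x \<in> C" using cl[of "\<pi> x"] fbar[of x] by (simp add: C_def strip_def)
  qed
  have comp: "C \<in> connected_components_of (subtopology M strip)"
  proof (rule clopen_connected_component[OF _ Cne])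
    show "connectedin (subtopology M strip) C" using conn C_strip by (simp add: connectedin_subtopology)
    have "openin (subtopology M strip) (strip \<inter> C)" using oC by (rule openin_subtopology_Int2)
    moreover have "strip \<inter> C = C" using C_strip by blast
    ultimately show "openin (subtopology M strip) C" by simp
    have "closedin M {x \<in> topspace M. \<pi> x \<in> Y closure_of S}"
      by (rule closedin_continuous_map_preimage[OF continuous_\<pi> closedin_closure_of])
    then have "closedin (subtopology M strip) (strip \<inter> {x \<in> topspace M. \<pi> x \<in> Y closure_of S})"
      by (rule closedin_subtopology_Int_closed)
    then show "closedin (subtopology M strip) C" using C_cl by simp
  qed
  have ess: "d \<in> f ` Cr \<and> (\<exists>K. essential_component M A f d K \<and> M closure_of C \<inter> K \<noteq> {})"
    if d: "\<exists>y\<in>V. y \<in> Y closure_of S \<and> fbar y = d" for d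
  proof -
    obtain k where k: "k \<in> Cr" "\<pi> k \<in> Y closure_of S" "fbar (\<pi> k) = d" using d by blast
    have kM: "k \<in> topspace M" using k(1) Cr_subset by blast
    then have fk: "f k = d" using k(3) fbar by simp
    have "closedin Y (\<pi> ` (M closure_of C))" using closed_\<pi> closedin_closure_of by (simp add: closed_map_def)
    moreover have "S \<subseteq> \<pi> ` (M closure_of C)"
      using closure_of_subset[OF openin_subset[OF oC]] \<pi>C by blast
    ultimately have "Y closure_of S \<subseteq> \<pi> ` (M closure_of C)" by (rule closure_of_minimal[rotated])
    then obtain z where z: "z \<in> M closure_of C" "\<pi> k = \<pi> z" using k(2) by blast
    have "z \<in> topspace M" using z(1) by (rule subsetD[OF closure_of_subset_topspace])
    then have "z \<in> \<pi> k" using fibre(1) z(2) by simp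
    then have "M closure_of C \<inter> \<pi> k \<noteq> {}" using z(1) by blast
    moreover have "essential_component M A f d (\<pi> k)" using essential_component_iff k(1) fk by blast
    ultimately show ?thesis using k(1) fk by blast
  qed
  have "C \<inter> Cr = {}" using S(2) by (auto simp: C_def)
  moreover have "c < c'" using y0c by simp
  ultimately have "type_IIa M A f c c' C"
    using ess[OF ends(1)] ess[OF ends(2)] comp unfolding type_IIa_def strip_def by blast
  then show thesis using y0S y0c S(3) unfolding C_def by (rule that)
qed

end

locale closed_C1_function_edges = closed_C1_function M A f
  for M :: "'a topology" and A :: "('a, real ^ 'n) chart set" and f :: "'a \<Rightarrow> real" +
  fixes \<gamma> :: "real \<Rightarrow> real \<Rightarrow> 'a set \<Rightarrow> real \<Rightarrow> 'a"
  assumes edge_path: "type_IIa M A f c c' C \<Longrightarrow> decreasing_edge_path M A f c c' C (\<gamma> c c' C)"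
begin

text \<open>The edges of the graph that join different essential components.\<close>

definition long_edges :: "(real \<Rightarrow> 'a) set" where
  "long_edges = {\<gamma> c c' C | c c' C. type_IIa M A f c c' C}"

lemma IIa_fibre:
  assumes C: "type_IIa M A f c c' C" and x: "x \<in> C"
  shows "x \<in> topspace M" "c < f x" "f x < c'" "\<pi> x \<subseteq> C" "\<pi> x \<notin> V"
proof -
  let ?Q = "subtopology M {x \<in> topspace M. c < f x \<and> f x < c'}"
  have comp: "C \<in> connected_components_of ?Q" and Cr: "C \<inter> Cr = {}" using C by (auto simp: type_IIa_def)
  have "C \<subseteq> topspace ?Q" by (rule connected_components_of_subset[OF comp])
  then have "x \<in> topspace ?Q" using x by (rule subsetD)
  then show 1: "x \<in> topspace M" "c < f x" "f x < c'" by simp_all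
  have "\<pi> x \<subseteq> {x \<in> topspace M. c < f x \<and> f x < c'}"
  proof
    fix w assume "w \<in> \<pi> x"
    from fibre(3)[OF 1(1) this] show "w \<in> {x \<in> topspace M. c < f x \<and> f x < c'}" using 1(2,3) by simp
  qed
  then have "connectedin ?Q (\<pi> x)" using fibre(2)[OF 1(1)] by (simp add: connectedin_subtopology)
  moreover have "\<not> disjnt C (\<pi> x)" using x fibre(1)[OF 1(1)] by (auto simp: disjnt_def)
  ultimately show 2: "\<pi> x \<subseteq> C" by (intro connected_components_of_maximal[OF comp])
  show "\<pi> x \<notin> V"
  proof
    assume "\<pi> x \<in> V"
    then obtain k where k: "k \<in> Cr" "\<pi> x = \<pi> k" by blast
    then have "k \<in> \<pi> x" using fibre(1) Cr_subset by auto
    then show False using k(1) 2 Cr by blast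
  qed
qed

lemma IIa_path:
  assumes C: "type_IIa M A f c c' C"
  shows "pathin M (\<gamma> c c' C)" "\<gamma> c c' C 0 \<in> Cr" "\<gamma> c c' C 1 \<in> Cr" "f (\<gamma> c c' C 0) = c'" "f (\<gamma> c c' C 1) = c"
    "\<And>t. t \<in> {0<..<1} \<Longrightarrow> \<gamma> c c' C t \<in> C"
    "\<And>s t. s \<in> {0..1} \<Longrightarrow> t \<in> {0..1} \<Longrightarrow> s < t \<Longrightarrow> f (\<gamma> c c' C t) < f (\<gamma> c c' C s)"
proof -
  let ?e = "\<gamma> c c' C"
  have d: "pathin M ?e" "\<exists>K'. essential_component M A f c' K' \<and> ?e 0 \<in> M closure_of C \<inter> K' \<inter> Cr"
    "\<exists>K. essential_component M A f c K \<and> ?e 1 \<in> M closure_of C \<inter> K \<inter> Cr"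
    "?e ` {0<..<1} \<subseteq> C" "\<forall>t\<in>{0..1}. \<forall>t'\<in>{0..1}. t' < t \<longrightarrow> f (?e t) < f (?e t')"
    using edge_path[OF C] unfolding decreasing_edge_path_def by simp_all
  show "pathin M ?e" by (rule d(1))
  show "?e 0 \<in> Cr" "?e 1 \<in> Cr" using d(2,3) by auto
  have lev: "f x = b" if lv: "essential_component M A f b K" "x \<in> K" for b K x
  proof -
    obtain k where k: "k \<in> Cr" "f k = b" "K = \<pi> k" using lv(1)[unfolded essential_component_iff] by blast
    then show ?thesis using fibre(3)[of k x] Cr_subset lv(2) by auto
  qed
  show "f (?e 0) = c'" "f (?e 1) = c" using d(2,3) lev by auto
  show "?e t \<in> C" if "t \<in> {0<..<1}" for t using d(4) that by blast
  show "f (?e t) < f (?e s)" if "s \<in> {0..1}" "t \<in> {0..1}" "s < t" for s t using d(5) that by blast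
qed

lemma long_edge:
  assumes e: "e \<in> long_edges"
  shows "pathin M e" "e 0 \<in> Cr" "e 1 \<in> Cr"
    "\<And>s t. s \<in> {0..1} \<Longrightarrow> t \<in> {0..1} \<Longrightarrow> f (e s) = f (e t) \<Longrightarrow> s = t"
    "\<And>t. t \<in> {0<..<1} \<Longrightarrow> \<pi> (e t) \<notin> V"
proof -
  obtain c c' C where C: "type_IIa M A f c c' C" "e = \<gamma> c c' C" using e by (auto simp: long_edges_def)
  note p = IIa_path[OF C(1), folded C(2)]
  show "pathin M e" "e 0 \<in> Cr" "e 1 \<in> Cr" by (fact p)+
  show "s = t" if "s \<in> {0..1}" "t \<in> {0..1}" "f (e s) = f (e t)" for s t
    using p(7)[of s t] p(7)[of t s] that by linarith
  show "\<pi> (e t) \<notin> V" if "t \<in> {0<..<1}" for t by (rule IIa_fibre(5)[OF C(1) p(6)[OF that]])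
qed

text \<open>The chosen path of the component over a maximal branch takes every intermediate value of
  \<open>f\<close>.\<close>

lemma long_edges_cover:
  assumes y: "y \<in> topspace Y - V"
  shows "\<exists>e\<in>long_edges. \<exists>t\<in>{0<..<1}. y = \<pi> (e t)"
proof -
  obtain c c' S where S: "type_IIa M A f c c' {x \<in> topspace M. \<pi> x \<in> S}" "y \<in> S" "c < fbar y" "fbar y < c'" "inj_on fbar S"
    by (rule regular_in_IIa[OF y], rule that)
  let ?e = "\<gamma> c c' {x \<in> topspace M. \<pi> x \<in> S}"
  note p = IIa_path[OF S(1)]
  have "continuous_map (top_of_set {0..1}) euclideanreal (f \<circ> ?e)"
    by (rule continuous_map_compose[OF p(1)[unfolded pathin_def] f_continuous])
  then have "continuous_on {0..1} (f \<circ> ?e)" by simp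
  then obtain t where t: "0 \<le> t" "t \<le> 1" "(f \<circ> ?e) t = fbar y"
    using IVT2'[of "f \<circ> ?e" 1 "fbar y" 0] p(4,5) S(3,4) by auto
  have "t \<noteq> 0" "t \<noteq> 1" using t(3) p(4,5) S(3,4) by auto
  then have t01: "t \<in> {0<..<1}" using t by auto
  then have "?e t \<in> topspace M" "\<pi> (?e t) \<in> S" using p(6)[OF t01] by auto
  moreover have "fbar (\<pi> (?e t)) = fbar y" using t(3) fbar[OF \<open>?e t \<in> topspace M\<close>] by simp
  ultimately have "\<pi> (?e t) = y" using inj_onD[OF S(5)] S(2) by blast
  then show ?thesis using t01 S(1) unfolding long_edges_def by blast
qed

text \<open>Otherwise the path of \<open>D\<close>, followed from its point in \<open>C\<close> to one of its
  ends, would stay in the strip of \<open>C\<close>, hence in \<open>C\<close>, and end in a critical point of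
  \<open>C\<close>.\<close>

lemma IIa_strips_agree:
  assumes C: "type_IIa M A f c c' C" and D: "type_IIa M A f d d' D" and p: "t \<in> {0<..<1}" "\<gamma> d d' D t \<in> C"
  shows "d \<le> c" "c' \<le> d'"
proof -
  let ?e = "\<gamma> d d' D"
  let ?strip = "{x \<in> topspace M. c < f x \<and> f x < c'}"
  note e = IIa_path[OF D]
  have comp: "C \<in> connected_components_of (subtopology M ?strip)" and Cr: "C \<inter> Cr = {}" using C by (auto simp: type_IIa_def)
  have ft: "c < f (?e t)" "f (?e t) < c'" using IIa_fibre[OF C p(2)] by auto
  have path: "continuous_map (top_of_set {0..1}) M ?e" using e(1) by (simp add: pathin_def)
  have stays: "?e ` {a..b} \<subseteq> C" if ab: "0 \<le> a" "a \<le> t" "t \<le> b" "b \<le> 1" "f (?e a) < c'" "c < f (?e b)" for a b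
  proof -
    have mono: "f (?e s) \<le> f (?e r)" if "0 \<le> r" "r \<le> s" "s \<le> 1" for r s
      using e(7)[of r s] that by (cases "r = s") auto
    have "connectedin (top_of_set {0..1}) {a..b}" using ab by (auto simp: connectedin_subtopology)
    then have "connectedin M (?e ` {a..b})" by (rule connectedin_continuous_map_image[OF path])
    moreover have "?e ` {a..b} \<subseteq> ?strip"
    proof
      fix x assume "x \<in> ?e ` {a..b}"
      then obtain s where s: "a \<le> s" "s \<le> b" "x = ?e s" by auto
      have "f (?e b) \<le> f x" "f x \<le> f (?e a)" using mono[of s b] mono[of a s] s ab by auto
      moreover have "x \<in> topspace M" using continuous_map_image_subset_topspace[OF path] s ab by auto
      ultimately show "x \<in> ?strip" using ab by auto
    qed
    ultimately have "connectedin (subtopology M ?strip) (?e ` {a..b})" by (simp add: connectedin_subtopology)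
    moreover have "\<not> disjnt C (?e ` {a..b})" using p(2) ab by (auto simp: disjnt_def)
    ultimately show ?thesis by (intro connected_components_of_maximal[OF comp])
  qed
  show "d \<le> c"
  proof (rule ccontr)
    assume "\<not> d \<le> c"
    then have "?e ` {t..1} \<subseteq> C" using p(1) ft e(5) by (intro stays) auto
    then have "?e 1 \<in> C" using p(1) by auto
    then show False using e(3) Cr by blast
  qed
  show "c' \<le> d'"
  proof (rule ccontr)
    assume "\<not> c' \<le> d'"
    then have "?e ` {0..t} \<subseteq> C" using p(1) ft e(4) by (intro stays) auto
    then have "?e 0 \<in> C" using p(1) by auto
    then show False using e(2) Cr by blast
  qed
qed

lemma long_edges_disjoint:
  assumes e: "e \<in> long_edges" "e' \<in> long_edges" and st: "s \<in> {0<..<1}" "t \<in> {0<..<1}" and eq: "\<pi> (e s) = \<pi> (e' t)"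
  shows "e = e'" "s = t"
proof -
  obtain c c' C where C: "type_IIa M A f c c' C" "e = \<gamma> c c' C" using e(1) by (auto simp: long_edges_def)
  obtain d d' D where D: "type_IIa M A f d d' D" "e' = \<gamma> d d' D" using e(2) by (auto simp: long_edges_def)
  have in_own: "e s \<in> C" "e' t \<in> D" using IIa_path(6)[OF C(1) st(1)] IIa_path(6)[OF D(1) st(2)] C(2) D(2) by auto
  have top: "e s \<in> topspace M" "e' t \<in> topspace M" using IIa_fibre(1)[OF C(1) in_own(1)] IIa_fibre(1)[OF D(1) in_own(2)] by auto
  have "e' t \<in> \<pi> (e s)" "e s \<in> \<pi> (e' t)" using fibre(1)[OF top(1)] fibre(1)[OF top(2)] eq by auto
  then have in_other: "e' t \<in> C" "e s \<in> D" using IIa_fibre(4)[OF C(1) in_own(1)] IIa_fibre(4)[OF D(1) in_own(2)] by auto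
  have cd: "c = d" "c' = d'"
    using IIa_strips_agree[OF C(1) D(1) st(2)] IIa_strips_agree[OF D(1) C(1) st(1)] in_other C(2) D(2) by auto
  have "C \<in> connected_components_of (subtopology M {x \<in> topspace M. c < f x \<and> f x < c'})"
    "D \<in> connected_components_of (subtopology M {x \<in> topspace M. c < f x \<and> f x < c'})"
    using C(1) D(1) cd by (auto simp: type_IIa_def)
  then have "C = D" using connected_components_of_overlap in_own(1) in_other(2) by blast
  then show ee: "e = e'" using C(2) D(2) cd by simp
  have "f (e s) = f (e t)" using fbar[OF top(1)] fbar[OF top(2)] eq ee by simp
  then show "s = t" using long_edge(4)[OF e(1)] st by simp
qed

text \<open>A noncritical level between \<open>c\<close> and \<open>c'\<close> consists of finitely many
  classes, as \<open>fbar\<close> is locally injective and the level is compact; each component passes through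
  a class of its own.\<close>

lemma finite_IIa: "finite {C. type_IIa M A f c c' C}"
proof (cases "c < c'")
  case False
  then have "{C. type_IIa M A f c c' C} = {}" by (auto simp: type_IIa_def)
  then show ?thesis by simp
next
  case True
  have "infinite ({c<..<c'} - f ` Cr)" using infinite_Ioo[OF True] finite_Cr by (simp add: Diff_infinite_finite)
  then obtain m where m: "m \<in> {c<..<c'}" "m \<notin> f ` Cr" using infinite_imp_nonempty by blast
  define L where "L = {y \<in> topspace Y. fbar y \<in> {m}}"
  have "closedin Y L" unfolding L_def using closedin_continuous_map_preimage[OF continuous_fbar, of "{m}"] by simp
  then have L: "compactin Y L" by (rule closedin_compact_space[OF Y_compact])
  have LV: "y \<notin> V" if "y \<in> L" for y using that m(2) fbar Cr_subset by (auto simp: L_def)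
  let ?\<U> = "{S. branch S}"
  have "L \<subseteq> \<Union>?\<U>"
  proof
    fix y assume y: "y \<in> L"
    then have "y \<in> topspace Y - V" using LV by (simp add: L_def)
    then obtain S where "branch S" "y \<in> S" by (rule branch_at)
    then show "y \<in> \<Union>?\<U>" by blast
  qed
  then obtain \<F> where F: "finite \<F>" "\<F> \<subseteq> ?\<U>" "L \<subseteq> \<Union>\<F>"
    using compactinD[OF L, of ?\<U>] by (auto simp: branch_def)
  have "finite (\<Union>S\<in>\<F>. S \<inter> L)"
  proof (rule finite_UN_I[OF F(1)])
    fix S assume S: "S \<in> \<F>"
    show "finite (S \<inter> L)"
    proof (cases "S \<inter> L = {}")
      case False
      then obtain y where y: "y \<in> S" "y \<in> L" by blast
      have "inj_on fbar S" using F(2) S by (auto simp: branch_def)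
      then have "S \<inter> L \<subseteq> {y}" using y by (auto simp: L_def dest: inj_onD)
      then show ?thesis by (rule finite_subset) simp
    qed simp
  qed
  moreover have "L = (\<Union>S\<in>\<F>. S \<inter> L)" using F(3) by blast
  ultimately have fL: "finite L" by simp
  have "\<exists>y. y \<in> L \<and> y \<in> \<pi> ` C" if C: "type_IIa M A f c c' C" for C
  proof -
    note p = IIa_path[OF C]
    have "continuous_map (top_of_set {0..1}) euclideanreal (f \<circ> \<gamma> c c' C)"
      by (rule continuous_map_compose[OF p(1)[unfolded pathin_def] f_continuous])
    then have "continuous_on {0..1} (f \<circ> \<gamma> c c' C)" by simp
    then obtain t where t: "0 \<le> t" "t \<le> 1" "(f \<circ> \<gamma> c c' C) t = m"
      using IVT2'[of "f \<circ> \<gamma> c c' C" 1 m 0] p(4,5) m(1) by auto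
    have "t \<noteq> 0" "t \<noteq> 1" using t(3) p(4,5) m(1) by auto
    then have "\<gamma> c c' C t \<in> C" using t p(6) by simp
    moreover from this have "\<gamma> c c' C t \<in> topspace M" by (rule IIa_fibre(1)[OF C])
    ultimately have "\<pi> (\<gamma> c c' C t) \<in> L" "\<pi> (\<gamma> c c' C t) \<in> \<pi> ` C" using t(3) by (auto simp: L_def topspace_Y fbar)
    then show ?thesis by blast
  qed
  then have "\<forall>C\<in>{C. type_IIa M A f c c' C}. \<exists>y. y \<in> L \<and> y \<in> \<pi> ` C" by blast
  from bchoice[OF this] obtain h where h: "\<And>C. type_IIa M A f c c' C \<Longrightarrow> h C \<in> L \<and> h C \<in> \<pi> ` C" by blast
  have "inj_on h {C. type_IIa M A f c c' C}"
  proof (rule inj_onI)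
    fix C D assume CD: "C \<in> {C. type_IIa M A f c c' C}" "D \<in> {C. type_IIa M A f c c' C}" "h C = h D"
    then have C: "type_IIa M A f c c' C" and D: "type_IIa M A f c c' D" by auto
    obtain x where x: "x \<in> C" "h C = \<pi> x" using h[OF C] by blast
    obtain z where z: "z \<in> D" "h D = \<pi> z" using h[OF D] by blast
    have "z \<in> \<pi> x" using fibre(1)[OF IIa_fibre(1)[OF D z(1)]] CD(3) x z by simp
    then have "z \<in> C" using IIa_fibre(4)[OF C x(1)] by blast
    then show "C = D" using C D z(1) connected_components_of_overlap[of C _ D] unfolding type_IIa_def by blast
  qed
  moreover have "finite (h ` {C. type_IIa M A f c c' C})"
    by (rule finite_subset[OF _ fL]) (use h in auto)
  ultimately show ?thesis by (rule finite_imageD[rotated])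
qed

lemma finite_long_edges: "finite long_edges"
proof -
  have "long_edges \<subseteq> (\<Union>c\<in>f ` Cr. \<Union>c'\<in>f ` Cr. \<gamma> c c' ` {C. type_IIa M A f c c' C})"
  proof
    fix e assume "e \<in> long_edges"
    then obtain c c' C where C: "type_IIa M A f c c' C" "e = \<gamma> c c' C" by (auto simp: long_edges_def)
    have "c \<in> f ` Cr" "c' \<in> f ` Cr" using C(1) by (auto simp: type_IIa_def)
    then show "e \<in> (\<Union>c\<in>f ` Cr. \<Union>c'\<in>f ` Cr. \<gamma> c c' ` {C. type_IIa M A f c c' C})" using C by blast
  qed
  then show ?thesis by (rule finite_subset) (use finite_Cr finite_IIa in auto)
qed

end

section \<open>Contracting disjoint subtrees of a finite graph\<close>

lemma (in finite_graph) openin_edge_part: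
  assumes e: "e \<in> E" and D: "open D" "D \<subseteq> {0<..<1}"
  shows "openin Z (e ` D)"
proof -
  let ?C = "V \<union> (\<Union>e'\<in>E - {e}. e' ` {0..1}) \<union> e ` ({0..1} - D)"
  have D01: "D \<subseteq> {0..1}" using D(2) by (rule subset_trans) auto
  have "closedin Z (e ` ({0..1} - D))"
  proof -
    have "compact ({0..1} - D)" using compact_diff[OF compact_Icc D(1)] by simp
    then have "compactin (top_of_set {0..1}) ({0..1} - D)" by (simp add: compactin_subtopology)
    then have "compactin Z (e ` ({0..1} - D))"
      by (rule image_compactin) (use edge(1)[OF e] in \<open>simp add: pathin_def\<close>)
    then show ?thesis by (rule compactin_imp_closedin[OF Hausdorff])
  qed
  moreover have "closedin Z (\<Union>e'\<in>E - {e}. e' ` {0..1})"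
    using finite_E edge_compact by (intro closedin_Union) auto
  ultimately have "closedin Z ?C" by (intro closedin_Un V_closed[OF subset_refl])
  then have "openin Z (topspace Z - ?C)" by (intro openin_diff) auto
  moreover have "topspace Z - ?C = e ` D"
  proof (intro subset_antisym subsetI)
    fix x assume x: "x \<in> topspace Z - ?C"
    then obtain e' t where e': "e' \<in> E" "t \<in> {0..1}" "x = e' t" using cover by auto
    have "e' = e"
    proof (rule ccontr)
      assume "e' \<noteq> e"
      then have "x \<in> (\<Union>e'\<in>E - {e}. e' ` {0..1})" using e' by blast
      then show False using x by blast
    qed
    then show "x \<in> e ` D" using x e' by blast
  next
    fix x assume "x \<in> e ` D"
    then obtain t where t: "t \<in> D" "x = e t" by blast
    have t1: "t \<in> {0<..<1}" "t \<in> {0..1}" using t(1) D(2) D01 by auto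
    have nV: "x \<notin> V" using edge(5)[OF e] t1 t(2) by blast
    have "x \<notin> e' ` {0..1}" if e': "e' \<in> E - {e}" for e'
    proof
      assume "x \<in> e' ` {0..1}"
      then obtain s where s: "s \<in> {0..1}" "x = e' s" by blast
      have "e = e'" using edge_eq[OF e _ t1(2) s(1), of e'] e' s(2) t(2) nV by simp
      then show False using e' by simp
    qed
    moreover have "x \<notin> e ` ({0..1} - D)"
    proof
      assume "x \<in> e ` ({0..1} - D)"
      then obtain s where s: "s \<in> {0..1}" "s \<notin> D" "x = e s" by blast
      have "s = t" by (rule inj_onD[OF edge(2)[OF e] _ s(1) t1(2)]) (use s(3) t(2) in simp)
      then show False using s(2) t(1) by simp
    qed
    ultimately show "x \<in> topspace Z - ?C" using nV edge_in[OF e t1(2)] t(2) by blast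
  qed
  ultimately show ?thesis by simp
qed

text \<open>An open segment of an edge is an open subset of the graph, so a midpoint is a wall that separates
  the two halves of its open edge.\<close>

lemma (in finite_graph) midpoint_walls:
  fixes \<epsilon> :: "'i \<Rightarrow> real \<Rightarrow> 'a"
  assumes B: "finite B" "inj_on \<epsilon> B" "\<epsilon> ` B \<subseteq> E"
  defines "N \<equiv> \<lambda>i. \<epsilon> i ` {0<..<1/2}" and "M \<equiv> \<lambda>i. {\<epsilon> i (1/2)}" and "P \<equiv> \<lambda>i. \<epsilon> i ` {1/2<..<1}"
  shows "wall_system Z B N M P" "\<And>i. i \<in> B \<Longrightarrow> crosses_once B M P i (\<epsilon> i)"
    "\<And>i x. i \<in> B \<Longrightarrow> x \<in> V \<Longrightarrow> x \<notin> M i"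
    "\<And>i e t. i \<in> B \<Longrightarrow> e \<in> E \<Longrightarrow> t \<in> {0..1} \<Longrightarrow> e t \<in> M i \<Longrightarrow> e = \<epsilon> i"
proof -
  have eE: "\<epsilon> i \<in> E" if "i \<in> B" for i using B(3) that by blast
  have inj: "s = t" if "i \<in> B" "s \<in> {0..1}" "t \<in> {0..1}" "\<epsilon> i s = \<epsilon> i t" for i s t
    using inj_onD[OF edge(2)[OF eE[OF that(1)]]] that by blast
  have nV: "\<epsilon> i t \<notin> V" if "i \<in> B" "t \<in> {0<..<1}" for i t using edge(5)[OF eE[OF that(1)]] that(2) by blast
  have same: "e = \<epsilon> i" if "i \<in> B" "e \<in> E" "s \<in> {0..1}" "t \<in> {0<..<1}" "e s = \<epsilon> i t" for i e s t
    using edge_eq[OF that(2) eE[OF that(1)] that(3), of t] that nV[OF that(1,4)] by auto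
  have ij: "i = j" if "i \<in> B" "j \<in> B" "s \<in> {0..1}" "t \<in> {0<..<1}" "\<epsilon> i s = \<epsilon> j t" for i j s t
    using inj_onD[OF B(2) same[OF that(2) eE[OF that(1)] that(3,4,5)] that(1,2)] .
  show 1: "x \<notin> M i" if "i \<in> B" "x \<in> V" for i x using nV[OF that(1), of "1/2"] that(2) by (auto simp: M_def)
  show "e = \<epsilon> i" if "i \<in> B" "e \<in> E" "t \<in> {0..1}" "e t \<in> M i" for i e t
    using same[OF that(1-3), of "1/2"] that(4) by (simp add: M_def)
  show "wall_system Z B N M P"
  proof
    fix i assume i: "i \<in> B"
    have "N i \<union> M i \<union> P i = \<epsilon> i ` ({0<..<1/2} \<union> {1/2} \<union> {1/2<..<1})"
      unfolding N_def M_def P_def image_Un by blast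
    moreover have "{0<..<1/2} \<union> {1/2} \<union> {1/2<..<1} = {0<..<1::real}" by auto
    ultimately have "N i \<union> M i \<union> P i = \<epsilon> i ` {0<..<1}" by (rule trans[OF _ arg_cong])
    moreover have "openin Z (\<epsilon> i ` {0<..<1})" by (rule openin_edge_part[OF eE[OF i]]) auto
    ultimately show "openin Z (N i \<union> M i \<union> P i)" by (rule ssubst)
    show "openin Z (N i)" unfolding N_def by (rule openin_edge_part[OF eE[OF i]]) auto
    show "openin Z (P i)" unfolding P_def by (rule openin_edge_part[OF eE[OF i]]) auto
    show "closedin Z (M i)"
      unfolding M_def using closedin_Hausdorff_singleton[OF Hausdorff] edge_in[OF eE[OF i], of "1/2"] by simp
    have "\<epsilon> i s \<noteq> \<epsilon> i t" if "0 < s" "s < t" "t < 1" for s t using inj[OF i, of s t] that by auto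
    then show "N i \<inter> M i = {}" "P i \<inter> M i = {}" "N i \<inter> P i = {}"
      unfolding N_def M_def P_def by (fastforce dest: sym)+
  next
    fix i j assume i: "i \<in> B" "j \<in> B" "i \<noteq> j"
    have "\<epsilon> i s \<noteq> \<epsilon> j (1/2)" if "s \<in> {0..1}" for s using ij[OF i(1,2) that, of "1/2"] i(3) by auto
    then show "M j \<inter> (N i \<union> M i \<union> P i) = {}"
      unfolding N_def M_def P_def by (fastforce dest: sym)
  qed (rule B(1))
  show "crosses_once B M P i (\<epsilon> i)" if i: "i \<in> B" for i
    unfolding crosses_once_def
  proof (intro bexI[of _ "1/2"] conjI ballI exI[of _ "1/2"])
    fix t j assume t: "t \<in> {0..1::real}" and j: "j \<in> B"
    show "\<epsilon> i t \<in> M j \<longleftrightarrow> j = i \<and> t = 1/2"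
    proof
      assume "\<epsilon> i t \<in> M j"
      then have eq: "\<epsilon> i t = \<epsilon> j (1/2)" by (simp add: M_def)
      then have "i = j" using ij[OF i j t, of "1/2"] by simp
      then show "j = i \<and> t = 1/2" using inj[OF i t, of "1/2"] eq by simp
    next
      assume "j = i \<and> t = 1/2"
      then show "\<epsilon> i t \<in> M j" by (simp only: M_def singleton_iff)
    qed
  next
    fix t assume t: "t \<in> {0..1::real}"
    show "1/2 - 1/2 < t \<and> t < 1/2 \<longrightarrow> \<epsilon> i t \<notin> P i"
    proof (rule impI, rule notI)
      assume "1/2 - 1/2 < t \<and> t < 1/2" "\<epsilon> i t \<in> P i"
      then obtain s where "s \<in> {1/2<..<1}" "\<epsilon> i t = \<epsilon> i s" "t < 1/2" by (auto simp: P_def)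
      then show False using inj[OF i t, of s] by auto
    qed
    show "1/2 < t \<and> t < 1/2 + 1/2 \<longrightarrow> \<epsilon> i t \<in> P i" by (auto simp: P_def)
  qed auto
qed

lemma wall_system_preimage:
  assumes "wall_system Y B N M P" and q: "continuous_map Z Y q"
  shows "wall_system Z B (\<lambda>i. {x \<in> topspace Z. q x \<in> N i}) (\<lambda>i. {x \<in> topspace Z. q x \<in> M i}) (\<lambda>i. {x \<in> topspace Z. q x \<in> P i})"
proof -
  interpret wall_system Y B N M P by fact
  show ?thesis
  proof
    fix i assume i: "i \<in> B"
    have "openin Z {x \<in> topspace Z. q x \<in> N i \<union> M i \<union> P i}" by (rule openin_continuous_map_preimage[OF q wall_nbhd[OF i]])
    moreover have "{x \<in> topspace Z. q x \<in> N i \<union> M i \<union> P i} =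
        {x \<in> topspace Z. q x \<in> N i} \<union> {x \<in> topspace Z. q x \<in> M i} \<union> {x \<in> topspace Z. q x \<in> P i}" by blast
    ultimately show "openin Z ({x \<in> topspace Z. q x \<in> N i} \<union> {x \<in> topspace Z. q x \<in> M i} \<union> {x \<in> topspace Z. q x \<in> P i})" by simp
    show "openin Z {x \<in> topspace Z. q x \<in> N i}" "openin Z {x \<in> topspace Z. q x \<in> P i}"
      using openin_continuous_map_preimage[OF q] open_sides[OF i] by auto
    show "closedin Z {x \<in> topspace Z. q x \<in> M i}" by (rule closedin_continuous_map_preimage[OF q closed_wall[OF i]])
    show "{x \<in> topspace Z. q x \<in> N i} \<inter> {x \<in> topspace Z. q x \<in> M i} = {}"
      "{x \<in> topspace Z. q x \<in> P i} \<inter> {x \<in> topspace Z. q x \<in> M i} = {}"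
      "{x \<in> topspace Z. q x \<in> N i} \<inter> {x \<in> topspace Z. q x \<in> P i} = {}"
      using sides_disjoint[OF i] by blast+
  next
    fix i j assume "i \<in> B" "j \<in> B" "i \<noteq> j"
    then show "{x \<in> topspace Z. q x \<in> M j} \<inter>
       ({x \<in> topspace Z. q x \<in> N i} \<union> {x \<in> topspace Z. q x \<in> M i} \<union> {x \<in> topspace Z. q x \<in> P i}) = {}"
      using walls_disjoint[of i j] by blast
  qed (rule finite_walls)
qed

lemma generate_eq_if_covers:
  assumes "group G" and A: "generate G A = carrier G" and C: "C \<subseteq> A" "A \<subseteq> insert \<one>\<^bsub>G\<^esub> C" and car: "A \<subseteq> carrier G"
  shows "generate G C = carrier G"
proof -
  interpret group G by fact
  have Cc: "C \<subseteq> carrier G" using C(1) car by blast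
  have sub: "subgroup (generate G C) G" by (rule generate_is_subgroup[OF Cc])
  have "C \<subseteq> generate G C" by (auto intro: generate.incl)
  then have "A \<subseteq> generate G C" using C(2) subgroup.one_closed[OF sub] by blast
  then have "carrier G \<subseteq> generate G C" using generate_subgroup_incl[OF _ sub] A by blast
  then show ?thesis using subgroup.subset[OF sub] by blast
qed

text \<open>The map \<open>q\<close> sends the subtree with edges \<open>F v\<close> to the vertex
  \<open>v\<close> and the remaining edges, those in \<open>L\<close>, to the edges of
  \<open>Y\<close>.\<close>

locale graph_collapse =
  Z: finite_graph Z U "L \<union> (\<Union>v\<in>V. F v)" + Y: finite_graph Y V "(\<lambda>e. q \<circ> e) ` L"
  for Z :: "'a topology" and U :: "'a set" and L :: "(real \<Rightarrow> 'a) set" and F :: "'b \<Rightarrow> (real \<Rightarrow> 'a) set"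
    and Y :: "'b topology" and V :: "'b set" and q :: "'a \<Rightarrow> 'b" +
  fixes z0 :: 'a
  assumes q: "continuous_map Z Y q" and vertices: "q ` U = V" and L_inj: "inj_on (\<lambda>e. q \<circ> e) L"
    and forest: "v \<in> V \<Longrightarrow> e \<in> F v \<Longrightarrow> t \<in> {0..1} \<Longrightarrow> q (e t) = v"
    and connected_trees: "v \<in> V \<Longrightarrow> connectedin Z ({u \<in> U. q u = v} \<union> (\<Union>e\<in>F v. e ` {0..1}))"
    and no_circles: "v \<in> V \<Longrightarrow> S \<subseteq> {u \<in> U. q u = v} \<union> (\<Union>e\<in>F v. e ` {0..1}) \<Longrightarrow>
      \<not> subtopology Z S homeomorphic_space top_of_set (sphere (0::complex) 1)"
    and connected: "connected_space Y" and z0: "z0 \<in> U"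
begin

text \<open>The subtree over \<open>v\<close>, with all vertices over \<open>v\<close>; it may be a single
  point.\<close>

definition tree :: "'b \<Rightarrow> 'a set" where
  "tree v = {u \<in> U. q u = v} \<union> (\<Union>e\<in>F v. e ` {0..1})"

lemma tree_fibre: "v \<in> V \<Longrightarrow> x \<in> tree v \<Longrightarrow> q x = v"
proof -
  assume v: "v \<in> V" and x: "x \<in> tree v"
  consider "q x = v" | e t where "e \<in> F v" "t \<in> {0..1}" "x = e t" using x unfolding tree_def by blast
  then show ?thesis using forest[OF v] by cases auto
qed

lemma tree_subset: "v \<in> V \<Longrightarrow> tree v \<subseteq> topspace Z"
  using connectedin_subset_topspace[OF connected_trees[of v]] by (simp add: tree_def)

lemma tree_graph:
  assumes v: "v \<in> V" shows "finite_graph (subtopology Z (tree v)) {u \<in> U. q u = v} (F v)"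
proof
  have top: "topspace (subtopology Z (tree v)) = tree v" using tree_subset[OF v] by auto
  have FE: "e \<in> L \<union> (\<Union>v\<in>V. F v)" if "e \<in> F v" for e using that v by blast
  show "Hausdorff_space (subtopology Z (tree v))" using Z.Hausdorff by (rule Hausdorff_space_subtopology)
  show "finite {u \<in> U. q u = v}" using Z.finite_V by simp
  show "{u \<in> U. q u = v} \<subseteq> topspace (subtopology Z (tree v))" unfolding top by (auto simp: tree_def)
  show "finite (F v)" by (rule finite_subset[OF _ Z.finite_E]) (use v in blast)
  show "topspace (subtopology Z (tree v)) = {u \<in> U. q u = v} \<union> (\<Union>e\<in>F v. e ` {0..1})" unfolding top by (simp add: tree_def)
  fix e assume e: "e \<in> F v"
  have im: "e t \<in> tree v" if "t \<in> {0..1}" for t using e that unfolding tree_def by blast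
  show "pathin (subtopology Z (tree v)) e" using Z.edge(1)[OF FE[OF e]] im by (simp add: pathin_subtopology)
  show "inj_on e {0..1}" by (rule Z.edge(2)[OF FE[OF e]])
  show "e 0 \<in> {u \<in> U. q u = v}" "e 1 \<in> {u \<in> U. q u = v}"
    using Z.edge(3,4)[OF FE[OF e]] forest[OF v e] by auto
  show "e ` {0<..<1} \<inter> {u \<in> U. q u = v} = {}" using Z.edge(5)[OF FE[OF e]] by blast
  fix e' assume e': "e' \<in> F v" "e \<noteq> e'"
  show "e ` {0<..<1} \<inter> e' ` {0<..<1} = {}" by (rule Z.edges_disjoint[OF FE[OF e] FE[OF e'(1)] e'(2)])
qed

lemma tree_contraction:
  assumes v: "v \<in> V" and u0: "u0 \<in> U" "q u0 = v"
  obtains \<sigma> where "\<sigma> u0 = (\<lambda>_. u0)"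
    "\<And>u. u \<in> U \<Longrightarrow> q u = v \<Longrightarrow> pathin Z (\<sigma> u) \<and> \<sigma> u 0 = u0 \<and> \<sigma> u 1 = u \<and> \<sigma> u ` {0..1} \<subseteq> tree v"
    "\<And>e. e \<in> F v \<Longrightarrow> path_homotopic Z (join_loops (\<sigma> (e 0)) e) (\<sigma> (e 1))"
proof -
  interpret T: finite_graph "subtopology Z (tree v)" "{u \<in> U. q u = v}" "F v" by (rule tree_graph[OF v])
  have top: "topspace (subtopology Z (tree v)) = tree v" using tree_subset[OF v] by auto
  have conn: "connected_space (subtopology Z (tree v))"
    using connected_trees[OF v] by (simp add: tree_def connectedin_def)
  have nc: "\<not> (\<exists>S\<subseteq>topspace (subtopology Z (tree v)). subtopology (subtopology Z (tree v)) S homeomorphic_space top_of_set (sphere (0::complex) 1))"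
  proof (rule notI, elim exE conjE)
    fix S assume S: "S \<subseteq> topspace (subtopology Z (tree v))"
      and h: "subtopology (subtopology Z (tree v)) S homeomorphic_space top_of_set (sphere (0::complex) 1)"
    have St: "S \<subseteq> tree v" using S top by simp
    then have "tree v \<inter> S = S" by blast
    then have "subtopology Z S homeomorphic_space top_of_set (sphere (0::complex) 1)"
      using h by (simp add: subtopology_subtopology)
    then show False using no_circles[OF v, of S] St by (simp add: tree_def)
  qed
  have u0': "u0 \<in> {u \<in> U. q u = v}" using u0 by simp
  obtain \<sigma> where \<sigma>: "\<sigma> u0 = (\<lambda>_. u0)"
    "\<And>u. u \<in> {u \<in> U. q u = v} \<Longrightarrow> pathin (subtopology Z (tree v)) (\<sigma> u) \<and> \<sigma> u 0 = u0 \<and> \<sigma> u 1 = u"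
    "\<And>e. e \<in> F v \<Longrightarrow> path_homotopic (subtopology Z (tree v)) (join_loops (\<sigma> (e 0)) e) (\<sigma> (e 1))"
    by (rule T.tree_contracts[OF conn u0' nc], rule that)
  show thesis
  proof (rule that[of \<sigma>], rule \<sigma>(1))
    fix u assume "u \<in> U" "q u = v"
    then have "pathin (subtopology Z (tree v)) (\<sigma> u) \<and> \<sigma> u 0 = u0 \<and> \<sigma> u 1 = u" by (intro \<sigma>(2)) simp
    then show "pathin Z (\<sigma> u) \<and> \<sigma> u 0 = u0 \<and> \<sigma> u 1 = u \<and> \<sigma> u ` {0..1} \<subseteq> tree v"
      by (auto simp: pathin_subtopology)
  next
    fix e assume e: "e \<in> F v"
    have "continuous_map (subtopology Z (tree v)) Z id" using continuous_map_from_subtopology[OF continuous_map_id] by simp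
    from path_homotopic_image[OF \<sigma>(3)[OF e] this]
    show "path_homotopic Z (join_loops (\<sigma> (e 0)) e) (\<sigma> (e 1))" by simp
  qed
qed

definition forest_part :: "(real \<Rightarrow> 'a) set \<Rightarrow> 'a set" where
  "forest_part S = (\<Union>v\<in>V. tree v) \<union> (\<Union>e\<in>S. e ` {0..1})"

text \<open>The state of growing a spanning tree of \<open>Y\<close>, with vertices \<open>W\<close> and edges
  \<open>S\<close> reached so far, in terms of paths in \<open>Z\<close>: \<open>\<tau> u\<close> leads from
  \<open>z0\<close> to \<open>u\<close> through \<open>S\<close> and the subtrees. In \<open>Y\<close> it only
  depends on the vertex \<open>q u\<close>, and conjugation by these paths makes all edges reached so far
  trivial.\<close>

definition spanned :: "'b set \<Rightarrow> (real \<Rightarrow> 'a) set \<Rightarrow> ('a \<Rightarrow> real \<Rightarrow> 'a) \<Rightarrow> bool" where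
  "spanned W S \<tau> \<longleftrightarrow> \<tau> z0 = (\<lambda>_. z0) \<and>
     (\<forall>u\<in>U. q u \<in> W \<longrightarrow> pathin Z (\<tau> u) \<and> \<tau> u 0 = z0 \<and> \<tau> u 1 = u \<and> \<tau> u ` {0..1} \<subseteq> forest_part S) \<and>
     (\<forall>u\<in>U. \<forall>u'\<in>U. q u \<in> W \<longrightarrow> q u = q u' \<longrightarrow> (\<forall>t\<in>{0..1}. q (\<tau> u t) = q (\<tau> u' t))) \<and>
     (\<forall>e\<in>S. q (e 0) \<in> W \<and> q (e 1) \<in> W) \<and>
     (\<forall>e\<in>S \<union> (\<Union>v\<in>W. F v). path_homotopic Z (join_loops (\<tau> (e 0)) e) (\<tau> (e 1)))"

lemma spannedD:
  assumes "spanned W S \<tau>"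
  shows "\<tau> z0 = (\<lambda>_. z0)"
    "\<And>u. u \<in> U \<Longrightarrow> q u \<in> W \<Longrightarrow> pathin Z (\<tau> u)" "\<And>u. u \<in> U \<Longrightarrow> q u \<in> W \<Longrightarrow> \<tau> u 0 = z0"
    "\<And>u. u \<in> U \<Longrightarrow> q u \<in> W \<Longrightarrow> \<tau> u 1 = u" "\<And>u. u \<in> U \<Longrightarrow> q u \<in> W \<Longrightarrow> \<tau> u ` {0..1} \<subseteq> forest_part S"
    "\<And>u u' t. u \<in> U \<Longrightarrow> u' \<in> U \<Longrightarrow> q u \<in> W \<Longrightarrow> q u = q u' \<Longrightarrow> t \<in> {0..1} \<Longrightarrow> q (\<tau> u t) = q (\<tau> u' t)"
    "\<And>e. e \<in> S \<Longrightarrow> q (e 0) \<in> W" "\<And>e. e \<in> S \<Longrightarrow> q (e 1) \<in> W"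
    "\<And>e. e \<in> S \<union> (\<Union>v\<in>W. F v) \<Longrightarrow> path_homotopic Z (join_loops (\<tau> (e 0)) e) (\<tau> (e 1))"
proof -
  note s = assms[unfolded spanned_def]
  show "\<tau> z0 = (\<lambda>_. z0)" using s by blast
  show "pathin Z (\<tau> u)" "\<tau> u 0 = z0" "\<tau> u 1 = u" "\<tau> u ` {0..1} \<subseteq> forest_part S" if "u \<in> U" "q u \<in> W" for u
    using bspec[OF conjunct1[OF conjunct2[OF s]] that(1)] that(2) by auto
  show "q (\<tau> u t) = q (\<tau> u' t)" if "u \<in> U" "u' \<in> U" "q u \<in> W" "q u = q u'" "t \<in> {0..1}" for u u' t
    using s that by blast
  show "q (e 0) \<in> W" "q (e 1) \<in> W" if "e \<in> S" for e using s that by blast+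
  show "path_homotopic Z (join_loops (\<tau> (e 0)) e) (\<tau> (e 1))" if "e \<in> S \<union> (\<Union>v\<in>W. F v)" for e
    using s that by blast
qed

lemma spanned_start: "\<exists>\<tau>. spanned {q z0} {} \<tau>"
proof -
  have v: "q z0 \<in> V" using z0 vertices by blast
  obtain \<sigma> where \<sigma>: "\<sigma> z0 = (\<lambda>_. z0)"
    "\<And>u. u \<in> U \<Longrightarrow> q u = q z0 \<Longrightarrow> pathin Z (\<sigma> u) \<and> \<sigma> u 0 = z0 \<and> \<sigma> u 1 = u \<and> \<sigma> u ` {0..1} \<subseteq> tree (q z0)"
    "\<And>e. e \<in> F (q z0) \<Longrightarrow> path_homotopic Z (join_loops (\<sigma> (e 0)) e) (\<sigma> (e 1))"
    by (rule tree_contraction[OF v z0 refl], rule that)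
  have const: "q (\<sigma> u t) = q z0" if "u \<in> U" "q u = q z0" "t \<in> {0..1}" for u t
    using \<sigma>(2)[OF that(1,2)] that(3) by (intro tree_fibre[OF v]) blast
  have "\<sigma> u ` {0..1} \<subseteq> forest_part {}" if "u \<in> U" "q u = q z0" for u
    using \<sigma>(2)[OF that] v unfolding forest_part_def by blast
  then have "spanned {q z0} {} \<sigma>"
    unfolding spanned_def using \<sigma> const by simp
  then show ?thesis by blast
qed

text \<open>The paths to the new subtree go through \<open>e\<close> to its end \<open>r\<close> over
  \<open>b\<close>, and on within the subtree, which is contracted to \<open>r\<close> for this
  purpose.\<close>

lemma spanned_step:
  assumes \<tau>: "spanned W S \<tau>" and z0W: "q z0 \<in> W" and WV: "W \<subseteq> V" and SL: "S \<subseteq> L" and e: "e \<in> L"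
    and ab: "a = q (e 0) \<and> b = q (e 1) \<or> a = q (e 1) \<and> b = q (e 0)" and a: "a \<in> W" and b: "b \<in> V - W"
  shows "\<exists>\<tau>'. spanned (insert b W) (insert e S) \<tau>'"
proof -
  have eE: "e \<in> L \<union> (\<Union>v\<in>V. F v)" using e by blast
  note pe = Z.edge(1)[OF eE]
  have eU: "e 0 \<in> U" "e 1 \<in> U" using Z.edge(3,4)[OF eE] by auto
  have abne: "a \<noteq> b" using a b by auto
  define fwd where "fwd \<longleftrightarrow> q (e 0) = a"
  define \<epsilon> where "\<epsilon> = (if fwd then e else reverse_path e)"
  define p r where "p = \<epsilon> 0" and "r = \<epsilon> 1"
  have \<epsilon>: "pathin Z \<epsilon>" "\<epsilon> ` {0..1} = e ` {0..1}" "p \<in> U" "r \<in> U" "q p = a" "q r = b"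
    using pe pathin_reverse_path[OF pe] reverse_path_image[of e] eU ab by (auto simp: \<epsilon>_def p_def r_def fwd_def)
  note \<tau>D = spannedD[OF \<tau>]
  have bV: "b \<in> V" using b by simp
  obtain \<sigma> where \<sigma>: "\<sigma> r = (\<lambda>_. r)"
    "\<And>u. u \<in> U \<Longrightarrow> q u = b \<Longrightarrow> pathin Z (\<sigma> u) \<and> \<sigma> u 0 = r \<and> \<sigma> u 1 = u \<and> \<sigma> u ` {0..1} \<subseteq> tree b"
    "\<And>d. d \<in> F b \<Longrightarrow> path_homotopic Z (join_loops (\<sigma> (d 0)) d) (\<sigma> (d 1))"
    by (rule tree_contraction[OF bV \<epsilon>(4,6)], rule that)
  define \<kappa> where "\<kappa> = join_loops (\<tau> p) \<epsilon>"
  have aW: "q p \<in> W" using \<epsilon>(5) a by simp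
  have \<tau>p: "pathin Z (\<tau> p)" "\<tau> p 0 = z0" "\<tau> p 1 = p" using \<tau>D(2-4)[OF \<epsilon>(3) aW] by auto
  have \<kappa>: "pathin Z \<kappa>" "\<kappa> 0 = z0" "\<kappa> 1 = r"
    unfolding \<kappa>_def using \<tau>p \<epsilon>(1) by (auto intro: pathin_join_loops simp: p_def r_def)
  define \<tau>' where "\<tau>' u = (if q u = b then join_loops \<kappa> (\<sigma> u) else \<tau> u)" for u
  have old: "\<tau>' u = \<tau> u" if "q u \<in> W" for u using that b by (auto simp: \<tau>'_def)
  have new: "\<tau>' u = join_loops \<kappa> (\<sigma> u)" if "q u = b" for u using that by (simp add: \<tau>'_def)
  have grow: "forest_part S \<subseteq> forest_part (insert e S)" by (auto simp: forest_part_def)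
  have "\<kappa> ` {0..1} \<subseteq> forest_part (insert e S)"
    unfolding \<kappa>_def
  proof (rule subset_trans[OF join_loops_image], rule Un_least)
    show "\<tau> p ` {0..1} \<subseteq> forest_part (insert e S)" by (rule subset_trans[OF \<tau>D(5)[OF \<epsilon>(3) aW] grow])
    show "\<epsilon> ` {0..1} \<subseteq> forest_part (insert e S)" unfolding \<epsilon>(2) by (auto simp: forest_part_def)
  qed
  then have new_image: "join_loops \<kappa> (\<sigma> u) ` {0..1} \<subseteq> forest_part (insert e S)" if "u \<in> U" "q u = b" for u
  proof (intro subset_trans[OF join_loops_image] Un_least)
    show "\<sigma> u ` {0..1} \<subseteq> forest_part (insert e S)" using \<sigma>(2)[OF that] bV unfolding forest_part_def by blast
  qed
  have new_path: "pathin Z (join_loops \<kappa> (\<sigma> u))" if "u \<in> U" "q u = b" for u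
    using \<sigma>(2)[OF that] \<kappa> by (intro pathin_join_loops) auto
  have fibre: "q (\<sigma> u t) = b" if "u \<in> U" "q u = b" "t \<in> {0..1}" for u t
    using \<sigma>(2)[OF that(1,2)] that(3) by (intro tree_fibre[OF bV]) blast
  have new_fibre: "q (join_loops \<kappa> (\<sigma> u) t) = q (join_loops \<kappa> (\<sigma> u') t)"
    if "u \<in> U" "q u = b" "u' \<in> U" "q u' = b" "t \<in> {0..1}" for u u' t
    using fibre[OF that(1,2), of "2 * t - 1"] fibre[OF that(3,4), of "2 * t - 1"] that(5) by (auto simp: join_loops_def)
  have to_r: "path_homotopic Z (join_loops \<kappa> (\<sigma> r)) \<kappa>"
    unfolding \<sigma>(1) by (rule path_homotopic_unit_right[OF \<kappa>(1)]) (simp add: \<kappa>)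
  have new_edge: "path_homotopic Z (join_loops (\<tau>' (e 0)) e) (\<tau>' (e 1))"
  proof (cases fwd)
    case True
    then have s: "p = e 0" "r = e 1" "\<epsilon> = e" by (simp_all add: p_def r_def \<epsilon>_def)
    have "\<tau>' (e 0) = \<tau> p" using old[OF aW] s by simp
    moreover have "\<tau>' (e 1) = join_loops \<kappa> (\<sigma> r)" using new[OF \<epsilon>(6)] s by simp
    moreover have "join_loops (\<tau> p) e = \<kappa>" using s by (simp add: \<kappa>_def)
    ultimately show ?thesis using path_homotopic_sym[OF to_r] by simp
  next
    case False
    then have s: "p = e 1" "r = e 0" "\<epsilon> = reverse_path e" by (simp_all add: p_def r_def \<epsilon>_def)
    have e1: "\<tau>' (e 0) = join_loops \<kappa> (\<sigma> r)" "\<tau>' (e 1) = \<tau> p" using new[OF \<epsilon>(6)] old[OF aW] s by simp_all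
    have "path_homotopic Z (join_loops (join_loops \<kappa> (\<sigma> r)) e) (join_loops \<kappa> e)"
      by (rule path_homotopic_join[OF to_r path_homotopic_refl[OF pe]]) (simp add: \<sigma>(1) s(2)[symmetric])
    also have "path_homotopic Z \<dots> (join_loops (\<tau> p) (join_loops (reverse_path e) e))"
      unfolding \<kappa>_def s(3) using \<tau>p s by (intro path_homotopic_assoc pathin_reverse_path pe) auto
    also have "path_homotopic Z \<dots> (join_loops (\<tau> p) (\<lambda>_. e 1))"
      using \<tau>p s by (intro path_homotopic_join path_homotopic_refl path_homotopic_inverse_left pe) auto
    also have "path_homotopic Z \<dots> (\<tau> p)" using \<tau>p s by (intro path_homotopic_unit_right) auto
    finally show ?thesis unfolding e1 .
  qed
  have tree_edge: "path_homotopic Z (join_loops (\<tau>' (d 0)) d) (\<tau>' (d 1))" if d: "d \<in> F b" for d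
  proof -
    have dE: "d \<in> L \<union> (\<Union>v\<in>V. F v)" using d bV by blast
    have dU: "d 0 \<in> U" "d 1 \<in> U" "q (d 0) = b" "q (d 1) = b" using Z.edge(3,4)[OF dE] forest[OF bV d] by auto
    have \<sigma>0: "pathin Z (\<sigma> (d 0))" "\<sigma> (d 0) 0 = r" "\<sigma> (d 0) 1 = d 0" using \<sigma>(2)[OF dU(1,3)] by auto
    have "path_homotopic Z (join_loops (join_loops \<kappa> (\<sigma> (d 0))) d) (join_loops \<kappa> (join_loops (\<sigma> (d 0)) d))"
      using \<kappa> \<sigma>0 by (intro path_homotopic_assoc Z.edge(1)[OF dE]) auto
    also have "path_homotopic Z \<dots> (join_loops \<kappa> (\<sigma> (d 1)))"
      using \<kappa> \<sigma>0 by (intro path_homotopic_join path_homotopic_refl \<sigma>(3)[OF d]) auto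
    finally show ?thesis unfolding new[OF dU(3)] new[OF dU(4)] .
  qed
  have old_edge: "path_homotopic Z (join_loops (\<tau>' (d 0)) d) (\<tau>' (d 1))" if d: "d \<in> S \<union> (\<Union>v\<in>W. F v)" for d
  proof -
    have "q (d 0) \<in> W" "q (d 1) \<in> W"
      using d \<tau>D(7,8)[of d] forest[of _ d 0] forest[of _ d 1] WV by auto
    then show ?thesis using \<tau>D(9)[OF d] old by simp
  qed
  have "spanned (insert b W) (insert e S) \<tau>'"
    unfolding spanned_def
  proof (intro conjI ballI impI)
    show "\<tau>' z0 = (\<lambda>_. z0)" using old[OF z0W] \<tau>D(1) by simp
    fix u assume u: "u \<in> U" "q u \<in> insert b W"
    have "pathin Z (\<tau>' u) \<and> \<tau>' u 0 = z0 \<and> \<tau>' u 1 = u \<and> \<tau>' u ` {0..1} \<subseteq> forest_part (insert e S)"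
    proof (cases "q u = b")
      case True
      then show ?thesis using new[OF True] new_path[OF u(1) True] new_image[OF u(1) True] \<sigma>(2)[OF u(1) True] \<kappa>(2) by simp
    next
      case False
      then have uW: "q u \<in> W" using u(2) by simp
      show ?thesis using old[OF uW] \<tau>D(2-4)[OF u(1) uW] subset_trans[OF \<tau>D(5)[OF u(1) uW] grow] by simp
    qed
    then show "pathin Z (\<tau>' u)" "\<tau>' u 0 = z0" "\<tau>' u 1 = u" "\<tau>' u ` {0..1} \<subseteq> forest_part (insert e S)" by auto
  next
    fix u u' t assume u: "u \<in> U" "u' \<in> U" "q u \<in> insert b W" "q u = q u'" "t \<in> {0..1::real}"
    show "q (\<tau>' u t) = q (\<tau>' u' t)"
    proof (cases "q u = b")
      case True
      then show ?thesis using new[of u] new[of u'] new_fibre[OF u(1) _ u(2) _ u(5)] u(4) by simp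
    next
      case False
      then have uW: "q u \<in> W" using u(3) by simp
      then have "q u' \<in> W" using u(4) by simp
      then show ?thesis using old[OF uW] old[of u'] \<tau>D(6)[OF u(1,2) uW u(4,5)] by simp
    qed
  next
    fix d assume d: "d \<in> insert e S"
    show "q (d 0) \<in> insert b W" "q (d 1) \<in> insert b W" using d \<tau>D(7,8)[of d] ab a by auto
  next
    fix d assume "d \<in> insert e S \<union> (\<Union>v\<in>insert b W. F v)"
    then consider "d = e" | "d \<in> F b" | "d \<in> S \<union> (\<Union>v\<in>W. F v)" by blast
    then show "path_homotopic Z (join_loops (\<tau>' (d 0)) d) (\<tau>' (d 1))"
      using new_edge tree_edge old_edge by cases auto
  qed
  then show ?thesis by blast
qed

lemma spanned_exists: "\<exists>S\<subseteq>L. \<exists>\<tau>. spanned V S \<tau>"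
proof (rule spanning_growth[of V "q z0" L "\<lambda>e a b. a = q (e 0) \<and> b = q (e 1) \<or> a = q (e 1) \<and> b = q (e 0)"
      "\<lambda>W S. \<exists>\<tau>. spanned W S \<tau>"])
  show "finite V" by (rule Y.finite_V)
  show "q z0 \<in> V" using z0 vertices by blast
  show "\<exists>\<tau>. spanned {q z0} {} \<tau>" by (rule spanned_start)
  show "\<exists>e\<in>L. \<exists>a b. (a = q (e 0) \<and> b = q (e 1) \<or> a = q (e 1) \<and> b = q (e 0)) \<and> a \<in> W \<and> b \<in> V - W"
    if "q z0 \<in> W" "W \<subseteq> V" "W \<noteq> V" for W
  proof -
    have "W \<noteq> {}" using that(1) by blast
    from Y.connected_crossing_edge[OF connected that(2) this that(3)] show ?thesis by auto
  qed
  show "\<exists>\<tau>. spanned (insert b W) (insert e S) \<tau>"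
    if "\<exists>\<tau>. spanned W S \<tau>" "q z0 \<in> W" "W \<subseteq> V" "S \<subseteq> L" "e \<in> L"
      "a = q (e 0) \<and> b = q (e 1) \<or> a = q (e 1) \<and> b = q (e 0)" "a \<in> W" "b \<in> V - W" for W S e a b
  proof -
    from that(1) show ?thesis by (elim exE) (rule spanned_step[OF _ that(2-8)])
  qed
qed

text \<open>The loops are indexed by the edges in \<open>L\<close> outside of a spanning tree \<open>S\<close>
  of \<open>Y\<close>. All other edges of \<open>Z\<close> are trivial in the fundamental group, so that these
  loops generate, in \<open>Z\<close> as well as in \<open>Y\<close>. The loop of an edge \<open>e\<close>
  goes through the subtrees and \<open>S\<close> to the beginning of \<open>e\<close>, along \<open>e\<close>
  and back again, so it meets only the wall at the midpoint of \<open>e\<close>.\<close>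

theorem corresponding_loop_bases:
  obtains B :: "(real \<Rightarrow> 'a) set" and N M P N' M' P' l where
    "loop_basis Z B N M P z0 l" "loop_basis Y B N' M' P' (q z0) (\<lambda>i. q \<circ> l i)"
proof -
  obtain S \<tau> where SL: "S \<subseteq> L" and \<tau>: "spanned V S \<tau>" using spanned_exists by blast
  note \<tau>D = spannedD[OF \<tau>]
  have qV: "q u \<in> V" if "u \<in> U" for u using that vertices by blast
  define B where "B = L - S"
  define l where "l e = join_loops (join_loops (\<tau> (e 0)) e) (reverse_path (\<tau> (e 1)))" for e
  let ?E = "L \<union> (\<Union>v\<in>V. F v)"
  have BE: "e \<in> ?E" if "e \<in> B" for e using that by (auto simp: B_def)
  have z0Z: "z0 \<in> topspace Z" using z0 Z.V_subset by blast
  then have z0Y: "q z0 \<in> topspace Y" using q by (auto simp: continuous_map_def)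
  have \<tau>e: "pathin Z (\<tau> (e 0))" "\<tau> (e 0) 0 = z0" "\<tau> (e 0) 1 = e 0" "pathin Z (\<tau> (e 1))" "\<tau> (e 1) 0 = z0" "\<tau> (e 1) 1 = e 1"
    if "e \<in> ?E" for e
    using \<tau>D(2-4)[OF Z.edge(3)[OF that] qV[OF Z.edge(3)[OF that]]] \<tau>D(2-4)[OF Z.edge(4)[OF that] qV[OF Z.edge(4)[OF that]]] by auto
  have l: "l e \<in> loops Z z0" if "e \<in> ?E" for e
    unfolding l_def loops_def using \<tau>e[OF that] Z.edge(1)[OF that] by (auto intro!: pathin_join_loops pathin_reverse_path)
  have ql: "q \<circ> l e \<in> loops Y (q z0)" if "e \<in> ?E" for e by (rule loops_compose[OF l[OF that] q])
  have trivial: "path_homotopic Z (l e) (\<lambda>_. z0)" if e: "e \<in> ?E" "e \<notin> B" for e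
  proof -
    have "e \<in> S \<union> (\<Union>v\<in>V. F v)" using e by (auto simp: B_def)
    then have "path_homotopic Z (join_loops (\<tau> (e 0)) e) (\<tau> (e 1))" by (rule \<tau>D(9))
    then have "path_homotopic Z (l e) (join_loops (\<tau> (e 1)) (reverse_path (\<tau> (e 1))))"
      unfolding l_def using \<tau>e[OF e(1)] by (intro path_homotopic_join path_homotopic_refl pathin_reverse_path) auto
    also have "path_homotopic Z \<dots> (\<lambda>_. \<tau> (e 1) 0)" by (rule path_homotopic_inverse_right[OF \<tau>e(4)[OF e(1)]])
    finally show ?thesis using \<tau>e(5)[OF e(1)] by simp
  qed
  have pcZ: "path_connected_space Z"
  proof -
    have reach: "\<exists>g. pathin Z g \<and> g 0 = z0 \<and> g 1 = x" if x: "x \<in> topspace Z" for x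
    proof (cases "x \<in> U")
      case True
      then show ?thesis using \<tau>D(2-4)[OF True qV[OF True]] by blast
    next
      case False
      then obtain e t where e: "e \<in> ?E" "t \<in> {0..1}" "x = e t" using x Z.cover by blast
      have "pathin Z (subpath_in e 0 t)" by (rule pathin_subpath_in[OF Z.edge(1)[OF e(1)]]) (use e(2) in auto)
      then have "pathin Z (join_loops (\<tau> (e 0)) (subpath_in e 0 t))"
        using \<tau>e[OF e(1)] by (intro pathin_join_loops) auto
      then show ?thesis using \<tau>e[OF e(1)] e(3) by (intro exI[of _ "join_loops (\<tau> (e 0)) (subpath_in e 0 t)"]) simp
    qed
    show ?thesis
      unfolding path_connected_space_def
    proof (intro ballI)
      fix x y assume "x \<in> topspace Z" "y \<in> topspace Z"
      then obtain g g' where g: "pathin Z g" "g 0 = z0" "g 1 = x" "pathin Z g'" "g' 0 = z0" "g' 1 = y" using reach by metis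
      then show "\<exists>h. pathin Z h \<and> h 0 = x \<and> h 1 = y"
        by (intro exI[of _ "join_loops (reverse_path g) g'"]) (auto intro!: pathin_join_loops pathin_reverse_path)
    qed
  qed
  have q_onto: "topspace Y \<subseteq> q ` topspace Z"
  proof
    fix y assume "y \<in> topspace Y"
    then consider "y \<in> V" | e t where "e \<in> L" "t \<in> {0..1}" "y = (q \<circ> e) t" using Y.cover by auto
    then show "y \<in> q ` topspace Z"
    proof cases
      case 1 then show ?thesis using vertices Z.V_subset by blast
    next
      case 2
      then have "e t \<in> topspace Z" by (intro Z.edge_in) auto
      then show ?thesis using 2(3) by simp
    qed
  qed
  have pcY: "path_connected_space Y"
  proof -
    have "path_connectedin Y (q ` topspace Z)"
      by (rule path_connectedin_continuous_map_image[OF q]) (use pcZ in \<open>simp add: path_connectedin_topspace\<close>)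
    moreover have "q ` topspace Z = topspace Y" using q_onto q by (auto simp: continuous_map_def)
    ultimately show ?thesis by (simp add: path_connectedin_topspace)
  qed
  have genZ: "generate (fundamental_group Z z0) ((\<lambda>e. loop_class Z z0 (l e)) ` B) = carrier (fundamental_group Z z0)"
  proof (rule generate_eq_if_covers[OF group_fundamental_group[OF z0Z]])
    have "generate (fundamental_group Z z0) (path_class Z z0 \<tau> ` ?E) = carrier (fundamental_group Z z0)"
    proof (rule Z.fundamental_group_generated_by_edges[OF z0])
      show "pathin Z (\<tau> v) \<and> \<tau> v 0 = z0 \<and> \<tau> v 1 = v" if "v \<in> U" for v using \<tau>D(2-4)[OF that qV[OF that]] by blast
    qed (rule \<tau>D(1))
    moreover have "path_class Z z0 \<tau> = (\<lambda>e. loop_class Z z0 (l e))" by (simp add: path_class_def l_def fun_eq_iff)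
    ultimately show "generate (fundamental_group Z z0) ((\<lambda>e. loop_class Z z0 (l e)) ` ?E) = carrier (fundamental_group Z z0)" by simp
    show "(\<lambda>e. loop_class Z z0 (l e)) ` B \<subseteq> (\<lambda>e. loop_class Z z0 (l e)) ` ?E" using BE by blast
    show "(\<lambda>e. loop_class Z z0 (l e)) ` ?E \<subseteq> carrier (fundamental_group Z z0)" using loop_class_carrier[OF l] by blast
    show "(\<lambda>e. loop_class Z z0 (l e)) ` ?E \<subseteq> insert \<one>\<^bsub>fundamental_group Z z0\<^esub> ((\<lambda>e. loop_class Z z0 (l e)) ` B)"
    proof (rule image_subsetI)
      fix e assume e: "e \<in> ?E"
      show "loop_class Z z0 (l e) \<in> insert \<one>\<^bsub>fundamental_group Z z0\<^esub> ((\<lambda>e. loop_class Z z0 (l e)) ` B)"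
      proof (cases "e \<in> B")
        case False
        have "loop_class Z z0 (l e) = \<one>\<^bsub>fundamental_group Z z0\<^esub>"
          unfolding one_fundamental_group loop_class_eq_iff[OF l[OF e] const_loop[OF z0Z]] by (rule trivial[OF e False])
        then show ?thesis by simp
      qed simp
    qed
  qed
  define root where "root v = (if v = q z0 then z0 else (SOME u. u \<in> U \<and> q u = v))" for v
  have root: "root v \<in> U" "q (root v) = v" if "v \<in> V" for v
  proof -
    have "\<exists>u. u \<in> U \<and> q u = v" using that vertices by blast
    from someI_ex[OF this] show "root v \<in> U" "q (root v) = v" using z0 by (auto simp: root_def)
  qed
  define \<tau>Y where "\<tau>Y v = q \<circ> \<tau> (root v)" for v
  have \<tau>Y: "pathin Y (\<tau>Y v) \<and> \<tau>Y v 0 = q z0 \<and> \<tau>Y v 1 = v" if "v \<in> V" for v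
  proof -
    have "q (root v) \<in> V" using root[OF that] that by simp
    note t = \<tau>D(2-4)[OF root(1)[OF that] this]
    show ?thesis unfolding \<tau>Y_def using pathin_compose[OF t(1) q] t(2,3) root(2)[OF that] by simp
  qed
  have \<tau>Y0: "\<tau>Y (q z0) = (\<lambda>_. q z0)" using \<tau>D(1) by (simp add: \<tau>Y_def root_def fun_eq_iff)
  \<comment> \<open>In \<open>Y\<close> the path \<open>\<tau> u\<close> can be replaced by the path to any
    other vertex of the same subtree.\<close>
  have classY: "path_class Y (q z0) \<tau>Y (q \<circ> e) = loop_class Y (q z0) (q \<circ> l e)" if e: "e \<in> L" for e
  proof -
    have eE: "e \<in> ?E" using e by blast
    have same: "\<tau>Y (q u) t = q (\<tau> u t)" if "u \<in> U" "t \<in> {0..1}" for u t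
      using \<tau>D(6)[OF root(1)[OF qV[OF that(1)]] that(1) _ root(2)[OF qV[OF that(1)]] that(2)] root(2)[OF qV[OF that(1)]] qV[OF that(1)]
      by (simp add: \<tau>Y_def)
    let ?k = "join_loops (join_loops (\<tau>Y (q (e 0))) (q \<circ> e)) (reverse_path (\<tau>Y (q (e 1))))"
    have "?k t = (q \<circ> l e) t" if t: "t \<in> {0..1}" for t
      using same[OF Z.edge(3)[OF eE]] same[OF Z.edge(4)[OF eE]] t
      by (auto simp: join_loops_def reverse_path_def l_def)
    then have "path_homotopic Y (q \<circ> l e) ?k"
      by (intro path_homotopic_cong) (use ql[OF eE] in \<open>auto simp: loops_def\<close>)
    moreover have "?k \<in> loops Y (q z0)"
      using path_homotopic_pathin[OF calculation] path_homotopic_ends[OF calculation] ql[OF eE] by (auto simp: loops_def)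
    ultimately have "loop_class Y (q z0) (q \<circ> l e) = loop_class Y (q z0) ?k"
      using loop_class_eq_iff[OF ql[OF eE]] by blast
    then show ?thesis by (simp add: path_class_def)
  qed
  have genY: "generate (fundamental_group Y (q z0)) ((\<lambda>e. loop_class Y (q z0) (q \<circ> l e)) ` B) = carrier (fundamental_group Y (q z0))"
  proof (rule generate_eq_if_covers[OF group_fundamental_group[OF z0Y]])
    have "generate (fundamental_group Y (q z0)) (path_class Y (q z0) \<tau>Y ` (\<lambda>e. q \<circ> e) ` L) = carrier (fundamental_group Y (q z0))"
      by (rule Y.fundamental_group_generated_by_edges[OF qV[OF z0] \<tau>Y \<tau>Y0])
    moreover have "path_class Y (q z0) \<tau>Y ` (\<lambda>e. q \<circ> e) ` L = (\<lambda>e. loop_class Y (q z0) (q \<circ> l e)) ` L"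
      unfolding image_image by (rule image_cong[OF refl classY])
    ultimately show "generate (fundamental_group Y (q z0)) ((\<lambda>e. loop_class Y (q z0) (q \<circ> l e)) ` L) = carrier (fundamental_group Y (q z0))" by simp
    show "(\<lambda>e. loop_class Y (q z0) (q \<circ> l e)) ` B \<subseteq> (\<lambda>e. loop_class Y (q z0) (q \<circ> l e)) ` L" by (auto simp: B_def)
    show "(\<lambda>e. loop_class Y (q z0) (q \<circ> l e)) ` L \<subseteq> carrier (fundamental_group Y (q z0))" using loop_class_carrier[OF ql] by blast
    show "(\<lambda>e. loop_class Y (q z0) (q \<circ> l e)) ` L \<subseteq> insert \<one>\<^bsub>fundamental_group Y (q z0)\<^esub> ((\<lambda>e. loop_class Y (q z0) (q \<circ> l e)) ` B)"
    proof (rule image_subsetI)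
      fix e assume e: "e \<in> L"
      then have eE: "e \<in> ?E" by blast
      show "loop_class Y (q z0) (q \<circ> l e) \<in> insert \<one>\<^bsub>fundamental_group Y (q z0)\<^esub> ((\<lambda>e. loop_class Y (q z0) (q \<circ> l e)) ` B)"
      proof (cases "e \<in> B")
        case False
        have "path_homotopic Y (q \<circ> l e) (q \<circ> (\<lambda>_. z0))" by (rule path_homotopic_image[OF trivial[OF eE False] q])
        then have "path_homotopic Y (q \<circ> l e) (\<lambda>_. q z0)" by (simp add: o_def)
        then have "loop_class Y (q z0) (q \<circ> l e) = \<one>\<^bsub>fundamental_group Y (q z0)\<^esub>"
          unfolding one_fundamental_group loop_class_eq_iff[OF ql[OF eE] const_loop[OF z0Y]] .
        then show ?thesis by simp
      qed simp
    qed
  qed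
  have finB: "finite B" by (rule finite_subset[OF _ Z.finite_E]) (auto simp: B_def)
  have injB: "inj_on (\<lambda>e. q \<circ> e) B" using L_inj by (rule inj_on_subset) (auto simp: B_def)
  have BL: "(\<lambda>e. q \<circ> e) ` B \<subseteq> (\<lambda>e. q \<circ> e) ` L" by (auto simp: B_def)
  define N' :: "(real \<Rightarrow> 'a) \<Rightarrow> 'b set" where "N' e = (q \<circ> e) ` {0<..<1/2}" for e
  define M' :: "(real \<Rightarrow> 'a) \<Rightarrow> 'b set" where "M' e = {(q \<circ> e) (1/2)}" for e
  define P' :: "(real \<Rightarrow> 'a) \<Rightarrow> 'b set" where "P' e = (q \<circ> e) ` {1/2<..<1}" for e
  note mw = Y.midpoint_walls[OF finB injB BL, folded N'_def M'_def P'_def]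
  note wallsY = mw(1) and crossY = mw(2) and wall_vertex = mw(3) and wall_edge = mw(4)
  define N :: "(real \<Rightarrow> 'a) \<Rightarrow> 'a set" where "N e = {x \<in> topspace Z. q x \<in> N' e}" for e
  define M :: "(real \<Rightarrow> 'a) \<Rightarrow> 'a set" where "M e = {x \<in> topspace Z. q x \<in> M' e}" for e
  define P :: "(real \<Rightarrow> 'a) \<Rightarrow> 'a set" where "P e = {x \<in> topspace Z. q x \<in> P' e}" for e
  have wallsZ: "wall_system Z B N M P"
    using wall_system_preimage[OF wallsY q] unfolding N_def[abs_def] M_def[abs_def] P_def[abs_def] .
  have off: "q x \<notin> M' i" if x: "x \<in> forest_part S" and i: "i \<in> B" for x i
  proof
    assume w: "q x \<in> M' i"
    consider v where "v \<in> V" "x \<in> tree v" | e t where "e \<in> S" "t \<in> {0..1}" "x = e t" using x by (auto simp: forest_part_def)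
    then show False
    proof cases
      case 1 then show False using tree_fibre[OF 1] wall_vertex[OF i] w by simp
    next
      case 2
      then have eL: "e \<in> L" using SL by blast
      have "q \<circ> e = q \<circ> i" by (rule wall_edge[OF i _ 2(2)]) (use eL w 2(3) in auto)
      then have "e = i" using inj_onD[OF L_inj _ eL] i by (simp add: B_def)
      then show False using 2(1) i by (simp add: B_def)
    qed
  qed
  have avoid: "avoids B M' (q \<circ> \<tau> u)" "avoids B M' (q \<circ> reverse_path (\<tau> u))" "avoids B M (\<tau> u)" "avoids B M (reverse_path (\<tau> u))"
    if u: "u \<in> U" for u
  proof -
    have "\<tau> u t \<in> forest_part S" if "t \<in> {0..1}" for t using \<tau>D(5)[OF u qV[OF u]] that by blast
    then have "q (\<tau> u t) \<notin> M' i" if "t \<in> {0..1}" "i \<in> B" for t i using off that by blast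
    then show "avoids B M' (q \<circ> \<tau> u)" "avoids B M' (q \<circ> reverse_path (\<tau> u))" "avoids B M (\<tau> u)" "avoids B M (reverse_path (\<tau> u))"
      by (auto simp: avoids_def M_def reverse_path_def)
  qed
  have crossZ: "crosses_once B M P i i" if i: "i \<in> B" for i
  proof -
    have "i t \<in> topspace Z" if "t \<in> {0..1}" for t by (rule Z.edge_in[OF BE[OF i] that])
    then show ?thesis using crossY[OF i] unfolding crosses_once_def M_def P_def by (simp add: o_def)
  qed
  have basisZ: "loop_basis Z B N M P z0 l"
    unfolding loop_basis_def loop_basis_axioms_def
  proof (intro conjI allI impI)
    show "wall_system Z B N M P" by (rule wallsZ)
    show "path_connected_space Z" by (rule pcZ)
    show "z0 \<in> topspace Z" by (rule z0Z)
    show "generate (fundamental_group Z z0) ((\<lambda>e. loop_class Z z0 (l e)) ` B) = carrier (fundamental_group Z z0)" by (rule genZ)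
    fix i assume i: "i \<in> B"
    show "l i \<in> loops Z z0" by (rule l[OF BE[OF i]])
    show "\<exists>\<sigma> \<epsilon> \<rho>. pathin Z \<sigma> \<and> pathin Z \<epsilon> \<and> pathin Z \<rho> \<and> \<sigma> 1 = \<epsilon> 0 \<and> \<epsilon> 1 = \<rho> 0 \<and>
        l i = join_loops (join_loops \<sigma> \<epsilon>) \<rho> \<and> avoids B M \<sigma> \<and> avoids B M \<rho> \<and> crosses_once B M P i \<epsilon>"
      using \<tau>e[OF BE[OF i]] Z.edge(1)[OF BE[OF i]] avoid(3)[OF Z.edge(3)[OF BE[OF i]]] avoid(4)[OF Z.edge(4)[OF BE[OF i]]] crossZ[OF i]
      by (rule_tac exI[of _ "\<tau> (i 0)"], rule_tac exI[of _ i], rule_tac exI[of _ "reverse_path (\<tau> (i 1))"])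
        (simp add: l_def pathin_reverse_path)
  qed
  have basisY: "loop_basis Y B N' M' P' (q z0) (\<lambda>i. q \<circ> l i)"
    unfolding loop_basis_def loop_basis_axioms_def
  proof (intro conjI allI impI)
    show "wall_system Y B N' M' P'" by (rule wallsY)
    show "path_connected_space Y" by (rule pcY)
    show "q z0 \<in> topspace Y" by (rule z0Y)
    show "generate (fundamental_group Y (q z0)) ((\<lambda>e. loop_class Y (q z0) (q \<circ> l e)) ` B) = carrier (fundamental_group Y (q z0))" by (rule genY)
    fix i assume i: "i \<in> B"
    show "q \<circ> l i \<in> loops Y (q z0)" by (rule ql[OF BE[OF i]])
    show "\<exists>\<sigma> \<epsilon> \<rho>. pathin Y \<sigma> \<and> pathin Y \<epsilon> \<and> pathin Y \<rho> \<and> \<sigma> 1 = \<epsilon> 0 \<and> \<epsilon> 1 = \<rho> 0 \<and>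
        q \<circ> l i = join_loops (join_loops \<sigma> \<epsilon>) \<rho> \<and> avoids B M' \<sigma> \<and> avoids B M' \<rho> \<and> crosses_once B M' P' i \<epsilon>"
    proof (rule exI[of _ "q \<circ> \<tau> (i 0)"], rule exI[of _ "q \<circ> i"], rule exI[of _ "q \<circ> reverse_path (\<tau> (i 1))"], intro conjI)
      show "pathin Y (q \<circ> \<tau> (i 0))" "pathin Y (q \<circ> i)" "pathin Y (q \<circ> reverse_path (\<tau> (i 1)))"
        using \<tau>e[OF BE[OF i]] Z.edge(1)[OF BE[OF i]] q by (auto intro: pathin_compose pathin_reverse_path)
      show "(q \<circ> \<tau> (i 0)) 1 = (q \<circ> i) 0" "(q \<circ> i) 1 = (q \<circ> reverse_path (\<tau> (i 1))) 0" using \<tau>e[OF BE[OF i]] by simp_all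
      show "q \<circ> l i = join_loops (join_loops (q \<circ> \<tau> (i 0)) (q \<circ> i)) (q \<circ> reverse_path (\<tau> (i 1)))"
        by (simp add: l_def join_loops_compose)
      show "avoids B M' (q \<circ> \<tau> (i 0))" "avoids B M' (q \<circ> reverse_path (\<tau> (i 1)))"
        using avoid(1)[OF Z.edge(3)[OF BE[OF i]]] avoid(2)[OF Z.edge(4)[OF BE[OF i]]] by auto
      show "crosses_once B M' P' i (q \<circ> i)" by (rule crossY[OF i])
    qed
  qed
  show thesis by (rule that[OF basisZ basisY])
qed

end

section \<open>The projection of the graph to the Reeb space contracts the spanning trees\<close>

context closed_C1_function_edges
begin

text \<open>The coordinate \<open>fbar\<close> makes the images of the edge paths injective.\<close>

lemma reeb_finite_graph: "finite_graph Y V ((\<lambda>e. \<pi> \<circ> e) ` long_edges)"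
proof
  show "Hausdorff_space Y" by (rule Y_Hausdorff)
  show "finite V" using finite_Cr by simp
  show "V \<subseteq> topspace Y" by (rule V_subset)
  show "finite ((\<lambda>e. \<pi> \<circ> e) ` long_edges)" using finite_long_edges by simp
  have in_M: "e t \<in> topspace M" if "e \<in> long_edges" "t \<in> {0..1}" for e t
    using path_image_subset_topspace[OF long_edge(1)[OF that(1)]] that(2) by blast
  show "topspace Y = V \<union> (\<Union>e\<in>(\<lambda>e. \<pi> \<circ> e) ` long_edges. e ` {0..1})"
  proof (intro subset_antisym subsetI)
    fix y assume y: "y \<in> topspace Y"
    show "y \<in> V \<union> (\<Union>e\<in>(\<lambda>e. \<pi> \<circ> e) ` long_edges. e ` {0..1})"
    proof (cases "y \<in> V")
      case False
      then obtain e t where e: "e \<in> long_edges" "t \<in> {0<..<1}" "y = \<pi> (e t)" using long_edges_cover y by blast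
      then have "y \<in> (\<pi> \<circ> e) ` {0..1}" by (intro image_eqI[of _ _ t]) auto
      then show ?thesis using e(1) by blast
    qed simp
  next
    fix y assume "y \<in> V \<union> (\<Union>e\<in>(\<lambda>e. \<pi> \<circ> e) ` long_edges. e ` {0..1})"
    then consider "y \<in> V" | e t where "e \<in> long_edges" "t \<in> {0..1}" "y = \<pi> (e t)" by auto
    then show "y \<in> topspace Y" using V_subset in_M by cases (auto simp: topspace_Y)
  qed
  fix \<epsilon> assume "\<epsilon> \<in> (\<lambda>e. \<pi> \<circ> e) ` long_edges"
  then obtain e where e: "e \<in> long_edges" "\<epsilon> = \<pi> \<circ> e" by blast
  show "pathin Y \<epsilon>" unfolding e(2) by (rule pathin_compose[OF long_edge(1)[OF e(1)] continuous_\<pi>])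
  show "inj_on \<epsilon> {0..1}"
  proof (rule inj_onI)
    fix s t assume st: "s \<in> {0..1::real}" "t \<in> {0..1}" "\<epsilon> s = \<epsilon> t"
    then have "f (e s) = f (e t)" using fbar[OF in_M[OF e(1)]] e(2) by (metis comp_apply)
    then show "s = t" by (rule long_edge(4)[OF e(1) st(1,2)])
  qed
  show "\<epsilon> 0 \<in> V" "\<epsilon> 1 \<in> V" using long_edge(2,3)[OF e(1)] e(2) by auto
  show "\<epsilon> ` {0<..<1} \<inter> V = {}"
  proof (rule ccontr)
    assume "\<not> ?thesis"
    then obtain t where "t \<in> {0<..<1}" "\<epsilon> t \<in> V" by blast
    then show False using long_edge(5)[OF e(1)] e(2) by simp
  qed
  fix \<epsilon>' assume "\<epsilon>' \<in> (\<lambda>e. \<pi> \<circ> e) ` long_edges" and ne: "\<epsilon> \<noteq> \<epsilon>'"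
  then obtain e' where e': "e' \<in> long_edges" "\<epsilon>' = \<pi> \<circ> e'" by blast
  show "\<epsilon> ` {0<..<1} \<inter> \<epsilon>' ` {0<..<1} = {}"
  proof (rule ccontr)
    assume "\<not> ?thesis"
    then obtain x where x: "x \<in> \<epsilon> ` {0<..<1}" "x \<in> \<epsilon>' ` {0<..<1}" by blast
    obtain s where s: "s \<in> {0<..<1}" "x = \<epsilon> s" using x(1) by blast
    obtain t where t: "t \<in> {0<..<1}" "x = \<epsilon>' t" using x(2) by blast
    have st: "s \<in> {0<..<1}" "t \<in> {0<..<1}" "\<epsilon> s = \<epsilon>' t" using s t by auto
    have "e = e'" by (rule long_edges_disjoint(1)[OF e(1) e'(1) st(1,2)]) (use st(3) e(2) e'(2) in simp)
    then show False using ne e(2) e'(2) by simp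
  qed
qed

lemma vertex_fibre: "v \<in> V \<Longrightarrow> x \<in> v \<Longrightarrow> x \<in> topspace M \<and> \<pi> x = v"
  using fibre(3) Cr_subset by blast

lemma in_vertex_iff: "v \<in> V \<Longrightarrow> u \<in> Cr \<Longrightarrow> \<pi> u = v \<longleftrightarrow> u \<in> v"
  using vertex_fibre[of v u] fibre(1)[of u] Cr_subset by blast

text \<open>Spanning trees lie in essential components, which are single points of the Reeb space, while the
  interiors of the edge paths lie over the complement of the vertices. Therefore the two kinds of edges can
  only meet in critical points.\<close>

theorem graph_collapse_reeb:
  assumes tree: "\<And>c K. essential_component M A f c K \<Longrightarrow> spanning_tree M A f K (T K)"
    and G: "G = Cr \<union> \<Union>{T K | c K. essential_component M A f c K} \<union>
      \<Union>{\<gamma> c c' C ` {0..1} | c c' C. type_IIa M A f c c' C}"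
    and x0: "x0 \<in> Cr"
  shows "\<exists>F. graph_collapse (subtopology M G) Cr long_edges F Y V \<pi> x0"
proof -
  have ess: "\<exists>c. essential_component M A f c v" if "v \<in> V" for v using that unfolding essential_component_iff by blast
  have emb: "T v \<subseteq> v \<and> embedded_tree M (v \<inter> Cr) (T v)" if v: "v \<in> V" for v
  proof -
    obtain c where "essential_component M A f c v" using ess[OF v] by blast
    from tree[OF this] have st: "spanning_tree M A f v (T v)" .
    have "T v \<subseteq> topspace (subtopology M v)" by (rule closedin_subset) (use st in \<open>simp add: spanning_tree_def\<close>)
    then show ?thesis using st by (simp add: spanning_tree_def)
  qed
  define edges_of where "edges_of v E \<longleftrightarrow> finite E \<and>
        (\<forall>e\<in>E. pathin M e \<and> inj_on e {0..1} \<and> e 0 \<in> v \<inter> Cr \<and> e 1 \<in> v \<inter> Cr \<and> e ` {0<..<1} \<inter> (v \<inter> Cr) = {}) \<and>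
        (\<forall>e\<in>E. \<forall>e'\<in>E. e \<noteq> e' \<longrightarrow> e ` {0<..<1} \<inter> e' ` {0<..<1} = {}) \<and>
        T v = (v \<inter> Cr) \<union> (\<Union>e\<in>E. e ` {0..1})" for v and E :: "(real \<Rightarrow> 'a) set"
  have "\<forall>v\<in>V. \<exists>E. edges_of v E"
  proof
    fix v assume "v \<in> V"
    then have "embedded_tree M (v \<inter> Cr) (T v)" using emb by blast
    then show "\<exists>E. edges_of v E" unfolding embedded_tree_def edges_of_def by (rule conjunct1)
  qed
  from bchoice[OF this] obtain F where F: "\<And>v. v \<in> V \<Longrightarrow> edges_of v (F v)" by blast
  have Fe: "pathin M e" "inj_on e {0..1}" "e 0 \<in> v \<inter> Cr" "e 1 \<in> v \<inter> Cr" "e ` {0<..<1} \<inter> (v \<inter> Cr) = {}"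
    if "v \<in> V" "e \<in> F v" for v e
    using F[OF that(1)] that(2) unfolding edges_of_def by simp_all
  have Fdisj: "e ` {0<..<1} \<inter> e' ` {0<..<1} = {}" if "v \<in> V" "e \<in> F v" "e' \<in> F v" "e \<noteq> e'" for v e e'
    using F[OF that(1)] that(2-) unfolding edges_of_def by blast
  have FT: "T v = (v \<inter> Cr) \<union> (\<Union>e\<in>F v. e ` {0..1})" if "v \<in> V" for v using F[OF that] by (simp add: edges_of_def)
  have Fin: "e t \<in> v" if "v \<in> V" "e \<in> F v" "t \<in> {0..1}" for v e t
  proof -
    have "e t \<in> T v" unfolding FT[OF that(1)] using that(2,3) by blast
    then show ?thesis using emb[OF that(1)] by blast
  qed
  have Fpi: "\<pi> (e t) = v" if "v \<in> V" "e \<in> F v" "t \<in> {0..1}" for v e t using vertex_fibre[OF that(1) Fin[OF that]] by simp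
  have G': "G = Cr \<union> (\<Union>v\<in>V. T v) \<union> (\<Union>e\<in>long_edges. e ` {0..1})"
  proof -
    have "\<Union>{T K | c K. essential_component M A f c K} = (\<Union>v\<in>V. T v)" unfolding essential_component_iff by blast
    moreover have "\<Union>{\<gamma> c c' C ` {0..1} | c c' C. type_IIa M A f c c' C} = (\<Union>e\<in>long_edges. e ` {0..1})"
      unfolding long_edges_def by blast
    ultimately show ?thesis using G by simp
  qed
  have G'': "G = Cr \<union> (\<Union>e\<in>long_edges \<union> (\<Union>v\<in>V. F v). e ` {0..1})"
  proof -
    have "(\<Union>v\<in>V. T v) = (\<Union>v\<in>V. (v \<inter> Cr) \<union> (\<Union>e\<in>F v. e ` {0..1}))" by (rule SUP_cong[OF refl FT])
    moreover have "Cr \<union> (\<Union>v\<in>V. (v \<inter> Cr) \<union> (\<Union>e\<in>F v. I e)) \<union> (\<Union>e\<in>long_edges. I e) =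
        Cr \<union> (\<Union>e\<in>long_edges \<union> (\<Union>v\<in>V. F v). I e)" for I :: "(real \<Rightarrow> 'a) \<Rightarrow> 'a set" by blast
    ultimately show ?thesis unfolding G' by simp
  qed
  have GM: "G \<subseteq> topspace M"
  proof -
    have "e ` {0..1} \<subseteq> topspace M" if "e \<in> long_edges \<union> (\<Union>v\<in>V. F v)" for e
      using that path_image_subset_topspace long_edge(1) Fe(1) by blast
    then show ?thesis unfolding G'' using Cr_subset by blast
  qed
  have top: "topspace (subtopology M G) = G" using GM by auto
  have mid: "\<pi> (e t) \<in> V \<longleftrightarrow> e \<in> (\<Union>v\<in>V. F v)" if "e \<in> long_edges \<union> (\<Union>v\<in>V. F v)" "t \<in> {0<..<1}" for e t
    using that long_edge(5)[of e t] Fpi[of _ e t] by auto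
  have graph: "finite_graph (subtopology M G) Cr (long_edges \<union> (\<Union>v\<in>V. F v))"
  proof
    show "Hausdorff_space (subtopology M G)" using M_Hausdorff by (rule Hausdorff_space_subtopology)
    show "finite Cr" by (rule finite_Cr)
    have "Cr \<subseteq> G" unfolding G'' by blast
    then show "Cr \<subseteq> topspace (subtopology M G)" by (simp only: top)
    have "finite (F v)" if "v \<in> V" for v using F[OF that] by (simp add: edges_of_def)
    then show "finite (long_edges \<union> (\<Union>v\<in>V. F v))" using finite_long_edges finite_Cr by auto
    show "topspace (subtopology M G) = Cr \<union> (\<Union>e\<in>long_edges \<union> (\<Union>v\<in>V. F v). e ` {0..1})"
      unfolding top by (rule G'')
    fix e assume e: "e \<in> long_edges \<union> (\<Union>v\<in>V. F v)"
    then consider (long) "e \<in> long_edges" | (tree) v where "v \<in> V" "e \<in> F v" by blast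
    then have basic: "pathin M e \<and> inj_on e {0..1} \<and> e 0 \<in> Cr \<and> e 1 \<in> Cr \<and> e ` {0<..<1} \<inter> Cr = {}"
    proof cases
      case long
      have "inj_on e {0..1}" by (rule inj_onI) (rule long_edge(4)[OF long], simp_all)
      moreover have "e ` {0<..<1} \<inter> Cr = {}"
      proof (rule ccontr)
        assume "e ` {0<..<1} \<inter> Cr \<noteq> {}"
        then obtain t where "t \<in> {0<..<1}" "e t \<in> Cr" by blast
        then show False using long_edge(5)[OF long] by blast
      qed
      ultimately show ?thesis using long_edge(1-3)[OF long] by blast
    next
      case tree
      have "e ` {0<..<1} \<inter> Cr = {}"
      proof (rule ccontr)
        assume "e ` {0<..<1} \<inter> Cr \<noteq> {}"
        then obtain t where t: "t \<in> {0<..<1}" "e t \<in> Cr" by blast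
        then have "e t \<in> v" using Fin[OF tree, of t] by simp
        then show False using Fe(5)[OF tree] t by blast
      qed
      then show ?thesis using Fe(1-4)[OF tree] by blast
    qed
    have "e t \<in> G" if "t \<in> {0..1}" for t unfolding G'' using e that by blast
    then show "pathin (subtopology M G) e" using basic by (simp add: pathin_subtopology)
    show "inj_on e {0..1}" "e 0 \<in> Cr" "e 1 \<in> Cr" "e ` {0<..<1} \<inter> Cr = {}" using basic by auto
    fix e' assume e': "e' \<in> long_edges \<union> (\<Union>v\<in>V. F v)" and ne: "e \<noteq> e'"
    show "e ` {0<..<1} \<inter> e' ` {0<..<1} = {}"
    proof (rule ccontr)
      assume "\<not> ?thesis"
      then obtain x where x: "x \<in> e ` {0<..<1}" "x \<in> e' ` {0<..<1}" by blast
      obtain s where s: "s \<in> {0<..<1}" "x = e s" using x(1) by blast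
      obtain t where t: "t \<in> {0<..<1}" "x = e' t" using x(2) by blast
      have st: "s \<in> {0<..<1}" "t \<in> {0<..<1}" "e s = e' t" using s t by auto
      have "e = e'"
      proof (cases "\<pi> (e s) \<in> V")
        case False
        then have "e \<in> long_edges" "e' \<in> long_edges" using mid[OF e st(1)] mid[OF e' st(2)] st(3) e e' by auto
        then show ?thesis by (rule long_edges_disjoint(1)[OF _ _ st(1,2)]) (simp add: st(3))
      next
        case True
        then obtain v v' where v: "v \<in> V" "e \<in> F v" "v' \<in> V" "e' \<in> F v'"
          using mid[OF e st(1)] mid[OF e' st(2)] st(3) by auto
        have s01: "s \<in> {0..1}" "t \<in> {0..1}" using st by auto
        have "v = v'" using Fpi[OF v(1,2) s01(1)] Fpi[OF v(3,4) s01(2)] st(3) by simp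
        then show ?thesis using Fdisj[OF v(1,2), of e'] v(4) st by blast
      qed
      then show False using ne by simp
    qed
  qed
  have Tv: "{u \<in> Cr. \<pi> u = v} \<union> (\<Union>e\<in>F v. e ` {0..1}) = T v" if v: "v \<in> V" for v
    unfolding FT[OF v] using in_vertex_iff[OF v] by blast
  have TG: "T v \<subseteq> G" if "v \<in> V" for v unfolding G' using that by blast
  have "graph_collapse (subtopology M G) Cr long_edges F Y V \<pi> x0"
    unfolding graph_collapse_def graph_collapse_axioms_def
  proof (intro conjI allI impI)
    show "finite_graph (subtopology M G) Cr (long_edges \<union> (\<Union>v\<in>V. F v))" by (rule graph)
    show "finite_graph Y V ((\<lambda>e. \<pi> \<circ> e) ` long_edges)" by (rule reeb_finite_graph)
    show "continuous_map (subtopology M G) Y \<pi>" by (rule continuous_map_from_subtopology[OF continuous_\<pi>])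
    show "V = V" by (rule refl)
    show "inj_on (\<lambda>e. \<pi> \<circ> e) long_edges"
    proof (rule inj_onI)
      fix e e' assume ee: "e \<in> long_edges" "e' \<in> long_edges" "\<pi> \<circ> e = \<pi> \<circ> e'"
      have "\<pi> (e (1/2)) = \<pi> (e' (1/2))" using fun_cong[OF ee(3), of "1/2"] by simp
      then show "e = e'" by (rule long_edges_disjoint(1)[OF ee(1,2), of "1/2" "1/2", rotated 2]) auto
    qed
    show "connected_space Y" by (rule Y_connected)
    show "x0 \<in> Cr" by (rule x0)
    fix v assume v: "v \<in> V"
    show "\<pi> (e t) = v" if "e \<in> F v" "t \<in> {0..1}" for e t by (rule Fpi[OF v that])
    show "connectedin (subtopology M G) ({u \<in> Cr. \<pi> u = v} \<union> (\<Union>e\<in>F v. e ` {0..1}))"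
      unfolding Tv[OF v] using emb[OF v] TG[OF v] by (simp add: embedded_tree_def connectedin_subtopology)
    fix S assume "S \<subseteq> {u \<in> Cr. \<pi> u = v} \<union> (\<Union>e\<in>F v. e ` {0..1})"
    then have S: "S \<subseteq> T v" unfolding Tv[OF v] .
    then have "G \<inter> S = S" using TG[OF v] by blast
    then have "subtopology (subtopology M G) S = subtopology M S" by (simp add: subtopology_subtopology)
    then show "\<not> subtopology (subtopology M G) S homeomorphic_space top_of_set (sphere (0::complex) 1)"
      using emb[OF v] S unfolding embedded_tree_def by simp
  qed
  then show ?thesis by blast
qed

end

theorem proposition5p1:
  fixes M :: "'a topology"
    and A :: "('a, real ^ 'n) chart set"
    and f :: "'a \<Rightarrow> real"
    and G :: "'a set"
    and x0 :: 'a
  assumes "CARD('n) \<ge> 2"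
    and "closed_connected_C1_manifold M A"
    and "C1_function A f"
    and "isolated_points M (critical_points A f)"
    and "gamma_graph M A f G"
    and "x0 \<in> critical_points A f"
  shows
    "let \<Gamma> = subtopology M G; \<R> = reeb_graph M f;
         \<iota> = (\<lambda>x. x); \<pi> = reeb_projection M f
     in \<exists>r::nat.
       (free_group_of_rank (fundamental_group \<Gamma> x0) r \<and>
        free_group_of_rank (fundamental_group \<R> (\<pi> x0)) r \<and>
        fundamental_group_map \<R> (\<pi> x0) (\<pi> \<circ> \<iota>)
          \<in> iso (fundamental_group \<Gamma> x0) (fundamental_group \<R> (\<pi> x0)) \<and>
        (\<forall>a\<in>carrier (fundamental_group \<Gamma> x0).
           fundamental_group_map \<R> (\<pi> x0) (\<pi> \<circ> \<iota>) a =
           fundamental_group_map \<R> (\<pi> x0) \<pi> (fundamental_group_map M x0 \<iota> a))) \<and>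
       (homology_group 1 \<Gamma> \<cong> free_Abelian_group {..<r} \<and>
        homology_group 1 \<R> \<cong> free_Abelian_group {..<r} \<and>
        hom_induced 1 \<Gamma> {} \<R> {} (\<pi> \<circ> \<iota>) \<in> iso (homology_group 1 \<Gamma>) (homology_group 1 \<R>) \<and>
        (\<forall>a\<in>carrier (homology_group 1 \<Gamma>).
           hom_induced 1 \<Gamma> {} \<R> {} (\<pi> \<circ> \<iota>) a =
           hom_induced 1 M {} \<R> {} \<pi> (hom_induced 1 \<Gamma> {} M {} \<iota> a))) \<and>
       (\<forall>R :: 'r ring. ring R \<longrightarrow>
          module_iso R (cohomology R 1 \<Gamma>) (free_module R r) \<noteq> {} \<and>
          module_iso R (cohomology R 1 \<R>) (free_module R r) \<noteq> {} \<and>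
          cohomology_map R 1 \<Gamma> (\<pi> \<circ> \<iota>)
            \<in> module_iso R (cohomology R 1 \<R>) (cohomology R 1 \<Gamma>) \<and>
          (\<forall>a\<in>carrier (cohomology R 1 \<R>).
             cohomology_map R 1 \<Gamma> (\<pi> \<circ> \<iota>) a =
             cohomology_map R 1 \<Gamma> \<iota> (cohomology_map R 1 M \<pi> a)))"
proof -
  obtain T \<gamma> where T: "\<And>c K. essential_component M A f c K \<Longrightarrow> spanning_tree M A f K (T K)"
    and \<gamma>: "\<And>c c' C. type_IIa M A f c c' C \<Longrightarrow> decreasing_edge_path M A f c c' C (\<gamma> c c' C)"
    and G: "G = critical_points A f \<union> \<Union>{T K | c K. essential_component M A f c K} \<union>
      \<Union>{\<gamma> c c' C ` {0..1} | c c' C. type_IIa M A f c c' C}"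
    using assms(5) unfolding gamma_graph_def by auto
  interpret closed_C1_function_edges M A f \<gamma>
    by unfold_locales (fact assms(2-4) \<gamma>)+
  let ?\<Gamma> = "subtopology M G" let ?\<iota> = "\<lambda>x. x :: 'a"
  have "\<exists>F. graph_collapse ?\<Gamma> Cr long_edges F Y V \<pi> x0"
    by (rule graph_collapse_reeb[of T, OF _ G assms(6)]) (rule T)
  then obtain F where "graph_collapse ?\<Gamma> Cr long_edges F Y V \<pi> x0" ..
  then interpret collapse: graph_collapse ?\<Gamma> Cr long_edges F Y V \<pi> x0 .
  obtain B :: "(real \<Rightarrow> 'a) set" and N W P N' W' P' l where
    b\<Gamma>: "loop_basis ?\<Gamma> B N W P x0 l" and bY: "loop_basis Y B N' W' P' (\<pi> x0) (\<lambda>i. \<pi> \<circ> l i)"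
    by (rule collapse.corresponding_loop_bases, rule that)
  have \<pi>\<Gamma>: "continuous_map ?\<Gamma> Y \<pi>" by (rule collapse.q)
  have \<iota>: "continuous_map ?\<Gamma> M ?\<iota>" using continuous_map_from_subtopology[OF continuous_map_id, of M G] by (simp add: id_def)
  have \<pi>\<iota>: "\<pi> \<circ> ?\<iota> = \<pi>" by (simp add: fun_eq_iff)
  have 1: "fundamental_group_map Y (\<pi> x0) \<pi> a = fundamental_group_map Y (\<pi> x0) \<pi> (fundamental_group_map M x0 ?\<iota> a)"
    if a: "a \<in> carrier (fundamental_group ?\<Gamma> x0)" for a
  proof -
    obtain p where p: "p \<in> loops ?\<Gamma> x0" "a = loop_class ?\<Gamma> x0 p" using a by (auto simp: carrier_fundamental_group)
    have "fundamental_group_map M x0 ?\<iota> a = loop_class M x0 p"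
      using fundamental_group_map_loop_class[OF p(1) \<iota>] p(2) by (simp add: o_def)
    moreover have "p \<in> loops M x0" using loops_compose[OF p(1) \<iota>] by (simp add: o_def)
    ultimately show ?thesis
      using fundamental_group_map_loop_class[OF _ continuous_\<pi>, of p x0] fundamental_group_map_loop_class[OF p(1) \<pi>\<Gamma>] p(2) by simp
  qed
  have 2: "hom_induced 1 ?\<Gamma> {} Y {} \<pi> a = hom_induced 1 M {} Y {} \<pi> (hom_induced 1 ?\<Gamma> {} M {} ?\<iota> a)" for a
    using fun_cong[OF hom_induced_compose[OF \<iota> _ continuous_\<pi>, of "{}" "{}" "{}" 1], of a] by (simp add: \<pi>\<iota>)
  have 3: "cohomology_map R 1 ?\<Gamma> \<pi> a = cohomology_map R 1 ?\<Gamma> ?\<iota> (cohomology_map R 1 M \<pi> a)"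
    if R: "ring R" and a: "a \<in> carrier (cohomology R 1 Y)" for R :: "'r ring" and a
    using cohomology_map_compose[OF R \<iota> continuous_\<pi>, of a 0] a by (simp add: \<pi>\<iota>)
  show ?thesis
    unfolding Let_def \<pi>\<iota>
  proof (rule exI[of _ "card B"], intro conjI ballI allI impI)
    show "free_group_of_rank (fundamental_group ?\<Gamma> x0) (card B)" by (rule loop_basis.fundamental_group_free[OF b\<Gamma>])
    show "free_group_of_rank (fundamental_group Y (\<pi> x0)) (card B)" by (rule loop_basis.fundamental_group_free[OF bY])
    show "fundamental_group_map Y (\<pi> x0) \<pi> \<in> iso (fundamental_group ?\<Gamma> x0) (fundamental_group Y (\<pi> x0))"
      by (rule loop_basis_fundamental_group_iso[OF b\<Gamma> bY \<pi>\<Gamma>])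
    show "fundamental_group_map Y (\<pi> x0) \<pi> a = fundamental_group_map Y (\<pi> x0) \<pi> (fundamental_group_map M x0 ?\<iota> a)"
      if "a \<in> carrier (fundamental_group ?\<Gamma> x0)" for a by (rule 1[OF that])
    show "homology_group 1 ?\<Gamma> \<cong> free_Abelian_group {..<card B}" by (rule loop_basis.homology_group_free[OF b\<Gamma>])
    show "homology_group 1 Y \<cong> free_Abelian_group {..<card B}" by (rule loop_basis.homology_group_free[OF bY])
    show "hom_induced 1 ?\<Gamma> {} Y {} \<pi> \<in> iso (homology_group 1 ?\<Gamma>) (homology_group 1 Y)"
      by (rule loop_basis_homology_iso[OF b\<Gamma> bY \<pi>\<Gamma>])
    show "hom_induced 1 ?\<Gamma> {} Y {} \<pi> a = hom_induced 1 M {} Y {} \<pi> (hom_induced 1 ?\<Gamma> {} M {} ?\<iota> a)" for a by (rule 2)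
  next
    fix R :: "'r ring" assume R: "ring R"
    note iso = loop_basis_cohomology_iso[OF b\<Gamma> bY \<pi>\<Gamma> R, folded One_nat_def]
    show "module_iso R (cohomology R 1 ?\<Gamma>) (free_module R (card B)) \<noteq> {}" by (rule iso(1))
    show "module_iso R (cohomology R 1 Y) (free_module R (card B)) \<noteq> {}" by (rule iso(2))
    show "cohomology_map R 1 ?\<Gamma> \<pi> \<in> module_iso R (cohomology R 1 Y) (cohomology R 1 ?\<Gamma>)" by (rule iso(3))
    show "cohomology_map R 1 ?\<Gamma> \<pi> a = cohomology_map R 1 ?\<Gamma> ?\<iota> (cohomology_map R 1 M \<pi> a)"
      if "a \<in> carrier (cohomology R 1 Y)" for a by (rule 3[OF R that])
  qed
qed

end
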